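(* There are Hopf algebra isomorphisms $f:\mathcal K(\mathbf\Pi)\to\mathbf{NCSym}$ and $\overline f:\overline{\mathcal K}(\mathbf\Pi)\to\mathbf{Sym}$ such that the square formed by $f$, $\overline f$, the quotient map $\pi:\mathcal K(\mathbf\Pi)\to\overline{\mathcal K}(\mathbf\Pi)$ and the commutation map $\rho:\mathbf{NCSym}\to\mathbf{Sym}$ commutes, i.e. $\rho\circ f=\overline f\circ\pi$, and such that whenever $\Lambda$ is a set partition of $[n]$ ($n\ge0$) whose type is the integer partition $\lambda$, $$f(m_\Lambda)=m_\Lambda,\quad f(p_\Lambda)=p_\Lambda,\quad f(e_\Lambda)=e_\Lambda,\quad f(h_\Lambda)=h_\Lambda,$$ $$\overline f(m_\Lambda)=\lambda^!\cdot m_\lambda,\quad\overline f(p_\Lambda)=p_\lambda,\quad\overline f(e_\Lambda)=\lambda!\cdot e_\lambda,\quad\overline f(h_\Lambda)=\lambda!\cdot h_\lambda,$$ where in $\overline f(x_\Lambda)$ the symbol $x_\Lambda$ denotes the image $\pi(x_\Lambda)$.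
   Context: $\mathbb K$ is a field of characteristic zero and $[n]=\{1,\dots,n\}$. All Hopf algebras are graded connected over $\mathbb K$. **The Hopf algebras $\mathcal K(\mathbf\Pi)$ and $\overline{\mathcal K}(\mathbf\Pi)$.** Let $\Pi[n]$ be the set of partitions of $[n]$ and $\mathbf\Pi[n]$ the vector space with basis $\Pi[n]$. Then $\mathcal K(\mathbf\Pi)=\bigoplus_{n\ge0}\mathbf\Pi[n]$ is a Hopf algebra, with unit the partition of $\varnothing$, counit the projection onto degree $0$, product of $X\in\Pi[m]$ and $Y\in\Pi[n]$ equal to $X\sqcup(Y+m)\in\Pi[m+n]$ (where $Y+m$ is obtained by adding $m$ to all elements), and coproduct $\Delta(Z)=\sum_{[n]=S\sqcup T}\mathrm{st}(Z|_S)\otimes\mathrm{st}(Z|_T)$ for $Z\in\Pi[n]$, summed over all $2^n$ ordered decompositions, where $Z|_S=\{B\cap S:B\in Z\}\setminus\{\varnothing\}$ and $\mathrm{st}$ relabels by the order-preserving bijection $S\to[|S|]$. $\overline{\mathcal K}(\mathbf\Pi)=\bigoplus_n\mathbf\Pi[n]_{S_n}$ is the graded space of $S_n$-coinvariants (the quotient of $\mathbf\Pi[n]$ by the span of all $x-\sigma x$, $\sigma\in S_n$, for the natural action), with the Hopf algebra structure induced from $\mathcal K(\mathbf\Pi)$; $\pi$ is the quotient map. **Bases of $\mathbf\Pi[n]$.** Order $\Pi[n]$ by refinement ($X\le Y$ if each block of $X$ lies in a block of $Y$), let $\mu$ be the Möbius function and $\mu(\Lambda)=\mu(\hat0,\Lambda)$,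 with $\hat0$ the partition into singletons. In $\mathbf\Pi[n]$ define $p_\Lambda=\sum_{\Lambda'\le\Lambda}\mu(\Lambda',\Lambda)\Lambda'$, $m_\Lambda=\sum_{\Lambda'\ge\Lambda}\mu(\Lambda,\Lambda')p_{\Lambda'}$, $e_\Lambda=\sum_{\Lambda'\le\Lambda}\mu(\Lambda')p_{\Lambda'}$, $h_\Lambda=\sum_{\Lambda'\le\Lambda}|\mu(\Lambda')|p_{\Lambda'}$. **$\mathbf{NCSym}$ and $\mathbf{Sym}$.** Let $\mathbb K\langle\langle x\rangle\rangle$ be the algebra of formal power series in countably many noncommuting variables $x_1,x_2,\dots$. $\mathbf{NCSym}$ is the subspace of series of bounded degree invariant, for every $n$, under the action of $S_n$ permuting the indices of $x_1,\dots,x_n$. It is a Hopf algebra with the usual product, unit $1$, counit the constant term, and coproduct $f(x_1,x_2,\dots)\mapsto f(x_1,y_1,x_2,y_2,\dots)\in\mathbf{NCSym}(x)\otimes\mathbf{NCSym}(y)\cong\mathbf{NCSym}\otimes\mathbf{NCSym}$, where $x$ and $y$ are two sets of noncommuting variables which commute with each other. $\mathbf{Sym}$ is defined in the same way using commuting variables, and $\rho:\mathbf{NCSym}\to\mathbf{Sym}$ is the homomorphism letting the variables commute. In $\mathbf{NCSym}$, for $\Lambda\in\Pi[n]$: $m_\Lambda$, $p_\Lambda$, $e_\Lambda$ are each sums $\sum x_{i_1}\cdots x_{i_n}$ over $n$-tuples of positive integers such that, respectively, (for $m$) $i_j=i_k$ if and only if $j,k$ are in the same block of $\Lambda$; (for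 $p$) $i_j=i_k$ if $j,k$ are in the same block; (for $e$) $i_j\ne i_k$ if $j\neq k$ are in the same block. And $h_\Lambda=\sum_{(f,L)}x_{f(1)}\cdots x_{f(n)}$ over pairs of a map $f:[n]\to\{1,2,\dots\}$ and a sequence $L$ of linear orderings of each of the sets $f^{-1}(i)\cap B$ ($i\ge1$, $B\in\Lambda$). In $\mathbf{Sym}$, for an integer partition $\lambda=(\lambda_1,\dots,\lambda_\ell)$, $m_\lambda,p_\lambda,e_\lambda,h_\lambda$ are the usual monomial, power sum, elementary and complete homogeneous symmetric functions. **Notation.** The type of a set partition is the integer partition whose parts are its block sizes. For $\lambda=(\lambda_1,\dots,\lambda_\ell)\vdash n$, $\lambda!=\lambda_1!\cdots\lambda_\ell!$ and $\lambda^!=m_1!\cdots m_n!$, where $m_i$ is the number of parts of $\lambda$ equal to $i$. *)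

theory Defs
  imports Complex_Main "HOL-Library.Poly_Mapping" "HOL-Library.Multiset" "HOL-Library.FuncSet"
    "HOL-Library.Disjoint_Sets" "HOL-Combinatorics.Permutations"
begin

section \<open>Linear algebra on free vector spaces\<close>

text \<open>The free vector space on \<open>'x\<close> is \<open>'x \<Rightarrow>\<^sub>0 'k\<close>, with basis \<open>single z 1\<close>.\<close>

definition fscale :: "'k \<Rightarrow> ('x \<Rightarrow>\<^sub>0 'k::field) \<Rightarrow> ('x \<Rightarrow>\<^sub>0 'k)" where
  "fscale c t = Poly_Mapping.map ((*) c) t"

definition lin_ext :: "('k::field \<Rightarrow> 'v \<Rightarrow> 'v::ab_group_add) \<Rightarrow> ('x \<Rightarrow> 'v) \<Rightarrow> ('x \<Rightarrow>\<^sub>0 'k) \<Rightarrow> 'v" where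
  "lin_ext s g t = (\<Sum>z\<in>Poly_Mapping.keys t. s (Poly_Mapping.lookup t z) (g z))"

definition push :: "('x \<Rightarrow> 'y) \<Rightarrow> ('x \<Rightarrow>\<^sub>0 'k::field) \<Rightarrow> ('y \<Rightarrow>\<^sub>0 'k)" where
  "push g = lin_ext fscale (\<lambda>z. Poly_Mapping.single (g z) 1)"

lemma lookup_fscale [simp]: "Poly_Mapping.lookup (fscale c t) z = c * Poly_Mapping.lookup t z"
  unfolding fscale_def by transfer (simp add: when_def)

lemma vector_space_fscale: "vector_space (fscale :: 'k::field \<Rightarrow> ('x \<Rightarrow>\<^sub>0 'k) \<Rightarrow> _)"
  unfolding vector_space_def by (auto intro!: poly_mapping_eqI simp: lookup_add algebra_simps)

interpretation fs: vector_space "fscale :: 'k::field \<Rightarrow> ('x \<Rightarrow>\<^sub>0 'k) \<Rightarrow> _"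
  by (rule vector_space_fscale)

lemma fscale_single [simp]: "fscale c (Poly_Mapping.single z d) = Poly_Mapping.single z (c * d)"
  unfolding fscale_def by simp

section \<open>Set partitions\<close>

typedef set_partition = "{P :: nat set set. \<exists>n. partition_on {1..n} P}"
  morphisms blocks Abs_set_partition
  by (rule exI[of _ "{}"]) (auto simp: partition_on_def intro!: exI[of _ 0])

setup_lifting type_definition_set_partition

definition psize :: "set_partition \<Rightarrow> nat" where
  "psize X = card (\<Union>(blocks X))"

lemma partition_on_blocks: "partition_on {1..psize X} (blocks X)"
proof -
  obtain n where n: "partition_on {1..n} (blocks X)" using blocks[of X] by blast
  hence "psize X = n" by (simp add: psize_def partition_onD1[symmetric])
  with n show ?thesis by simp
qed

lemma Union_blocks: "\<Union>(blocks X) = {1..psize X}"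
  using partition_onD1[OF partition_on_blocks] by simp

lemma finite_blocks: "finite (blocks X)"
  using finite_elements[OF _ partition_on_blocks] by simp

lemma psizeI: "partition_on {1..n} (blocks X) \<Longrightarrow> psize X = n"
  by (auto simp: psize_def dest: partition_onD1[symmetric])

text \<open>Refinement order; partitions of different sets \<open>[n]\<close> are incomparable.\<close>

instantiation set_partition :: order
begin

definition less_eq_set_partition :: "set_partition \<Rightarrow> set_partition \<Rightarrow> bool" where
  "X \<le> Y \<longleftrightarrow> psize X = psize Y \<and> (\<forall>B\<in>blocks X. \<exists>C\<in>blocks Y. B \<subseteq> C)"

definition less_set_partition :: "set_partition \<Rightarrow> set_partition \<Rightarrow> bool" where
  "X < Y \<longleftrightarrow> X \<le> Y \<and> \<not> Y \<le> (X::set_partition)"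

instance
proof
  fix X Y Z :: set_partition
  show "X \<le> X" by (auto simp: less_eq_set_partition_def)
  show "X \<le> Y \<Longrightarrow> Y \<le> Z \<Longrightarrow> X \<le> Z"
    unfolding less_eq_set_partition_def by (metis order_trans)
  have sub: "blocks U \<subseteq> blocks V" if UV: "U \<le> V" "V \<le> U" for U V
  proof
    fix B assume B: "B \<in> blocks U"
    then obtain C where C: "C \<in> blocks V" "B \<subseteq> C"
      using UV by (auto simp: less_eq_set_partition_def)
    then obtain D where D: "D \<in> blocks U" "C \<subseteq> D"
      using UV by (auto simp: less_eq_set_partition_def)
    have "B = D"
      using partition_on_blocks[of U] B D C
      unfolding partition_on_def disjoint_def by (metis Int_absorb2 order_trans)
    with C D show "B \<in> blocks V" by (simp add: subset_antisym)
  qed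
  show "X \<le> Y \<Longrightarrow> Y \<le> X \<Longrightarrow> X = Y"
    using sub[of X Y] sub[of Y X] by (simp add: blocks_inject[symmetric])
qed (auto simp: less_set_partition_def)

end

lift_definition discrete_partition :: "nat \<Rightarrow> set_partition" is "\<lambda>n. (\<lambda>i. {i}) ` {1..n}"
  using partition_on_singletons by blast

text \<open>If \<open>\<sigma>\<close> does not permute the underlying set \<open>[n]\<close> the result is a dummy value.\<close>

lift_definition permute_partition :: "(nat \<Rightarrow> nat) \<Rightarrow> set_partition \<Rightarrow> set_partition" is
  "\<lambda>\<sigma> P. if \<sigma> permutes \<Union>P then (`) \<sigma> ` P else P"
proof -
  fix \<sigma> :: "nat \<Rightarrow> nat" and P :: "nat set set"
  assume "\<exists>n. partition_on {1..n} P"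
  then obtain n where n: "partition_on {1..n} P" by blast
  hence U: "\<Union>P = {1..n}" by (simp add: partition_on_def)
  have "partition_on {1..n} ((`) \<sigma> ` P)" if s: "\<sigma> permutes {1..n}"
  proof -
    have "partition_on (\<sigma> ` {1..n}) ((`) \<sigma> ` P - {{}})"
      by (rule partition_on_inj_image[OF n]) (rule permutes_inj_on[OF s])
    moreover have "{} \<notin> (`) \<sigma> ` P" using n by (auto simp: partition_on_def)
    ultimately show ?thesis using permutes_image[OF s] by simp
  qed
  with n U show "\<exists>n. partition_on {1..n} (if \<sigma> permutes \<Union>P then (`) \<sigma> ` P else P)" by auto
qed

text \<open>\<open>standard_restrict S Z\<close> is \<open>st(Z|\<^sub>S)\<close>; the order-preserving bijection \<open>S \<rightarrow> [|S|]\<close> sends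
  \<open>i\<close> to the number of elements of \<open>S\<close> that are at most \<open>i\<close>.\<close>

definition rank :: "nat set \<Rightarrow> nat \<Rightarrow> nat" where
  "rank S i = card {j\<in>S. j \<le> i}"

lemma rank_strict_mono:
  assumes "finite S" "i < j" "j \<in> S"
  shows "rank S i < rank S j"
proof -
  have "{k\<in>S. k \<le> i} \<subseteq> {k\<in>S. k \<le> j}" "j \<in> {k\<in>S. k \<le> j}" "j \<notin> {k\<in>S. k \<le> i}"
    using assms by auto
  hence "{k\<in>S. k \<le> i} \<subset> {k\<in>S. k \<le> j}" by blast
  thus ?thesis unfolding rank_def using assms(1) by (intro psubset_card_mono) auto
qed

lemma inj_on_rank: "finite S \<Longrightarrow> inj_on (rank S) S"
  by (rule inj_onI) (metis rank_strict_mono less_irrefl linorder_neqE_nat)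

lemma rank_image: "finite S \<Longrightarrow> rank S ` S = {1..card S}"
proof (rule card_subset_eq)
  assume S: "finite S"
  show "rank S ` S \<subseteq> {1..card S}"
  proof
    fix y assume "y \<in> rank S ` S"
    then obtain i where i: "i \<in> S" "y = rank S i" by blast
    have "i \<in> {j\<in>S. j \<le> i}" "finite {j\<in>S. j \<le> i}" using S i by auto
    hence "card {j\<in>S. j \<le> i} > 0" by (metis card_gt_0_iff empty_iff)
    moreover have "card {j\<in>S. j \<le> i} \<le> card S" using S by (intro card_mono) auto
    ultimately show "y \<in> {1..card S}" using i by (simp add: rank_def)
  qed
  show "card (rank S ` S) = card {1..card S}"
    using card_image[OF inj_on_rank[OF S]] by simp
qed simp

lift_definition standard_restrict :: "nat set \<Rightarrow> set_partition \<Rightarrow> set_partition" is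
  "\<lambda>S P. (\<lambda>B. rank (S \<inter> \<Union>P) ` (B \<inter> S)) ` P - {{}}"
proof -
  fix S :: "nat set" and P :: "nat set set"
  assume "\<exists>n. partition_on {1..n} P"
  then obtain n where n: "partition_on {1..n} P" by blast
  hence U: "\<Union>P = {1..n}" by (simp add: partition_on_def)
  let ?T = "S \<inter> {1..n}"
  have "partition_on ?T ((\<inter>) S ` P - {{}})"
    by (rule partition_on_restrict[OF n])
  hence "partition_on (rank ?T ` ?T) ((`) (rank ?T) ` ((\<inter>) S ` P - {{}}) - {{}})"
    by (rule partition_on_inj_image) (simp add: inj_on_rank)
  moreover have "(`) (rank ?T) ` ((\<inter>) S ` P - {{}}) - {{}} = (\<lambda>B. rank ?T ` (B \<inter> S)) ` P - {{}}"
    by (auto simp: image_iff Int_commute)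
  ultimately show "\<exists>m. partition_on {1..m} ((\<lambda>B. rank (S \<inter> \<Union>P) ` (B \<inter> S)) ` P - {{}})"
    unfolding U by (auto simp: rank_image)
qed

text \<open>The monoid operation is the concatenation \<open>X \<squnion> (Y + m)\<close> for \<open>X\<close> a partition of \<open>[m]\<close>.\<close>

lemma partition_on_shift:
  fixes m n :: nat
  assumes "partition_on {1..n} Q"
  shows "partition_on {m + 1..m + n} ((`) ((+) m) ` Q)"
proof -
  have "partition_on ((+) m ` {1..n}) ((`) ((+) m) ` Q - {{}})"
    by (rule partition_on_inj_image[OF assms]) (simp add: inj_on_def)
  moreover have "{} \<notin> (`) ((+) m) ` Q" using assms by (auto simp: partition_on_def)
  ultimately show ?thesis by (simp add: add.commute)
qed

lemma partition_on_concat: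
  fixes m n :: nat
  assumes "partition_on {1..m} P" "partition_on {1..n} Q"
  shows "partition_on {1..m + n} (P \<union> (`) ((+) m) ` Q)"
proof -
  note Q = partition_on_shift[OF assms(2), of m]
  have "disjnt p q" if "p \<in> P" "q \<in> (`) ((+) m) ` Q" for p q
  proof -
    have "p \<subseteq> {1..m}" "q \<subseteq> {m + 1..m + n}"
      using that assms(1) Q unfolding partition_on_def by blast+
    thus ?thesis unfolding disjnt_def by force
  qed
  moreover have "{1..m + n} = {1..m} \<union> {m + 1..m + n}" by auto
  ultimately show ?thesis
    using assms(1) Q unfolding partition_on_def pairwise_def
    by (metis (no_types, lifting) Un_iff Union_Un_distrib disjnt_sym)
qed

instantiation set_partition :: monoid_add
begin

lift_definition zero_set_partition :: set_partition is "{}"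
  by (rule exI[of _ 0]) (simp add: partition_on_def)

lift_definition plus_set_partition :: "set_partition \<Rightarrow> set_partition \<Rightarrow> set_partition" is
  "\<lambda>P Q. P \<union> (`) ((+) (card (\<Union>P))) ` Q"
proof -
  fix P Q :: "nat set set"
  assume "\<exists>m. partition_on {1..m} P" "\<exists>n. partition_on {1..n} Q"
  then obtain m n where P: "partition_on {1..m} P" and Q: "partition_on {1..n} Q" by blast
  have "card (\<Union>P) = m" using P by (simp add: partition_on_def)
  with partition_on_concat[OF P Q]
  show "\<exists>n. partition_on {1..n} (P \<union> (`) ((+) (card (\<Union>P))) ` Q)" by blast
qed

lemma blocks_plus: "blocks (X + Y) = blocks X \<union> (`) ((+) (psize X)) ` blocks Y"
  unfolding psize_def by transfer simp

lemma psize_plus [simp]: "psize (X + Y) = psize X + psize Y"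
  by (rule psizeI, unfold blocks_plus) (rule partition_on_concat; rule partition_on_blocks)

lemma blocks_zero [simp]: "blocks 0 = {}"
  by transfer simp

lemma psize_zero [simp]: "psize 0 = 0"
  by (simp add: psize_def)

instance
proof
  fix X Y Z :: set_partition
  have "(`) ((+) (psize X + psize Y)) ` blocks Z
      = (`) ((+) (psize X)) ` (`) ((+) (psize Y)) ` blocks Z"
    by (auto simp: image_image add.assoc)
  thus "X + Y + Z = X + (Y + Z)"
    by (simp add: blocks_inject[symmetric] blocks_plus image_Un Un_assoc)
  show "0 + X = X" "X + 0 = X"
    by (simp_all add: blocks_inject[symmetric] blocks_plus)
qed

end

definition ptype :: "set_partition \<Rightarrow> nat multiset" where
  "ptype X = image_mset card (mset_set (blocks X))"

text \<open>\<open>\<lambda>!\<close> and \<open>\<lambda>\<^sup>!\<close> for an integer partition \<open>\<lambda>\<close>, encoded as the multiset \<open>p\<close> of its parts.\<close>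

definition parts_fact :: "nat multiset \<Rightarrow> nat" where
  "parts_fact p = (\<Prod>i\<in>#p. fact i)"

definition mults_fact :: "nat multiset \<Rightarrow> nat" where
  "mults_fact p = (\<Prod>i\<in>set_mset p. fact (count p i))"

text \<open>The last case of the recursion covers \<open>x \<not>\<le> y\<close>; an infinite interval, on which the recursion
  would not be meaningful, also gets the value 0, but intervals of set partitions are finite.\<close>

function moebius :: "'a::order \<Rightarrow> 'a \<Rightarrow> int" where
  "moebius x y = (if x = y then 1
     else if x < y \<and> finite {x..y} then - (\<Sum>z\<in>{x..<y}. moebius x z) else 0)"
  by auto
termination
proof (relation "Wellfounded.measure (\<lambda>(x, y). card {x..<y})", simp)
  fix x y z :: 'a
  assume "x < y \<and> finite {x..y}" and z: "z \<in> {x..<y}"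
  hence "finite {x..<y}" by (auto elim!: rev_finite_subset)
  moreover have "{x..<z} \<subset> {x..<y}" using z by (auto intro: less_trans order_less_imp_le)
  ultimately show "((x, z), (x, y)) \<in> Wellfounded.measure (\<lambda>(x, y). card {x..<y})"
    by (simp add: psubset_card_mono)
qed

declare moebius.simps [simp del]

definition moebius0 :: "set_partition \<Rightarrow> int" where
  "moebius0 X = moebius (discrete_partition (psize X)) X"

section \<open>Graded connected Hopf algebras\<close>

text \<open>The tensor power \<open>V\<^sup>\<otimes>\<^sup>n\<close> is the free vector space on the lists of length \<open>n\<close> over \<open>V\<close>
  (the basis element of \<open>[a\<^sub>1,\<dots>,a\<^sub>n]\<close> stands for \<open>a\<^sub>1 \<otimes> \<dots> \<otimes> a\<^sub>n\<close>) modulo the multilinearity relations.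
  Its elements are handled through representatives in the free vector space, and \<open>tensor_eq s n\<close>
  is equality in \<open>V\<^sup>\<otimes>\<^sup>n\<close>, \<open>s\<close> being the scalar multiplication of \<open>V\<close>.\<close>

definition tensor_null :: "('k::field \<Rightarrow> 'a::ab_group_add \<Rightarrow> 'a) \<Rightarrow> nat \<Rightarrow> ('a list \<Rightarrow>\<^sub>0 'k) set" where
  "tensor_null s n = fs.span
     ({Poly_Mapping.single (u @ [a + b] @ v) 1 - Poly_Mapping.single (u @ [a] @ v) 1
         - Poly_Mapping.single (u @ [b] @ v) 1 | u a b v. length u + 1 + length v = n}
    \<union> {Poly_Mapping.single (u @ [s c a] @ v) 1 - fscale c (Poly_Mapping.single (u @ [a] @ v) 1)
         | u c a v. length u + 1 + length v = n})"

definition tensor_eq ::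
  "('k::field \<Rightarrow> 'a::ab_group_add \<Rightarrow> 'a) \<Rightarrow> nat \<Rightarrow> ('a list \<Rightarrow>\<^sub>0 'k) \<Rightarrow> ('a list \<Rightarrow>\<^sub>0 'k) \<Rightarrow> bool" where
  "tensor_eq s n t t' \<longleftrightarrow>
     (\<forall>l\<in>Poly_Mapping.keys t \<union> Poly_Mapping.keys t'. length l = n) \<and> t - t' \<in> tensor_null s n"

text \<open>Multiplication and unit are those of the type class \<open>ring_1\<close>; \<open>coprod H x\<close> is a
  representative of the coproduct of \<open>x\<close>, and \<open>part H n\<close> is the homogeneous part of degree \<open>n\<close>.\<close>

record (overloaded) ('k, 'a) hopf_data =
  scale :: "'k \<Rightarrow> 'a \<Rightarrow> 'a"
  coprod :: "'a \<Rightarrow> ('a list \<Rightarrow>\<^sub>0 'k::zero)"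
  counit :: "'a \<Rightarrow> 'k"
  part :: "nat \<Rightarrow> 'a set"

locale hopf_algebra = vector_space "scale H"
  for H :: "('k::field, 'a::ring_1) hopf_data" +
  assumes scale_mult_left: "scale H c (x * y) = scale H c x * y"
    and scale_mult_right: "scale H c (x * y) = x * scale H c y"
    and coprod_add: "tensor_eq (scale H) 2 (coprod H (x + y)) (coprod H x + coprod H y)"
    and coprod_scale: "tensor_eq (scale H) 2 (coprod H (scale H c x)) (fscale c (coprod H x))"
    and counit_linear: "Vector_Spaces.linear (scale H) (*) (counit H)"
    and coassoc: "tensor_eq (scale H) 3
        (lin_ext fscale (\<lambda>l. push (\<lambda>d. d @ [l ! 1]) (coprod H (l ! 0))) (coprod H x))
        (lin_ext fscale (\<lambda>l. push (\<lambda>d. [l ! 0] @ d) (coprod H (l ! 1))) (coprod H x))"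
    and counit_left: "lin_ext (scale H) (\<lambda>l. scale H (counit H (l ! 0)) (l ! 1)) (coprod H x) = x"
    and counit_right: "lin_ext (scale H) (\<lambda>l. scale H (counit H (l ! 1)) (l ! 0)) (coprod H x) = x"
    and coprod_one: "tensor_eq (scale H) 2 (coprod H 1) (Poly_Mapping.single [1, 1] 1)"
    and coprod_mult: "tensor_eq (scale H) 2 (coprod H (x * y))
        (lin_ext fscale (\<lambda>l. push (\<lambda>m. [l ! 0 * m ! 0, l ! 1 * m ! 1]) (coprod H y)) (coprod H x))"
    and counit_one: "counit H 1 = 1"
    and counit_mult: "counit H (x * y) = counit H x * counit H y"
    and antipode: "\<exists>S. Vector_Spaces.linear (scale H) (scale H) S \<and>
        (\<forall>x. lin_ext (scale H) (\<lambda>l. S (l ! 0) * l ! 1) (coprod H x) = scale H (counit H x) 1 \<and>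
             lin_ext (scale H) (\<lambda>l. l ! 0 * S (l ! 1)) (coprod H x) = scale H (counit H x) 1)"

locale graded_connected_hopf_algebra = hopf_algebra +
  assumes part_subspace: "subspace (part H n)"
    and part_direct: "\<exists>!g. (\<forall>n. g n \<in> part H n) \<and> finite {n. g n \<noteq> 0} \<and> x = (\<Sum>n | g n \<noteq> 0. g n)"
    and part_mult: "x \<in> part H m \<Longrightarrow> y \<in> part H n \<Longrightarrow> x * y \<in> part H (m + n)"
    and part_coprod: "x \<in> part H n \<Longrightarrow> \<exists>t. tensor_eq (scale H) 2 (coprod H x) t \<and>
        (\<forall>l\<in>Poly_Mapping.keys t. \<exists>i j. i + j = n \<and> l ! 0 \<in> part H i \<and> l ! 1 \<in> part H j)"
    and part_counit: "x \<in> part H n \<Longrightarrow> n > 0 \<Longrightarrow> counit H x = 0"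
    and connected: "part H 0 = range (\<lambda>c. scale H c 1)"

definition hopf_iso ::
  "('k::field, 'a::ring_1) hopf_data \<Rightarrow> ('k, 'b::ring_1) hopf_data \<Rightarrow> ('a \<Rightarrow> 'b) \<Rightarrow> bool" where
  "hopf_iso H H' f \<longleftrightarrow>
     graded_connected_hopf_algebra H \<and> graded_connected_hopf_algebra H' \<and>
     bij f \<and> Vector_Spaces.linear (scale H) (scale H') f \<and>
     f 1 = 1 \<and> (\<forall>x y. f (x * y) = f x * f y) \<and>
     (\<forall>x. tensor_eq (scale H') 2 (coprod H' (f x)) (push (map f) (coprod H x))) \<and>
     (\<forall>x. counit H' (f x) = counit H x) \<and>
     (\<forall>n. f ` part H n = part H' n)"

section \<open>The Hopf algebra of set partitions\<close>

text \<open>The product is that of the monoid algebra: \<open>single X 1 * single Y 1 = single (X + Y) 1\<close>.\<close>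

type_synonym 'k kpi = "set_partition \<Rightarrow>\<^sub>0 'k"

definition kpi_part :: "nat \<Rightarrow> 'k::field kpi set" where
  "kpi_part n = {x. \<forall>X\<in>Poly_Mapping.keys x. psize X = n}"

definition kpi_coprod :: "'k::field kpi \<Rightarrow> ('k kpi list \<Rightarrow>\<^sub>0 'k)" where
  "kpi_coprod = lin_ext fscale (\<lambda>Z. \<Sum>S\<in>Pow {1..psize Z}.
     Poly_Mapping.single [Poly_Mapping.single (standard_restrict S Z) 1,
       Poly_Mapping.single (standard_restrict ({1..psize Z} - S) Z) 1] 1)"

definition kpi_counit :: "'k::field kpi \<Rightarrow> 'k" where
  "kpi_counit x = Poly_Mapping.lookup x 0"

definition KPi :: "('k::field, 'k kpi) hopf_data" where
  "KPi = \<lparr>scale = fscale, coprod = kpi_coprod, counit = kpi_counit, part = kpi_part\<rparr>"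

definition kpi_p :: "set_partition \<Rightarrow> 'k::field kpi" where
  "kpi_p X = (\<Sum>Y\<in>{..X}. fscale (of_int (moebius Y X)) (Poly_Mapping.single Y 1))"

definition kpi_m :: "set_partition \<Rightarrow> 'k::field kpi" where
  "kpi_m X = (\<Sum>Y\<in>{X..}. fscale (of_int (moebius X Y)) (kpi_p Y))"

definition kpi_e :: "set_partition \<Rightarrow> 'k::field kpi" where
  "kpi_e X = (\<Sum>Y\<in>{..X}. fscale (of_int (moebius0 Y)) (kpi_p Y))"

definition kpi_h :: "set_partition \<Rightarrow> 'k::field kpi" where
  "kpi_h X = (\<Sum>Y\<in>{..X}. fscale (of_int \<bar>moebius0 Y\<bar>) (kpi_p Y))"

subsection \<open>Coinvariants\<close>

definition coinv_null :: "'k::field kpi set" where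
  "coinv_null = fs.span
     {x - push (permute_partition \<sigma>) x | x \<sigma> n. x \<in> kpi_part n \<and> \<sigma> permutes {1..n}}"

quotient_type (overloaded) 'k kpi_bar = "'k::field kpi" / "\<lambda>x y. x - y \<in> coinv_null"
  morphisms rep_kpi_bar kpi_proj
proof (rule equivpI)
  show "reflp (\<lambda>x y :: 'k kpi. x - y \<in> coinv_null)"
    by (rule reflpI) (simp add: coinv_null_def fs.span_zero)
  show "symp (\<lambda>x y :: 'k kpi. x - y \<in> coinv_null)"
    by (rule sympI) (use fs.span_neg in \<open>fastforce simp: coinv_null_def\<close>)
  show "transp (\<lambda>x y :: 'k kpi. x - y \<in> coinv_null)"
  proof (rule transpI)
    fix x y z :: "'k kpi" assume "x - y \<in> coinv_null" "y - z \<in> coinv_null"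
    hence "(x - y) + (y - z) \<in> coinv_null" unfolding coinv_null_def by (rule fs.span_add)
    thus "x - z \<in> coinv_null" by simp
  qed
qed

lemma push_add: "push g (s + t) = push g s + push g t"
proof -
  let ?K = "Poly_Mapping.keys s \<union> Poly_Mapping.keys t"
  let ?f = "\<lambda>r z. fscale (Poly_Mapping.lookup r z) (Poly_Mapping.single (g z) 1)"
  have K: "push g r = (\<Sum>z\<in>?K. ?f r z)" if "Poly_Mapping.keys r \<subseteq> ?K" for r
    unfolding push_def lin_ext_def using that
    by (intro sum.mono_neutral_left) (auto simp: in_keys_iff)
  show ?thesis
    using K[of s] K[of t] K[of "s + t"] Poly_Mapping.keys_add[of s t]
    by (simp add: sum.distrib[symmetric] lookup_add single_add)
qed

lemma push_single: "push g (Poly_Mapping.single z c) = Poly_Mapping.single (g z) c"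
  by (cases "c = 0") (simp_all add: push_def lin_ext_def)

lemma push_zero [simp]: "push g 0 = 0"
  by (simp add: push_def lin_ext_def)

lemma push_sum: "push g (sum f A) = (\<Sum>a\<in>A. push g (f a))"
  by (induction A rule: infinite_finite_induct) (simp_all add: push_add)

lemma poly_mapping_sum_singles:
  "(x :: 'x \<Rightarrow>\<^sub>0 'k::field) = (\<Sum>z\<in>Poly_Mapping.keys x. Poly_Mapping.single z (Poly_Mapping.lookup x z))"
  by (rule poly_mapping_eqI)
    (simp add: lookup_sum lookup_single when_def in_keys_iff)

lemma blocks_permute:
  "\<sigma> permutes {1..psize X} \<Longrightarrow> blocks (permute_partition \<sigma> X) = (`) \<sigma> ` blocks X"
  by (simp add: permute_partition.rep_eq Union_blocks)

lemma psize_permute: "\<sigma> permutes {1..psize X} \<Longrightarrow> psize (permute_partition \<sigma> X) = psize X"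
  by (simp add: psize_def blocks_permute)
     (simp add: image_Union[symmetric] Union_blocks permutes_image)

lemma permute_plus_left:
  assumes "\<sigma> permutes {1..psize X}"
  shows "permute_partition \<sigma> X + Y = permute_partition \<sigma> (X + Y)"
    and "\<sigma> permutes {1..psize (X + Y)}"
proof -
  show s: "\<sigma> permutes {1..psize (X + Y)}"
    by (rule permutes_subset[OF assms]) auto
  have "\<sigma> ` (+) (psize X) ` B = (+) (psize X) ` B" if "B \<in> blocks Y" for B
  proof -
    have "\<sigma> (psize X + j) = psize X + j" if "j \<in> B" for j
    proof -
      have "j \<in> {1..psize Y}" using that \<open>B \<in> blocks Y\<close> Union_blocks[of Y] by blast
      thus ?thesis using assms by (auto simp: permutes_def)
    qed
    thus ?thesis by (auto simp: image_image)
  qed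
  hence "(`) \<sigma> ` (`) ((+) (psize X)) ` blocks Y = (`) ((+) (psize X)) ` blocks Y"
    by (auto simp: image_image)
  thus "permute_partition \<sigma> X + Y = permute_partition \<sigma> (X + Y)"
    using assms s
    by (simp add: blocks_inject[symmetric] blocks_plus blocks_permute psize_permute image_Un)
qed

lemma permute_plus_right:
  fixes X Y :: set_partition
  assumes "\<sigma> permutes {1..psize X}"
  defines "\<tau> \<equiv> \<lambda>i. if i \<le> psize Y then i else \<sigma> (i - psize Y) + psize Y"
  shows "Y + permute_partition \<sigma> X = permute_partition \<tau> (Y + X)"
    and "\<tau> permutes {1..psize (Y + X)}"
proof -
  have bij: "bij \<sigma>" using assms(1) permutes_bij by blast
  have s0: "\<sigma> 0 = 0" using assms(1) by (simp add: permutes_def)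
  have pos: "\<sigma> i > 0" if "i > 0" for i
    using bij s0 that by (metis bij_is_inj injD not_gr0)
  have fixed: "\<sigma> i = i" if "i > psize X" for i
    using assms(1) that by (simp add: permutes_def)
  show s: "\<tau> permutes {1..psize (Y + X)}"
  proof -
    have "\<tau> i = i" if "i \<notin> {1..psize (Y + X)}" for i
      using that fixed[of "i - psize Y"] by (auto simp: \<tau>_def)
    moreover have "bij \<tau>"
    proof (rule bijI)
      show "inj \<tau>"
      proof (rule injI)
        fix i j assume e: "\<tau> i = \<tau> j"
        show "i = j"
          using e pos[of "i - psize Y"] pos[of "j - psize Y"] bij_is_inj[OF bij, THEN injD, of "i - psize Y" "j - psize Y"]
          by (auto simp: \<tau>_def split: if_splits)
      qed
      show "surj \<tau>"
      proof (rule surjI)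
        fix i
        show "\<tau> (if i \<le> psize Y then i else inv \<sigma> (i - psize Y) + psize Y) = i"
        proof (cases "i \<le> psize Y")
          case False
          have "\<sigma> (inv \<sigma> (i - psize Y)) = i - psize Y"
            using bij by (simp add: bij_is_surj surj_f_inv_f)
          moreover from this have "inv \<sigma> (i - psize Y) > 0"
            using False s0 by (metis diff_is_0_eq gr0I)
          ultimately show ?thesis using False by (simp add: \<tau>_def)
        qed (simp add: \<tau>_def)
      qed
    qed
    ultimately show ?thesis unfolding permutes_def bij_iff by blast
  qed
  have 1: "\<tau> ` B = B" if "B \<in> blocks Y" for B
  proof -
    have "\<tau> j = j" if "j \<in> B" for j
      using that \<open>B \<in> blocks Y\<close> Union_blocks[of Y] by (fastforce simp: \<tau>_def)
    thus ?thesis by auto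
  qed
  have 2: "\<tau> ` (+) (psize Y) ` B = (+) (psize Y) ` \<sigma> ` B" if "B \<in> blocks X" for B
  proof -
    have "\<tau> (psize Y + j) = psize Y + \<sigma> j" if "j \<in> B" for j
    proof -
      have "j \<in> {1..psize X}" using that \<open>B \<in> blocks X\<close> Union_blocks[of X] by blast
      thus ?thesis by (auto simp: \<tau>_def)
    qed
    thus ?thesis by (auto simp: image_image)
  qed
  have "(`) \<tau> ` blocks Y = blocks Y" using 1 by auto
  moreover have "(`) \<tau> ` (`) ((+) (psize Y)) ` blocks X = (`) ((+) (psize Y)) ` (`) \<sigma> ` blocks X"
    using 2 by (simp add: image_image)
  ultimately show "Y + permute_partition \<sigma> X = permute_partition \<tau> (Y + X)"
    using assms(1) s
    by (simp add: blocks_inject[symmetric] blocks_plus blocks_permute image_Un)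
qed

lemma single_diff_coinv:
  assumes "\<sigma> permutes {1..psize X}"
  shows "Poly_Mapping.single X c - Poly_Mapping.single (permute_partition \<sigma> X) c
    \<in> (coinv_null :: 'k::field kpi set)"
  unfolding coinv_null_def
proof (rule fs.span_base, clarsimp, intro exI conjI)
  show "Poly_Mapping.single X c - Poly_Mapping.single (permute_partition \<sigma> X) c =
    Poly_Mapping.single X c - push (permute_partition \<sigma>) (Poly_Mapping.single X c)"
    by (simp add: push_single)
  show "Poly_Mapping.single X c \<in> kpi_part (psize X)"
    by (simp add: kpi_part_def)
  show "\<sigma> permutes {Suc 0..psize X}" using assms by simp
qed

lemma coinv_null_linear_image:
  fixes L :: "'k::field kpi \<Rightarrow> 'k kpi"
  assumes add: "\<And>x y. L (x + y) = L x + L y" and sc: "\<And>c x. L (fscale c x) = fscale c (L x)"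
    and base: "\<And>X \<sigma> c. \<sigma> permutes {1..psize X} \<Longrightarrow>
      L (Poly_Mapping.single X c) - L (Poly_Mapping.single (permute_partition \<sigma> X) c) \<in> coinv_null"
    and x: "x \<in> coinv_null"
  shows "L x \<in> coinv_null"
proof -
  have zero: "L 0 = 0" using add[of 0 0] by simp
  have diff: "L (x - y) = L x - L y" for x y
    using add[of "x - y" y] by (simp add: algebra_simps)
  have sum: "L (sum f A) = (\<Sum>a\<in>A. L (f a))" for f and A :: "set_partition set"
    by (induction A rule: infinite_finite_induct) (simp_all add: zero add)
  have sub: "fs.subspace (coinv_null :: 'k kpi set)"
    unfolding coinv_null_def by (rule fs.subspace_span)
  show ?thesis
    using x unfolding coinv_null_def
  proof (induction rule: fs.span_induct)
    case base
    show ?case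
      unfolding fs.subspace_def
      using sub[unfolded coinv_null_def fs.subspace_def] by (auto simp: zero add sc)
  next
    case (step x)
    then obtain y \<sigma> n where y: "x = y - push (permute_partition \<sigma>) y" "y \<in> kpi_part n"
      "\<sigma> permutes {1..n}" by blast
    let ?s = "\<lambda>X. Poly_Mapping.single X (Poly_Mapping.lookup y X)"
    let ?s' = "\<lambda>X. Poly_Mapping.single (permute_partition \<sigma> X) (Poly_Mapping.lookup y X)"
    have "x = (\<Sum>X\<in>Poly_Mapping.keys y. ?s X) - (\<Sum>X\<in>Poly_Mapping.keys y. ?s' X)"
      unfolding y(1) by (subst (1 2) poly_mapping_sum_singles[of y]) (simp only: push_sum push_single)
    hence "L x = (\<Sum>X\<in>Poly_Mapping.keys y. L (?s X) - L (?s' X))"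
      by (simp add: diff sum sum_subtractf)
    also have "\<dots> \<in> coinv_null"
      using y base by (intro fs.subspace_sum[OF sub]) (auto simp: kpi_part_def)
    finally show ?case by (simp add: coinv_null_def)
  qed
qed

lemma kpi_mult_eq_sum:
  "(x :: 'k::field kpi) * y = (\<Sum>Y\<in>Poly_Mapping.keys y. x * Poly_Mapping.single Y (Poly_Mapping.lookup y Y))"
  by (subst (1) poly_mapping_sum_singles[of y]) (simp add: sum_distrib_left)

lemma fscale_mult:
  "fscale c (x * y) = fscale c x * (y :: 'k::field kpi)"
  "fscale c (x * y) = x * fscale c (y :: 'k::field kpi)"
proof -
  show 1: "fscale c (x * y) = fscale c x * (y :: 'k::field kpi)" for x y
    unfolding fscale_def mult_map_scale_conv_mult by (simp add: mult.assoc)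
  have "Poly_Mapping.single 0 c * x = x * Poly_Mapping.single 0 c"
    by (subst (1 2) poly_mapping_sum_singles[of x])
      (simp add: sum_distrib_left sum_distrib_right mult_single mult.commute)
  thus "fscale c (x * y) = x * fscale c (y :: 'k::field kpi)"
    unfolding fscale_def mult_map_scale_conv_mult by (simp add: mult.assoc[symmetric])
qed

lemma coinv_null_mult:
  assumes "(x :: 'k::field kpi) \<in> coinv_null"
  shows "x * y \<in> coinv_null" "y * x \<in> coinv_null"
proof -
  have sub: "fs.subspace (coinv_null :: 'k kpi set)"
    unfolding coinv_null_def by (rule fs.subspace_span)
  have L: "x * Poly_Mapping.single Y d \<in> coinv_null" for Y d
  proof (rule coinv_null_linear_image[OF _ _ _ assms, where L = "\<lambda>x. x * Poly_Mapping.single Y d"])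
    fix X \<sigma> and c :: 'k assume "\<sigma> permutes {1..psize X}"
    from permute_plus_left[OF this, of Y]
    show "Poly_Mapping.single X c * Poly_Mapping.single Y d
        - Poly_Mapping.single (permute_partition \<sigma> X) c * Poly_Mapping.single Y d \<in> coinv_null"
      by (simp add: mult_single single_diff_coinv)
  qed (simp_all only: distrib_right fscale_mult(1))
  have R: "Poly_Mapping.single Y d * x \<in> coinv_null" for Y d
  proof (rule coinv_null_linear_image[OF _ _ _ assms, where L = "\<lambda>x. Poly_Mapping.single Y d * x"])
    fix X \<sigma> and c :: 'k assume "\<sigma> permutes {1..psize X}"
    from permute_plus_right[OF this, of Y]
    show "Poly_Mapping.single Y d * Poly_Mapping.single X c
        - Poly_Mapping.single Y d * Poly_Mapping.single (permute_partition \<sigma> X) c \<in> coinv_null"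
      by (simp add: mult_single single_diff_coinv)
  qed (simp_all only: distrib_left fscale_mult(2))
  show "x * y \<in> coinv_null"
    by (subst poly_mapping_sum_singles[of y], subst sum_distrib_left)
      (intro fs.subspace_sum[OF sub] L)
  show "y * x \<in> coinv_null"
    by (subst poly_mapping_sum_singles[of y], subst sum_distrib_right)
      (intro fs.subspace_sum[OF sub] R)
qed

lemma coinv_null_lookup_zero: "x \<in> coinv_null \<Longrightarrow> Poly_Mapping.lookup (x :: 'k::field kpi) 0 = 0"
  unfolding coinv_null_def
proof (induction rule: fs.span_induct)
  case base
  show ?case by (auto simp: fs.subspace_def lookup_add)
next
  case (step x)
  then obtain y \<sigma> n where y: "x = y - push (permute_partition \<sigma>) y" "y \<in> kpi_part n"
    "\<sigma> permutes {1..n}" by blast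
  have z: "permute_partition \<sigma> X = 0 \<longleftrightarrow> X = 0" if "X \<in> Poly_Mapping.keys y" for X
    using y that by (simp add: kpi_part_def blocks_inject[symmetric] blocks_permute)
  have "Poly_Mapping.lookup (push (permute_partition \<sigma>) y) 0
      = (\<Sum>X\<in>Poly_Mapping.keys y. Poly_Mapping.lookup y X when permute_partition \<sigma> X = 0)"
    by (subst (1) poly_mapping_sum_singles[of y])
      (simp add: push_sum push_single lookup_sum lookup_single)
  also have "\<dots> = (\<Sum>X\<in>Poly_Mapping.keys y. Poly_Mapping.lookup y X when X = 0)"
    using z by (intro sum.cong) auto
  also have "\<dots> = Poly_Mapping.lookup y 0"
    by (simp add: when_def in_keys_iff)
  finally show ?case by (simp add: y(1) lookup_minus)
qed

instantiation kpi_bar :: (field) ring_1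
begin

lift_definition zero_kpi_bar :: "'a kpi_bar" is 0 .
lift_definition one_kpi_bar :: "'a kpi_bar" is 1 .
lift_definition plus_kpi_bar :: "'a kpi_bar \<Rightarrow> 'a kpi_bar \<Rightarrow> 'a kpi_bar" is "(+)"
proof -
  fix a b c d :: "'a kpi" assume "a - b \<in> coinv_null" "c - d \<in> coinv_null"
  hence "(a - b) + (c - d) \<in> coinv_null" unfolding coinv_null_def by (rule fs.span_add)
  thus "(a + c) - (b + d) \<in> coinv_null" by (simp add: algebra_simps)
qed
lift_definition uminus_kpi_bar :: "'a kpi_bar \<Rightarrow> 'a kpi_bar" is uminus
proof -
  fix a b :: "'a kpi" assume "a - b \<in> coinv_null"
  hence "- (a - b) \<in> coinv_null" unfolding coinv_null_def by (rule fs.span_neg)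
  thus "- a - - b \<in> coinv_null" by simp
qed
lift_definition minus_kpi_bar :: "'a kpi_bar \<Rightarrow> 'a kpi_bar \<Rightarrow> 'a kpi_bar" is "(-)"
proof -
  fix a b c d :: "'a kpi" assume "a - b \<in> coinv_null" "c - d \<in> coinv_null"
  hence "(a - b) - (c - d) \<in> coinv_null" unfolding coinv_null_def by (rule fs.span_diff)
  thus "(a - c) - (b - d) \<in> coinv_null" by (simp add: algebra_simps)
qed
lift_definition times_kpi_bar :: "'a kpi_bar \<Rightarrow> 'a kpi_bar \<Rightarrow> 'a kpi_bar" is "(*)"
proof -
  fix a b c d :: "'a kpi" assume "a - b \<in> coinv_null" "c - d \<in> coinv_null"
  hence "(a - b) * c + b * (c - d) \<in> coinv_null"
    using fs.span_add coinv_null_mult unfolding coinv_null_def by blast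
  thus "a * c - b * d \<in> coinv_null" by (simp add: algebra_simps)
qed

instance
proof
  fix a b c :: "'a kpi_bar"
  note [simp] = coinv_null_def fs.span_zero
  show "a * b * c = a * (b * c)" by transfer (simp add: mult.assoc)
  show "1 * a = a" "a * 1 = a" by (transfer; simp)+
  show "a + b + c = a + (b + c)" by transfer (simp add: add.assoc)
  show "a + b = b + a" by transfer (simp add: add.commute)
  show "0 + a = a" by transfer simp
  show "- a + a = 0" by transfer simp
  show "a - b = a + - b" by transfer simp
  show "(a + b) * c = a * c + b * c" by transfer (simp add: algebra_simps)
  show "a * (b + c) = a * b + a * c" by transfer (simp add: algebra_simps)
  have "(0 :: 'a kpi) - 1 \<notin> coinv_null"
    using coinv_null_lookup_zero[of "0 - 1 :: 'a kpi"] by (auto simp: lookup_minus)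
  thus "(0 :: 'a kpi_bar) \<noteq> 1" by transfer
qed

end

lift_definition kpi_bar_scale :: "'k::field \<Rightarrow> 'k kpi_bar \<Rightarrow> 'k kpi_bar" is fscale
proof -
  fix c and x y :: "'k kpi" assume "x - y \<in> coinv_null"
  hence "fscale c (x - y) \<in> coinv_null" unfolding coinv_null_def by (rule fs.span_scale)
  thus "fscale c x - fscale c y \<in> coinv_null" by (simp add: fs.scale_right_diff_distrib)
qed

text \<open>Coproduct and counit are invariant under the choice of a preimage in \<open>'k kpi\<close>, the coproduct
  up to \<open>tensor_eq\<close>, so that \<open>rep_kpi_bar\<close> yields the induced structure.\<close>

definition KPi_bar :: "('k::field, 'k kpi_bar) hopf_data" where
  "KPi_bar = \<lparr>scale = kpi_bar_scale,
     coprod = (\<lambda>y. push (map kpi_proj) (kpi_coprod (rep_kpi_bar y))),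
     counit = (\<lambda>y. kpi_counit (rep_kpi_bar y)),
     part = (\<lambda>n. kpi_proj ` kpi_part n)\<rparr>"

section \<open>Symmetric functions in noncommuting and in commuting variables\<close>

text \<open>The variable \<open>x\<^sub>i\<^sub>+\<^sub>1\<close> is encoded by the natural number \<open>i\<close>. A monomial is a word
  (\<open>nat list\<close>) in noncommuting variables and a multiset (\<open>nat multiset\<close>) in commuting variables,
  and a formal power series is the function of its coefficients.\<close>

lemma convolution_assoc:
  fixes f g h :: "'m \<Rightarrow> 'k::comm_ring_1"
  assumes assoc: "\<And>x y z. op (op x y) z = op x (op y z)"
    and fin: "\<And>w. finite {(u, v). op u v = w}"
  shows "(\<Sum>(p, z) | op p z = w. (\<Sum>(x, y) | op x y = p. f x * g y) * h z)
       = (\<Sum>(x, q) | op x q = w. f x * (\<Sum>(y, z) | op y z = q. g y * h z))"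
proof -
  have "(\<Sum>(p, z) | op p z = w. (\<Sum>(x, y) | op x y = p. f x * g y) * h z)
      = (\<Sum>c\<in>{(p, z). op p z = w}. \<Sum>d\<in>{(x, y). op x y = fst c}. f (fst d) * g (snd d) * h (snd c))"
    by (simp add: sum_distrib_right split_def)
  also have "\<dots> = (\<Sum>(c, d)\<in>Sigma {(p, z). op p z = w} (\<lambda>c. {(x, y). op x y = fst c}).
      f (fst d) * g (snd d) * h (snd c))"
    by (subst sum.Sigma) (use fin in auto)
  also have "\<dots> = (\<Sum>(c, d)\<in>Sigma {(x, q). op x q = w} (\<lambda>c. {(y, z). op y z = snd c}).
      f (fst c) * (g (fst d) * h (snd d)))"
    by (rule sum.reindex_bij_witness[where
          i = "\<lambda>((x, q), (y, z)). ((op x y, z), (x, y))" and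
          j = "\<lambda>((p, z), (x, y)). ((x, op y z), (y, z))"])
       (auto simp: assoc mult.assoc)
  also have "\<dots> = (\<Sum>c\<in>{(x, q). op x q = w}. \<Sum>d\<in>{(y, z). op y z = snd c}.
      f (fst c) * (g (fst d) * h (snd d)))"
    by (subst sum.Sigma) (use fin in auto)
  also have "\<dots> = (\<Sum>(x, q) | op x q = w. f x * (\<Sum>(y, z) | op y z = q. g y * h z))"
    by (simp add: sum_distrib_left split_def)
  finally show ?thesis .
qed

lemma convolution_invariant:
  assumes "\<And>x y. \<phi> (op x y) = op (\<phi> x) (\<phi> y)" "\<And>x y. \<psi> (op x y) = op (\<psi> x) (\<psi> y)"
    and "\<And>x. \<phi> (\<psi> x) = x" "\<And>x. \<psi> (\<phi> x) = x"
    and "\<And>x. f (\<phi> x) = f x" "\<And>x. g (\<phi> x) = g x"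
  shows "(\<Sum>(u, v) | op u v = \<phi> w. f u * g v) = (\<Sum>(u, v) | op u v = w. f u * (g v :: 'k::comm_ring_1))"
proof (rule sum.reindex_bij_witness[where i = "map_prod \<phi> \<phi>" and j = "map_prod \<psi> \<psi>"])
  have fp: "f (\<psi> x) = f x" and gp: "g (\<psi> x) = g x" for x
    using assms(3,5,6) by metis+
  show "(case map_prod \<psi> \<psi> a of (u, v) \<Rightarrow> f u * g v) = (case a of (u, v) \<Rightarrow> f u * g v)" for a
    by (simp add: fp gp split: prod.split)
  show "map_prod \<psi> \<psi> a \<in> {(u, v). op u v = w}" if "a \<in> {(u, v). op u v = \<phi> w}" for a
    using that assms(2)[of "fst a" "snd a"] assms(4)[of w] by (auto split: prod.splits)
  show "map_prod \<phi> \<phi> b \<in> {(u, v). op u v = \<phi> w}" if "b \<in> {(u, v). op u v = w}" for b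
    using that assms(1)[of "fst b" "snd b"] by (auto split: prod.splits)
qed (use assms(3,4) in \<open>auto split: prod.splits\<close>)

lemma finite_append_pairs: "finite {(u, v). u @ v = (w :: nat list)}"
proof (rule finite_subset)
  show "{(u, v). u @ v = w} \<subseteq> (\<lambda>k. (take k w, drop k w)) ` {..length w}"
  proof clarify
    fix u v assume "w = u @ v"
    thus "(u, v) \<in> (\<lambda>k. (take k (u @ v), drop k (u @ v))) ` {..length (u @ v)}"
      by (intro image_eqI[of _ _ "length u"]) auto
  qed
qed simp

lemma finite_add_pairs: "finite {(A, B). A + B = (M :: nat multiset)}"
proof (rule finite_subset)
  show "{(A, B). A + B = M} \<subseteq> (\<lambda>A. (A, M - A)) ` mset ` (\<Union>k\<le>size M. {l. set l \<subseteq> set_mset M \<and> length l = k})"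
  proof clarify
    fix A B assume M: "M = A + B"
    obtain l where l: "A = mset l" by (metis ex_mset)
    have "l \<in> (\<Union>k\<le>size (A + B). {l. set l \<subseteq> set_mset (A + B) \<and> length l = k})"
      using l by auto
    thus "(A, B) \<in> (\<lambda>C. (C, A + B - C)) ` mset ` (\<Union>k\<le>size (A + B). {l. set l \<subseteq> set_mset (A + B) \<and> length l = k})"
      unfolding image_image using l by (intro image_eqI[of _ _ l]) auto
  qed
  show "finite ((\<lambda>A. (A, M - A)) ` mset ` (\<Union>k\<le>size M. {l. set l \<subseteq> set_mset M \<and> length l = k}))"
    by (intro finite_imageI finite_UN_I) (auto simp: finite_lists_length_eq)
qed

subsection \<open>Noncommuting variables\<close>

typedef (overloaded) 'k ncsym = "{F :: nat list \<Rightarrow> 'k::field.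
    (\<exists>d. \<forall>w. length w > d \<longrightarrow> F w = 0) \<and> (\<forall>n \<sigma> w. \<sigma> permutes {..<n} \<longrightarrow> F (map \<sigma> w) = F w)}"
  morphisms nc_coeff Abs_ncsym
  by (rule exI[of _ "\<lambda>_. 0"]) simp

setup_lifting type_definition_ncsym

instantiation ncsym :: (field) ring_1
begin

lift_definition zero_ncsym :: "'a ncsym" is "\<lambda>_. 0" by simp
lift_definition one_ncsym :: "'a ncsym" is "\<lambda>w. if w = [] then 1 else 0" by auto
lift_definition plus_ncsym :: "'a ncsym \<Rightarrow> 'a ncsym \<Rightarrow> 'a ncsym" is "\<lambda>F G w. F w + G w"
proof -
  fix F G :: "nat list \<Rightarrow> 'a"
  assume FG: "(\<exists>d. \<forall>w. d < length w \<longrightarrow> F w = 0) \<and> (\<forall>n \<sigma> w. \<sigma> permutes {..<n} \<longrightarrow> F (map \<sigma> w) = F w)"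
    "(\<exists>d. \<forall>w. d < length w \<longrightarrow> G w = 0) \<and> (\<forall>n \<sigma> w. \<sigma> permutes {..<n} \<longrightarrow> G (map \<sigma> w) = G w)"
  then obtain d e where "\<forall>w. d < length w \<longrightarrow> F w = 0" "\<forall>w. e < length w \<longrightarrow> G w = 0" by blast
  hence "\<exists>d. \<forall>w. d < length w \<longrightarrow> F w + G w = 0" by (intro exI[of _ "max d e"]) simp
  with FG show "(\<exists>d. \<forall>w. d < length w \<longrightarrow> F w + G w = 0) \<and>
      (\<forall>n \<sigma> w. \<sigma> permutes {..<n} \<longrightarrow> F (map \<sigma> w) + G (map \<sigma> w) = F w + G w)" by simp
qed
lift_definition uminus_ncsym :: "'a ncsym \<Rightarrow> 'a ncsym" is "\<lambda>F w. - F w" by auto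
definition minus_ncsym :: "'a ncsym \<Rightarrow> 'a ncsym \<Rightarrow> 'a ncsym" where "F - G = F + - (G :: 'a ncsym)"
lift_definition times_ncsym :: "'a ncsym \<Rightarrow> 'a ncsym \<Rightarrow> 'a ncsym" is
  "\<lambda>F G w. \<Sum>(u, v) | u @ v = w. F u * G v"
proof -
  fix F G :: "nat list \<Rightarrow> 'a"
  assume FG: "(\<exists>d. \<forall>w. d < length w \<longrightarrow> F w = 0) \<and> (\<forall>n \<sigma> w. \<sigma> permutes {..<n} \<longrightarrow> F (map \<sigma> w) = F w)"
    "(\<exists>d. \<forall>w. d < length w \<longrightarrow> G w = 0) \<and> (\<forall>n \<sigma> w. \<sigma> permutes {..<n} \<longrightarrow> G (map \<sigma> w) = G w)"
  then obtain d e where d: "\<And>w. d < length w \<Longrightarrow> F w = 0" and e: "\<And>w. e < length w \<Longrightarrow> G w = 0"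
    by blast
  have "(\<Sum>(u, v) | u @ v = w. F u * G v) = 0" if w: "d + e < length w" for w
  proof (rule sum.neutral, clarify)
    fix u v assume "w = u @ v"
    hence "d < length u \<or> e < length v" using w by auto
    thus "F u * G v = 0" using d e by auto
  qed
  moreover have "(\<Sum>(u, v) | u @ v = map \<sigma> w. F u * G v) = (\<Sum>(u, v) | u @ v = w. F u * G v)"
    if s: "\<sigma> permutes {..<n}" for n \<sigma> w
  proof (rule convolution_invariant[where \<psi> = "map (inv \<sigma>)"])
    show "F (map \<sigma> x) = F x" "G (map \<sigma> x) = G x" for x using s FG by blast+
  qed (simp_all add: permutes_inv_o[OF s])
  ultimately show "(\<exists>d. \<forall>w. d < length w \<longrightarrow> (\<Sum>(u, v) | u @ v = w. F u * G v) = 0) \<and>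
      (\<forall>n \<sigma> w. \<sigma> permutes {..<n} \<longrightarrow>
        (\<Sum>(u, v) | u @ v = map \<sigma> w. F u * G v) = (\<Sum>(u, v) | u @ v = w. F u * G v))" by blast
qed

instance
proof
  fix a b c :: "'a ncsym"
  show "a * b * c = a * (b * c)"
    by transfer (rule ext, rule convolution_assoc; simp add: finite_append_pairs)
  have 1: "(\<Sum>(u, v) | u @ v = w. (if u = [] then 1 else 0) * F v) = F w" for F :: "nat list \<Rightarrow> 'a" and w
    by (rule trans[OF sum.mono_neutral_right[of _ "{([], w)}"]])
      (auto simp: finite_append_pairs split: if_splits)
  have 2: "(\<Sum>(u, v) | u @ v = w. F u * (if v = [] then 1 else 0)) = F w" for F :: "nat list \<Rightarrow> 'a" and w
    by (rule trans[OF sum.mono_neutral_right[of _ "{(w, [])}"]])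
      (auto simp: finite_append_pairs split: if_splits)
  show "1 * a = a" by transfer (rule ext, rule 1)
  show "a * 1 = a" by transfer (rule ext, rule 2)
  show "a + b + c = a + (b + c)" by transfer (simp add: add.assoc)
  show "a + b = b + a" by transfer (simp add: add.commute)
  show "0 + a = a" by transfer simp
  show "- a + a = 0" by transfer simp
  show "a - b = a + - b" by (simp add: minus_ncsym_def)
  show "(a + b) * c = a * c + b * c"
    by transfer (simp add: distrib_right split_def sum.distrib)
  show "a * (b + c) = a * b + a * c"
    by transfer (simp add: distrib_left split_def sum.distrib)
  show "(0 :: 'a ncsym) \<noteq> 1" by transfer (metis zero_neq_one)
qed

end

lift_definition nc_scale :: "'k::field \<Rightarrow> 'k ncsym \<Rightarrow> 'k ncsym" is "\<lambda>c F w. c * F w" by auto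

text \<open>In \<open>F(x\<^sub>1,y\<^sub>1,x\<^sub>2,y\<^sub>2,\<dots>)\<close> the variable encoded by \<open>2i\<close> becomes \<open>x\<^sub>i\<^sub>+\<^sub>1\<close> and the one encoded by
  \<open>2i+1\<close> becomes \<open>y\<^sub>i\<^sub>+\<^sub>1\<close>; as the \<open>x\<close>'s commute with the \<open>y\<close>'s, each monomial is a product \<open>u v\<close> of a
  word \<open>u\<close> in the \<open>x\<close>'s and a word \<open>v\<close> in the \<open>y\<close>'s. The coproduct is the element of the tensor square
  which corresponds to this series under \<open>a \<otimes> b \<mapsto> a(x) b(y)\<close>.\<close>

definition nc_doubled :: "'k::field ncsym \<Rightarrow> nat list \<Rightarrow> nat list \<Rightarrow> 'k" where
  "nc_doubled F u v = (\<Sum>w | map (\<lambda>i. i div 2) (filter even w) = u \<and>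
                             map (\<lambda>i. i div 2) (filter odd w) = v. nc_coeff F w)"

definition nc_coprod :: "'k::field ncsym \<Rightarrow> ('k ncsym list \<Rightarrow>\<^sub>0 'k)" where
  "nc_coprod F = (SOME t. (\<forall>l\<in>Poly_Mapping.keys t. length l = 2) \<and>
     (\<forall>u v. (\<Sum>l\<in>Poly_Mapping.keys t. Poly_Mapping.lookup t l *
                (nc_coeff (l ! 0) u * nc_coeff (l ! 1) v)) = nc_doubled F u v))"

definition NCSym :: "('k::field, 'k ncsym) hopf_data" where
  "NCSym = \<lparr>scale = nc_scale, coprod = nc_coprod, counit = (\<lambda>F. nc_coeff F []),
     part = (\<lambda>n. {F. \<forall>w. nc_coeff F w \<noteq> 0 \<longrightarrow> length w = n})\<rparr>"

definition same_block :: "set_partition \<Rightarrow> nat \<Rightarrow> nat \<Rightarrow> bool" where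
  "same_block X j k \<longleftrightarrow> (\<exists>B\<in>blocks X. j \<in> B \<and> k \<in> B)"

text \<open>A word \<open>w\<close> is the monomial \<open>x\<^bsub>i\<^sub>1\<^esub>\<cdots>x\<^bsub>i\<^sub>n\<^esub>\<close> with \<open>i\<^sub>j\<close> encoded by \<open>w ! (j - 1)\<close>.\<close>

lemma nth_map_permutes_eq:
  assumes "\<sigma> permutes S" "length w = n" "j \<in> {1..n}" "k \<in> {1..n}"
  shows "map \<sigma> w ! (j - 1) = map \<sigma> w ! (k - 1) \<longleftrightarrow> w ! (j - 1) = w ! (k - 1)"
proof -
  have "j - 1 < length w" "k - 1 < length w" using assms by auto
  thus ?thesis by (simp add: inj_eq[OF permutes_inj[OF assms(1)]])
qed

lemma ball_nth_map_permutes: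
  assumes "\<sigma> permutes S" "length w = n"
  shows "(\<forall>j\<in>{1..n}. \<forall>k\<in>{1..n}. Q j k (map \<sigma> w ! (j - 1) = map \<sigma> w ! (k - 1)))
    \<longleftrightarrow> (\<forall>j\<in>{1..n}. \<forall>k\<in>{1..n}. Q j k (w ! (j - 1) = w ! (k - 1)))"
  by (intro ball_cong refl) (simp only: nth_map_permutes_eq[OF assms])

lift_definition nc_m :: "set_partition \<Rightarrow> 'k::field ncsym" is
  "\<lambda>X w. if length w = psize X \<and> (\<forall>j\<in>{1..psize X}. \<forall>k\<in>{1..psize X}.
      w ! (j - 1) = w ! (k - 1) \<longleftrightarrow> same_block X j k) then 1 else 0"
proof (intro conjI allI impI)
  fix X :: set_partition and n :: nat and \<sigma> :: "nat \<Rightarrow> nat" and w :: "nat list"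
  assume s: "\<sigma> permutes {..<n}"
  show "(if length (map \<sigma> w) = psize X \<and> (\<forall>j\<in>{1..psize X}. \<forall>k\<in>{1..psize X}. map \<sigma> w ! (j - 1) = map \<sigma> w ! (k - 1) \<longleftrightarrow> same_block X j k) then 1 else 0) =
      (if length w = psize X \<and> (\<forall>j\<in>{1..psize X}. \<forall>k\<in>{1..psize X}. w ! (j - 1) = w ! (k - 1) \<longleftrightarrow> same_block X j k) then 1 else 0 :: 'k)"
    using ball_nth_map_permutes[OF s, of w "psize X" "\<lambda>j k e. e = same_block X j k"] by (simp cong: conj_cong del: One_nat_def)
qed (auto intro: exI[of _ "psize _"])

lift_definition nc_p :: "set_partition \<Rightarrow> 'k::field ncsym" is
  "\<lambda>X w. if length w = psize X \<and> (\<forall>j\<in>{1..psize X}. \<forall>k\<in>{1..psize X}.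
      same_block X j k \<longrightarrow> w ! (j - 1) = w ! (k - 1)) then 1 else 0"
proof (intro conjI allI impI)
  fix X :: set_partition and n :: nat and \<sigma> :: "nat \<Rightarrow> nat" and w :: "nat list"
  assume s: "\<sigma> permutes {..<n}"
  show "(if length (map \<sigma> w) = psize X \<and> (\<forall>j\<in>{1..psize X}. \<forall>k\<in>{1..psize X}. same_block X j k \<longrightarrow> map \<sigma> w ! (j - 1) = map \<sigma> w ! (k - 1)) then 1 else 0) =
      (if length w = psize X \<and> (\<forall>j\<in>{1..psize X}. \<forall>k\<in>{1..psize X}. same_block X j k \<longrightarrow> w ! (j - 1) = w ! (k - 1)) then 1 else 0 :: 'k)"
    using ball_nth_map_permutes[OF s, of w "psize X" "\<lambda>j k e. same_block X j k \<longrightarrow> e"] by (simp cong: conj_cong del: One_nat_def)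
qed (auto intro: exI[of _ "psize _"])

lift_definition nc_e :: "set_partition \<Rightarrow> 'k::field ncsym" is
  "\<lambda>X w. if length w = psize X \<and> (\<forall>j\<in>{1..psize X}. \<forall>k\<in>{1..psize X}.
      j \<noteq> k \<and> same_block X j k \<longrightarrow> w ! (j - 1) \<noteq> w ! (k - 1)) then 1 else 0"
proof (intro conjI allI impI)
  fix X :: set_partition and n :: nat and \<sigma> :: "nat \<Rightarrow> nat" and w :: "nat list"
  assume s: "\<sigma> permutes {..<n}"
  show "(if length (map \<sigma> w) = psize X \<and> (\<forall>j\<in>{1..psize X}. \<forall>k\<in>{1..psize X}. j \<noteq> k \<and> same_block X j k \<longrightarrow> map \<sigma> w ! (j - 1) \<noteq> map \<sigma> w ! (k - 1)) then 1 else 0) =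
      (if length w = psize X \<and> (\<forall>j\<in>{1..psize X}. \<forall>k\<in>{1..psize X}. j \<noteq> k \<and> same_block X j k \<longrightarrow> w ! (j - 1) \<noteq> w ! (k - 1)) then 1 else 0 :: 'k)"
    using ball_nth_map_permutes[OF s, of w "psize X" "\<lambda>j k e. j \<noteq> k \<and> same_block X j k \<longrightarrow> \<not> e"] by (simp cong: conj_cong del: One_nat_def)
qed (auto intro: exI[of _ "psize _"])

text \<open>The families \<open>L\<close> of linear orderings of the sets \<open>f\<^sup>-\<^sup>1(i) \<inter> B\<close>, for the map \<open>f\<close> given by \<open>w\<close>.\<close>

definition block_orderings :: "set_partition \<Rightarrow> nat list \<Rightarrow> (nat \<times> nat set \<Rightarrow> nat rel) set" where
  "block_orderings X w =
     (\<Pi>\<^sub>E (i, B)\<in>UNIV \<times> blocks X. {r. linear_order_on {j\<in>B. w ! (j - 1) = i} r})"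

lemma card_block_orderings_map:
  assumes s: "\<sigma> permutes {..<n}" and w: "length w = psize X"
  shows "card (block_orderings X (map \<sigma> w)) = card (block_orderings X w)"
proof -
  have *: "{j\<in>B. map \<sigma> w ! (j - 1) = i} = {j\<in>B. w ! (j - 1) = inv \<sigma> i}" if "B \<in> blocks X" for B i
  proof -
    have "j - 1 < length w" if "j \<in> B" for j
    proof -
      have "j \<in> {1..psize X}" using that \<open>B \<in> blocks X\<close> Union_blocks[of X] by blast
      thus ?thesis using w by auto
    qed
    moreover have "\<sigma> a = i \<longleftrightarrow> a = inv \<sigma> i" for a
      using permutes_inv_eq[OF s, of i a] by (auto simp: eq_commute)
    ultimately show ?thesis by (intro Collect_cong conj_cong refl) (simp only: nth_map)
  qed
  let ?c = "\<lambda>\<tau> L. \<lambda>x\<in>UNIV \<times> blocks X. L (\<tau> (fst x), snd x) :: nat rel"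
  have "bij_betw (?c \<sigma>) (block_orderings X (map \<sigma> w)) (block_orderings X w)"
  proof (rule bij_betw_byWitness[where f' = "?c (inv \<sigma>)"])
    show "?c \<sigma> ` block_orderings X (map \<sigma> w) \<subseteq> block_orderings X w"
    proof clarify
      fix L assume L: "L \<in> block_orderings X (map \<sigma> w)"
      show "?c \<sigma> L \<in> block_orderings X w"
        unfolding block_orderings_def
      proof (rule PiE_I, clarify)
        fix i B assume B: "B \<in> blocks X"
        have "L (\<sigma> i, B) \<in> {r. linear_order_on {j\<in>B. map \<sigma> w ! (j - 1) = \<sigma> i} r}"
          using PiE_mem[OF L[unfolded block_orderings_def], of "(\<sigma> i, B)"] B by simp
        thus "linear_order_on {j\<in>B. w ! (j - 1) = i} (?c \<sigma> L (i, B))"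
          using B *[OF B] permutes_inverses(2)[OF s] by simp
      qed auto
    qed
    show "?c (inv \<sigma>) ` block_orderings X w \<subseteq> block_orderings X (map \<sigma> w)"
    proof clarify
      fix L assume L: "L \<in> block_orderings X w"
      show "?c (inv \<sigma>) L \<in> block_orderings X (map \<sigma> w)"
        unfolding block_orderings_def
      proof (rule PiE_I, clarify)
        fix i B assume B: "B \<in> blocks X"
        have "L (inv \<sigma> i, B) \<in> {r. linear_order_on {j\<in>B. w ! (j - 1) = inv \<sigma> i} r}"
          using PiE_mem[OF L[unfolded block_orderings_def], of "(inv \<sigma> i, B)"] B by simp
        thus "linear_order_on {j\<in>B. map \<sigma> w ! (j - 1) = i} (?c (inv \<sigma>) L (i, B))"
          using B *[OF B] by simp
      qed auto
    qed
    show "\<forall>L\<in>block_orderings X (map \<sigma> w). ?c (inv \<sigma>) (?c \<sigma> L) = L"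
    proof (intro ballI ext)
      fix L x assume L: "L \<in> block_orderings X (map \<sigma> w)"
      show "?c (inv \<sigma>) (?c \<sigma> L) x = L x"
        using PiE_arb[OF L[unfolded block_orderings_def], of x]
        by (cases "x \<in> UNIV \<times> blocks X") (auto simp: permutes_inverses[OF s])
    qed
    show "\<forall>L\<in>block_orderings X w. ?c \<sigma> (?c (inv \<sigma>) L) = L"
    proof (intro ballI ext)
      fix L x assume L: "L \<in> block_orderings X w"
      show "?c \<sigma> (?c (inv \<sigma>) L) x = L x"
        using PiE_arb[OF L[unfolded block_orderings_def], of x]
        by (cases "x \<in> UNIV \<times> blocks X") (auto simp: permutes_inverses[OF s])
    qed
  qed
  thus ?thesis by (rule bij_betw_same_card)
qed

lift_definition nc_h :: "set_partition \<Rightarrow> 'k::field ncsym" is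
  "\<lambda>X w. if length w = psize X then of_nat (card (block_orderings X w)) else 0"
  by (auto simp: card_block_orderings_map)

subsection \<open>Commuting variables\<close>

typedef (overloaded) 'k sym = "{F :: nat multiset \<Rightarrow> 'k::field.
    (\<exists>d. \<forall>M. size M > d \<longrightarrow> F M = 0) \<and> (\<forall>n \<sigma> M. \<sigma> permutes {..<n} \<longrightarrow> F (image_mset \<sigma> M) = F M)}"
  morphisms sym_coeff Abs_sym
  by (rule exI[of _ "\<lambda>_. 0"]) simp

setup_lifting type_definition_sym

instantiation sym :: (field) comm_ring_1
begin

lift_definition zero_sym :: "'a sym" is "\<lambda>_. 0" by simp
lift_definition one_sym :: "'a sym" is "\<lambda>M. if M = {#} then 1 else 0" by auto
lift_definition plus_sym :: "'a sym \<Rightarrow> 'a sym \<Rightarrow> 'a sym" is "\<lambda>F G M. F M + G M"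
proof -
  fix F G :: "nat multiset \<Rightarrow> 'a"
  assume FG: "(\<exists>d. \<forall>w. d < size w \<longrightarrow> F w = 0) \<and> (\<forall>n \<sigma> w. \<sigma> permutes {..<n} \<longrightarrow> F (image_mset \<sigma> w) = F w)"
    "(\<exists>d. \<forall>w. d < size w \<longrightarrow> G w = 0) \<and> (\<forall>n \<sigma> w. \<sigma> permutes {..<n} \<longrightarrow> G (image_mset \<sigma> w) = G w)"
  then obtain d e where "\<forall>w. d < size w \<longrightarrow> F w = 0" "\<forall>w. e < size w \<longrightarrow> G w = 0" by blast
  hence "\<exists>d. \<forall>w. d < size w \<longrightarrow> F w + G w = 0" by (intro exI[of _ "max d e"]) simp
  with FG show "(\<exists>d. \<forall>w. d < size w \<longrightarrow> F w + G w = 0) \<and>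
      (\<forall>n \<sigma> w. \<sigma> permutes {..<n} \<longrightarrow> F (image_mset \<sigma> w) + G (image_mset \<sigma> w) = F w + G w)" by simp
qed
lift_definition uminus_sym :: "'a sym \<Rightarrow> 'a sym" is "\<lambda>F M. - F M" by auto
definition minus_sym :: "'a sym \<Rightarrow> 'a sym \<Rightarrow> 'a sym" where "F - G = F + - (G :: 'a sym)"
lift_definition times_sym :: "'a sym \<Rightarrow> 'a sym \<Rightarrow> 'a sym" is
  "\<lambda>F G M. \<Sum>(A, B) | A + B = M. F A * G B"
proof -
  fix F G :: "nat multiset \<Rightarrow> 'a"
  assume FG: "(\<exists>d. \<forall>w. d < size w \<longrightarrow> F w = 0) \<and> (\<forall>n \<sigma> w. \<sigma> permutes {..<n} \<longrightarrow> F (image_mset \<sigma> w) = F w)"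
    "(\<exists>d. \<forall>w. d < size w \<longrightarrow> G w = 0) \<and> (\<forall>n \<sigma> w. \<sigma> permutes {..<n} \<longrightarrow> G (image_mset \<sigma> w) = G w)"
  then obtain d e where d: "\<And>w. d < size w \<Longrightarrow> F w = 0" and e: "\<And>w. e < size w \<Longrightarrow> G w = 0"
    by blast
  have "(\<Sum>(u, v) | u + v = w. F u * G v) = 0" if w: "d + e < size w" for w
  proof (rule sum.neutral, clarify)
    fix u v assume "w = u + v"
    hence "d < size u \<or> e < size v" using w by auto
    thus "F u * G v = 0" using d e by auto
  qed
  moreover have "(\<Sum>(u, v) | u + v = image_mset \<sigma> w. F u * G v) = (\<Sum>(u, v) | u + v = w. F u * G v)"
    if s: "\<sigma> permutes {..<n}" for n \<sigma> w
  proof (rule convolution_invariant[where \<psi> = "image_mset (inv \<sigma>)"])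
    show "F (image_mset \<sigma> x) = F x" "G (image_mset \<sigma> x) = G x" for x using s FG by blast+
  qed (simp_all add: multiset.map_comp permutes_inv_o[OF s])
  ultimately show "(\<exists>d. \<forall>w. d < size w \<longrightarrow> (\<Sum>(u, v) | u + v = w. F u * G v) = 0) \<and>
      (\<forall>n \<sigma> w. \<sigma> permutes {..<n} \<longrightarrow>
        (\<Sum>(u, v) | u + v = image_mset \<sigma> w. F u * G v) = (\<Sum>(u, v) | u + v = w. F u * G v))" by blast
qed

instance
proof
  fix a b c :: "'a sym"
  show "a * b * c = a * (b * c)"
    by transfer (rule ext, rule convolution_assoc; simp add: finite_add_pairs add.assoc)
  have "(\<Sum>(u, v) | u + v = w. F u * G v) = (\<Sum>(u, v) | u + v = w. G u * F v)"
    for F G :: "nat multiset \<Rightarrow> 'a" and w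
    by (rule sum.reindex_bij_witness[where i = prod.swap and j = prod.swap])
      (auto simp: mult.commute add.commute)
  thus "a * b = b * a" by transfer blast
  have 1: "(\<Sum>(u, v) | u + v = w. (if u = {#} then 1 else 0) * F v) = F w"
    for F :: "nat multiset \<Rightarrow> 'a" and w
    by (rule trans[OF sum.mono_neutral_right[of _ "{({#}, w)}"]])
      (auto simp: finite_add_pairs split: if_splits)
  show "1 * a = a" by transfer (rule ext, rule 1)
  show "a + b + c = a + (b + c)" by transfer (simp add: add.assoc)
  show "a + b = b + a" by transfer (simp add: add.commute)
  show "0 + a = a" by transfer simp
  show "- a + a = 0" by transfer simp
  show "a - b = a + - b" by (simp add: minus_sym_def)
  show "(a + b) * c = a * c + b * c"
    by transfer (simp add: distrib_right split_def sum.distrib)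
  show "(0 :: 'a sym) \<noteq> 1" by transfer (metis zero_neq_one)
qed

end

lift_definition sym_scale :: "'k::field \<Rightarrow> 'k sym \<Rightarrow> 'k sym" is "\<lambda>c F M. c * F M" by auto

text \<open>In \<open>F(x\<^sub>1,y\<^sub>1,x\<^sub>2,y\<^sub>2,\<dots>)\<close> the coefficient of the monomial \<open>A\<close> in the \<open>x\<close>'s times the monomial
  \<open>B\<close> in the \<open>y\<close>'s is the following.\<close>

definition sym_doubled :: "'k::field sym \<Rightarrow> nat multiset \<Rightarrow> nat multiset \<Rightarrow> 'k" where
  "sym_doubled F A B = sym_coeff F (image_mset (\<lambda>i. 2 * i) A + image_mset (\<lambda>i. 2 * i + 1) B)"

definition sym_coprod :: "'k::field sym \<Rightarrow> ('k sym list \<Rightarrow>\<^sub>0 'k)" where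
  "sym_coprod F = (SOME t. (\<forall>l\<in>Poly_Mapping.keys t. length l = 2) \<and>
     (\<forall>A B. (\<Sum>l\<in>Poly_Mapping.keys t. Poly_Mapping.lookup t l *
                (sym_coeff (l ! 0) A * sym_coeff (l ! 1) B)) = sym_doubled F A B))"

definition Sym :: "('k::field, 'k sym) hopf_data" where
  "Sym = \<lparr>scale = sym_scale, coprod = sym_coprod, counit = (\<lambda>F. sym_coeff F {#}),
     part = (\<lambda>n. {F. \<forall>M. sym_coeff F M \<noteq> 0 \<longrightarrow> size M = n})\<rparr>"

lift_definition commute_vars :: "'k::field ncsym \<Rightarrow> 'k sym" is
  "\<lambda>F M. \<Sum>w | mset w = M. F w"
proof -
  fix F :: "nat list \<Rightarrow> 'k"
  assume F: "(\<exists>d. \<forall>w. d < length w \<longrightarrow> F w = 0) \<and> (\<forall>n \<sigma> w. \<sigma> permutes {..<n} \<longrightarrow> F (map \<sigma> w) = F w)"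
  then obtain d where d: "\<And>w. d < length w \<Longrightarrow> F w = 0" by blast
  have "(\<Sum>w | mset w = M. F w) = 0" if "d < size M" for M
    by (rule sum.neutral) (use d that in auto)
  moreover have "(\<Sum>w | mset w = image_mset \<sigma> M. F w) = (\<Sum>w | mset w = M. F w)"
    if s: "\<sigma> permutes {..<n}" for n \<sigma> M
  proof (rule sum.reindex_bij_witness[where i = "map \<sigma>" and j = "map (inv \<sigma>)"])
    have F': "F (map (inv \<sigma>) w) = F w" for w
      using F permutes_inv[OF s] by blast
    show "F (map (inv \<sigma>) w) = F w" for w by (rule F')
  qed (auto simp: permutes_inv_o[OF s] multiset.map_comp)
  ultimately show "(\<exists>d. \<forall>M. d < size M \<longrightarrow> (\<Sum>w | mset w = M. F w) = 0) \<and>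
    (\<forall>n \<sigma> M. \<sigma> permutes {..<n} \<longrightarrow>
      (\<Sum>w | mset w = image_mset \<sigma> M. F w) = (\<Sum>w | mset w = M. F w))" by blast
qed

text \<open>\<open>count M i\<close> is the exponent of the variable \<open>i\<close> in \<open>M\<close>.\<close>

lemma image_mset_permutes_eq:
  "\<sigma> permutes S \<Longrightarrow> image_mset \<sigma> M = N \<longleftrightarrow> M = image_mset (inv \<sigma>) N"
  by (auto simp: multiset.map_comp permutes_inv_o)

lemma count_image_mset_permutes: "\<sigma> permutes S \<Longrightarrow> count (image_mset \<sigma> M) i = count M (inv \<sigma> i)"
proof (induction M)
  case (add x M)
  thus ?case using permutes_inv_eq[OF add.prems, of i x] by (auto simp: eq_commute)
qed simp

lift_definition power_sum :: "nat \<Rightarrow> 'k::field sym" is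
  "\<lambda>k M. if \<exists>i. M = replicate_mset k i then 1 else 0"
proof (intro conjI allI impI)
  fix k n :: nat and \<sigma> :: "nat \<Rightarrow> nat" and M :: "nat multiset"
  assume s: "\<sigma> permutes {..<n}"
  have "(\<exists>i. image_mset \<sigma> M = replicate_mset k i) \<longleftrightarrow> (\<exists>i. M = replicate_mset k i)"
    using permutes_inverses(2)[OF s] by (metis image_mset_permutes_eq[OF s] image_replicate_mset)
  thus "(if \<exists>i. image_mset \<sigma> M = replicate_mset k i then 1 else 0) =
      (if \<exists>i. M = replicate_mset k i then 1 else 0 :: 'k)" by simp
qed auto

lift_definition elementary :: "nat \<Rightarrow> 'k::field sym" is
  "\<lambda>k M. if size M = k \<and> (\<forall>i. count M i \<le> 1) then 1 else 0"
proof (intro conjI allI impI)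
  fix k n :: nat and \<sigma> :: "nat \<Rightarrow> nat" and M :: "nat multiset"
  assume s: "\<sigma> permutes {..<n}"
  have "(\<forall>i. count (image_mset \<sigma> M) i \<le> 1) \<longleftrightarrow> (\<forall>i. count M i \<le> 1)"
    using permutes_inverses(2)[OF s] by (metis count_image_mset_permutes[OF s])
  thus "(if size (image_mset \<sigma> M) = k \<and> (\<forall>i. count (image_mset \<sigma> M) i \<le> 1) then 1 else 0) =
      (if size M = k \<and> (\<forall>i. count M i \<le> 1) then 1 else 0 :: 'k)" by simp
qed auto

lift_definition complete_hom :: "nat \<Rightarrow> 'k::field sym" is
  "\<lambda>k M. if size M = k then 1 else 0"
  by auto

lift_definition sym_m :: "nat multiset \<Rightarrow> 'k::field sym" is
  "\<lambda>p M. if image_mset (count M) (mset_set (set_mset M)) = p then 1 else 0"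
proof (intro conjI allI impI)
  fix p :: "nat multiset"
  show "\<exists>d. \<forall>M. d < size M \<longrightarrow>
      (if image_mset (count M) (mset_set (set_mset M)) = p then 1 else 0) = (0 :: 'k)"
    by (rule exI[of _ "sum_mset p"]) (auto simp: size_multiset_overloaded_eq sum_unfold_sum_mset)
next
  fix p :: "nat multiset" and n and \<sigma> :: "nat \<Rightarrow> nat" and M :: "nat multiset"
  assume s: "\<sigma> permutes {..<n}"
  have "image_mset (count (image_mset \<sigma> M)) (mset_set (\<sigma> ` set_mset M))
      = image_mset (count (image_mset \<sigma> M)) (image_mset \<sigma> (mset_set (set_mset M)))"
    by (subst image_mset_mset_set) (auto intro: permutes_inj_on[OF s])
  also have "\<dots> = image_mset (count M) (mset_set (set_mset M))"
    by (simp add: multiset.map_comp o_def count_image_mset_permutes[OF s] permutes_inverses[OF s])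
  finally show "(if image_mset (count (image_mset \<sigma> M)) (mset_set (set_mset (image_mset \<sigma> M))) = p
      then 1 else 0) = (if image_mset (count M) (mset_set (set_mset M)) = p then 1 else 0 :: 'k)" by simp
qed

definition sym_p :: "nat multiset \<Rightarrow> 'k::field sym" where
  "sym_p p = (\<Prod>k\<in>#p. power_sum k)"

definition sym_e :: "nat multiset \<Rightarrow> 'k::field sym" where
  "sym_e p = (\<Prod>k\<in>#p. elementary k)"

definition sym_h :: "nat multiset \<Rightarrow> 'k::field sym" where
  "sym_h p = (\<Prod>k\<in>#p. complete_hom k)"

end

theory Submission
  imports Defs "HOL-Combinatorics.Multiset_Permutations"
begin

text \<open>Moebius inversion gives \<open>X = (\<Sum>Y \<le> X. p\<^sub>Y)\<close> in
  \<open>\<^bold>\<Pi>[n]\<close>, so the condition on the \<open>p\<^sub>\<Lambda>\<close> forces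
  \<open>f X\<close> to be the sum of the series \<open>p\<^sub>Y\<close> over
  \<open>Y \<le> X\<close> (\<open>refinement_sum\<close>). Everything follows from one formula for
  coefficients. A word \<open>w\<close> colors the positions \<open>1,\<dots>,n\<close>, and the
  \<open>Y \<le> X\<close> on whose blocks \<open>w\<close> is constant are the partitions refining
  the cells \<open>{j \<in> B. w\<^sub>j = i}\<close> with \<open>B \<in> X\<close>. If a block of
  size \<open>k\<close> has weight \<open>g k\<close>, the total weight of these \<open>Y\<close> is
  a product over the cells (\<open>nc_coeff_sum_p\<close>). With \<open>g = 1\<close> this computes
  \<open>f X\<close>, as a product of Bell numbers. The values
  \<open>\<mu>(Y) = (\<Prod>B\<in>Y. (-1)^(|B|-1) (|B|-1)!)\<close> have this form too; the factor
  of a cell of size \<open>k\<close> is \<open>1\<close> or \<open>0\<close> as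
  \<open>k \<le> 1\<close> or not for \<open>\<mu>\<close>, and \<open>k!\<close> for
  \<open>|\<mu>|\<close>, which are the coefficients of \<open>e\<close> and \<open>h\<close>.

  Since the coefficients of \<open>f X\<close> are products over the blocks of \<open>X\<close>, and
  within a block over the letters, they are compatible with concatenation of words (the product) and
  with separating the letters into two alphabets (the coproduct). Expansion in the basis
  \<open>m\<close> shows that \<open>f\<close> is bijective.

  The Hopf algebra axioms are verified directly only for \<open>K(\<^bold>\<Pi>)\<close>, where the
  coproduct of a basis element is an explicit sum over subsets; the antipode exists in every graded
  connected bialgebra, as a geometric series in the convolution algebra. The axioms then pass to
  \<open>\<^bold>N\<^bold>C\<^bold>S\<^bold>y\<^bold>m\<close> along the bijection \<open>f\<close>,
  from there to \<open>\<^bold>S\<^bold>y\<^bold>m\<close> along the surjection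
  \<open>\<rho>\<close>, and back to the coinvariants along the inverse of the induced map
  (\<open>graded_connected_hopf_algebra_image\<close>,
  \<open>graded_connected_hopf_algebra_bij\<close>).

  The induced map is injective because the kernel of \<open>\<rho> \<circ> f\<close> is the span of
  the \<open>x - \<sigma> x\<close> (\<open>in_coinv_null_iff\<close>): if
  \<open>\<rho> (f x) = 0\<close> with \<open>x\<close> homogeneous of degree \<open>n\<close>, the
  sum of the translates \<open>\<sigma> x\<close> is zero, hence
  \<open>n! x = (\<Sum>\<sigma>. x - \<sigma> x)\<close>. The values on the bases count, for a
  monomial \<open>M\<close>, the colorings of the positions in which each color is used as often as
  it occurs in \<open>M\<close>, one block at a time.\<close>

abbreviation sgl :: "'x \<Rightarrow> 'k \<Rightarrow> ('x \<Rightarrow>\<^sub>0 'k::zero)" where "sgl \<equiv> Poly_Mapping.single"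
abbreviation coef :: "('x \<Rightarrow>\<^sub>0 'k::zero) \<Rightarrow> 'x \<Rightarrow> 'k" where "coef \<equiv> Poly_Mapping.lookup"
abbreviation supp :: "('x \<Rightarrow>\<^sub>0 'k::zero) \<Rightarrow> 'x set" where "supp \<equiv> Poly_Mapping.keys"
abbreviation lin where "lin \<equiv> Vector_Spaces.linear"

section \<open>Linear maps on free vector spaces\<close>

lemma linearD:
  assumes "lin s s' f"
  shows "vector_space s" "vector_space s'" "f (x + y) = f x + f y" "f (s c x) = s' c (f x)"
    "f 0 = 0" "f (x - y) = f x - f y" "f (sum h A) = (\<Sum>a\<in>A. f (h a))"
proof -
  show *: "vector_space s" "vector_space s'" and add: "\<And>x y. f (x + y) = f x + f y"
    and "f (s c x) = s' c (f x)"
    using assms by (auto simp: Vector_Spaces.linear_iff)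
  show 0: "f 0 = 0" using add[of 0 0] by simp
  show "f (x - y) = f x - f y" using add[of "x - y" y] by (simp add: algebra_simps)
  show "f (sum h A) = (\<Sum>a\<in>A. f (h a))"
    by (induction A rule: infinite_finite_induct) (simp_all add: 0 add)
qed

lemma linearI:
  assumes "vector_space s" "vector_space s'" "\<And>x y. f (x + y) = f x + f y"
    "\<And>c x. f (s c x) = s' c (f x)"
  shows "lin s s' f"
  using assms by (simp add: Vector_Spaces.linear_iff)

lemmas vector_spaceD = vector_space.vector_space_assms
  module.scale_zero_left[OF module_iff_vector_space[THEN iffD2]]
  module.scale_zero_right[OF module_iff_vector_space[THEN iffD2]]
  module.scale_left_diff_distrib[OF module_iff_vector_space[THEN iffD2]]
  module.scale_right_diff_distrib[OF module_iff_vector_space[THEN iffD2]]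
  module.scale_sum_left[OF module_iff_vector_space[THEN iffD2]]
  module.scale_sum_right[OF module_iff_vector_space[THEN iffD2]]

lemma linear_comp: "lin s1 s2 f \<Longrightarrow> lin s2 s3 g \<Longrightarrow> lin s1 s3 (\<lambda>x. g (f x))"
  by (auto simp: Vector_Spaces.linear_iff)

lemma linear_id: "vector_space s \<Longrightarrow> lin s s (\<lambda>x. x)"
  by (auto simp: Vector_Spaces.linear_iff)

lemma linear_inv:
  assumes "lin s s' f" "bij f"
  shows "lin s' s (inv f)"
proof (rule linearI)
  note f = linearD[OF assms(1)] and i = bij_inv_eq_iff[OF assms(2)]
    and s = surj_f_inv_f[OF bij_is_surj[OF assms(2)]]
  show "inv f (x + y) = inv f x + inv f y" for x y
    by (metis i f(3) s)
  show "inv f (s' c x) = s c (inv f x)" for c x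
    by (metis i f(4) s)
qed (use linearD[OF assms(1)] in auto)

lemma lin_ext_superset:
  assumes "vector_space s" "finite K" "supp t \<subseteq> K"
  shows "lin_ext s g t = (\<Sum>z\<in>K. s (coef t z) (g z))"
  unfolding lin_ext_def using assms
  by (intro sum.mono_neutral_left) (auto simp: in_keys_iff vector_spaceD)

lemma linear_lin_ext:
  fixes s :: "'k::field \<Rightarrow> 'v::ab_group_add \<Rightarrow> 'v" and g :: "'x \<Rightarrow> 'v"
  assumes "vector_space s"
  shows "lin fscale s (lin_ext s g)"
proof (rule linearI[OF vector_space_fscale assms])
  fix x y :: "'x \<Rightarrow>\<^sub>0 'k" and c
  let ?K = "supp x \<union> supp y"
  have "supp (x + y) \<subseteq> ?K" by (rule Poly_Mapping.keys_add)
  thus "lin_ext s g (x + y) = lin_ext s g x + lin_ext s g y"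
    using assms by (simp add: lin_ext_superset[where K = ?K] lookup_add vector_spaceD sum.distrib)
  have "supp (fscale c x) \<subseteq> supp x" by (auto simp: in_keys_iff)
  thus "lin_ext s g (fscale c x) = s c (lin_ext s g x)"
    using assms by (simp add: lin_ext_superset[where K = "supp x"] vector_spaceD)
qed

lemma lin_ext_single: "vector_space s \<Longrightarrow> lin_ext s g (sgl z c) = s c (g z)"
  by (simp add: lin_ext_superset[where K = "{z}"])

lemma lin_ext_single_1: "vector_space s \<Longrightarrow> lin_ext s g (sgl z 1) = g z"
  by (simp add: lin_ext_single vector_spaceD)

lemma lin_ext_cong: "(\<And>z. z \<in> supp t \<Longrightarrow> g z = h z) \<Longrightarrow> lin_ext s g t = lin_ext s h t"
  by (simp add: lin_ext_def)

lemma lin_ext_comp: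
  assumes "lin s s' h"
  shows "h (lin_ext s g t) = lin_ext s' (\<lambda>z. h (g z)) t"
  by (simp add: lin_ext_def linearD[OF assms])

lemma lin_ext_add_fun: "vector_space s \<Longrightarrow> lin_ext s (\<lambda>z. g z + h z) t = lin_ext s g t + lin_ext s h t"
  by (simp add: lin_ext_def vector_spaceD sum.distrib)

lemma lin_ext_diff_fun: "vector_space s \<Longrightarrow> lin_ext s (\<lambda>z. g z - h z) t = lin_ext s g t - lin_ext s h t"
  by (simp add: lin_ext_def vector_spaceD sum_subtractf)

lemma lin_ext_scale_fun: "vector_space s \<Longrightarrow> lin_ext s (\<lambda>z. s c (g z)) t = s c (lin_ext s g t)"
  by (simp add: lin_ext_def vector_spaceD mult.commute)

lemma lin_ext_sum_fun: "vector_space s \<Longrightarrow> lin_ext s (\<lambda>z. \<Sum>i\<in>I. g i z) t = (\<Sum>i\<in>I. lin_ext s (g i) t)"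
  by (simp add: lin_ext_def vector_spaceD) (rule sum.swap)

lemma lin_ext_lin_ext:
  "vector_space s \<Longrightarrow> lin_ext s g (lin_ext fscale h t) = lin_ext s (\<lambda>z. lin_ext s g (h z)) t"
  by (rule lin_ext_comp[OF linear_lin_ext])

lemma linear_push: "lin fscale fscale (push g)"
  unfolding push_def by (rule linear_lin_ext[OF vector_space_fscale])

lemma lin_ext_push: "vector_space s \<Longrightarrow> lin_ext s g (push h t) = lin_ext s (\<lambda>z. g (h z)) t"
  by (simp add: push_def lin_ext_lin_ext lin_ext_single_1)

lemma push_push: "push g (push h t) = push (\<lambda>z. g (h z)) t"
  unfolding push_def[of g] push_def[of "\<lambda>z. g (h z)"] by (rule lin_ext_push[OF vector_space_fscale])

lemma push_lin_ext: "push g (lin_ext fscale h t) = lin_ext fscale (\<lambda>z. push g (h z)) t"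
  by (rule lin_ext_comp[OF linear_push])

lemma push_cong: "(\<And>z. z \<in> supp t \<Longrightarrow> g z = h z) \<Longrightarrow> push g t = push h t"
  unfolding push_def by (rule lin_ext_cong) simp

lemma supp_lin_ext: "supp (lin_ext fscale g t) \<subseteq> (\<Union>z\<in>supp t. supp (g z))"
  unfolding lin_ext_def
  by (rule order_trans[OF Poly_Mapping.keys_sum]) (auto simp: in_keys_iff)

lemma supp_push: "supp (push g t) \<subseteq> g ` supp t"
  unfolding push_def by (rule order_trans[OF supp_lin_ext]) auto

lemma lin_ext_singles: "lin_ext fscale (\<lambda>z. sgl z 1) t = t"
  unfolding lin_ext_def by (simp flip: poly_mapping_sum_singles)

lemma linear_eq_on_basis:
  assumes f: "lin fscale s f" and g: "lin fscale s g" and "\<And>z. f (sgl z 1) = g (sgl z 1)"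
  shows "f t = g t"
proof -
  have "f t = lin_ext s (\<lambda>z. f (sgl z 1)) t"
    using lin_ext_comp[OF f, of "\<lambda>z. sgl z 1" t] by (simp add: lin_ext_singles)
  also have "\<dots> = lin_ext s (\<lambda>z. g (sgl z 1)) t" by (simp add: assms)
  also have "\<dots> = g t"
    using lin_ext_comp[OF g, of "\<lambda>z. sgl z 1" t] by (simp add: lin_ext_singles)
  finally show ?thesis .
qed

section \<open>Tensor powers\<close>

lemma subspace_tensor_null: "fs.subspace (tensor_null s n)"
  unfolding tensor_null_def by (rule fs.subspace_span)

lemma tensor_null_add:
  "length u + 1 + length v = n \<Longrightarrow>
    sgl (u @ [a + b] @ v) 1 - sgl (u @ [a] @ v) 1 - sgl (u @ [b] @ v) 1 \<in> tensor_null s n"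
  unfolding tensor_null_def by (rule fs.span_base) blast

lemma tensor_null_scale:
  "length u + 1 + length v = n \<Longrightarrow>
    sgl (u @ [s c a] @ v) 1 - fscale c (sgl (u @ [a] @ v) 1) \<in> tensor_null s n"
  unfolding tensor_null_def by (rule fs.span_base) blast

lemma lin_ext_in_subspace:
  assumes "vector_space s" "module.subspace s N" "\<And>z. z \<in> supp t \<Longrightarrow> g z \<in> N"
  shows "lin_ext s g t \<in> N"
proof -
  interpret vector_space s by fact
  show ?thesis unfolding lin_ext_def using assms by (intro subspace_sum subspace_scale)
qed

text \<open>This is the universal property of the tensor power, relative to a subspace
  \<open>N\<close> so that it also applies to maps which are multilinear only up to relations, such
  as those built from a coproduct.\<close>

lemma multilinear_lin_ext:
  assumes vs: "vector_space s'" and N: "module.subspace s' N"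
    and add: "\<And>u a b v. length u + 1 + length v = n \<Longrightarrow>
      M (u @ [a + b] @ v) - M (u @ [a] @ v) - M (u @ [b] @ v) \<in> N"
    and sc: "\<And>u c a v. length u + 1 + length v = n \<Longrightarrow>
      M (u @ [s c a] @ v) - s' c (M (u @ [a] @ v)) \<in> N"
    and t: "t \<in> tensor_null s n"
  shows "lin_ext s' M t \<in> N"
proof -
  interpret vector_space s' by fact
  note L = linearD[OF linear_lin_ext[OF vs, of M]]
  show ?thesis using t unfolding tensor_null_def
  proof (induction rule: fs.span_induct)
    case base
    show ?case using N by (auto simp: fs.subspace_def subspace_def L)
  next
    case (step x)
    thus ?case using add sc by (auto simp: L lin_ext_single vector_spaceD[OF vs])
  qed
qed

lemma length_2_split: "length u + 1 + length v = 2 \<longleftrightarrow> (\<exists>x. u = [] \<and> v = [x] \<or> u = [x] \<and> v = [])"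
  by (cases u; cases v) (auto simp: length_Suc_conv)

lemma bilinear_lin_ext_diff:
  assumes vs: "vector_space s'" and N: "module.subspace s' N"
    and "\<And>a b x. m (a + b) x - m a x - m b x \<in> N" "\<And>a b x. m x (a + b) - m x a - m x b \<in> N"
    and "\<And>c a x. m (s c a) x - s' c (m a x) \<in> N" "\<And>c a x. m x (s c a) - s' c (m x a) \<in> N"
    and t: "tensor_eq s 2 t t'"
  shows "lin_ext s' (\<lambda>l. m (l ! 0) (l ! 1)) t - lin_ext s' (\<lambda>l. m (l ! 0) (l ! 1)) t' \<in> N"
proof -
  have "lin_ext s' (\<lambda>l. m (l ! 0) (l ! 1)) (t - t') \<in> N"
    by (rule multilinear_lin_ext[where n = 2 and s = s, OF vs N])
      (use assms in \<open>auto simp: length_2_split tensor_eq_def simp del: One_nat_def\<close>)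
  thus ?thesis by (simp add: linearD[OF linear_lin_ext[OF vs]])
qed

lemma bilinear_lin_ext_eq:
  assumes vs: "vector_space s'"
    and "\<And>a b x. m (a + b) x = m a x + m b x" "\<And>a b x. m x (a + b) = m x a + m x b"
    and "\<And>c a x. m (s c a) x = s' c (m a x)" "\<And>c a x. m x (s c a) = s' c (m x a)"
    and t: "tensor_eq s 2 t t'"
  shows "lin_ext s' (\<lambda>l. m (l ! 0) (l ! 1)) t = lin_ext s' (\<lambda>l. m (l ! 0) (l ! 1)) t'"
proof -
  interpret vector_space s' by fact
  show ?thesis
    using bilinear_lin_ext_diff[OF vs subspace_single_0, of m s t t'] assms by simp
qed

lemma tensor_eq_refl: "(\<And>l. l \<in> supp t \<Longrightarrow> length l = n) \<Longrightarrow> tensor_eq s n t t"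
  using fs.subspace_0[OF subspace_tensor_null] by (auto simp: tensor_eq_def)

lemma tensor_eq_sym: "tensor_eq s n t t' \<Longrightarrow> tensor_eq s n t' t"
  using fs.subspace_neg[OF subspace_tensor_null] by (fastforce simp: tensor_eq_def)

lemma tensor_eq_trans: "tensor_eq s n t t' \<Longrightarrow> tensor_eq s n t' t'' \<Longrightarrow> tensor_eq s n t t''"
  using fs.subspace_add[OF subspace_tensor_null, of "t - t'" s n "t' - t''"]
  by (auto simp: tensor_eq_def)

lemma tensor_eq_add:
  assumes "tensor_eq s n t t'" "tensor_eq s n r r'"
  shows "tensor_eq s n (t + r) (t' + r')"
  using assms fs.subspace_add[OF subspace_tensor_null, of "t - t'" s n "r - r'"]
    Poly_Mapping.keys_add[of t r] Poly_Mapping.keys_add[of t' r']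
  by (auto simp: tensor_eq_def algebra_simps dest!: subsetD)

lemma tensor_eq_fscale:
  assumes "tensor_eq s n t t'"
  shows "tensor_eq s n (fscale c t) (fscale c t')"
proof -
  have "supp (fscale c r) \<subseteq> supp r" for r by (auto simp: in_keys_iff)
  thus ?thesis
    using assms fs.subspace_scale[OF subspace_tensor_null, of "t - t'" s n c]
    by (auto simp: tensor_eq_def fs.scale_right_diff_distrib in_keys_iff)
qed

lemma tensor_eq_push:
  assumes f: "lin s s' f" and t: "tensor_eq s n t t'"
  shows "tensor_eq s' n (push (map f) t) (push (map f) t')"
proof -
  note f = linearD[OF f]
  have "push (map f) (t - t') \<in> tensor_null s' n"
    unfolding push_def
    by (rule multilinear_lin_ext[where s = s and n = n, OF vector_space_fscale subspace_tensor_null])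
      (use t tensor_null_add[where s = s' and u = "map f _" and v = "map f _"]
          tensor_null_scale[where s = s' and u = "map f _" and v = "map f _"]
        in \<open>auto simp: f tensor_eq_def simp del: fscale_single\<close>)
  thus ?thesis
    using t supp_push[of "map f" t] supp_push[of "map f" t']
    by (force simp: tensor_eq_def linearD(6)[OF linear_push])
qed

lemma tensor_null_sum:
  assumes "vector_space s" "length u + 1 + length v = n" "finite I"
  shows "sgl (u @ [\<Sum>i\<in>I. s (r i) (b i)] @ v) c - (\<Sum>i\<in>I. sgl (u @ [b i] @ v) (c * r i)) \<in> tensor_null s n"
proof -
  note N = subspace_tensor_null[of s n]
  interpret vector_space s by fact
  have one: "sgl (u @ [\<Sum>i\<in>I. s (r i) (b i)] @ v) 1 - (\<Sum>i\<in>I. sgl (u @ [b i] @ v) (r i)) \<in> tensor_null s n"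
    using assms(3)
  proof (induction I)
    case empty
    show ?case using tensor_null_scale[OF assms(2), of s 0 0] by simp
  next
    case (insert i I)
    let ?x = "\<Sum>i\<in>I. s (r i) (b i)"
    have "(sgl (u @ [s (r i) (b i) + ?x] @ v) 1 - sgl (u @ [s (r i) (b i)] @ v) 1 - sgl (u @ [?x] @ v) 1)
       + (sgl (u @ [s (r i) (b i)] @ v) 1 - fscale (r i) (sgl (u @ [b i] @ v) 1))
       + (sgl (u @ [?x] @ v) 1 - (\<Sum>i\<in>I. sgl (u @ [b i] @ v) (r i))) \<in> tensor_null s n"
      using insert.IH assms(2)
      by (intro fs.subspace_add[OF N] tensor_null_add tensor_null_scale) auto
    thus ?case using insert.hyps by (simp add: algebra_simps)
  qed
  show ?thesis
    using fs.subspace_scale[OF N one, of c]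
    by (simp add: fs.scale_right_diff_distrib fs.scale_sum_right)
qed

lemma subspace_diff_cancel: "fs.subspace N \<Longrightarrow> x - y \<in> N \<Longrightarrow> x \<in> N \<Longrightarrow> y \<in> N"
  using fs.subspace_diff[of N x "x - y"] by simp

text \<open>Every element of \<open>V \<otimes> V\<close> can be written as
  \<open>(\<Sum>b. b \<otimes> y b)\<close> with linearly independent \<open>b\<close>. If all
  \<open>c\<^sub>i \<otimes> c\<^sub>j\<close> vanish on it, then
  \<open>(\<Sum>b. c\<^sub>j (y b) b)\<close> is killed by all \<open>c\<^sub>i\<close>, so it is
  zero, and by independence \<open>c\<^sub>j (y b) = 0\<close> for all \<open>j\<close>. This is
  what makes a tensor recognizable from the coefficients of the series which it represents.\<close>

lemma tensor_null_if_functionals_zero: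
  fixes s :: "'k::field \<Rightarrow> 'v::ab_group_add \<Rightarrow> 'v" and c :: "'i \<Rightarrow> 'v \<Rightarrow> 'k"
  assumes vs: "vector_space s" and c: "\<And>i. lin s (*) (c i)"
    and sep: "\<And>a. (\<And>i. c i a = 0) \<Longrightarrow> a = 0"
    and len: "\<And>l. l \<in> supp t \<Longrightarrow> length l = 2"
    and zero: "\<And>i j. (\<Sum>l\<in>supp t. coef t l * (c i (l ! 0) * c j (l ! 1))) = 0"
  shows "t \<in> tensor_null s 2"
proof -
  interpret vector_space s by fact
  note N = subspace_tensor_null[of s 2]
  let ?A = "(\<lambda>l. l ! 0) ` supp t"
  obtain B where B: "B \<subseteq> ?A" "independent B" "?A \<subseteq> span B"
    by (rule maximal_independent_subset)
  have finB: "finite B" using finite_subset[OF B(1)] by simp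
  \<comment> \<open>Coordinates of the left factors in a basis of their span, and the resulting right factors.\<close>
  define r where "r l = representation B (l ! 0)" for l :: "'v list"
  have r: "(\<Sum>b\<in>B. s (r l b) b) = l ! 0" if "l \<in> supp t" for l
    using that B finB unfolding r_def by (intro sum_representation_eq) auto
  define y where "y b = (\<Sum>l\<in>supp t. s (coef t l * r l b) (l ! 1))" for b
  have y0: "y b = 0" if b: "b \<in> B" for b
  proof (rule sep)
    fix j
    have "(\<Sum>b\<in>B. s (c j (y b)) b) = 0"
    proof (rule sep)
      fix i
      have "c i (\<Sum>b\<in>B. s (c j (y b)) b)
        = (\<Sum>b\<in>B. \<Sum>l\<in>supp t. (coef t l * r l b) * c j (l ! 1) * c i b)"
        by (simp add: linearD[OF c] y_def sum_distrib_right)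
      also have "\<dots> = (\<Sum>l\<in>supp t. coef t l * (c i (\<Sum>b\<in>B. s (r l b) b) * c j (l ! 1)))"
        by (subst sum.swap) (simp add: linearD[OF c] sum_distrib_left sum_distrib_right mult_ac)
      also have "\<dots> = 0" using zero[of i j] by (simp add: r)
      finally show "c i (\<Sum>b\<in>B. s (c j (y b)) b) = 0" .
    qed
    thus "c j (y b) = 0"
      using independentD[OF B(2) finB subset_refl, of "\<lambda>b. c j (y b)" b] b by simp
  qed
  have "t - (\<Sum>l\<in>supp t. \<Sum>b\<in>B. sgl [b, l ! 1] (coef t l * r l b)) \<in> tensor_null s 2"
  proof (subst (1) poly_mapping_sum_singles, subst sum_subtractf[symmetric], rule fs.subspace_sum[OF N])
    fix l assume l: "l \<in> supp t"
    have "l = [] @ [\<Sum>b\<in>B. s (r l b) b] @ [l ! 1]"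
      using len[OF l] r[OF l] by (auto simp: length_Suc_conv numeral_2_eq_2)
    with tensor_null_sum[OF vs _ finB, of "[]" "[l ! 1]" 2 "r l" "\<lambda>b. b" "coef t l"]
    show "sgl l (coef t l) - (\<Sum>b\<in>B. sgl [b, l ! 1] (coef t l * r l b)) \<in> tensor_null s 2"
      by simp
  qed
  moreover have "(\<Sum>l\<in>supp t. \<Sum>b\<in>B. sgl [b, l ! 1] (coef t l * r l b)) \<in> tensor_null s 2"
  proof (subst sum.swap, rule fs.subspace_sum[OF N])
    fix b assume "b \<in> B"
    have "sgl [b, y b] 1 - (\<Sum>l\<in>supp t. sgl [b, l ! 1] (coef t l * r l b)) \<in> tensor_null s 2"
      using tensor_null_sum[OF vs _ finite_keys, of "[b]" "[]" 2 "\<lambda>l. coef t l * r l b" "\<lambda>l. l ! 1" t 1]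
      by (simp add: y_def)
    moreover have "sgl [b, y b] 1 \<in> tensor_null s 2"
      using tensor_null_scale[of "[b]" "[]" 2 s 0 0] y0[OF \<open>b \<in> B\<close>] by simp
    ultimately show "(\<Sum>l\<in>supp t. sgl [b, l ! 1] (coef t l * r l b)) \<in> tensor_null s 2"
      by (rule subspace_diff_cancel[OF N])
  qed
  ultimately have "(t - (\<Sum>l\<in>supp t. \<Sum>b\<in>B. sgl [b, l ! 1] (coef t l * r l b)))
    + (\<Sum>l\<in>supp t. \<Sum>b\<in>B. sgl [b, l ! 1] (coef t l * r l b)) \<in> tensor_null s 2"
    by (rule fs.subspace_add[OF N])
  thus ?thesis by simp
qed

lemma tensor_eq_if_functionals_eq:
  fixes s :: "'k::field \<Rightarrow> 'v::ab_group_add \<Rightarrow> 'v" and c :: "'i \<Rightarrow> 'v \<Rightarrow> 'k"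
  assumes vs: "vector_space s" and c: "\<And>i. lin s (*) (c i)"
    and sep: "\<And>a. (\<And>i. c i a = 0) \<Longrightarrow> a = 0"
    and len: "\<And>l. l \<in> supp t \<Longrightarrow> length l = 2" "\<And>l. l \<in> supp t' \<Longrightarrow> length l = 2"
    and eq: "\<And>i j. (\<Sum>l\<in>supp t. coef t l * (c i (l ! 0) * c j (l ! 1)))
      = (\<Sum>l\<in>supp t'. coef t' l * (c i (l ! 0) * c j (l ! 1)))"
  shows "tensor_eq s 2 t t'"
proof -
  have K: "vector_space ((*) :: 'k \<Rightarrow> 'k \<Rightarrow> 'k)" by unfold_locales (auto simp: algebra_simps)
  have "t - t' \<in> tensor_null s 2"
  proof (rule tensor_null_if_functionals_zero[OF vs c sep])
    show "length l = 2" if "l \<in> supp (t - t')" for l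
      using that len Poly_Mapping.keys_diff[of t t'] by blast
    fix i j
    have "lin_ext (*) (\<lambda>l. c i (l ! 0) * c j (l ! 1)) (t - t') = 0"
      unfolding linearD(6)[OF linear_lin_ext[OF K]] using eq[of i j] by (simp add: lin_ext_def)
    thus "(\<Sum>l\<in>supp (t - t'). coef (t - t') l * (c i (l ! 0) * c j (l ! 1))) = 0"
      by (simp add: lin_ext_def)
  qed
  with len show ?thesis by (auto simp: tensor_eq_def)
qed

section \<open>Graded connected bialgebras\<close>

text \<open>Connectedness and the grading provide the antipode, so that these axioms suffice for a
  graded connected Hopf algebra.\<close>

locale graded_connected_bialgebra = vector_space "scale H"
  for H :: "('k::field, 'a::ring_1) hopf_data" +
  assumes scale_mult_left: "scale H c (x * y) = scale H c x * y"
    and scale_mult_right: "scale H c (x * y) = x * scale H c y"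
    and coprod_add: "tensor_eq (scale H) 2 (coprod H (x + y)) (coprod H x + coprod H y)"
    and coprod_scale: "tensor_eq (scale H) 2 (coprod H (scale H c x)) (fscale c (coprod H x))"
    and counit_linear: "Vector_Spaces.linear (scale H) (*) (counit H)"
    and coassoc: "tensor_eq (scale H) 3
        (lin_ext fscale (\<lambda>l. push (\<lambda>d. d @ [l ! 1]) (coprod H (l ! 0))) (coprod H x))
        (lin_ext fscale (\<lambda>l. push (\<lambda>d. [l ! 0] @ d) (coprod H (l ! 1))) (coprod H x))"
    and counit_left: "lin_ext (scale H) (\<lambda>l. scale H (counit H (l ! 0)) (l ! 1)) (coprod H x) = x"
    and counit_right: "lin_ext (scale H) (\<lambda>l. scale H (counit H (l ! 1)) (l ! 0)) (coprod H x) = x"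
    and coprod_one: "tensor_eq (scale H) 2 (coprod H 1) (sgl [1, 1] 1)"
    and coprod_mult: "tensor_eq (scale H) 2 (coprod H (x * y))
        (lin_ext fscale (\<lambda>l. push (\<lambda>m. [l ! 0 * m ! 0, l ! 1 * m ! 1]) (coprod H y)) (coprod H x))"
    and counit_one: "counit H 1 = 1"
    and counit_mult: "counit H (x * y) = counit H x * counit H y"
    and part_subspace: "subspace (part H n)"
    and part_direct: "\<exists>!g. (\<forall>n. g n \<in> part H n) \<and> finite {n. g n \<noteq> 0} \<and> x = (\<Sum>n | g n \<noteq> 0. g n)"
    and part_mult: "x \<in> part H m \<Longrightarrow> y \<in> part H n \<Longrightarrow> x * y \<in> part H (m + n)"
    and part_coprod: "x \<in> part H n \<Longrightarrow> \<exists>t. tensor_eq (scale H) 2 (coprod H x) t \<and>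
        (\<forall>l\<in>supp t. \<exists>i j. i + j = n \<and> l ! 0 \<in> part H i \<and> l ! 1 \<in> part H j)"
    and part_counit: "x \<in> part H n \<Longrightarrow> n > 0 \<Longrightarrow> counit H x = 0"
    and connected: "part H 0 = range (\<lambda>c. scale H c 1)"
begin

text \<open>The antipode is the inverse of the identity for this product.\<close>

definition conv :: "('a \<Rightarrow> 'a) \<Rightarrow> ('a \<Rightarrow> 'a) \<Rightarrow> 'a \<Rightarrow> 'a" where
  "conv f g x = lin_ext (scale H) (\<lambda>l. f (l ! 0) * g (l ! 1)) (coprod H x)"

definition conv_unit :: "'a \<Rightarrow> 'a" where
  "conv_unit x = scale H (counit H x) 1"

abbreviation endo :: "('a \<Rightarrow> 'a) \<Rightarrow> bool" where "endo \<equiv> lin (scale H) (scale H)"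

lemma conv_cong_coprod:
  assumes "endo f" "endo g" "tensor_eq (scale H) 2 t t'"
  shows "lin_ext (scale H) (\<lambda>l. f (l ! 0) * g (l ! 1)) t
    = lin_ext (scale H) (\<lambda>l. f (l ! 0) * g (l ! 1)) t'"
  by (rule bilinear_lin_ext_eq[where s = "scale H" and m = "\<lambda>a b. f a * g b"])
    (use vector_space_axioms in \<open>auto simp: linearD[OF assms(1)] linearD[OF assms(2)] assms(3)
      distrib_left distrib_right scale_mult_left[symmetric] scale_mult_right[symmetric]\<close>)

lemma linear_conv:
  assumes "endo f" "endo g"
  shows "endo (conv f g)"
proof (rule linearI[OF vector_space_axioms vector_space_axioms])
  note L = linearD[OF linear_lin_ext[OF vector_space_axioms]]
  show "conv f g (x + y) = conv f g x + conv f g y" for x y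
    unfolding conv_def conv_cong_coprod[OF assms coprod_add] by (rule L)
  show "conv f g (scale H c x) = scale H c (conv f g x)" for c x
    unfolding conv_def conv_cong_coprod[OF assms coprod_scale] by (rule L)
qed

lemma linear_conv_unit: "endo conv_unit"
  by (rule linearI[OF vector_space_axioms vector_space_axioms])
    (simp_all add: conv_unit_def linearD[OF counit_linear] scale_left_distrib)

lemma conv_unit_left: "endo f \<Longrightarrow> conv conv_unit f x = f x"
  using lin_ext_comp[of "scale H" "scale H" f "\<lambda>l. scale H (counit H (l ! 0)) (l ! 1)" "coprod H x"]
  by (simp add: conv_def conv_unit_def scale_mult_left[symmetric] counit_left linearD del: One_nat_def)

lemma conv_unit_right: "endo f \<Longrightarrow> conv f conv_unit x = f x"
  using lin_ext_comp[of "scale H" "scale H" f "\<lambda>l. scale H (counit H (l ! 1)) (l ! 0)" "coprod H x"]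
  by (simp add: conv_def conv_unit_def scale_mult_right[symmetric] counit_right linearD del: One_nat_def)

lemma length_coprod: "l \<in> supp (coprod H x) \<Longrightarrow> length l = 2"
  using coprod_mult[of x 1] by (auto simp: tensor_eq_def)

text \<open>Both sides evaluate \<open>f \<otimes> g \<otimes> h\<close> and then multiply, on the
  two iterated coproducts, which coassociativity identifies.\<close>

lemma conv_assoc:
  assumes "endo f" "endo g" "endo h"
  shows "conv (conv f g) h x = conv f (conv g h) x"
proof -
  note vs = vector_space_axioms
  let ?M = "\<lambda>l. f (l ! 0) * g (l ! 1) * h (l ! 2)"
  let ?l = "lin_ext fscale (\<lambda>l. push (\<lambda>d. d @ [l ! 1]) (coprod H (l ! 0))) (coprod H x)"
  let ?r = "lin_ext fscale (\<lambda>l. push (\<lambda>d. [l ! 0] @ d) (coprod H (l ! 1))) (coprod H x)"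
  note lin = linearD[OF assms(1)] linearD[OF assms(2)] linearD[OF assms(3)]
  have split3: "length u + 1 + length v = 3 \<longleftrightarrow> (\<exists>x y. u = [] \<and> v = [x, y] \<or> u = [x] \<and> v = [y] \<or> u
      = [x, y] \<and> v = [])"
    for u v :: "'a list"
    by (cases u; cases "tl u"; cases v) (auto simp: length_Suc_conv numeral_3_eq_3)
  have "lin_ext (scale H) ?M (?l - ?r) \<in> {0}"
    by (rule multilinear_lin_ext[where n = 3 and s = "scale H", OF vs subspace_single_0])
      (use coassoc[of x] in \<open>auto simp: split3 tensor_eq_def lin distrib_left distrib_right
        scale_mult_left[symmetric] scale_mult_right[symmetric] simp del: One_nat_def\<close>)
  hence eq: "lin_ext (scale H) ?M ?l = lin_ext (scale H) ?M ?r"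
    by (simp add: linearD[OF linear_lin_ext[OF vs]])
  have mult_right: "lin_ext (scale H) (\<lambda>d. p d * a) t = lin_ext (scale H) p t * a"
    and mult_left: "lin_ext (scale H) (\<lambda>d. a * p d) t = a * lin_ext (scale H) p t"
    for p and a and t :: "'a list \<Rightarrow>\<^sub>0 'k"
    unfolding lin_ext_def sum_distrib_left sum_distrib_right scale_mult_left
    by (rule refl) (simp only: scale_mult_left[symmetric] scale_mult_right[symmetric])
  have "lin_ext (scale H) ?M ?l
    = lin_ext (scale H) (\<lambda>l. lin_ext (scale H) (\<lambda>d. ?M (d @ [l ! 1])) (coprod H (l ! 0))) (coprod H x)"
    by (simp only: lin_ext_lin_ext[OF vs] lin_ext_push[OF vs])
  also have "\<dots> = conv (conv f g) h x"
    unfolding conv_def mult_right[symmetric]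
    by (intro lin_ext_cong) (simp add: nth_append length_coprod)
  finally have l: "lin_ext (scale H) ?M ?l = conv (conv f g) h x" .
  have "lin_ext (scale H) ?M ?r
    = lin_ext (scale H) (\<lambda>l. lin_ext (scale H) (\<lambda>d. ?M ([l ! 0] @ d)) (coprod H (l ! 1))) (coprod H x)"
    by (simp only: lin_ext_lin_ext[OF vs] lin_ext_push[OF vs])
  also have "\<dots> = conv f (conv g h) x"
    unfolding conv_def mult_left[symmetric]
    by (intro lin_ext_cong) (simp add: mult.assoc numeral_2_eq_2)
  finally show ?thesis using eq l by simp
qed

text \<open>The identity is \<open>conv_unit - J\<close>, where \<open>J\<close> vanishes in degree
  \<open>0\<close>. The \<open>k\<close>-th convolution power of \<open>J\<close> then vanishes in
  all degrees below \<open>k\<close>, and the geometric series of these powers is the convolution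
  inverse of the identity.\<close>

definition reduced :: "'a \<Rightarrow> 'a" where "reduced x = conv_unit x - x"

primrec reduced_power :: "nat \<Rightarrow> 'a \<Rightarrow> 'a" where
  "reduced_power 0 = conv_unit"
| "reduced_power (Suc k) = conv (reduced_power k) reduced"

lemma linear_reduced: "endo reduced"
  by (rule linearI[OF vector_space_axioms vector_space_axioms])
    (simp_all add: reduced_def linearD[OF linear_conv_unit] scale_right_diff_distrib)

lemma linear_reduced_power: "endo (reduced_power k)"
  by (induction k) (simp_all add: linear_conv_unit linear_conv linear_reduced)

lemma reduced_power_Suc: "reduced_power (Suc k) x = conv reduced (reduced_power k) x"
proof (induction k arbitrary: x)
  case 0
  show ?case by (simp add: conv_unit_left conv_unit_right linear_reduced)
next
  case (Suc k)
  hence "reduced_power (Suc k) = conv reduced (reduced_power k)" by blast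
  hence "reduced_power (Suc (Suc k)) x = conv (conv reduced (reduced_power k)) reduced x" by simp
  thus ?case by (simp add: conv_assoc linear_reduced linear_reduced_power)
qed

text \<open>In \<open>J\<^sup>k * J\<close> a tensor of bidegree \<open>(i, j)\<close> contributes
  only if \<open>j > 0\<close>, as \<open>J\<close> vanishes in degree \<open>0\<close>; then
  \<open>i\<close> is smaller than the total degree and the induction hypothesis applies.\<close>

lemma reduced_power_vanishes: "x \<in> part H n \<Longrightarrow> n < k \<Longrightarrow> reduced_power k x = 0"
proof (induction k arbitrary: x n)
  case (Suc k)
  obtain t where t: "tensor_eq (scale H) 2 (coprod H x) t"
    "\<forall>l\<in>supp t. \<exists>i j. i + j = n \<and> l ! 0 \<in> part H i \<and> l ! 1 \<in> part H j"
    using part_coprod[OF Suc.prems(1)] by (elim exE conjE)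
  have "reduced_power k (l ! 0) * reduced (l ! 1) = 0" if l: "l \<in> supp t" for l
  proof -
    obtain i j where ij: "i + j = n" "l ! 0 \<in> part H i" "l ! 1 \<in> part H j"
      using bspec[OF t(2) l] by (elim exE conjE)
    show ?thesis
    proof (cases "j = 0")
      case True
      then obtain c where "l ! 1 = scale H c 1" using ij connected by auto
      thus ?thesis
        by (simp add: reduced_def conv_unit_def linearD[OF counit_linear] counit_one)
    next
      case False
      thus ?thesis using Suc.IH[OF ij(2)] ij Suc.prems by simp
    qed
  qed
  hence "lin_ext (scale H) (\<lambda>l. reduced_power k (l ! 0) * reduced (l ! 1)) t = 0"
    by (simp add: lin_ext_def)
  thus ?case
    unfolding reduced_power.simps conv_def
      conv_cong_coprod[OF linear_reduced_power linear_reduced t(1)] .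
qed simp

lemma reduced_power_nilpotent: "\<exists>N. \<forall>k\<ge>N. reduced_power k x = 0"
proof -
  obtain g where g: "\<And>n. g n \<in> part H n" "finite {n. g n \<noteq> 0}" "x = (\<Sum>n | g n \<noteq> 0. g n)"
    using part_direct[of x] by blast
  have "reduced_power k x = 0" if k: "k \<ge> Suc (Max (insert 0 {n. g n \<noteq> 0}))" for k
  proof -
    have "reduced_power k (g n) = 0" if n: "g n \<noteq> 0" for n
    proof (rule reduced_power_vanishes[OF g(1)])
      have "n \<le> Max (insert 0 {n. g n \<noteq> 0})" using g(2) n by (intro Max_ge) auto
      thus "n < k" using k by simp
    qed
    thus ?thesis by (subst g(3)) (simp add: linearD[OF linear_reduced_power])
  qed
  thus ?thesis by blast
qed

lemma reduced_power_nilpotent_on: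
  assumes "finite A"
  shows "\<exists>N. \<forall>k\<ge>N. \<forall>x\<in>A. reduced_power k x = 0"
  using assms
proof (induction A)
  case (insert a A)
  then obtain N where "\<forall>k\<ge>N. \<forall>x\<in>A. reduced_power k x = 0" by blast
  moreover obtain N' where "\<forall>k\<ge>N'. reduced_power k a = 0" using reduced_power_nilpotent by blast
  ultimately show ?case by (intro exI[of _ "max N N'"]) auto
qed simp

definition geometric_series :: "'a \<Rightarrow> 'a" where
  "geometric_series x = (\<Sum>k | reduced_power k x \<noteq> 0. reduced_power k x)"

lemma geometric_series_eq:
  assumes "\<forall>k\<ge>N. reduced_power k x = 0"
  shows "geometric_series x = (\<Sum>k<N. reduced_power k x)"
  unfolding geometric_series_def using assms
  by (intro sum.mono_neutral_left) (auto simp: not_le[symmetric])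

lemma linear_geometric_series: "endo geometric_series"
proof (rule linearI[OF vector_space_axioms vector_space_axioms])
  fix x y c
  note lin = linearD[OF linear_reduced_power]
  obtain N where N: "\<forall>k\<ge>N. \<forall>z\<in>{x, y}. reduced_power k z = 0"
    using reduced_power_nilpotent_on[of "{x, y}"] by auto
  have "\<forall>k\<ge>N. reduced_power k (x + y) = 0" "\<forall>k\<ge>N. reduced_power k (scale H c x) = 0"
    using N by (simp_all add: lin)
  note eq = this[THEN geometric_series_eq]
  have eq_xy: "geometric_series z = (\<Sum>k<N. reduced_power k z)" if "z \<in> {x, y}" for z
    using N that by (intro geometric_series_eq) auto
  show "geometric_series (x + y) = geometric_series x + geometric_series y"
    by (simp add: eq eq_xy lin sum.distrib)
  show "geometric_series (scale H c x) = scale H c (geometric_series x)"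
    by (simp add: eq eq_xy lin scale_sum_right)
qed

text \<open>Writing the identity as \<open>conv_unit - reduced\<close> turns the convolution with
  the \<open>k\<close>-th power into the difference of two successive powers, and the sum
  telescopes.\<close>

lemma conv_geometric_series:
  "conv geometric_series (\<lambda>x. x) x = conv_unit x" "conv (\<lambda>x. x) geometric_series x = conv_unit x"
proof -
  let ?A = "insert x ((\<lambda>l. l ! 0) ` supp (coprod H x) \<union> (\<lambda>l. l ! 1) ` supp (coprod H x))"
  have "\<exists>N. \<forall>k\<ge>N. \<forall>z\<in>?A. reduced_power k z = 0"
    by (rule reduced_power_nilpotent_on) simp
  then obtain N where N: "\<forall>k\<ge>N. \<forall>z\<in>?A. reduced_power k z = 0" ..
  note lin = linear_reduced_power linear_reduced linear_conv_unit
  have step: "conv (reduced_power k) (\<lambda>x. x) x = reduced_power k x - reduced_power (Suc k) x"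
    "conv (\<lambda>x. x) (reduced_power k) x = reduced_power k x - reduced_power (Suc k) x" for k
  proof -
    have "conv (reduced_power k) (\<lambda>x. x) x = conv (reduced_power k) conv_unit x - conv (reduced_power k)
        reduced x"
      unfolding conv_def lin_ext_diff_fun[OF vector_space_axioms, symmetric]
      by (intro lin_ext_cong) (simp add: reduced_def right_diff_distrib)
    thus "conv (reduced_power k) (\<lambda>x. x) x = reduced_power k x - reduced_power (Suc k) x"
      by (simp add: conv_unit_right lin)
    have "conv (\<lambda>x. x) (reduced_power k) x = conv conv_unit (reduced_power k) x - conv reduced
        (reduced_power k) x"
      unfolding conv_def lin_ext_diff_fun[OF vector_space_axioms, symmetric]
      by (intro lin_ext_cong) (simp add: reduced_def left_diff_distrib)
    thus "conv (\<lambda>x. x) (reduced_power k) x = reduced_power k x - reduced_power (Suc k) x"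
      unfolding reduced_power_Suc[of k] by (simp only: conv_unit_left lin)
  qed
  have telescope: "(\<Sum>k<N. reduced_power k x - reduced_power (Suc k) x) = conv_unit x"
    using N sum_lessThan_telescope'[of "\<lambda>k. reduced_power k x" N]
    by (simp del: reduced_power.simps(2))
  have eq: "geometric_series (l ! i) = (\<Sum>k<N. reduced_power k (l ! i))"
    if "l \<in> supp (coprod H x)" "i = 0 \<or> i = 1" for l i
    by (rule geometric_series_eq) (use N that in auto)
  have "conv geometric_series (\<lambda>x. x) x = (\<Sum>k<N. conv (reduced_power k) (\<lambda>x. x) x)"
    unfolding conv_def lin_ext_sum_fun[OF vector_space_axioms, symmetric]
    by (intro lin_ext_cong) (simp add: eq sum_distrib_right)
  thus "conv geometric_series (\<lambda>x. x) x = conv_unit x" by (simp only: step telescope)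
  have "conv (\<lambda>x. x) geometric_series x = (\<Sum>k<N. conv (\<lambda>x. x) (reduced_power k) x)"
    unfolding conv_def lin_ext_sum_fun[OF vector_space_axioms, symmetric]
    by (intro lin_ext_cong) (simp add: eq sum_distrib_left)
  thus "conv (\<lambda>x. x) geometric_series x = conv_unit x" by (simp only: step telescope)
qed

theorem hopf: "graded_connected_hopf_algebra H"
proof (intro graded_connected_hopf_algebra.intro hopf_algebra.intro hopf_algebra_axioms.intro
    graded_connected_hopf_algebra_axioms.intro)
  show "\<exists>S. endo S \<and>
        (\<forall>x. lin_ext (scale H) (\<lambda>l. S (l ! 0) * l ! 1) (coprod H x) = scale H (counit H x) 1 \<and>
             lin_ext (scale H) (\<lambda>l. l ! 0 * S (l ! 1)) (coprod H x) = scale H (counit H x) 1)"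
    using linear_geometric_series conv_geometric_series
    unfolding conv_def conv_unit_def by (intro exI[of _ geometric_series]) simp
qed (assumption | rule vector_space_axioms scale_mult_left scale_mult_right coprod_add coprod_scale
    counit_linear
  coassoc counit_left counit_right coprod_one coprod_mult counit_one counit_mult part_subspace
  part_direct connected part_mult part_coprod part_counit)+

end

lemma tensor_eq_via:
  assumes "\<forall>l\<in>supp a. length l = n" "\<forall>l\<in>supp c. length l = n"
    and "a - b \<in> tensor_null s n" "b - c \<in> tensor_null s n"
  shows "tensor_eq s n a c"
  using assms fs.subspace_add[OF subspace_tensor_null assms(3,4)] by (auto simp: tensor_eq_def)

lemma length_lin_ext_push:
  assumes "l \<in> supp (lin_ext fscale (\<lambda>k. push (g k) (r k)) t)"
    and "\<And>k m. m \<in> supp (r k) \<Longrightarrow> length (g k m) = n"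
  shows "length l = n"
proof -
  obtain k where "l \<in> supp (push (g k) (r k))"
    using subsetD[OF supp_lin_ext assms(1)] by (elim UN_E)
  hence "l \<in> g k ` supp (r k)" by (rule subsetD[OF supp_push])
  thus ?thesis using assms(2) by (elim imageE) simp
qed

text \<open>All axioms are identities which \<open>f\<close> transports from \<open>H\<close>, once
  tensors are compared modulo multilinearity. What a map with a kernel may destroy is the
  independence of the homogeneous parts, whence the last assumption. The antipode comes from the
  theorem on bialgebras.\<close>

lemma graded_connected_hopf_algebra_image:
  fixes H :: "('k::field, 'a::ring_1) hopf_data" and H' :: "('k, 'b::ring_1) hopf_data"
  assumes H: "graded_connected_hopf_algebra H"
    and lin: "lin (scale H) (scale H') f" and surj: "surj f"
    and one: "f 1 = 1" and mult: "\<And>x y. f (x * y) = f x * f y"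
    and coprod: "\<And>x. tensor_eq (scale H') 2 (coprod H' (f x)) (push (map f) (coprod H x))"
    and counit: "\<And>x. counit H' (f x) = counit H x"
    and part: "\<And>n. f ` part H n = part H' n"
    and indep: "\<And>g. \<lbrakk>\<And>n. g n \<in> part H' n; finite {n. g n \<noteq> 0}; (\<Sum>n | g n \<noteq> 0. g n) = 0\<rbrakk>
      \<Longrightarrow> g = (\<lambda>_. 0)"
  shows "graded_connected_hopf_algebra H'"
proof -
  interpret H: graded_connected_hopf_algebra H by fact
  note vs = linearD(2)[OF lin] and f = linearD[OF lin]
  interpret vs: vector_space "scale H'" by fact
  let ?s = "scale H" and ?s' = "scale H'" and ?C = "coprod H" and ?C' = "coprod H'"
  note N = subspace_tensor_null
  note [trans] = tensor_eq_trans
  have ex: "\<exists>x. y = f x" for y using surj by blast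
  have len: "length l = 2" if "l \<in> supp (?C x)" for l x
    using H.coprod_add[of x 0] that by (auto simp: tensor_eq_def)
  have len': "length l = 2" if "l \<in> supp (?C' y)" for l y
    using ex[of y] coprod that by (auto simp: tensor_eq_def)
  have push_len: "length l = n" if "l \<in> supp (push (map f) t)" "\<forall>l\<in>supp t. length l = n" for l t n
    using supp_push[of "map f" t] that by auto
  have sl: "?s' c (x * y) = ?s' c x * y" for c x y
    using ex[of x] ex[of y] by (metis f(4) mult H.scale_mult_left)
  have sr: "?s' c (x * y) = x * ?s' c y" for c x y
    using ex[of x] ex[of y] by (metis f(4) mult H.scale_mult_right)
  have add: "tensor_eq ?s' 2 (?C' (x' + y')) (?C' x' + ?C' y')" for x' y'
  proof -
    obtain x y where xy: "x' = f x" "y' = f y" using ex by metis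
    have "tensor_eq ?s' 2 (?C' (f (x + y))) (push (map f) (?C (x + y)))" by (rule coprod)
    also have "tensor_eq ?s' 2 \<dots> (push (map f) (?C x + ?C y))"
      by (rule tensor_eq_push[OF lin H.coprod_add])
    also have "push (map f) (?C x + ?C y) = push (map f) (?C x) + push (map f) (?C y)"
      by (rule push_add)
    also have "tensor_eq ?s' 2 \<dots> (?C' (f x) + ?C' (f y))"
      by (intro tensor_eq_add tensor_eq_sym[OF coprod])
    finally show ?thesis by (simp add: f xy)
  qed
  have scale: "tensor_eq ?s' 2 (?C' (?s' c x')) (fscale c (?C' x'))" for c x'
  proof -
    obtain x where x: "x' = f x" using ex by metis
    have "tensor_eq ?s' 2 (?C' (f (?s c x))) (push (map f) (?C (?s c x)))" by (rule coprod)
    also have "tensor_eq ?s' 2 \<dots> (push (map f) (fscale c (?C x)))"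
      by (rule tensor_eq_push[OF lin H.coprod_scale])
    also have "push (map f) (fscale c (?C x)) = fscale c (push (map f) (?C x))"
      by (rule linearD(4)[OF linear_push])
    also have "tensor_eq ?s' 2 \<dots> (fscale c (?C' (f x)))"
      by (intro tensor_eq_fscale tensor_eq_sym[OF coprod])
    finally show ?thesis by (simp add: f x)
  qed
  have counit_lin: "lin ?s' (*) (counit H')"
  proof (rule linearI[OF vs linearD(2)[OF H.counit_linear]])
    show "counit H' (x + y) = counit H' x + counit H' y" for x y
      using ex[of x] ex[of y] by (metis f(3) counit linearD(3)[OF H.counit_linear])
    show "counit H' (?s' c x) = c * counit H' x" for c x
      using ex[of x] by (metis f(4) counit linearD(4)[OF H.counit_linear])
  qed
  note eps = linearD[OF counit_lin]
  show ?thesis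
  proof (rule graded_connected_bialgebra.hopf, intro graded_connected_bialgebra.intro
      graded_connected_bialgebra_axioms.intro, rule vs)
    fix x' y' :: 'b and n m :: nat
    obtain x where x: "x' = f x" using ex by metis
    obtain y where y: "y' = f y" using ex by metis
    \<comment> \<open>Modulo multilinearity both iterated coproducts are images of those in \<open>H\<close>. The outer coproduct is
      replaced first (\<open>L1\<close>, \<open>R1\<close>), then the inner one (\<open>L2\<close>, \<open>R2\<close>).\<close>
    show "tensor_eq ?s' 3 (lin_ext fscale (\<lambda>l. push (\<lambda>d. d @ [l ! 1]) (?C' (l ! 0))) (?C' x'))
      (lin_ext fscale (\<lambda>l. push (\<lambda>d. [l ! 0] @ d) (?C' (l ! 1))) (?C' x'))"
    proof -
      note bilin = bilinear_lin_ext_diff[OF vector_space_fscale N[of ?s' 3] _ _ _ _ coprod[of x]]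
      let ?L = "\<lambda>C a b. push (\<lambda>d. d @ [b]) (C a)" and ?R = "\<lambda>C a b. push (\<lambda>d. [a] @ d) (C b)"
      note P = linearD[OF linear_push]
      have inner: "push (\<lambda>d. d @ [b]) t - push (\<lambda>d. d @ [b]) t' \<in> tensor_null ?s' 3"
        "push (\<lambda>d. [b] @ d) t - push (\<lambda>d. [b] @ d) t' \<in> tensor_null ?s' 3"
        if "tensor_eq ?s' 2 t t'" for b t t'
      proof -
        have t: "t - t' \<in> tensor_null ?s' 2" using that by (simp add: tensor_eq_def)
        have "push (\<lambda>d. d @ [b]) (t - t') \<in> tensor_null ?s' 3"
          unfolding push_def
          by (rule multilinear_lin_ext[where s = ?s' and n = 2, OF vector_space_fscale N _ _ t])
            (use tensor_null_add[where s = ?s' and v = "_ @ [b]"] tensor_null_scale[where s = ?s' and v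
                = "_ @ [b]"]
              in \<open>auto simp del: fscale_single\<close>)
        moreover have "push (\<lambda>d. [b] @ d) (t - t') \<in> tensor_null ?s' 3"
          unfolding push_def
          by (rule multilinear_lin_ext[where s = ?s' and n = 2, OF vector_space_fscale N _ _ t])
            (use tensor_null_add[where s = ?s' and u = "b # _"] tensor_null_scale[where s = ?s' and u
                = "b # _"]
              in \<open>auto simp del: fscale_single\<close>)
        ultimately show "push (\<lambda>d. d @ [b]) t - push (\<lambda>d. d @ [b]) t' \<in> tensor_null ?s' 3"
          "push (\<lambda>d. [b] @ d) t - push (\<lambda>d. [b] @ d) t' \<in> tensor_null ?s' 3"
          by (simp_all only: P)
      qed
      have outer: "push (\<lambda>d. d @ [a + b]) t - push (\<lambda>d. d @ [a]) t - push (\<lambda>d. d @ [b]) t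
          \<in> tensor_null ?s' 3"
        "push (\<lambda>d. [a + b] @ d) t - push (\<lambda>d. [a] @ d) t - push (\<lambda>d. [b] @ d) t \<in> tensor_null ?s' 3"
        "push (\<lambda>d. d @ [?s' c a]) t - fscale c (push (\<lambda>d. d @ [a]) t) \<in> tensor_null ?s' 3"
        "push (\<lambda>d. [?s' c a] @ d) t - fscale c (push (\<lambda>d. [a] @ d) t) \<in> tensor_null ?s' 3"
        if "\<And>l. l \<in> supp t \<Longrightarrow> length l = 2" for a b c t
        unfolding push_def lin_ext_diff_fun[OF vector_space_fscale, symmetric]
          lin_ext_scale_fun[OF vector_space_fscale, symmetric]
        using tensor_null_add[where s = ?s' and v = "[]" and n = 3] tensor_null_scale[where s
            = ?s' and v = "[]" and n = 3]
          tensor_null_add[where s = ?s' and u = "[]" and n = 3] tensor_null_scale[where s = ?s' and u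
              = "[]" and n = 3] that
        by (auto intro!: lin_ext_in_subspace[OF vector_space_fscale N] simp del: fscale_single)
      have diff3: "a - b - c = a - (b + c)" for a b c :: "'b list \<Rightarrow>\<^sub>0 'k" by simp
      have L1: "lin_ext fscale (\<lambda>l. ?L ?C' (l ! 0) (l ! 1)) (?C' x')
          - lin_ext fscale (\<lambda>l. ?L ?C' (l ! 0) (l ! 1)) (push (map f) (?C x)) \<in> tensor_null ?s' 3"
        unfolding x using inner(1)[OF add] inner(1)[OF scale] outer(1,3) len'
        by (intro bilin) (simp_all only: diff3 P)
      have R1: "lin_ext fscale (\<lambda>l. ?R ?C' (l ! 0) (l ! 1)) (?C' x')
          - lin_ext fscale (\<lambda>l. ?R ?C' (l ! 0) (l ! 1)) (push (map f) (?C x)) \<in> tensor_null ?s' 3"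
        unfolding x using inner(2)[OF add] inner(2)[OF scale] outer(2,4) len'
        by (intro bilin) (simp_all only: diff3 P)
      have L2: "lin_ext fscale (\<lambda>l. ?L ?C' (l ! 0) (l ! 1)) (push (map f) (?C x))
          - push (map f) (lin_ext fscale (\<lambda>l. ?L ?C (l ! 0) (l ! 1)) (?C x)) \<in> tensor_null ?s' 3"
        unfolding lin_ext_push[OF vector_space_fscale] push_lin_ext lin_ext_diff_fun[OF
            vector_space_fscale, symmetric]
      proof (rule lin_ext_in_subspace[OF vector_space_fscale N])
        fix l assume "l \<in> supp (?C x)"
        hence "length l = 2" by (rule len)
        thus "push (\<lambda>d. d @ [map f l ! 1]) (?C' (map f l ! 0)) - push (map f) (push (\<lambda>d. d @ [l ! 1])
            (?C (l ! 0)))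
          \<in> tensor_null ?s' 3"
          using inner(1)[OF coprod, of "f (l ! 1)" "l ! 0"] by (simp add: push_push)
      qed
      have R2: "lin_ext fscale (\<lambda>l. ?R ?C' (l ! 0) (l ! 1)) (push (map f) (?C x))
          - push (map f) (lin_ext fscale (\<lambda>l. ?R ?C (l ! 0) (l ! 1)) (?C x)) \<in> tensor_null ?s' 3"
        unfolding lin_ext_push[OF vector_space_fscale] push_lin_ext lin_ext_diff_fun[OF
            vector_space_fscale, symmetric]
      proof (rule lin_ext_in_subspace[OF vector_space_fscale N])
        fix l assume "l \<in> supp (?C x)"
        hence "length l = 2" by (rule len)
        thus "push (\<lambda>d. [map f l ! 0] @ d) (?C' (map f l ! 1)) - push (map f) (push (\<lambda>d. [l ! 0] @ d)
            (?C (l ! 1)))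
          \<in> tensor_null ?s' 3"
          using inner(2)[OF coprod, of "f (l ! 0)" "l ! 1"] by (simp add: push_push)
      qed
      have lenL1: "\<forall>l\<in>supp (lin_ext fscale (\<lambda>l. ?L ?C' (l ! 0) (l ! 1)) (?C' x')). length l = 3"
        by (rule ballI, erule length_lin_ext_push) (simp add: len')
      have lenL2: "\<forall>l\<in>supp (lin_ext fscale (\<lambda>l. ?L ?C (l ! 0) (l ! 1)) (?C x)). length l = 3"
        by (rule ballI, erule length_lin_ext_push) (simp add: len)
      have lenR1: "\<forall>l\<in>supp (lin_ext fscale (\<lambda>l. ?R ?C' (l ! 0) (l ! 1)) (?C' x')). length l = 3"
        by (rule ballI, erule length_lin_ext_push) (simp add: len')
      have lenR2: "\<forall>l\<in>supp (lin_ext fscale (\<lambda>l. ?R ?C (l ! 0) (l ! 1)) (?C x)). length l = 3"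
        by (rule ballI, erule length_lin_ext_push) (simp add: len)
      have "tensor_eq ?s' 3 (lin_ext fscale (\<lambda>l. ?L ?C' (l ! 0) (l ! 1)) (?C' x'))
          (push (map f) (lin_ext fscale (\<lambda>l. ?L ?C (l ! 0) (l ! 1)) (?C x)))"
        by (rule tensor_eq_via[OF lenL1 _ L1 L2]) (rule ballI, erule push_len[OF _ lenL2])
      also have "tensor_eq ?s' 3 \<dots> (push (map f) (lin_ext fscale (\<lambda>l. ?R ?C (l ! 0) (l ! 1)) (?C x)))"
        by (rule tensor_eq_push[OF lin H.coassoc])
      also have "tensor_eq ?s' 3 \<dots> (lin_ext fscale (\<lambda>l. ?R ?C' (l ! 0) (l ! 1)) (?C' x'))"
        by (rule tensor_eq_sym, rule tensor_eq_via[OF lenR1 _ R1 R2]) (rule ballI, erule push_len[OF _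
            lenR2])
      finally show ?thesis .
    qed
    show "lin_ext ?s' (\<lambda>l. ?s' (counit H' (l ! 0)) (l ! 1)) (?C' x') = x'"
    proof -
      have "lin_ext ?s' (\<lambda>l. ?s' (counit H' (l ! 0)) (l ! 1)) (?C' x')
          = lin_ext ?s' (\<lambda>l. ?s' (counit H' (l ! 0)) (l ! 1)) (push (map f) (?C x))"
        unfolding x by (rule bilinear_lin_ext_eq[OF vs _ _ _ _ coprod[of x]])
          (simp_all add: eps vs.scale_left_distrib vs.scale_right_distrib mult.commute)
      also have "\<dots> = lin_ext ?s' (\<lambda>l. f (?s (counit H (l ! 0)) (l ! 1))) (?C x)"
        unfolding lin_ext_push[OF vs] by (intro lin_ext_cong) (simp add: len counit f)
      also have "\<dots> = x'" unfolding lin_ext_comp[OF lin, symmetric] H.counit_left x ..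
      finally show ?thesis .
    qed
    show "lin_ext ?s' (\<lambda>l. ?s' (counit H' (l ! 1)) (l ! 0)) (?C' x') = x'"
    proof -
      have "lin_ext ?s' (\<lambda>l. ?s' (counit H' (l ! 1)) (l ! 0)) (?C' x')
          = lin_ext ?s' (\<lambda>l. ?s' (counit H' (l ! 1)) (l ! 0)) (push (map f) (?C x))"
        unfolding x by (rule bilinear_lin_ext_eq[OF vs _ _ _ _ coprod[of x], of "\<lambda>a b. ?s' (counit H' b)
            a"])
          (simp_all add: eps vs.scale_left_distrib vs.scale_right_distrib mult.commute)
      also have "\<dots> = lin_ext ?s' (\<lambda>l. f (?s (counit H (l ! 1)) (l ! 0))) (?C x)"
        unfolding lin_ext_push[OF vs] by (intro lin_ext_cong) (simp add: len counit f)
      also have "\<dots> = x'" unfolding lin_ext_comp[OF lin, symmetric] H.counit_right x ..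
      finally show ?thesis .
    qed
    show "tensor_eq ?s' 2 (?C' 1) (sgl [1, 1] 1)"
    proof -
      have "tensor_eq ?s' 2 (?C' (f 1)) (push (map f) (?C 1))" by (rule coprod)
      also have "tensor_eq ?s' 2 \<dots> (push (map f) (sgl [1, 1] 1))"
        by (rule tensor_eq_push[OF lin H.coprod_one])
      finally show ?thesis by (simp add: push_single one)
    qed
    show "tensor_eq ?s' 2 (?C' (x' * y'))
      (lin_ext fscale (\<lambda>l. push (\<lambda>m. [l ! 0 * m ! 0, l ! 1 * m ! 1]) (?C' y')) (?C' x'))"
    proof -
      let ?P = "\<lambda>r a b. push (\<lambda>m. [a * m ! 0, b * m ! 1]) r"
      have lenP: "length l = 2" if "l \<in> supp (lin_ext fscale (\<lambda>l. ?P r (l ! 0) (l ! 1)) t)"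
        for r t and l :: "'b list"
        using that by (rule length_lin_ext_push) simp
      have lin_x: "lin_ext fscale (\<lambda>l. ?P r (l ! 0) (l ! 1)) t - lin_ext fscale (\<lambda>l. ?P r (l ! 0) (l !
          1)) t' \<in> tensor_null ?s' 2"
        if "tensor_eq ?s' 2 t t'" for r t t'
        by (rule bilinear_lin_ext_diff[OF vector_space_fscale N _ _ _ _ that])
          (unfold push_def lin_ext_diff_fun[OF vector_space_fscale, symmetric]
            lin_ext_scale_fun[OF vector_space_fscale, symmetric] distrib_right sl[symmetric],
           use tensor_null_add[where s = ?s' and n = 2 and u = "[]" and v
               = "[_]"] tensor_null_add[where s = ?s' and n = 2 and u = "[_]" and v = "[]"]
             tensor_null_scale[where s = ?s' and n = 2 and u = "[]" and v
                 = "[_]"] tensor_null_scale[where s = ?s' and n = 2 and u = "[_]" and v = "[]"]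
           in \<open>auto intro!: lin_ext_in_subspace[OF vector_space_fscale N] simp del: fscale_single\<close>)
      have lin_y: "?P r a b - ?P r' a b \<in> tensor_null ?s' 2" if "tensor_eq ?s' 2 r r'" for r r' a b
        unfolding push_def
        by (rule bilinear_lin_ext_diff[OF vector_space_fscale N _ _ _ _ that])
          (unfold distrib_left sr[symmetric],
           use tensor_null_add[where s = ?s' and n = 2 and u = "[]" and v
               = "[_]"] tensor_null_add[where s = ?s' and n = 2 and u = "[_]" and v = "[]"]
             tensor_null_scale[where s = ?s' and n = 2 and u = "[]" and v
                 = "[_]"] tensor_null_scale[where s = ?s' and n = 2 and u = "[_]" and v = "[]"]
           in \<open>auto simp del: fscale_single\<close>)
      have "tensor_eq ?s' 2 (?C' (f (x * y))) (push (map f) (?C (x * y)))" by (rule coprod)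
      also have "tensor_eq ?s' 2 \<dots> (push (map f) (lin_ext fscale (\<lambda>l. ?P (?C y) (l ! 0) (l ! 1)) (?C x)))"
        by (rule tensor_eq_push[OF lin H.coprod_mult])
      also have "push (map f) (lin_ext fscale (\<lambda>l. ?P (?C y) (l ! 0) (l ! 1)) (?C x))
          = lin_ext fscale (\<lambda>l. ?P (push (map f) (?C y)) (l ! 0) (l ! 1)) (push (map f) (?C x))"
        unfolding push_lin_ext lin_ext_push[OF vector_space_fscale] push_push
        by (intro lin_ext_cong push_cong) (simp add: len mult)
      also have "tensor_eq ?s' 2 \<dots> (lin_ext fscale (\<lambda>l. ?P (push (map f) (?C y)) (l ! 0) (l ! 1)) (?C' x'))"
        unfolding tensor_eq_def x using lenP lin_x[OF tensor_eq_sym[OF coprod[of x]]] by blast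
      also have "tensor_eq ?s' 2 \<dots> (lin_ext fscale (\<lambda>l. ?P (?C' y') (l ! 0) (l ! 1)) (?C' x'))"
      proof -
        have "lin_ext fscale (\<lambda>l. ?P (push (map f) (?C y)) (l ! 0) (l ! 1)) (?C' x')
          - lin_ext fscale (\<lambda>l. ?P (?C' y') (l ! 0) (l ! 1)) (?C' x') \<in> tensor_null ?s' 2"
          unfolding lin_ext_diff_fun[OF vector_space_fscale, symmetric] y
          by (intro lin_ext_in_subspace[OF vector_space_fscale N] lin_y[OF tensor_eq_sym[OF coprod[of y]]])
        thus ?thesis unfolding tensor_eq_def using lenP by blast
      qed
      finally show ?thesis by (simp add: mult x y)
    qed
    show "counit H' 1 = 1" using counit[of 1] by (simp add: one H.counit_one)
    show "counit H' (x' * y') = counit H' x' * counit H' y'"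
      using counit[of "x * y"] by (simp add: x y mult counit H.counit_mult)
    show "vs.subspace (part H' n)"
    proof (rule vs.subspaceI)
      note P = H.part_subspace[of n]
      show "0 \<in> part H' n" unfolding part[symmetric] using H.subspace_0[OF P] f(5) by force
      show "a + b \<in> part H' n" if "a \<in> part H' n" "b \<in> part H' n" for a b
        using that H.subspace_add[OF P] unfolding part[symmetric] by (auto simp flip: f(3))
      show "?s' c a \<in> part H' n" if "a \<in> part H' n" for c a
        using that H.subspace_scale[OF P] unfolding part[symmetric] by (auto simp flip: f(4))
    qed
    show "\<exists>!g. (\<forall>n. g n \<in> part H' n) \<and> finite {n. g n \<noteq> 0} \<and> x' = (\<Sum>n | g n \<noteq> 0. g n)"
    proof -
      obtain g where g: "\<And>n. g n \<in> part H n" "finite {n. g n \<noteq> 0}" "x = (\<Sum>n | g n \<noteq> 0. g n)"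
        using H.part_direct[of x] by blast
      have sup: "{n. f (g n) \<noteq> 0} \<subseteq> {n. g n \<noteq> 0}" by (auto simp: f(5))
      show ?thesis
      proof (rule ex1I[of _ "\<lambda>n. f (g n)"], intro conjI allI)
        show "f (g n) \<in> part H' n" for n using g(1) part by blast
        show "finite {n. f (g n) \<noteq> 0}" using finite_subset[OF sup g(2)] .
        show "x' = (\<Sum>n | f (g n) \<noteq> 0. f (g n))"
          unfolding x g(3) f(7) using g(2) sup by (intro sum.mono_neutral_right) auto
      next
        fix h assume h: "(\<forall>n. h n \<in> part H' n) \<and> finite {n. h n \<noteq> 0} \<and> x' = (\<Sum>n | h n \<noteq> 0. h n)"
        let ?K = "{n. h n \<noteq> 0} \<union> {n. g n \<noteq> 0}" and ?d = "\<lambda>n. h n - f (g n)"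
        have subd: "{n. ?d n \<noteq> 0} \<subseteq> ?K" by (auto simp: f(5))
        have fin: "finite ?K" using h g(2) by blast
        have "(\<Sum>n | ?d n \<noteq> 0. ?d n) = (\<Sum>n\<in>?K. ?d n)"
          using subd fin by (intro sum.mono_neutral_left) auto
        also have "\<dots> = (\<Sum>n\<in>?K. h n) - (\<Sum>n\<in>?K. f (g n))" by (rule sum_subtractf)
        also have "(\<Sum>n\<in>?K. h n) = x'"
          using h fin by (metis (mono_tags, lifting) DiffD2 Un_upper1 mem_Collect_eq sum.mono_neutral_right)
        also have "(\<Sum>n\<in>?K. f (g n)) = f (\<Sum>n\<in>?K. g n)" by (simp add: f)
        also have "(\<Sum>n\<in>?K. g n) = x"
          unfolding g(3) using fin by (intro sum.mono_neutral_right) auto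
        finally have "(\<Sum>n | ?d n \<noteq> 0. ?d n) = 0" by (simp add: x)
        moreover have "?d n \<in> part H' n" for n
        proof -
          have "vs.subspace (part H' n)"
            unfolding part[symmetric]
            using H.subspace_0[OF H.part_subspace] H.subspace_add[OF H.part_subspace]
                H.subspace_scale[OF H.part_subspace]
            by (intro vs.subspaceI) (force simp: f(5), auto simp flip: f(3) f(4))
          thus ?thesis using h g(1)[of n] part[of n] by (intro vs.subspace_diff) auto
        qed
        moreover have "finite {n. ?d n \<noteq> 0}" using finite_subset[OF subd fin] .
        ultimately have "?d = (\<lambda>_. 0)" by (intro indep)
        thus "h = (\<lambda>n. f (g n))" by (metis eq_iff_diff_eq_0)
      qed
    qed
    show "x' * y' \<in> part H' (m + n)" if "x' \<in> part H' m" "y' \<in> part H' n"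
      using that H.part_mult unfolding part[symmetric] by (auto simp flip: mult)
    show "\<exists>t. tensor_eq ?s' 2 (?C' x') t \<and>
        (\<forall>l\<in>supp t. \<exists>i j. i + j = n \<and> l ! 0 \<in> part H' i \<and> l ! 1 \<in> part H' j)" if xn: "x' \<in> part H' n"
    proof -
      obtain z where z: "x' = f z" "z \<in> part H n" using xn unfolding part[symmetric] by (elim imageE)
      obtain t where t: "tensor_eq ?s 2 (?C z) t"
        "\<forall>l\<in>supp t. \<exists>i j. i + j = n \<and> l ! 0 \<in> part H i \<and> l ! 1 \<in> part H j"
        using H.part_coprod[OF z(2)] by (elim exE conjE)
      have "\<exists>i j. i + j = n \<and> l ! 0 \<in> part H' i \<and> l ! 1 \<in> part H' j" if l: "l \<in> supp (push (map f) t)" for l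
      proof -
        obtain k where k: "k \<in> supp t" "l = map f k" using subsetD[OF supp_push l] by (elim imageE)
        moreover have "length k = 2" using t(1) k(1) by (auto simp: tensor_eq_def)
        ultimately show ?thesis using t(2) part by (fastforce simp: image_iff)
      qed
      thus ?thesis using tensor_eq_trans[OF coprod tensor_eq_push[OF lin t(1)]] z(1) by blast
    qed
    show "counit H' x' = 0" if "x' \<in> part H' n" "n > 0"
      using that H.part_counit counit unfolding part[symmetric] by auto
    show "part H' 0 = range (\<lambda>c. ?s' c 1)"
      unfolding part[symmetric] H.connected image_image by (simp add: f one)
  qed (rule sl sr add scale counit_lin)+
qed

corollary graded_connected_hopf_algebra_bij:
  fixes H :: "('k::field, 'a::ring_1) hopf_data" and H' :: "('k, 'b::ring_1) hopf_data"
  assumes H: "graded_connected_hopf_algebra H"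
    and lin: "lin (scale H) (scale H') f" and bij: "bij f"
    and one: "f 1 = 1" and mult: "\<And>x y. f (x * y) = f x * f y"
    and coprod: "\<And>x. tensor_eq (scale H') 2 (coprod H' (f x)) (push (map f) (coprod H x))"
    and counit: "\<And>x. counit H' (f x) = counit H x"
    and part: "\<And>n. f ` part H n = part H' n"
  shows "graded_connected_hopf_algebra H'"
proof (rule graded_connected_hopf_algebra_image[OF H lin bij_is_surj[OF bij] one mult coprod counit part])
  interpret H: graded_connected_hopf_algebra H by fact
  note f = linearD[OF lin]
  fix g assume g: "\<And>n. g n \<in> part H' n" "finite {n. g n \<noteq> 0}" "(\<Sum>n | g n \<noteq> 0. g n) = 0"
  have inv: "f (inv f y) = y" "inv f (f x) = x" for x y
    using bij by (simp_all add: bij_is_surj surj_f_inv_f bij_is_inj)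
  define h where "h n = inv f (g n)" for n
  have fh: "f (h n) = g n" for n by (simp add: h_def inv)
  have nz: "h n \<noteq> 0 \<longleftrightarrow> g n \<noteq> 0" for n using fh[of n] f(5) inv(2) by metis
  have "h n \<in> part H n" for n using g(1)[of n] inv(2) unfolding part[symmetric] h_def by auto
  moreover have "finite {n. h n \<noteq> 0}" using g(2) by (simp add: nz)
  moreover have "(\<Sum>n | h n \<noteq> 0. h n) = 0"
  proof -
    have "f (\<Sum>n | h n \<noteq> 0. h n) = 0" using g(3) by (simp add: f fh nz)
    thus ?thesis using inv(2) f(5) by metis
  qed
  moreover have "0 \<in> part H n" for n using H.subspace_0[OF H.part_subspace] .
  ultimately have h: "(\<forall>n. h n \<in> part H n) \<and> finite {n. h n \<noteq> 0} \<and> 0 = (\<Sum>n | h n \<noteq> 0. h n)"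
    and z: "(\<forall>n. (0 :: 'a) \<in> part H n) \<and> finite {n :: nat. (0 :: 'a) \<noteq> 0} \<and> 0
        = (\<Sum>n :: nat | (0 :: 'a) \<noteq> 0. (0 :: 'a))"
    by simp_all
  have "h = (\<lambda>_. 0)"
  proof (rule ex1E[OF H.part_direct[of 0]])
    fix k
    assume "\<forall>y. (\<forall>n. y n \<in> part H n) \<and> finite {n. y n \<noteq> 0} \<and> 0 = (\<Sum>n | y n \<noteq> 0. y n) \<longrightarrow> y = k"
    note uniq = mp[OF spec[OF this]]
    show "h = (\<lambda>_. 0)" unfolding uniq[OF h] uniq[OF z] ..
  qed
  thus "g = (\<lambda>_. 0)" using fh by (simp add: fun_eq_iff f(5))
qed

section \<open>Moebius inversion\<close>

lemma sum_moebius_upper: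
  fixes x y :: "'a::order"
  assumes "x \<le> y" "finite {x..y}"
  shows "(\<Sum>z\<in>{x..y}. moebius x z) = (if x = y then 1 else 0)"
proof (cases "x = y")
  case False
  hence "x < y" using assms(1) by simp
  have "{x..y} = insert y {x..<y}" using assms(1) by auto
  moreover have "finite {x..<y}" using assms(2) by (rule rev_finite_subset) auto
  ultimately have "(\<Sum>z\<in>{x..y}. moebius x z) = moebius x y + (\<Sum>z\<in>{x..<y}. moebius x z)" by simp
  also have "moebius x y = - (\<Sum>z\<in>{x..<y}. moebius x z)"
    using \<open>x < y\<close> assms(2) by (subst moebius.simps) simp
  finally show ?thesis using False by simp
qed (simp add: moebius.simps)

text \<open>With \<open>g z\<close> for the sum over \<open>[z,y]\<close>, exchanging the order of
  summation shows that \<open>(\<Sum>z\<in>[x,y]. \<mu>(x,z) g z)\<close> equals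
  \<open>\<mu>(x,y)\<close>. By induction only \<open>z = x\<close> and \<open>z = y\<close>
  contribute to it, with \<open>g x\<close> and \<open>\<mu>(x,y)\<close>.\<close>

lemma sum_moebius_lower:
  fixes x y :: "'a::order"
  assumes "x \<le> y" "finite {x..y}"
  shows "(\<Sum>z\<in>{x..y}. moebius z y) = (if x = y then 1 else 0)"
  using assms
proof (induction "card {x..y}" arbitrary: x rule: less_induct)
  case less
  show ?case
  proof (cases "x = y")
    case False
    let ?g = "\<lambda>z. \<Sum>w\<in>{z..y}. moebius w y"
    have sub: "finite {z..y}" "finite {x..z}" if "z \<in> {x..y}" for z
      by (rule finite_subset[OF _ less.prems(2)], use that in \<open>auto intro: order_trans\<close>)+
    have IH: "?g z = (if z = y then 1 else 0)" if "z \<in> {x..y}" "z \<noteq> x" for z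
    proof (rule less.hyps)
      have "{z..y} \<subset> {x..y}" using that by (auto intro: order_trans)
      thus "card {z..y} < card {x..y}" using less.prems(2) by (rule psubset_card_mono[rotated])
    qed (use that sub in auto)
    have "(\<Sum>z\<in>{x..y}. moebius x z * ?g z)
        = (\<Sum>(z, w)\<in>Sigma {x..y} (\<lambda>z. {z..y}). moebius x z * moebius w y)"
      using less.prems(2) sub by (simp add: sum_distrib_left sum.Sigma)
    also have "\<dots> = (\<Sum>(w, z)\<in>Sigma {x..y} (\<lambda>w. {x..w}). moebius x z * moebius w y)"
      by (rule sum.reindex_bij_witness[where i = prod.swap and j = prod.swap]) (auto intro: order_trans)
    also have "\<dots> = (\<Sum>w\<in>{x..y}. moebius w y * (\<Sum>z\<in>{x..w}. moebius x z))"
      using less.prems(2) sub by (simp add: sum_distrib_left sum.Sigma mult.commute)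
    also have "\<dots> = (\<Sum>w\<in>{x..y}. if w = x then moebius w y else 0)"
      using sub by (intro sum.cong) (auto simp: sum_moebius_upper)
    also have "\<dots> = moebius x y" using less.prems by simp
    finally have 1: "(\<Sum>z\<in>{x..y}. moebius x z * ?g z) = moebius x y" .
    have "(\<Sum>z\<in>{x..y}. moebius x z * ?g z) = (\<Sum>z\<in>{x, y}. moebius x z * ?g z)"
      using less.prems IH by (intro sum.mono_neutral_right) auto
    also have "\<dots> = ?g x + moebius x y"
      using False IH[of y] less.prems by (simp add: moebius.simps[of x x])
    finally show ?thesis using 1 False by simp
  qed (simp add: moebius.simps)
qed

section \<open>Sums over set partitions\<close>

lemma partition_on_iff_blocks: "partition_on {1..n} P \<longleftrightarrow> (\<exists>X. psize X = n \<and> blocks X = P)"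
proof
  assume P: "partition_on {1..n} P"
  hence "blocks (Abs_set_partition P) = P" by (intro Abs_set_partition_inverse) auto
  with P show "\<exists>X. psize X = n \<and> blocks X = P" by (metis psizeI)
qed (use partition_on_blocks in auto)

lemma bij_betw_blocks:
  "bij_betw blocks {X. psize X = n \<and> Q (blocks X)} {P. partition_on {1..n} P \<and> Q P}"
  unfolding bij_betw_def inj_on_def by (auto simp: blocks_inject partition_on_iff_blocks simp del:
      One_nat_def)

lemma finite_psize: "finite {X. psize X = n}"
  using bij_betw_finite[OF bij_betw_blocks[of n "\<lambda>_. True"]] finitely_many_partition_on[of "{1..n}"]
  by simp

lemma le_psize: "X \<le> Y \<Longrightarrow> psize X = psize Y" for X Y :: set_partition
  by (simp add: less_eq_set_partition_def)

lemma finite_intervals [simp]: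
  "finite {..X}" "finite {X..}" "finite {X..Y}" for X Y :: set_partition
proof -
  show *: "finite {..X}" "finite {X..}" for X :: set_partition
    by (auto intro!: finite_subset[OF _ finite_psize[of "psize X"]] dest: le_psize)
  show "finite {X..Y}" by (rule finite_subset[OF _ *(1)[of Y]]) auto
qed

lemma blocks_nonempty: "B \<in> blocks X \<Longrightarrow> B \<noteq> {}"
  using partition_onD3[OF partition_on_blocks] by blast

lemma blocks_subset: "B \<in> blocks X \<Longrightarrow> B \<subseteq> {1..psize X}"
  using Union_blocks by blast

lemma finite_block: "B \<in> blocks X \<Longrightarrow> finite B"
  using blocks_subset finite_subset by blast

lemma blocks_disjoint: "\<lbrakk>B \<in> blocks X; C \<in> blocks X; j \<in> B; j \<in> C\<rbrakk> \<Longrightarrow> B = C"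
  using partition_onD2[OF partition_on_blocks[of X]] unfolding disjoint_def by blast

lemma ex_block: "j \<in> {1..psize X} \<Longrightarrow> \<exists>B\<in>blocks X. j \<in> B"
  using Union_blocks by blast

text \<open>The numbers related to \<open>g\<close> by the exponential formula. For \<open>g = 1\<close> they are the Bell numbers.\<close>

definition partition_weight :: "(nat \<Rightarrow> 'k::comm_ring_1) \<Rightarrow> nat \<Rightarrow> 'k" where
  "partition_weight g n = (\<Sum>P | partition_on {..<n} P. \<Prod>B\<in>P. g (card B))"

lemma partition_on_bij_image:
  assumes "bij_betw h A A'" "partition_on A P"
  shows "partition_on A' ((`) h ` P)"
proof -
  have "partition_on (h ` A) ((`) h ` P - {{}})"
    by (rule partition_on_inj_image[OF assms(2) bij_betw_imp_inj_on[OF assms(1)]])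
  moreover have "{} \<notin> (`) h ` P" using partition_onD3[OF assms(2)] by auto
  ultimately show ?thesis using bij_betw_imp_surj_on[OF assms(1)] by simp
qed

lemma sum_partition_on:
  assumes "finite A"
  shows "(\<Sum>P | partition_on A P. \<Prod>B\<in>P. g (card B)) = partition_weight g (card A)"
proof -
  obtain h where h: "bij_betw h A {..<card A}"
    using ex_bij_betw_finite_nat[OF assms] by (auto simp: atLeast0LessThan)
  define h' where "h' = inv_into A h"
  have h': "bij_betw h' {..<card A} A" unfolding h'_def by (rule bij_betw_inv_into[OF h])
  have inv: "h' ` h ` B = B" if "B \<subseteq> A" for B
    using that bij_betw_inv_into_left[OF h] by (force simp: h'_def image_image)
  have inv': "h ` h' ` B = B" if "B \<subseteq> {..<card A}" for B
    using that bij_betw_inv_into_right[OF h] by (force simp: h'_def image_image)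
  have sub: "B \<subseteq> X" if "partition_on X P" "B \<in> P" for X :: "'c set" and P B
    using that by (auto simp: partition_on_def)
  show ?thesis unfolding partition_weight_def
  proof (rule sum.reindex_bij_witness[where i = "\<lambda>P. (`) h' ` P" and j = "\<lambda>P. (`) h ` P"])
    fix P assume "P \<in> {P. partition_on A P}"
    hence P: "partition_on A P" by simp
    show "(`) h' ` (`) h ` P = P" using inv sub[OF P] by (force simp: image_image)
    show "(`) h ` P \<in> {P. partition_on {..<card A} P}" using partition_on_bij_image[OF h P] by simp
    have inj: "inj_on h B" if "B \<in> P" for B
      using inj_on_subset[OF bij_betw_imp_inj_on[OF h] sub[OF P that]] .
    have "inj_on ((`) h) P"
      by (rule inj_on_inverseI[where g = "(`) h'"]) (use inv sub[OF P] in auto)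
    thus "(\<Prod>B\<in>(`) h ` P. g (card B)) = (\<Prod>B\<in>P. g (card B))"
      by (simp add: prod.reindex card_image inj)
  next
    fix P assume "P \<in> {P. partition_on {..<card A} P}"
    hence P: "partition_on {..<card A} P" by simp
    show "(`) h ` (`) h' ` P = P" using inv' sub[OF P] by (force simp: image_image)
    show "(`) h' ` P \<in> {P. partition_on A P}" using partition_on_bij_image[OF h' P] by simp
  qed
qed

text \<open>A partition refining a disjoint family is a choice of a partition of each of its members.\<close>

lemma sum_refinements:
  fixes C :: "'i \<Rightarrow> 'a set" and g :: "nat \<Rightarrow> 'k::comm_ring_1"
  assumes "finite I" "\<And>i. i \<in> I \<Longrightarrow> finite (C i)" "disjoint_family_on C I"
  shows "(\<Sum>P | partition_on (\<Union>i\<in>I. C i) P \<and> (\<forall>B\<in>P. \<exists>i\<in>I. B \<subseteq> C i). \<Prod>B\<in>P. g (card B))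
    = (\<Prod>i\<in>I. partition_weight g (card (C i)))"
  using assms
proof (induction I)
  case empty
  have "{P. partition_on (\<Union>i\<in>{}. C i) P \<and> (\<forall>B\<in>P. \<exists>i\<in>{}. B \<subseteq> C i)} = {{}}"
    by (auto simp: partition_on_def)
  thus ?case by (simp only: sum.insert sum.empty prod.empty finite.emptyI empty_iff add_0_right
      not_False_eq_True)
next
  case (insert a I)
  let ?R = "\<lambda>I. {P. partition_on (\<Union>i\<in>I. C i) P \<and> (\<forall>B\<in>P. \<exists>i\<in>I. B \<subseteq> C i)}"
  let ?w = "\<lambda>P. \<Prod>B\<in>P. g (card B)"
  have disj: "C a \<inter> C i = {}" if "i \<in> I" for i
    using insert.prems(2) insert.hyps that by (auto simp: disjoint_family_on_def)
  have outside: "\<not> B \<subseteq> C a" if QB: "Q \<in> ?R I" "B \<in> Q" for B Q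
  proof -
    have "B \<noteq> {}" using QB by (auto simp: partition_on_def)
    moreover obtain i where "i \<in> I" "B \<subseteq> C i" using QB by blast
    ultimately show ?thesis using disj by blast
  qed
  have "sum ?w (?R (insert a I)) = (\<Sum>(P, Q)\<in>{P. partition_on (C a) P} \<times> ?R I. ?w P * ?w Q)"
  proof (rule sum.reindex_bij_witness[where i = "\<lambda>(P, Q). P \<union> Q"
        and j = "\<lambda>P. ({B\<in>P. B \<subseteq> C a}, {B\<in>P. \<not> B \<subseteq> C a})"])
    fix P assume P: "P \<in> ?R (insert a I)"
    let ?P = "{B\<in>P. B \<subseteq> C a}" and ?Q = "{B\<in>P. \<not> B \<subseteq> C a}"
    have U: "\<Union>P = (\<Union>i\<in>insert a I. C i)" using P by (simp add: partition_on_def)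
    have cell: "\<exists>i\<in>I. B \<subseteq> C i" if "B \<in> ?Q" for B using P that by auto
    have "\<Union>?P = C a"
    proof
      show "C a \<subseteq> \<Union>?P"
      proof
        fix x assume x: "x \<in> C a"
        hence "x \<in> \<Union>P" unfolding U by blast
        then obtain B where B: "B \<in> P" "x \<in> B" by (elim UnionE)
        have "B \<subseteq> C a" using cell[of B] B x disj by blast
        thus "x \<in> \<Union>?P" using B by blast
      qed
    qed blast
    moreover have "\<Union>?Q = (\<Union>i\<in>I. C i)"
    proof
      show "(\<Union>i\<in>I. C i) \<subseteq> \<Union>?Q"
      proof
        fix x assume x: "x \<in> (\<Union>i\<in>I. C i)"
        hence "x \<in> \<Union>P" unfolding U by blast
        then obtain B where B: "B \<in> P" "x \<in> B" by (elim UnionE)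
        have "\<not> B \<subseteq> C a" using B x disj by blast
        thus "x \<in> \<Union>?Q" using B by blast
      qed
    qed (use cell in blast)
    ultimately show "(?P, ?Q) \<in> {P. partition_on (C a) P} \<times> ?R I"
      using P cell by (auto simp: partition_on_def disjoint_def)
    have "finite P"
      using P insert.prems(1) insert.hyps(1) by (auto intro!: finite_elements[of "\<Union>i\<in>insert a I. C i"])
    hence "?w (?P \<union> ?Q) = ?w ?P * ?w ?Q" by (intro prod.union_disjoint) auto
    moreover have "?P \<union> ?Q = P" by blast
    ultimately show "(case (?P, ?Q) of (P, Q) \<Rightarrow> ?w P * ?w Q) = ?w P" by simp
    show "(case (?P, ?Q) of (P, Q) \<Rightarrow> P \<union> Q) = P" by auto
  next
    fix b assume "b \<in> {P. partition_on (C a) P} \<times> ?R I"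
    then obtain P Q where b: "b = (P, Q)" and P: "partition_on (C a) P" and Q: "Q \<in> ?R I" by blast
    have "B \<subseteq> C a" if "B \<in> P" for B using P that by (auto simp: partition_on_def)
    with outside[OF Q] have "{B\<in>P \<union> Q. B \<subseteq> C a} = P" "{B\<in>P \<union> Q. \<not> B \<subseteq> C a} = Q" by blast+
    thus "({B \<in> case b of (P, Q) \<Rightarrow> P \<union> Q. B \<subseteq> C a}, {B \<in> case b of (P, Q) \<Rightarrow> P \<union> Q. \<not> B \<subseteq> C a}) = b"
      by (simp add: b)
    have PC: "\<Union>P = C a" using P by (simp add: partition_on_def)
    have QC: "\<Union>Q = (\<Union>i\<in>I. C i)" using Q by (simp add: partition_on_def)
    have "disjnt B B'" if "B \<in> P" "B' \<in> Q" for B B'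
    proof -
      have "B \<subseteq> C a" "B' \<subseteq> (\<Union>i\<in>I. C i)" using that PC QC by blast+
      thus ?thesis using disj unfolding disjnt_def by blast
    qed
    hence "disjoint (P \<union> Q)"
      using P Q unfolding partition_on_def pairwise_def by (auto simp: disjnt_sym)
    moreover have "\<Union>(P \<union> Q) = (\<Union>i\<in>insert a I. C i)" using PC QC by simp
    ultimately have "partition_on (\<Union>i\<in>insert a I. C i) (P \<union> Q)"
      using P Q by (simp add: partition_on_def)
    thus "(case b of (P, Q) \<Rightarrow> P \<union> Q) \<in> ?R (insert a I)"
      using PC Q by (auto simp: b)
  qed
  also have "\<dots> = (\<Sum>P | partition_on (C a) P. ?w P) * sum ?w (?R I)"
    by (simp add: sum_product sum.cartesian_product)
  also have "sum ?w (?R I) = (\<Prod>i\<in>I. partition_weight g (card (C i)))"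
    using insert.prems insert.hyps by (intro insert.IH) (auto simp: disjoint_family_on_def)
  also have "(\<Sum>P | partition_on (C a) P. ?w P) = partition_weight g (card (C a))"
    using insert.prems by (intro sum_partition_on) simp
  finally show ?case using insert.hyps by simp
qed

lemma sum_set_partitions_refining:
  fixes C :: "'i \<Rightarrow> nat set" and g :: "nat \<Rightarrow> 'k::comm_ring_1"
  assumes "finite I" "disjoint_family_on C I" "(\<Union>i\<in>I. C i) = {1..n}"
  shows "(\<Sum>Y | psize Y = n \<and> (\<forall>B\<in>blocks Y. \<exists>i\<in>I. B \<subseteq> C i). \<Prod>B\<in>blocks Y. g (card B))
    = (\<Prod>i\<in>I. partition_weight g (card (C i)))"
proof -
  have "finite (C i)" if "i \<in> I" for i
    using assms(3) that by (metis UN_upper finite_atLeastAtMost finite_subset)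
  note sum_refinements[OF assms(1) this assms(2), of g, unfolded assms(3)]
  thus ?thesis
    using sum.reindex_bij_betw[OF bij_betw_blocks[of n "\<lambda>P. \<forall>B\<in>P. \<exists>i\<in>I. B \<subseteq> C i"], of "\<lambda>P. \<Prod>B\<in>P. g (card
        B)"]
    by simp
qed

lemma sum_below:
  "(\<Sum>Y\<in>{..X}. \<Prod>B\<in>blocks Y. g (card B)) = (\<Prod>B\<in>blocks X. partition_weight g (card B))"
proof -
  have "disjoint_family_on (\<lambda>B. B) (blocks X)"
    using blocks_disjoint by (auto simp: disjoint_family_on_def)
  moreover have "{..X} = {Y. psize Y = psize X \<and> (\<forall>B\<in>blocks Y. \<exists>C\<in>blocks X. B \<subseteq> C)}"
    by (auto simp: less_eq_set_partition_def)
  ultimately show ?thesis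
    using sum_set_partitions_refining[OF finite_blocks[of X], of "\<lambda>B. B" "psize X" g] Union_blocks[of X]
        by simp
qed

subsection \<open>Blocks weighted by cyclic orders\<close>

text \<open>Remove from a partition of \<open>{..n}\<close> the block \<open>insert n B\<close> of \<open>n\<close>.\<close>

lemma partition_weight_Suc:
  "partition_weight g (Suc n) = (\<Sum>B\<in>Pow {..<n}. g (Suc (card B)) * partition_weight g (n - card B))"
proof -
  let ?w = "\<lambda>P. \<Prod>B\<in>P. g (card B)"
  let ?A = "{..<n}"
  have S: "{..<Suc n} = insert n ?A" by auto
  have "partition_weight g (Suc n) = (\<Sum>(B, Q)\<in>Sigma (Pow ?A) (\<lambda>B. {Q. partition_on (?A - B) Q}). g (Suc
      (card B)) * ?w Q)"
    unfolding partition_weight_def S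
  proof (rule sum.reindex_bij_witness[where i = "\<lambda>(B, Q). insert (insert n B) Q"
        and j = "\<lambda>P. ((THE B. B \<in> P \<and> n \<in> B) - {n}, P - {THE B. B \<in> P \<and> n \<in> B})"])
    fix P assume "P \<in> {P. partition_on (insert n ?A) P}"
    hence P: "partition_on (insert n ?A) P" by simp
    have fin: "finite P" by (rule finite_elements[OF _ P]) simp
    have "n \<in> \<Union>P" using P by (simp add: partition_on_def)
    then obtain B where B: "B \<in> P" "n \<in> B" by (elim UnionE)
    have the: "(THE B. B \<in> P \<and> n \<in> B) = B"
      using P B unfolding partition_on_def disjoint_def by (intro the_equality) blast+
    have Bsub: "B \<subseteq> insert n ?A" using P B by (auto simp: partition_on_def)
    have d: "B' \<inter> B = {}" if "B' \<in> P - {B}" for B'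
      using P B that by (auto simp: partition_on_def disjoint_def)
    have "\<Union>(P - {B}) = insert n ?A - B"
      using d B unfolding partition_onD1[OF P] by blast
    moreover have "disjoint (P - {B})"
      by (rule pairwise_subset[OF partition_onD2[OF P]]) blast
    ultimately have "partition_on (insert n ?A - B) (P - {B})"
      using partition_onD3[OF P] by (simp add: partition_on_def)
    moreover have "insert n ?A - B = ?A - (B - {n})" using B by auto
    ultimately show "((THE B. B \<in> P \<and> n \<in> B) - {n}, P - {THE B. B \<in> P \<and> n \<in> B})
        \<in> Sigma (Pow ?A) (\<lambda>B. {Q. partition_on (?A - B) Q})"
      using Bsub by (auto simp: the)
    show "(case ((THE B. B \<in> P \<and> n \<in> B) - {n}, P - {THE B. B \<in> P \<and> n \<in> B}) of
        (B, Q) \<Rightarrow> insert (insert n B) Q) = P"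
    proof -
      have "insert n (B - {n}) = B" "insert B (P - {B}) = P" using B by blast+
      thus ?thesis by (simp only: the prod.case)
    qed
    have "finite B" using finite_subset[OF Bsub] by simp
    hence "card B = Suc (card (B - {n}))" using B(2) by (rule card.remove)
    moreover have "?w P = g (card B) * ?w (P - {B})" using fin B by (simp add: prod.remove)
    ultimately show "(case ((THE B. B \<in> P \<and> n \<in> B) - {n}, P - {THE B. B \<in> P \<and> n \<in> B}) of
        (B, Q) \<Rightarrow> g (Suc (card B)) * ?w Q) = ?w P"
      by (simp add: the)
  next
    fix b assume "b \<in> Sigma (Pow ?A) (\<lambda>B. {Q. partition_on (?A - B) Q})"
    then obtain B Q where b: "b = (B, Q)" and B: "B \<subseteq> ?A" and Q: "partition_on (?A - B) Q" by auto
    have n: "n \<notin> B" "n \<notin> C" if "C \<in> Q" for C using B Q that by (auto simp: partition_on_def)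
    have nB: "n \<notin> B" using B by auto
    have the: "(THE C. C \<in> insert (insert n B) Q \<and> n \<in> C) = insert n B"
      using n by (intro the_equality) auto
    have "insert n B \<notin> Q" using n by blast
    thus "((THE C. C \<in> (case b of (B, Q) \<Rightarrow> insert (insert n B) Q) \<and> n \<in> C) - {n},
        (case b of (B, Q) \<Rightarrow> insert (insert n B) Q) - {THE C. C
            \<in> (case b of (B, Q) \<Rightarrow> insert (insert n B) Q) \<and> n \<in> C}) = b"
      using nB by (simp add: b the[simplified])
    have "C \<inter> insert n B = {}" if "C \<in> Q" for C using that n Q by (auto simp: partition_on_def)
    hence "partition_on (insert n ?A) (insert (insert n B) Q)"
      using Q B n unfolding partition_on_def pairwise_insert disjnt_def by auto
    thus "(case b of (B, Q) \<Rightarrow> insert (insert n B) Q) \<in> {P. partition_on (insert n ?A) P}"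
      by (simp add: b)
  qed
  also have "\<dots> = (\<Sum>B\<in>Pow ?A. \<Sum>Q | partition_on (?A - B) Q. g (Suc (card B)) * ?w Q)"
    by (rule sum.Sigma[symmetric]) (auto intro: finitely_many_partition_on)
  also have "\<dots> = (\<Sum>B\<in>Pow ?A. g (Suc (card B)) * partition_weight g (n - card B))"
    by (intro sum.cong refl) (auto simp: sum_distrib_left[symmetric] sum_partition_on card_Diff_subset
        finite_subset)
  finally show ?thesis .
qed

lemma sum_Pow_card: "(\<Sum>B\<in>Pow {..<n}. f (card B)) = (\<Sum>k\<le>n. of_nat (n choose k) * f k)"
  for f :: "nat \<Rightarrow> 'k::comm_ring_1"
proof -
  have "(\<Sum>B\<in>Pow {..<n}. f (card B)) = (\<Sum>k\<le>n. \<Sum>B\<in>{B\<in>Pow {..<n}. card B = k}. f (card B))"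
    by (rule sum.group[symmetric]) (auto dest: card_mono[rotated])
  also have "\<dots> = (\<Sum>k\<le>n. of_nat (n choose k) * f k)"
    by (intro sum.cong refl) (use n_subsets[of "{..<n}"] in auto)
  finally show ?thesis .
qed

text \<open>A set of size \<open>k\<close> has \<open>(k - 1)!\<close> cyclic orders, so with
  \<open>s = 1\<close> these are the permutations, counted by their cycle partitions;
  \<open>s\<close> keeps track of the number of cycles.\<close>

lemma partition_weight_cyclic:
  fixes s :: "'k::{comm_ring_1, ring_char_0}"
  shows "partition_weight (\<lambda>k. s ^ (k - 1) * fact (k - 1)) n = (\<Prod>i<n. 1 + of_nat i * s)"
proof -
  let ?g = "\<lambda>k. s ^ (k - 1) * fact (k - 1)" and ?c = "\<lambda>n. \<Prod>i<n. 1 + of_nat i * s"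
  have T: "(\<Sum>k\<le>n. of_nat (n choose k) * (s ^ k * fact k * ?c (n - k))) = ?c (Suc n)" for n
  proof (induction n)
    case (Suc n)
    have key: "of_nat (Suc n choose Suc k) * fact (Suc k)
        = of_nat (Suc n) * (of_nat (n choose k) * (fact k :: 'k))" for k
    proof -
      have "(Suc n choose Suc k) * fact (Suc k) = Suc n * ((n choose k) * (fact k :: nat))"
        using Suc_times_binomial_eq[of n k] by (simp add: algebra_simps)
      hence "of_nat ((Suc n choose Suc k) * fact (Suc k))
          = (of_nat (Suc n * ((n choose k) * fact k)) :: 'k)"
        by simp
      thus ?thesis by (simp only: of_nat_mult of_nat_fact)
    qed
    have *: "of_nat (Suc n choose Suc k) * (s ^ Suc k * fact (Suc k) * x)
        = of_nat (Suc n) * s * (of_nat (n choose k) * (s ^ k * fact k * x))" for k x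
    proof -
      have "of_nat (Suc n choose Suc k) * (s ^ Suc k * fact (Suc k) * x)
          = (of_nat (Suc n choose Suc k) * fact (Suc k)) * (s * s ^ k * x)"
        by (simp only: power_Suc mult_ac)
      thus ?thesis unfolding key by (simp only: mult_ac)
    qed
    have "(\<Sum>k\<le>Suc n. of_nat (Suc n choose k) * (s ^ k * fact k * ?c (Suc n - k)))
      = ?c (Suc n) + (\<Sum>k\<le>n. of_nat (Suc n choose Suc k) * (s ^ Suc k * fact (Suc k) * ?c (n - k)))"
      by (subst sum.atMost_Suc_shift) simp
    also have "\<dots> = ?c (Suc n) + of_nat (Suc n) * s * ?c (Suc n)"
      by (simp only: * sum_distrib_left[symmetric] Suc.IH)
    also have "\<dots> = ?c (Suc (Suc n))" by (simp add: algebra_simps)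
    finally show ?case .
  qed simp
  show ?thesis
  proof (induction n rule: less_induct)
    case (less n)
    show ?case
    proof (cases n)
      case 0
      have "{P. partition_on {} P} = {{} :: nat set set}" by (auto simp: partition_on_def)
      thus ?thesis by (simp add: 0 partition_weight_def)
    next
      case (Suc m)
      have "partition_weight ?g n = (\<Sum>B\<in>Pow {..<m}. s ^ card B * fact (card B) * ?c (m - card B))"
        unfolding Suc partition_weight_Suc using less.IH Suc by (intro sum.cong) auto
      also have "\<dots> = ?c n"
        unfolding sum_Pow_card[of "\<lambda>k. s ^ k * fact k * ?c (m - k)"] T Suc ..
      finally show ?thesis .
    qed
  qed
qed

lemma prod_one_minus: "(\<Prod>i<n. 1 + of_nat i * (- 1 :: 'k::comm_ring_1)) = (if n \<le> 1 then 1 else 0)"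
proof (cases "n \<le> 1")
  case False
  thus ?thesis by (auto intro!: prod_zero bexI[of _ 1])
qed (auto simp: le_Suc_eq)

lemma prod_one_plus: "(\<Prod>i<n. 1 + of_nat i * (1 :: 'k::comm_ring_1)) = of_nat (fact n)"
  by (induction n) (auto simp: algebra_simps)

lemma blocks_discrete: "blocks (discrete_partition n) = (\<lambda>i. {i}) ` {1..n}"
  by transfer simp

lemma psize_discrete [simp]: "psize (discrete_partition n) = n"
  by (simp add: psize_def blocks_discrete)

lemma discrete_le: "discrete_partition (psize X) \<le> X"
  using ex_block by (auto simp: less_eq_set_partition_def blocks_discrete)

lemma discrete_iff_singletons: "X = discrete_partition (psize X) \<longleftrightarrow> (\<forall>B\<in>blocks X. card B \<le> 1)"
proof
  assume "X = discrete_partition (psize X)"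
  thus "\<forall>B\<in>blocks X. card B \<le> 1" using blocks_discrete[of "psize X"] by auto
next
  assume *: "\<forall>B\<in>blocks X. card B \<le> 1"
  have "X \<le> discrete_partition (psize X)"
    unfolding less_eq_set_partition_def psize_discrete
  proof (intro conjI ballI refl)
    fix B assume B: "B \<in> blocks X"
    then obtain j where j: "j \<in> B" using blocks_nonempty by blast
    have "B = {j}" using *[rule_format, OF B] finite_block[OF B] j
        by (metis card_le_Suc0_iff_eq One_nat_def insertI1 empty_iff insert_iff subsetI subset_antisym)
    thus "\<exists>C\<in>blocks (discrete_partition (psize X)). B \<subseteq> C"
      using blocks_subset[OF B] by (auto simp: blocks_discrete)
  qed
  thus "X = discrete_partition (psize X)" using discrete_le[of X] by (rule antisym)
qed

text \<open>The product of the signed weights satisfies the recursion which defines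
  \<open>\<mu>\<close>, since for \<open>s = -1\<close> the factor \<open>1 + s\<close> vanishes.\<close>

lemma moebius0_eq: "moebius0 X = (\<Prod>B\<in>blocks X. (- 1) ^ (card B - 1) * fact (card B - 1))"
proof (induction "card {..X}" arbitrary: X rule: less_induct)
  case less
  let ?a = "\<lambda>Y. \<Prod>B\<in>blocks Y. (- 1) ^ (card B - 1) * fact (card B - 1) :: int"
  let ?D = "discrete_partition (psize X)"
  have below: "{?D..X} = {..X}"
    using discrete_le by (auto dest: le_psize) (metis le_psize)
  have "(\<Sum>Y\<in>{..X}. ?a Y) = (\<Prod>B\<in>blocks X. if card B \<le> 1 then 1 else 0)"
    unfolding sum_below[of "\<lambda>k. (- 1) ^ (k - 1) * fact (k - 1)"] partition_weight_cyclic prod_one_minus ..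
  also have "\<dots> = (if X = ?D then 1 else 0)"
    unfolding discrete_iff_singletons using finite_blocks[of X]
        by (auto simp: prod_zero_iff intro!: prod.neutral)
  finally have a: "(\<Sum>Y\<in>{..X}. ?a Y) = (if X = ?D then 1 else 0)" .
  have m: "(\<Sum>Y\<in>{..X}. moebius ?D Y) = (if X = ?D then 1 else 0)"
    using sum_moebius_upper[OF discrete_le, of X] by (auto simp: below eq_commute)
  have IH: "moebius ?D Y = ?a Y" if "Y \<in> {..X} - {X}" for Y
  proof -
    have "{..Y} \<subset> {..X}" using that by auto
    hence "card {..Y} < card {..X}" by (intro psubset_card_mono) simp_all
    from less[OF this] show ?thesis using that le_psize[of Y X] by (simp add: moebius0_def)
  qed
  have split: "(\<Sum>Y\<in>{..X}. q Y) = q X + (\<Sum>Y\<in>{..X} - {X}. q Y)" for q :: "set_partition \<Rightarrow> int"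
    by (rule sum.remove) auto
  have "(\<Sum>Y\<in>{..X} - {X}. moebius ?D Y) = (\<Sum>Y\<in>{..X} - {X}. ?a Y)" using IH by (intro sum.cong) auto
  thus ?case using a m split[of "moebius ?D"] split[of ?a] by (simp add: moebius0_def)
qed

lemma abs_moebius0_eq: "\<bar>moebius0 X\<bar> = (\<Prod>B\<in>blocks X. 1 ^ (card B - 1) * fact (card B - 1))"
proof -
  have "\<bar>prod f A\<bar> = (\<Prod>x\<in>A. \<bar>f x\<bar>)" for f :: "nat set \<Rightarrow> int" and A
    by (induction A rule: infinite_finite_induct) (simp_all add: abs_mult)
  thus ?thesis by (simp add: moebius0_eq abs_mult power_abs)
qed

section \<open>Coefficients of the bases\<close>

text \<open>The letters of \<open>w\<close> at the positions in \<open>B\<close>. All the series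
  considered here have coefficients which are products, over the blocks \<open>B\<close> of a set
  partition, of a function of these multisets.\<close>

definition colors :: "nat list \<Rightarrow> nat set \<Rightarrow> nat multiset" where
  "colors w B = image_mset (\<lambda>j. w ! (j - 1)) (mset_set B)"

definition block_prod :: "(nat multiset \<Rightarrow> 'k::comm_ring_1) \<Rightarrow> set_partition \<Rightarrow> nat list \<Rightarrow> 'k" where
  "block_prod \<psi> X w = (if length w = psize X then \<Prod>B\<in>blocks X. \<psi> (colors w B) else 0)"

definition count_prod :: "(nat \<Rightarrow> 'k::comm_ring_1) \<Rightarrow> nat multiset \<Rightarrow> 'k" where
  "count_prod g N = (\<Prod>i\<in>set_mset N. g (count N i))"

lemma count_colors: "finite B \<Longrightarrow> count (colors w B) i = card {j\<in>B. w ! (j - 1) = i}"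
  unfolding colors_def count_image_mset' by (simp add: conj_commute eq_commute)

lemma size_colors: "finite B \<Longrightarrow> size (colors w B) = card B"
  by (simp add: colors_def)

lemma set_colors: "finite B \<Longrightarrow> set_mset (colors w B) = (\<lambda>j. w ! (j - 1)) ` B"
  by (simp add: colors_def)

lemma colors_cong: "(\<And>j. j \<in> B \<Longrightarrow> w ! (j - 1) = w' ! (j - 1)) \<Longrightarrow> colors w B = colors w' B"
  unfolding colors_def by (cases "finite B") (auto intro!: image_mset_cong)

definition constant_mset :: "nat multiset \<Rightarrow> 'k::comm_ring_1" where
  "constant_mset N = (if \<exists>i. N = replicate_mset (size N) i then 1 else 0)"

definition distinct_mset :: "nat multiset \<Rightarrow> 'k::comm_ring_1" where
  "distinct_mset N = (if \<forall>i. count N i \<le> 1 then 1 else 0)"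

lemma prod_indicator:
  "finite A \<Longrightarrow> (\<Prod>x\<in>A. if P x then 1 else 0) = (if \<forall>x\<in>A. P x then 1 else 0 :: 'k::comm_ring_1)"
  by (induction A rule: finite_induct) auto

lemma constant_colors_iff:
  assumes "finite B" "B \<noteq> {}"
  shows "(\<exists>i. colors w B = replicate_mset (size (colors w B)) i)
    \<longleftrightarrow> (\<forall>j\<in>B. \<forall>k\<in>B. w ! (j - 1) = w ! (k - 1))"
proof
  assume "\<exists>i. colors w B = replicate_mset (size (colors w B)) i"
  then obtain i where i: "colors w B = replicate_mset (size (colors w B)) i" ..
  have "set_mset (colors w B) = (if size (colors w B) = 0 then {} else {i})"
    using arg_cong[OF i, of set_mset] unfolding set_mset_replicate_mset_subset .
  hence "set_mset (colors w B) \<subseteq> {i}" by (simp split: if_splits)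
  thus "\<forall>j\<in>B. \<forall>k\<in>B. w ! (j - 1) = w ! (k - 1)" using assms(1) by (auto simp: set_colors)
next
  assume *: "\<forall>j\<in>B. \<forall>k\<in>B. w ! (j - 1) = w ! (k - 1)"
  obtain j where j: "j \<in> B" using assms(2) by blast
  have "colors w B = image_mset (\<lambda>_. w ! (j - 1)) (mset_set B)"
    unfolding colors_def
  proof (rule image_mset_cong)
    fix x assume "x \<in># mset_set B"
    hence "x \<in> B" using assms(1) by simp
    thus "w ! (x - 1) = w ! (j - 1)" using * j by blast
  qed
  also have "\<dots> = replicate_mset (size (colors w B)) (w ! (j - 1))"
    by (simp add: image_mset_const_eq size_colors[OF assms(1)])
  finally show "\<exists>i. colors w B = replicate_mset (size (colors w B)) i" by (rule exI)
qed

lemma distinct_colors_iff: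
  assumes "finite B"
  shows "(\<forall>i. count (colors w B) i \<le> 1) \<longleftrightarrow> (\<forall>j\<in>B. \<forall>k\<in>B. j \<noteq> k \<longrightarrow> w ! (j - 1) \<noteq> w ! (k - 1))"
proof -
  have "card {j\<in>B. w ! (j - 1) = i} \<le> 1 \<longleftrightarrow>
      (\<forall>j\<in>{j\<in>B. w ! (j - 1) = i}. \<forall>k\<in>{j\<in>B. w ! (j - 1) = i}. j = k)" for i
    unfolding One_nat_def using assms by (intro card_le_Suc0_iff_eq) simp
  thus ?thesis unfolding count_colors[OF assms] by blast
qed

lemma ball_same_block:
  "(\<forall>j\<in>{1..psize X}. \<forall>k\<in>{1..psize X}. P j k \<and> same_block X j k \<longrightarrow> Q j k)
    \<longleftrightarrow> (\<forall>B\<in>blocks X. \<forall>j\<in>B. \<forall>k\<in>B. P j k \<longrightarrow> Q j k)"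
proof -
  have "j \<in> {1..psize X}" if "B \<in> blocks X" "j \<in> B" for B j
    using blocks_subset that by blast
  thus ?thesis unfolding same_block_def by blast
qed

lemma nc_coeff_p: "nc_coeff (nc_p X) w = block_prod constant_mset X w"
proof -
  have "(\<forall>j\<in>{1..psize X}. \<forall>k\<in>{1..psize X}. same_block X j k \<longrightarrow> w ! (j - 1) = w ! (k - 1))
    \<longleftrightarrow> (\<forall>B\<in>blocks X. \<exists>i. colors w B = replicate_mset (size (colors w B)) i)"
    using ball_same_block[of X "\<lambda>_ _. True" "\<lambda>j k. w ! (j - 1) = w ! (k - 1)"]
    by (simp add: constant_colors_iff finite_block blocks_nonempty del: One_nat_def)
  thus ?thesis
    by (simp add: nc_p.rep_eq block_prod_def constant_mset_def prod_indicator finite_blocks del: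
        One_nat_def)
qed

lemma nc_coeff_e: "nc_coeff (nc_e X) w = block_prod distinct_mset X w"
proof -
  have "(\<forall>j\<in>{1..psize X}. \<forall>k\<in>{1..psize X}. j \<noteq> k \<and> same_block X j k \<longrightarrow> w ! (j - 1) \<noteq> w ! (k - 1))
    \<longleftrightarrow> (\<forall>B\<in>blocks X. \<forall>i. count (colors w B) i \<le> 1)"
    using ball_same_block[of X "\<lambda>j k. j \<noteq> k" "\<lambda>j k. w ! (j - 1) \<noteq> w ! (k - 1)"]
    by (simp add: distinct_colors_iff finite_block del: One_nat_def)
  thus ?thesis
    by (simp add: nc_e.rep_eq block_prod_def distinct_mset_def prod_indicator finite_blocks del:
        One_nat_def)
qed

subsection \<open>Linear orderings\<close>

text \<open>A linear order on a nonempty finite set is a choice of the least element and of a linear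
  order on the rest.\<close>

lemma card_linear_orders: "finite A \<Longrightarrow> card {r. linear_order_on A r} = fact (card A)"
proof (induction "card A" arbitrary: A)
  case 0
  hence "{r. linear_order_on A r} = {{}}"
    by (auto simp: order_on_defs refl_on_def trans_def antisym_def total_on_def)
  thus ?case using 0 by simp
next
  case (Suc n)
  let ?L = "\<lambda>A. {r. linear_order_on A r}"
  let ?M = "\<lambda>a. {r\<in>?L A. \<forall>x\<in>A. (a, x) \<in> r}"
  have finL: "finite (?L A)"
    by (rule finite_subset[of _ "Pow (A \<times> A)"]) (use Suc.prems in \<open>auto simp: order_on_defs\<close>)
  have "\<exists>a\<in>A. \<forall>x\<in>A. (a, x) \<in> r" if r: "linear_order_on A r" for r
  proof -
    have "finite B \<Longrightarrow> B \<noteq> {} \<Longrightarrow> B \<subseteq> A \<Longrightarrow> \<exists>a\<in>B. \<forall>x\<in>B. (a, x) \<in> r" for B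
    proof (induction B rule: finite_ne_induct)
      case (singleton x)
      thus ?case using r by (auto simp: order_on_defs refl_on_def)
    next
      case (insert b B)
      then obtain a where a: "a \<in> B" "\<forall>x\<in>B. (a, x) \<in> r" by auto
      have refl: "(b, b) \<in> r" using r insert.prems by (auto simp: order_on_defs refl_on_def)
      have "(a, b) \<in> r \<or> (b, a) \<in> r"
        using r a insert by (auto simp: order_on_defs total_on_def refl_on_def)
      thus ?case
      proof
        assume "(b, a) \<in> r"
        moreover have "trans r" using r by (simp add: order_on_defs)
        ultimately have "\<forall>x\<in>B. (b, x) \<in> r" using a by (meson transD)
        with refl show ?case by blast
      qed (use a in auto)
    qed
    thus ?thesis using Suc by fastforce
  qed
  hence L: "?L A = (\<Union>a\<in>A. ?M a)" by blast
  have "card (\<Union>a\<in>A. ?M a) = (\<Sum>a\<in>A. card (?M a))"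
  proof (rule card_UN_disjoint)
    show "\<forall>a\<in>A. finite (?M a)" using finL by simp
    show "\<forall>a\<in>A. \<forall>b\<in>A. a \<noteq> b \<longrightarrow> ?M a \<inter> ?M b = {}"
      by (auto simp: order_on_defs antisym_def)
  qed (use Suc.prems in simp)
  moreover have "card (?M a) = fact n" if a: "a \<in> A" for a
  proof -
    have "bij_betw (\<lambda>r. r \<inter> (A - {a}) \<times> (A - {a})) (?M a) (?L (A - {a}))"
    proof (rule bij_betw_byWitness[where f' = "\<lambda>r. r \<union> {a} \<times> A"])
      show "\<forall>r\<in>?M a. r \<inter> (A - {a}) \<times> (A - {a}) \<union> {a} \<times> A = r"
        using a by (auto simp: order_on_defs antisym_def)
      show "\<forall>r\<in>?L (A - {a}). (r \<union> {a} \<times> A) \<inter> (A - {a}) \<times> (A - {a}) = r"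
        by (auto simp: order_on_defs)
      show "(\<lambda>r. r \<inter> (A - {a}) \<times> (A - {a})) ` ?M a \<subseteq> ?L (A - {a})"
      proof clarify
        fix r assume "linear_order_on A r"
        thus "linear_order_on (A - {a}) (r \<inter> (A - {a}) \<times> (A - {a}))"
          unfolding order_on_defs refl_on_def trans_def antisym_def total_on_def by blast
      qed
      show "(\<lambda>r. r \<union> {a} \<times> A) ` ?L (A - {a}) \<subseteq> ?M a"
      proof (rule image_subsetI)
        fix r assume "r \<in> ?L (A - {a})"
        hence r: "linear_order_on (A - {a}) r" by simp
        hence sub: "r \<subseteq> (A - {a}) \<times> (A - {a})" by (simp add: order_on_defs)
        have "trans (r \<union> {a} \<times> A)"
          using r sub unfolding order_on_defs trans_def by blast
        moreover have "antisym (r \<union> {a} \<times> A)"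
          using r sub unfolding order_on_defs antisym_def by blast
        moreover have "refl_on A (r \<union> {a} \<times> A)" "total_on A (r \<union> {a} \<times> A)"
          using r unfolding order_on_defs refl_on_def total_on_def by blast+
        ultimately have "linear_order_on A (r \<union> {a} \<times> A)"
          using sub a by (auto simp: order_on_defs)
        thus "r \<union> {a} \<times> A \<in> ?M a" by blast
      qed
    qed
    hence "card (?M a) = card (?L (A - {a}))" by (rule bij_betw_same_card)
    also have "\<dots> = fact (card (A - {a}))"
      using Suc.hyps(2) Suc.prems a by (intro Suc.hyps(1)) simp_all
    also have "card (A - {a}) = n" using Suc.hyps(2) a by simp
    finally show ?thesis .
  qed
  ultimately have "card (\<Union>a\<in>A. ?M a) = card A * fact n" by simp
  with arg_cong[OF L, of card] have "card (?L A) = card A * fact n" by (rule trans)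
  moreover have "fact (card A) = card A * (fact n :: nat)"
    unfolding Suc.hyps(2)[symmetric] by (rule fact_Suc[where 'a = nat, unfolded of_nat_id])
  ultimately show ?case by (simp only: of_nat_fact)
qed

lemma card_PiE_singletons:
  assumes J: "finite J" "J \<subseteq> I" and single: "\<And>x. x \<in> I - J \<Longrightarrow> card (F x) = 1"
  shows "card (Pi\<^sub>E I F) = (\<Prod>x\<in>J. card (F x))"
proof -
  define c where "c x = the_elem (F x)" for x
  have c: "F x = {c x}" if x: "x \<in> I - J" for x
  proof -
    obtain y where "F x = {y}" using single[OF x] by (rule card_1_singletonE)
    thus ?thesis by (simp add: c_def)
  qed
  have "bij_betw (\<lambda>f. restrict f J) (Pi\<^sub>E I F) (Pi\<^sub>E J F)"
  proof (rule bij_betw_byWitness[where f' = "\<lambda>f. \<lambda>x\<in>I. if x \<in> J then f x else c x"])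
    show "\<forall>f\<in>Pi\<^sub>E I F. (\<lambda>x\<in>I. if x \<in> J then restrict f J x else c x) = f"
    proof (intro ballI ext)
      fix f x assume f: "f \<in> Pi\<^sub>E I F"
      show "(\<lambda>x\<in>I. if x \<in> J then restrict f J x else c x) x = f x"
        using PiE_arb[OF f, of x] PiE_mem[OF f, of x] c[of x] by (cases "x \<in> I") auto
    qed
    show "\<forall>f\<in>Pi\<^sub>E J F. restrict (\<lambda>x\<in>I. if x \<in> J then f x else c x) J = f"
    proof (intro ballI ext)
      fix f x assume f: "f \<in> Pi\<^sub>E J F"
      show "restrict (\<lambda>x\<in>I. if x \<in> J then f x else c x) J x = f x"
        using PiE_arb[OF f, of x] J(2) by (cases "x \<in> J") auto
    qed
    show "(\<lambda>f. restrict f J) ` Pi\<^sub>E I F \<subseteq> Pi\<^sub>E J F" using J(2) by auto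
    show "(\<lambda>f. \<lambda>x\<in>I. if x \<in> J then f x else c x) ` Pi\<^sub>E J F \<subseteq> Pi\<^sub>E I F"
      using c by auto
  qed
  thus ?thesis using card_PiE[OF J(1)] by (simp add: bij_betw_same_card)
qed

text \<open>\<open>block_orderings\<close> has a factor for every variable, but only those which
  occur in \<open>w\<close> at a position in \<open>B\<close> admit more than the empty ordering.\<close>

lemma nc_coeff_h: "nc_coeff (nc_h X) w = block_prod (count_prod (\<lambda>k. of_nat (fact k))) X w"
proof (cases "length w = psize X")
  case True
  \<comment> \<open>The cells on which there is a choice.\<close>
  let ?J = "SIGMA B:blocks X. set_mset (colors w B)"
  let ?F = "\<lambda>(i, B). {r. linear_order_on {j\<in>B. w ! (j - 1) = i} r}"
  have fin: "finite ?J" using finite_blocks by auto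
  have "card (block_orderings X w) = (\<Prod>x\<in>prod.swap ` ?J. card (?F x))"
    unfolding block_orderings_def
  proof (rule card_PiE_singletons)
    show "card (?F x) = 1" if x: "x \<in> UNIV \<times> blocks X - prod.swap ` ?J" for x
    proof -
      obtain i B where iB: "x = (i, B)" "B \<in> blocks X" "i \<notin># colors w B" using x by force
      hence "card {j\<in>B. w ! (j - 1) = i} = 0"
        unfolding count_colors[OF finite_block[OF iB(2)], symmetric] not_in_iff by simp
      moreover have "finite {j\<in>B. w ! (j - 1) = i}" using iB finite_block by simp
      ultimately show ?thesis using iB(1) card_linear_orders[of "{j\<in>B. w ! (j - 1) = i}"] by simp
    qed
  qed (use fin in auto)
  also have "\<dots> = (\<Prod>(B, i)\<in>?J. fact (count (colors w B) i))"
    by (subst prod.reindex) (auto intro!: prod.cong simp: card_linear_orders count_colors finite_block)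
  also have "\<dots> = (\<Prod>B\<in>blocks X. \<Prod>i\<in>set_mset (colors w B). fact (count (colors w B) i))"
    by (rule prod.Sigma[symmetric]) (auto simp: finite_blocks)
  finally show ?thesis using True by (simp add: nc_h.rep_eq block_prod_def count_prod_def)
qed (simp add: nc_h.rep_eq block_prod_def)

subsection \<open>Sums over refinements\<close>

lemma nc_coeff_simps [simp]:
  "nc_coeff 0 w = 0" "nc_coeff (F + G) w = nc_coeff F w + nc_coeff G w"
  "nc_coeff (nc_scale c F) w = c * nc_coeff F w"
  by (simp_all add: zero_ncsym.rep_eq plus_ncsym.rep_eq nc_scale.rep_eq)

lemma nc_coeff_sum: "nc_coeff (sum f A) w = (\<Sum>a\<in>A. nc_coeff (f a) w)"
  by (induction A rule: infinite_finite_induct) simp_all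

lemma nc_coeff_eqI: "(\<And>w. nc_coeff F w = nc_coeff G w) \<Longrightarrow> F = G"
  by (simp add: nc_coeff_inject[symmetric] fun_eq_iff)

text \<open>The \<open>Y \<le> X\<close> on whose blocks \<open>w\<close> is constant are the
  partitions refining the cells \<open>{j \<in> B. w\<^sub>j = i}\<close> for
  \<open>B \<in> X\<close>.\<close>

lemma nc_coeff_sum_p:
  fixes g :: "nat \<Rightarrow> 'k::field"
  shows "nc_coeff (\<Sum>Y\<in>{..X}. nc_scale (\<Prod>B\<in>blocks Y. g (card B)) (nc_p Y)) w
    = block_prod (count_prod (partition_weight g)) X w"
proof (cases "length w = psize X")
  case True
  let ?I = "SIGMA B:blocks X. set_mset (colors w B)"
  let ?C = "\<lambda>(B, i). {j\<in>B. w ! (j - 1) = i}"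
  have cell: "(\<exists>x\<in>?I. A \<subseteq> ?C x) \<longleftrightarrow> (\<exists>B\<in>blocks X. A \<subseteq> B) \<and> (\<forall>j\<in>A. \<forall>k\<in>A. w ! (j - 1) = w ! (k - 1))"
    if "A \<noteq> {}" for A
  proof
    assume "\<exists>x\<in>?I. A \<subseteq> ?C x"
    then obtain B i where B: "B \<in> blocks X" "A \<subseteq> {j\<in>B. w ! (j - 1) = i}" by force
    hence "\<forall>j\<in>A. w ! (j - 1) = i" by blast
    hence "\<forall>j\<in>A. \<forall>k\<in>A. w ! (j - 1) = w ! (k - 1)" by simp
    with B show "(\<exists>B\<in>blocks X. A \<subseteq> B) \<and> (\<forall>j\<in>A. \<forall>k\<in>A. w ! (j - 1) = w ! (k - 1))" by blast
  next
    assume A: "(\<exists>B\<in>blocks X. A \<subseteq> B) \<and> (\<forall>j\<in>A. \<forall>k\<in>A. w ! (j - 1) = w ! (k - 1))"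
    then obtain B where B: "B \<in> blocks X" "A \<subseteq> B" by blast
    obtain j where j: "j \<in> A" using \<open>A \<noteq> {}\<close> by blast
    have "(B, w ! (j - 1)) \<in> ?I" using B j by (auto simp: set_colors finite_block)
    moreover have "A \<subseteq> ?C (B, w ! (j - 1))" using A B j by blast
    ultimately show "\<exists>x\<in>?I. A \<subseteq> ?C x" by blast
  qed
  define con where "con Y \<longleftrightarrow> (\<forall>B\<in>blocks Y. \<forall>j\<in>B. \<forall>k\<in>B. w ! (j - 1) = w ! (k - 1))" for Y
  have p: "nc_coeff (nc_p Y) w = (if con Y then 1 else 0 :: 'k)" if Y: "Y \<le> X" for Y
  proof -
    have "nc_coeff (nc_p Y) w = (\<Prod>B\<in>blocks Y. constant_mset (colors w B) :: 'k)"
      using True le_psize[OF Y] by (simp add: nc_coeff_p block_prod_def)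
    also have "\<dots> = (\<Prod>B\<in>blocks Y. if \<forall>j\<in>B. \<forall>k\<in>B. w ! (j - 1) = w ! (k - 1) then 1 else 0)"
      by (intro prod.cong refl)
        (simp add: constant_mset_def constant_colors_iff finite_block blocks_nonempty del: One_nat_def)
    finally show ?thesis by (simp only: prod_indicator[OF finite_blocks] con_def)
  qed
  have refine: "Y \<le> X \<and> con Y \<longleftrightarrow> psize Y = psize X \<and> (\<forall>B\<in>blocks Y. \<exists>x\<in>?I. B \<subseteq> ?C x)" for Y
  proof -
    have "(\<forall>B\<in>blocks Y. \<exists>x\<in>?I. B \<subseteq> ?C x) \<longleftrightarrow>
        (\<forall>B\<in>blocks Y. (\<exists>C\<in>blocks X. B \<subseteq> C) \<and> (\<forall>j\<in>B. \<forall>k\<in>B. w ! (j - 1) = w ! (k - 1)))"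
      by (rule ball_cong[OF refl], rule cell, rule blocks_nonempty)
    thus ?thesis unfolding con_def less_eq_set_partition_def ball_conj_distrib by (simp only: conj_assoc)
  qed
  have "nc_coeff (\<Sum>Y\<in>{..X}. nc_scale (\<Prod>B\<in>blocks Y. g (card B)) (nc_p Y)) w
      = (\<Sum>Y\<in>{..X}. if con Y then \<Prod>B\<in>blocks Y. g (card B) else 0)"
    unfolding nc_coeff_sum nc_coeff_simps by (rule sum.cong[OF refl]) (simp add: p)
  also have "\<dots> = (\<Sum>Y\<in>{Y\<in>{..X}. con Y}. \<Prod>B\<in>blocks Y. g (card B))"
    by (rule sum.inter_filter[symmetric]) simp
  also have "{Y\<in>{..X}. con Y} = {Y. psize Y = psize X \<and> (\<forall>B\<in>blocks Y. \<exists>x\<in>?I. B \<subseteq> ?C x)}"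
    unfolding atMost_iff refine ..
  also have "(\<Sum>Y | psize Y = psize X \<and> (\<forall>B\<in>blocks Y. \<exists>x\<in>?I. B \<subseteq> ?C x). \<Prod>B\<in>blocks Y. g (card B))
      = (\<Prod>x\<in>?I. partition_weight g (card (?C x)))"
  proof (rule sum_set_partitions_refining)
    show "finite ?I" using finite_blocks by auto
    show "disjoint_family_on ?C ?I"
      unfolding disjoint_family_on_def
    proof (intro ballI impI)
      fix x y assume xy: "x \<in> ?I" "y \<in> ?I" "x \<noteq> y"
      obtain B i where x: "x = (B, i)" by (cases x)
      obtain B' i' where y: "y = (B', i')" by (cases y)
      show "?C x \<inter> ?C y = {}"
      proof (rule ccontr)
        assume "?C x \<inter> ?C y \<noteq> {}"
        then obtain j where "j \<in> B" "j \<in> B'" "i = i'" unfolding x y by blast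
        thus False using blocks_disjoint[of B X B' j] xy x y by blast
      qed
    qed
    show "(\<Union>x\<in>?I. ?C x) = {1..psize X}"
      unfolding Union_blocks[symmetric]
    proof (intro equalityI subsetI)
      fix j assume "j \<in> \<Union>(blocks X)"
      then obtain B where B: "B \<in> blocks X" "j \<in> B" by blast
      hence "(B, w ! (j - 1)) \<in> ?I" by (simp add: set_colors finite_block)
      moreover have "j \<in> ?C (B, w ! (j - 1))" using B by simp
      ultimately show "j \<in> (\<Union>x\<in>?I. ?C x)" by (rule UN_I)
    qed auto
  qed
  also have "\<dots> = (\<Prod>B\<in>blocks X. \<Prod>i\<in>set_mset (colors w B). partition_weight g (count (colors w B) i))"
    by (subst prod.Sigma, simp_all add: finite_blocks)
      (rule prod.cong[OF refl], auto simp: count_colors finite_block)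
  finally show ?thesis using True by (simp add: block_prod_def count_prod_def)
next
  case False
  thus ?thesis
    by (auto simp: nc_coeff_sum nc_coeff_p block_prod_def dest: le_psize intro!: sum.neutral)
qed

lemma block_prod_cong:
  "(\<And>N. \<psi> N = \<psi>' N) \<Longrightarrow> block_prod \<psi> X w = block_prod \<psi>' X w"
  by (simp add: block_prod_def)

text \<open>For the weights of \<open>\<mu>\<close> a cell with more than one element contributes
  \<open>0\<close>, so that letters within a block have to be distinct.\<close>

lemma nc_e_eq_sum_p:
  "(\<Sum>Y\<in>{..X}. nc_scale (of_int (moebius0 Y)) (nc_p Y)) = (nc_e X :: 'k::field_char_0 ncsym)"
proof (rule nc_coeff_eqI)
  fix w
  let ?g = "\<lambda>k. (- 1) ^ (k - 1) * fact (k - 1) :: 'k"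
  have "(\<Sum>Y\<in>{..X}. nc_scale (of_int (moebius0 Y)) (nc_p Y))
    = (\<Sum>Y\<in>{..X}. nc_scale (\<Prod>B\<in>blocks Y. ?g (card B)) (nc_p Y :: 'k ncsym))"
    by (simp add: moebius0_eq)
  also have "nc_coeff \<dots> w = block_prod (count_prod (partition_weight ?g)) X w" by (rule nc_coeff_sum_p)
  also have "\<dots> = block_prod distinct_mset X w"
  proof (rule block_prod_cong)
    show "count_prod (partition_weight ?g) N = distinct_mset N" for N
      unfolding count_prod_def distinct_mset_def partition_weight_cyclic prod_one_minus
      by (auto simp: prod_indicator) (metis count_inI le0)
  qed
  finally show "nc_coeff (\<Sum>Y\<in>{..X}. nc_scale (of_int (moebius0 Y)) (nc_p Y)) w
      = nc_coeff (nc_e X :: 'k ncsym) w"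
    by (simp add: nc_coeff_e)
qed

text \<open>For the weights of \<open>|\<mu>|\<close> a cell contributes the number of its linear orders.\<close>

lemma nc_h_eq_sum_p:
  "(\<Sum>Y\<in>{..X}. nc_scale (of_int \<bar>moebius0 Y\<bar>) (nc_p Y)) = (nc_h X :: 'k::field_char_0 ncsym)"
proof (rule nc_coeff_eqI)
  fix w
  let ?g = "\<lambda>k. 1 ^ (k - 1) * fact (k - 1) :: 'k"
  have "(\<Sum>Y\<in>{..X}. nc_scale (of_int \<bar>moebius0 Y\<bar>) (nc_p Y))
    = (\<Sum>Y\<in>{..X}. nc_scale (\<Prod>B\<in>blocks Y. ?g (card B)) (nc_p Y :: 'k ncsym))"
    unfolding abs_moebius0_eq by simp
  also have "nc_coeff \<dots> w = block_prod (count_prod (partition_weight ?g)) X w" by (rule nc_coeff_sum_p)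
  also have "\<dots> = block_prod (count_prod (\<lambda>k. of_nat (fact k))) X w"
    unfolding partition_weight_cyclic prod_one_plus ..
  finally show "nc_coeff (\<Sum>Y\<in>{..X}. nc_scale (of_int \<bar>moebius0 Y\<bar>) (nc_p Y)) w
      = nc_coeff (nc_h X :: 'k ncsym) w"
    by (simp add: nc_coeff_h)
qed

section \<open>Kernels of words\<close>

lemma same_block_range: "same_block X j k \<Longrightarrow> j \<in> {1..psize X} \<and> k \<in> {1..psize X}"
  unfolding same_block_def using blocks_subset by blast

lemma same_block_refl: "j \<in> {1..psize X} \<Longrightarrow> same_block X j j"
  unfolding same_block_def using ex_block by blast

lemma le_iff_same_block:
  "X \<le> Y \<longleftrightarrow> psize X = psize Y \<and> (\<forall>j k. same_block X j k \<longrightarrow> same_block Y j k)"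
proof
  assume "X \<le> Y"
  thus "psize X = psize Y \<and> (\<forall>j k. same_block X j k \<longrightarrow> same_block Y j k)"
    unfolding less_eq_set_partition_def same_block_def by blast
next
  assume *: "psize X = psize Y \<and> (\<forall>j k. same_block X j k \<longrightarrow> same_block Y j k)"
  have "\<exists>C\<in>blocks Y. B \<subseteq> C" if B: "B \<in> blocks X" for B
  proof -
    obtain j where j: "j \<in> B" using blocks_nonempty[OF B] by blast
    hence sY: "same_block Y j k" if "k \<in> B" for k using * B that unfolding same_block_def by blast
    obtain C where C: "C \<in> blocks Y" "j \<in> C" using sY[OF j] unfolding same_block_def by blast
    have "k \<in> C" if "k \<in> B" for k
      using sY[OF that] C blocks_disjoint[of _ Y C j] unfolding same_block_def by blast
    with C show ?thesis by blast
  qed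
  with * show "X \<le> Y" by (simp add: less_eq_set_partition_def)
qed

text \<open>Set partitions are compared through the equivalence relations which they induce.\<close>

lemma set_partition_eqI:
  assumes "psize X = psize Y" "\<And>j k. same_block X j k \<longleftrightarrow> same_block Y j k"
  shows "X = Y"
  by (rule antisym) (use assms in \<open>simp_all add: le_iff_same_block\<close>)

definition kernel :: "nat list \<Rightarrow> set_partition" where
  "kernel w = Abs_set_partition ((\<lambda>i. {j\<in>{1..length w}. w ! (j - 1) = i}) ` set w)"

lemma nth_pred_in_set: "j \<in> {1..length w} \<Longrightarrow> w ! (j - 1) \<in> set w"
  by (rule nth_mem) auto

lemma partition_on_kernel:
  "partition_on {1..length w} ((\<lambda>i. {j\<in>{1..length w}. w ! (j - 1) = i}) ` set w)"
proof (rule partition_onI)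
  show "\<Union>((\<lambda>i. {j\<in>{1..length w}. w ! (j - 1) = i}) ` set w) = {1..length w}"
    using nth_pred_in_set by blast
  have "p \<noteq> {}" if p: "p \<in> (\<lambda>i. {j\<in>{1..length w}. w ! (j - 1) = i}) ` set w" for p
  proof -
    obtain i where i: "i \<in> set w" "p = {j\<in>{1..length w}. w ! (j - 1) = i}" using p by blast
    obtain k where "k < length w" "w ! k = i" using i(1) by (auto simp: in_set_conv_nth)
    hence "Suc k \<in> p" unfolding i(2) by simp
    thus ?thesis by blast
  qed
  thus "{} \<notin> (\<lambda>i. {j\<in>{1..length w}. w ! (j - 1) = i}) ` set w" by blast
  show "disjnt p q" if "p \<in> (\<lambda>i. {j\<in>{1..length w}. w ! (j - 1) = i}) ` set w"
    "q \<in> (\<lambda>i. {j\<in>{1..length w}. w ! (j - 1) = i}) ` set w" "p \<noteq> q" for p q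
    using that by (auto simp: disjnt_def)
qed

lemma blocks_kernel: "blocks (kernel w) = (\<lambda>i. {j\<in>{1..length w}. w ! (j - 1) = i}) ` set w"
  unfolding kernel_def by (rule Abs_set_partition_inverse) (use partition_on_kernel in blast)

lemma psize_kernel [simp]: "psize (kernel w) = length w"
  by (rule psizeI) (unfold blocks_kernel, rule partition_on_kernel)

lemma same_block_kernel:
  "same_block (kernel w) j k \<longleftrightarrow> j \<in> {1..length w} \<and> k \<in> {1..length w} \<and> w ! (j - 1) = w ! (k - 1)"
  unfolding same_block_def blocks_kernel using nth_pred_in_set[of k w]
  by (auto simp del: One_nat_def)

lemma nc_coeff_m: "nc_coeff (nc_m X) w = (if X = kernel w then 1 else 0)"
proof -
  have "(length w = psize X \<and> (\<forall>j\<in>{1..psize X}. \<forall>k\<in>{1..psize X}.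
      w ! (j - 1) = w ! (k - 1) \<longleftrightarrow> same_block X j k)) \<longleftrightarrow> X = kernel w"
  proof
    assume *: "length w = psize X \<and> (\<forall>j\<in>{1..psize X}. \<forall>k\<in>{1..psize X}.
      w ! (j - 1) = w ! (k - 1) \<longleftrightarrow> same_block X j k)"
    show "X = kernel w"
    proof (rule set_partition_eqI)
      show "psize X = psize (kernel w)" using * by (simp only: psize_kernel)
      fix j k
      have "length w = psize X" using * by blast
      thus "same_block X j k \<longleftrightarrow> same_block (kernel w) j k"
        unfolding same_block_kernel using * same_block_range[of X j k] by metis
    qed
  qed (use same_block_kernel in auto)
  thus ?thesis unfolding nc_m.rep_eq by (simp only:)
qed

lemma nc_coeff_p_kernel: "nc_coeff (nc_p X) w = (if X \<le> kernel w then 1 else 0)"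
proof -
  have "(length w = psize X \<and> (\<forall>j\<in>{1..psize X}. \<forall>k\<in>{1..psize X}.
      same_block X j k \<longrightarrow> w ! (j - 1) = w ! (k - 1))) \<longleftrightarrow> X \<le> kernel w"
    unfolding le_iff_same_block same_block_kernel psize_kernel using same_block_range[of X] by metis
  thus ?thesis unfolding nc_p.rep_eq by (simp only:)
qed

lemma nc_p_eq_sum_m: "(nc_p X :: 'k::field ncsym) = (\<Sum>Y\<in>{X..}. nc_m Y)"
  by (rule nc_coeff_eqI) (simp add: nc_coeff_sum nc_coeff_m nc_coeff_p_kernel)

definition canonical_word :: "set_partition \<Rightarrow> nat list" where
  "canonical_word X = map (\<lambda>j. Min {k. same_block X j k}) [1..<Suc (psize X)]"

text \<open>Labelling each block by its least element gives every set partition as a kernel.\<close>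

lemma kernel_canonical_word: "kernel (canonical_word X) = X"
proof (rule set_partition_eqI)
  have len: "length (canonical_word X) = psize X" by (simp add: canonical_word_def)
  thus "psize (kernel (canonical_word X)) = psize X" by simp
  have nth: "canonical_word X ! (j - 1) = Min {k. same_block X j k}" if "j \<in> {1..psize X}" for j
    using that by (auto simp: canonical_word_def nth_append less_Suc_eq_le simp del: upt_Suc)
  have fin: "finite {k. same_block X j k}" for j
    by (rule finite_subset[of _ "{1..psize X}"]) (use same_block_range in auto)
  have cong: "same_block X j k \<Longrightarrow> same_block X j l \<longleftrightarrow> same_block X k l" for j k l
    unfolding same_block_def using blocks_disjoint by metis
  have sym: "same_block X j k \<longleftrightarrow> same_block X k j" for j k unfolding same_block_def by blast
  fix j k
  show "same_block (kernel (canonical_word X)) j k \<longleftrightarrow> same_block X j k"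
  proof
    assume "same_block (kernel (canonical_word X)) j k"
    hence jk: "j \<in> {1..psize X}" "k \<in> {1..psize X}" and
      eq: "Min {l. same_block X j l} = Min {l. same_block X k l}"
      by (auto simp: same_block_kernel len nth simp del: One_nat_def)
    have "same_block X j (Min {l. same_block X j l})" "same_block X k (Min {l. same_block X k l})"
      using Min_in[OF fin[of j]] Min_in[OF fin[of k]] same_block_refl jk by blast+
    thus "same_block X j k" using eq cong sym by metis
  next
    assume s: "same_block X j k"
    hence "{l. same_block X j l} = {l. same_block X k l}" using cong by blast
    thus "same_block (kernel (canonical_word X)) j k"
      using same_block_range[OF s] by (simp only: same_block_kernel len nth simp_thms)
  qed
qed

lemma extend_to_permutation:
  assumes U: "finite U" and AB: "A \<subseteq> U" "B \<subseteq> U" and h: "bij_betw h A B"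
  obtains \<sigma> where "\<sigma> permutes U" "\<And>x. x \<in> A \<Longrightarrow> \<sigma> x = h x"
proof -
  have fin: "finite A" "finite B" using U AB finite_subset by blast+
  have "card (U - A) = card (U - B)"
    using bij_betw_same_card[OF h] AB fin by (simp add: card_Diff_subset)
  then obtain g where g: "bij_betw g (U - A) (U - B)"
    using finite_same_card_bij[of "U - A" "U - B"] U by blast
  define \<sigma> where "\<sigma> x = (if x \<in> A then h x else if x \<in> U then g x else x)" for x
  have "bij_betw \<sigma> A B" using h by (rule bij_betw_cong[THEN iffD1, rotated]) (simp add: \<sigma>_def)
  moreover have "bij_betw \<sigma> (U - A) (U - B)"
    using g by (rule bij_betw_cong[THEN iffD1, rotated]) (simp add: \<sigma>_def)
  ultimately have "bij_betw \<sigma> (A \<union> (U - A)) (B \<union> (U - B))" by (rule bij_betw_combine) blast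
  moreover have "A \<union> (U - A) = U" "B \<union> (U - B) = U" using AB by blast+
  ultimately have "bij_betw \<sigma> U U" by simp
  moreover have "\<sigma> x = x" if "x \<notin> U" for x using that AB by (auto simp: \<sigma>_def)
  ultimately have "\<sigma> permutes U" by (rule bij_imp_permutes)
  moreover have "\<sigma> x = h x" if "x \<in> A" for x using that by (simp add: \<sigma>_def)
  ultimately show thesis using that by blast
qed

text \<open>Words with the same kernel differ by an injective renaming of the letters, which extends
  to a permutation of an initial segment of the variables.\<close>

lemma nc_coeff_kernel_eq:
  assumes "kernel w = kernel w'"
  shows "nc_coeff F w = nc_coeff F w'"
proof -
  have len: "length w = length w'" using arg_cong[OF assms, of psize] by simp
  have eq: "w ! i = w ! j \<longleftrightarrow> w' ! i = w' ! j" if "i < length w" "j < length w" for i j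
    using same_block_kernel[of w "Suc i" "Suc j"] same_block_kernel[of w' "Suc i" "Suc j"] that assms len
    by simp
  define h where "h x = w' ! (SOME i. i < length w \<and> w ! i = x)" for x
  have h: "h (w ! i) = w' ! i" if i: "i < length w" for i
  proof -
    have "(SOME j. j < length w \<and> w ! j = w ! i) < length w \<and> w ! (SOME j. j < length w \<and> w ! j = w ! i)
        = w ! i"
      by (rule someI[of "\<lambda>j. j < length w \<and> w ! j = w ! i" i]) (use i in simp)
    thus ?thesis unfolding h_def using eq i by blast
  qed
  have map: "map h w = w'" by (rule nth_equalityI) (simp_all add: len h)
  have "bij_betw h (set w) (set w')"
  proof (rule bij_betw_imageI)
    show "inj_on h (set w)"
    proof (rule inj_onI)
      fix x y assume xy: "x \<in> set w" "y \<in> set w" "h x = h y"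
      obtain i where i: "i < length w" "x = w ! i" using xy(1) by (metis in_set_conv_nth)
      obtain j where j: "j < length w" "y = w ! j" using xy(2) by (metis in_set_conv_nth)
      have "w' ! i = w' ! j" using xy(3) unfolding i(2) j(2) h[OF i(1)] h[OF j(1)] .
      thus "x = y" unfolding i(2) j(2) using eq[OF i(1) j(1)] by blast
    qed
    show "h ` set w = set w'" unfolding map[symmetric] by simp
  qed
  moreover obtain n where n: "set w \<subseteq> {..<n}" "set w' \<subseteq> {..<n}"
    using finite_nat_set_iff_bounded[of "set w \<union> set w'"] by auto
  ultimately obtain \<sigma> where s: "\<sigma> permutes {..<n}" "\<And>x. x \<in> set w \<Longrightarrow> \<sigma> x = h x"
    using extend_to_permutation[of "{..<n}" "set w" "set w'" h] by auto
  have "map \<sigma> w = w'" unfolding map[symmetric] by (rule map_cong) (simp_all add: s(2))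
  moreover have "nc_coeff F (map \<sigma> w) = nc_coeff F w" using nc_coeff[of F] s(1) by blast
  ultimately show ?thesis by simp
qed

lemma nc_coeff_bounded: "\<exists>d. \<forall>w. d < length w \<longrightarrow> nc_coeff F w = 0"
  using nc_coeff[of F] by blast

lemma ncsym_expansion:
  assumes "\<forall>w. d < length w \<longrightarrow> nc_coeff F w = 0"
  shows "F = (\<Sum>X | psize X \<le> d. nc_scale (nc_coeff F (canonical_word X)) (nc_m X))"
proof (rule nc_coeff_eqI)
  fix w
  have fin: "finite {X. psize X \<le> d}"
    by (rule finite_subset[of _ "\<Union>n\<le>d. {X. psize X = n}"]) (use finite_psize in auto)
  have "nc_coeff (\<Sum>X | psize X \<le> d. nc_scale (nc_coeff F (canonical_word X)) (nc_m X)) w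
    = (\<Sum>X | psize X \<le> d. if X = kernel w then nc_coeff F (canonical_word X) else 0)"
    unfolding nc_coeff_sum by (rule sum.cong[OF refl]) (simp add: nc_coeff_m)
  also have "\<dots> = (if length w \<le> d then nc_coeff F (canonical_word (kernel w)) else 0)"
    using fin by simp
  also have "\<dots> = nc_coeff F w"
    using assms nc_coeff_kernel_eq[of "canonical_word (kernel w)" w F, OF kernel_canonical_word] by auto
  finally show "nc_coeff F w = nc_coeff (\<Sum>X | psize X \<le> d. nc_scale (nc_coeff F (canonical_word X))
      (nc_m X)) w" ..
qed

section \<open>The isomorphism onto symmetric functions in noncommuting variables\<close>

lemma vector_space_nc_scale: "vector_space (nc_scale :: 'k::field \<Rightarrow> _)"
  unfolding vector_space_def by (auto intro!: nc_coeff_eqI simp: algebra_simps)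

lemma vector_space_times: "vector_space ((*) :: 'k::field \<Rightarrow> 'k \<Rightarrow> 'k)"
  unfolding vector_space_def by (simp add: algebra_simps)

lemma linear_nc_coeff: "lin nc_scale (*) (\<lambda>F. nc_coeff F w)"
  by (rule linearI[OF vector_space_nc_scale vector_space_times]) simp_all

text \<open>As \<open>X = (\<Sum>Y \<le> X. p\<^sub>Y)\<close> in \<open>\<^bold>\<Pi>\<close>, this
  has to be the image of \<open>X\<close>. In its coefficients the contribution of a block is a
  product of Bell numbers.\<close>

definition refinement_sum :: "set_partition \<Rightarrow> 'k::field ncsym" where
  "refinement_sum X = (\<Sum>Y\<in>{..X}. nc_p Y)"

definition bell_prod :: "nat multiset \<Rightarrow> 'k::comm_ring_1" where
  "bell_prod = count_prod (partition_weight (\<lambda>_. 1))"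

lemma nc_coeff_refinement_sum: "nc_coeff (refinement_sum X) w = block_prod bell_prod X w"
  using nc_coeff_sum_p[of "\<lambda>_. 1" X w]
  by (simp add: refinement_sum_def bell_prod_def vector_spaceD[OF vector_space_nc_scale])

definition to_ncsym :: "'k::field kpi \<Rightarrow> 'k ncsym" where
  "to_ncsym = lin_ext nc_scale refinement_sum"

lemma linear_to_ncsym: "lin fscale nc_scale to_ncsym"
  unfolding to_ncsym_def by (rule linear_lin_ext[OF vector_space_nc_scale])

lemma to_ncsym_single: "to_ncsym (sgl X 1) = refinement_sum X"
  by (simp add: to_ncsym_def lin_ext_single_1 vector_space_nc_scale)

subsection \<open>Images of the bases\<close>

text \<open>All four forms of Moebius inversion exchange the order of summation and then use one of
  the two identities for \<open>\<mu>\<close>, which enters as \<open>delta\<close>.\<close>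

lemma sum_swap_delta:
  assumes "vector_space s" "finite A" "\<And>Y. Y \<in> A \<Longrightarrow> finite (B Y)" "finite D" "X \<in> D"
    and swap: "\<And>Y Z. Y \<in> A \<and> Z \<in> B Y \<longleftrightarrow> Z \<in> D \<and> Y \<in> C Z"
    and delta: "\<And>Z. Z \<in> D \<Longrightarrow> (\<Sum>Y\<in>C Z. c Y Z) = (if Z = X then 1 else 0 :: int)"
  shows "(\<Sum>Y\<in>A. \<Sum>Z\<in>B Y. s (of_int (c Y Z)) (a Z)) = a X"
proof -
  interpret vector_space s by fact
  have sw: "Y \<in> A \<Longrightarrow> Z \<in> B Y \<Longrightarrow> Z \<in> D" "Y \<in> A \<Longrightarrow> Z \<in> B Y \<Longrightarrow> Y \<in> C Z"
    "Z \<in> D \<Longrightarrow> Y \<in> C Z \<Longrightarrow> Y \<in> A" "Z \<in> D \<Longrightarrow> Y \<in> C Z \<Longrightarrow> Z \<in> B Y" for Y Z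
    using swap[of Y Z] by blast+
  have finC: "finite (C Z)" if "Z \<in> D" for Z
    by (rule finite_subset[OF _ assms(2)]) (use swap that in blast)
  have "(\<Sum>Y\<in>A. \<Sum>Z\<in>B Y. s (of_int (c Y Z)) (a Z)) = (\<Sum>(Y, Z)\<in>Sigma A B. s (of_int (c Y Z)) (a Z))"
    using assms by (simp add: sum.Sigma)
  also have "\<dots> = (\<Sum>(Z, Y)\<in>Sigma D C. s (of_int (c Y Z)) (a Z))"
    by (rule sum.reindex_bij_witness[where i = prod.swap and j = prod.swap]) (auto intro: sw)
  also have "\<dots> = (\<Sum>Z\<in>D. \<Sum>Y\<in>C Z. s (of_int (c Y Z)) (a Z))"
    using assms finC by (simp add: sum.Sigma)
  also have "\<dots> = (\<Sum>Z\<in>D. s (of_int (\<Sum>Y\<in>C Z. c Y Z)) (a Z))"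
    by (simp add: scale_sum_left)
  also have "\<dots> = (\<Sum>Z\<in>D. if Z = X then a Z else 0)"
    by (rule sum.cong[OF refl]) (simp add: delta)
  finally show ?thesis using assms by simp
qed

lemma moebius_inversion:
  fixes a :: "set_partition \<Rightarrow> 'v::ab_group_add"
  assumes s: "vector_space (s :: 'k::field \<Rightarrow> _)"
  shows "(\<Sum>Y\<in>{..X}. \<Sum>Z\<in>{..Y}. s (of_int (moebius Y X)) (a Z)) = a X"
    and "(\<Sum>Y\<in>{..X}. \<Sum>Z\<in>{..Y}. s (of_int (moebius Z Y)) (a Z)) = a X"
    and "(\<Sum>Y\<in>{X..}. \<Sum>Z\<in>{Y..}. s (of_int (moebius X Y)) (a Z)) = a X"
    and "(\<Sum>Y\<in>{X..}. \<Sum>Z\<in>{Y..}. s (of_int (moebius Y Z)) (a Z)) = a X"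
proof -
  note d = sum_swap_delta[OF s]
  show "(\<Sum>Y\<in>{..X}. \<Sum>Z\<in>{..Y}. s (of_int (moebius Y X)) (a Z)) = a X"
    by (rule d[where D = "{..X}" and C = "\<lambda>Z. {Z..X}"]) (auto simp: sum_moebius_lower)
  show "(\<Sum>Y\<in>{..X}. \<Sum>Z\<in>{..Y}. s (of_int (moebius Z Y)) (a Z)) = a X"
    by (rule d[where D = "{..X}" and C = "\<lambda>Z. {Z..X}"]) (auto simp: sum_moebius_upper)
  show "(\<Sum>Y\<in>{X..}. \<Sum>Z\<in>{Y..}. s (of_int (moebius X Y)) (a Z)) = a X"
    by (rule d[where D = "{X..}" and C = "\<lambda>Z. {X..Z}"]) (auto simp: sum_moebius_upper)
  show "(\<Sum>Y\<in>{X..}. \<Sum>Z\<in>{Y..}. s (of_int (moebius Y Z)) (a Z)) = a X"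
    by (rule d[where D = "{X..}" and C = "\<lambda>Z. {X..Z}"]) (auto simp: sum_moebius_lower)
qed

lemma to_ncsym_p: "to_ncsym (kpi_p X) = nc_p X"
  using moebius_inversion(1)[OF vector_space_nc_scale, of X nc_p]
  by (simp add: kpi_p_def linearD[OF linear_to_ncsym] to_ncsym_single refinement_sum_def
      vector_spaceD[OF vector_space_nc_scale] del: fscale_single)

lemma to_ncsym_m: "to_ncsym (kpi_m X) = nc_m X"
  using moebius_inversion(3)[OF vector_space_nc_scale, of X nc_m]
  by (simp add: kpi_m_def linearD[OF linear_to_ncsym] to_ncsym_p nc_p_eq_sum_m
      vector_spaceD[OF vector_space_nc_scale])

lemma to_ncsym_e: "to_ncsym (kpi_e X) = (nc_e X :: 'k::field_char_0 ncsym)"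
  by (simp add: kpi_e_def linearD[OF linear_to_ncsym] to_ncsym_p nc_e_eq_sum_p)

lemma to_ncsym_h: "to_ncsym (kpi_h X) = (nc_h X :: 'k::field_char_0 ncsym)"
  by (simp add: kpi_h_def linearD[OF linear_to_ncsym] to_ncsym_p nc_h_eq_sum_p)

subsection \<open>Bijectivity\<close>

lemma single_eq_sum_p: "sgl X (1 :: 'k::field) = (\<Sum>Y\<in>{..X}. kpi_p Y)"
  unfolding kpi_p_def by (rule moebius_inversion(2)[OF vector_space_fscale, symmetric])

lemma kpi_p_eq_sum_m: "(kpi_p X :: 'k::field kpi) = (\<Sum>Y\<in>{X..}. kpi_m Y)"
  unfolding kpi_m_def by (rule moebius_inversion(4)[OF vector_space_fscale, symmetric])

lemma kpi_m_spans: "\<exists>y. x = lin_ext fscale kpi_m (y :: 'k::field kpi)"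
proof -
  \<comment> \<open>The coordinates with respect to the \<open>m\<close>'s of a set partition \<open>X\<close>, extended linearly.\<close>
  let ?U = "lin_ext fscale (\<lambda>X. \<Sum>Y\<in>{..X}. \<Sum>Z\<in>{Y..}. sgl Z (1 :: 'k))"
  let ?V = "lin_ext fscale (kpi_m :: _ \<Rightarrow> 'k kpi)"
  have V: "lin fscale fscale ?V" by (rule linear_lin_ext[OF vector_space_fscale])
  have "?V (?U x) = x"
  proof (rule linear_eq_on_basis[where f = "\<lambda>x. ?V (?U x)" and g = "\<lambda>x. x"])
    show "lin fscale fscale (\<lambda>x. ?V (?U x))"
      by (rule linear_comp[OF linear_lin_ext[OF vector_space_fscale] V])
    show "lin fscale fscale (\<lambda>x :: 'k kpi. x)" by (rule linear_id[OF vector_space_fscale])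
    show "?V (?U (sgl X 1)) = sgl X 1" for X
    proof -
      have "?V (?U (sgl X 1)) = (\<Sum>Y\<in>{..X}. \<Sum>Z\<in>{Y..}. kpi_m Z)"
        by (simp only: lin_ext_single_1[OF vector_space_fscale] linearD(7)[OF V])
      also have "\<dots> = sgl X 1" unfolding single_eq_sum_p[of X] kpi_p_eq_sum_m ..
      finally show ?thesis .
    qed
  qed
  thus ?thesis by metis
qed

text \<open>The image of \<open>(\<Sum>X. y\<^sub>X m\<^sub>X)\<close> has coefficient \<open>y\<^sub>X\<close> at each word with kernel \<open>X\<close>.\<close>

lemma inj_to_ncsym: "to_ncsym x = 0 \<Longrightarrow> x = 0"
proof -
  assume x: "to_ncsym x = 0"
  obtain y where y: "x = lin_ext fscale kpi_m y" using kpi_m_spans by blast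
  have "to_ncsym x = lin_ext nc_scale nc_m y"
    unfolding y lin_ext_comp[OF linear_to_ncsym] to_ncsym_m ..
  hence "nc_coeff (lin_ext nc_scale nc_m y) (canonical_word X) = 0" for X using x by simp
  hence "lin_ext (*) (\<lambda>Z. nc_coeff (nc_m Z) (canonical_word X)) y = 0" for X
    unfolding lin_ext_comp[OF linear_nc_coeff] .
  moreover have "lin_ext (*) (\<lambda>Z. nc_coeff (nc_m Z) (canonical_word X)) y = coef y X" for X
    by (simp add: nc_coeff_m kernel_canonical_word lin_ext_def in_keys_iff if_distrib cong: if_cong)
  ultimately have "y = 0" by (intro poly_mapping_eqI) simp
  thus "x = 0" by (simp add: y lin_ext_def)
qed

lemma bij_to_ncsym: "bij (to_ncsym :: 'k::field kpi \<Rightarrow> 'k ncsym)"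
proof (rule bijI)
  show "inj (to_ncsym :: 'k kpi \<Rightarrow> _)"
  proof (rule injI)
    fix x y :: "'k kpi" assume "to_ncsym x = to_ncsym y"
    hence "to_ncsym (x - y) = 0" by (simp add: linearD[OF linear_to_ncsym])
    thus "x = y" using inj_to_ncsym by fastforce
  qed
  show "surj (to_ncsym :: 'k kpi \<Rightarrow> _)"
  proof (rule surjI)
    fix F :: "'k ncsym"
    obtain d where d: "\<forall>w. d < length w \<longrightarrow> nc_coeff F w = 0" using nc_coeff_bounded by blast
    define x where "x = (\<Sum>X | psize X \<le> d. fscale (nc_coeff F (canonical_word X)) (kpi_m X))"
    have "to_ncsym x = F"
      by (subst ncsym_expansion[OF d]) (simp add: x_def linearD[OF linear_to_ncsym] to_ncsym_m)
    thus "to_ncsym (inv to_ncsym F) = F" by (metis f_inv_into_f rangeI)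
  qed
qed

subsection \<open>Product, counit and grading\<close>

text \<open>The blocks of \<open>X + Y\<close> lie entirely in one of the two factors of the word.\<close>

lemma block_prod_append:
  assumes u: "length u = psize X" and v: "length v = psize Y"
  shows "block_prod \<psi> (X + Y) (u @ v) = block_prod \<psi> X u * block_prod \<psi> Y v"
proof -
  let ?s = "(+) (psize X)"
  have 1: "colors (u @ v) B = colors u B" if B: "B \<in> blocks X" for B
  proof (rule colors_cong)
    fix j assume "j \<in> B"
    hence "j \<in> {1..psize X}" using blocks_subset[OF B] by blast
    thus "(u @ v) ! (j - 1) = u ! (j - 1)" using u by (auto simp: nth_append)
  qed
  have 2: "colors (u @ v) (?s ` B) = colors v B" if B: "B \<in> blocks Y" for B
  proof -
    have shift: "mset_set (?s ` B) = image_mset ?s (mset_set B)"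
      by (rule image_mset_mset_set[symmetric]) simp
    have "(u @ v) ! (psize X + j - 1) = v ! (j - 1)" if "j \<in># mset_set B" for j
    proof -
      have "j \<in> {1..psize Y}" using that blocks_subset[OF B] finite_block[OF B] by auto
      thus ?thesis using u by (auto simp: nth_append)
    qed
    thus ?thesis unfolding colors_def shift multiset.map_comp o_def by (rule image_mset_cong)
  qed
  have disj: "blocks X \<inter> (`) ?s ` blocks Y = {}"
  proof -
    have "\<not> ?s ` B \<subseteq> {1..psize X}" if B: "B \<in> blocks Y" for B
    proof -
      obtain j where j: "j \<in> B" using blocks_nonempty[OF B] by blast
      hence "j \<ge> 1" using blocks_subset[OF B] by auto
      thus ?thesis using j by force
    qed
    thus ?thesis using blocks_subset by blast
  qed
  have inj: "inj_on ((`) ?s) (blocks Y)" by (rule inj_onI) (simp add: inj_image_eq_iff)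
  have "(\<Prod>B\<in>blocks (X + Y). \<psi> (colors (u @ v) B))
    = (\<Prod>B\<in>blocks X. \<psi> (colors (u @ v) B)) * (\<Prod>B\<in>(`) ?s ` blocks Y. \<psi> (colors (u @ v) B))"
    unfolding blocks_plus by (rule prod.union_disjoint[OF _ _ disj]) (simp_all add: finite_blocks)
  also have "\<dots> = (\<Prod>B\<in>blocks X. \<psi> (colors u B)) * (\<Prod>B\<in>blocks Y. \<psi> (colors v B))"
    unfolding prod.reindex[OF inj] o_def
    by (rule arg_cong2[where f = "(*)"]; rule prod.cong[OF refl]) (simp_all add: 1 2)
  finally show ?thesis using u v by (simp add: block_prod_def)
qed

lemma nc_coeff_mult:
  "nc_coeff (F * G) w = (\<Sum>k\<le>length w. nc_coeff F (take k w) * nc_coeff G (drop k w))"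
  unfolding times_ncsym.rep_eq
  by (rule sum.reindex_bij_witness[where i = "\<lambda>k. (take k w, drop k w)" and j = "\<lambda>(u, v). length u"]) auto

lemma block_prod_series_mult:
  assumes F: "\<And>X w. nc_coeff (F X) w = block_prod \<psi> X w"
  shows "F (X + Y) = F X * F Y"
proof (rule nc_coeff_eqI)
  fix w
  have "nc_coeff (F X * F Y) w
    = (\<Sum>k\<le>length w. if k = psize X then block_prod \<psi> X (take k w) * block_prod \<psi> Y (drop k w) else 0)"
    unfolding nc_coeff_mult F by (rule sum.cong[OF refl]) (simp add: block_prod_def)
  also have "\<dots> = (if psize X \<le> length w then block_prod \<psi> X (take (psize X) w) * block_prod \<psi> Y (drop
      (psize X) w) else 0)"
    by simp
  also have "\<dots> = block_prod \<psi> (X + Y) w"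
  proof (cases "length w = psize X + psize Y")
    case True
    thus ?thesis using block_prod_append[of "take (psize X) w" X "drop (psize X) w" Y \<psi>] by simp
  qed (auto simp: block_prod_def)
  finally show "nc_coeff (F (X + Y)) w = nc_coeff (F X * F Y) w" by (simp add: F)
qed

lemma psize_eq_0_iff: "psize X = 0 \<longleftrightarrow> X = 0"
proof
  assume "psize X = 0"
  hence "blocks X = {}" using blocks_subset[of _ X] blocks_nonempty[of _ X] by fastforce
  thus "X = 0" by (simp add: blocks_inject[symmetric])
qed simp

lemma to_ncsym_one: "to_ncsym (1 :: 'k::field kpi) = 1"
proof (rule nc_coeff_eqI)
  fix w
  have "to_ncsym (1 :: 'k kpi) = refinement_sum 0" unfolding single_one[symmetric] to_ncsym_single ..
  thus "nc_coeff (to_ncsym (1 :: 'k kpi)) w = nc_coeff 1 w"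
    by (simp add: nc_coeff_refinement_sum block_prod_def one_ncsym.rep_eq)
qed

lemma nc_scale_mult: "nc_scale c (F * G) = nc_scale c F * G" "nc_scale c (F * G) = F * nc_scale c G"
  by (rule nc_coeff_eqI; simp add: nc_coeff_mult sum_distrib_left mult_ac)+

lemma linear_kpi_mult: "lin fscale fscale (\<lambda>x :: 'k::field kpi. x * y)" "lin fscale fscale (\<lambda>x :: 'k
    kpi. y * x)"
  by (rule linearI[OF vector_space_fscale vector_space_fscale]; simp add: distrib_left distrib_right
      fscale_mult[symmetric])+

lemma to_ncsym_mult: "to_ncsym (x * y) = to_ncsym x * to_ncsym (y :: 'k::field kpi)"
proof -
  note L = linearD[OF linear_to_ncsym]
  have 1: "to_ncsym (sgl X 1 * y) = refinement_sum X * to_ncsym y" for X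
  proof (rule linear_eq_on_basis[where f = "\<lambda>y. to_ncsym (sgl X 1 * y)" and g
      = "\<lambda>y. refinement_sum X * to_ncsym y"])
    show "lin fscale nc_scale (\<lambda>y :: 'k kpi. to_ncsym (sgl X 1 * y))"
      by (rule linear_comp[OF linear_kpi_mult(2) linear_to_ncsym])
    show "lin fscale nc_scale (\<lambda>y :: 'k kpi. refinement_sum X * to_ncsym y)"
      by (rule linearI[OF vector_space_fscale vector_space_nc_scale]) (simp_all add: L distrib_left
          nc_scale_mult(2))
    show "to_ncsym (sgl X 1 * sgl Y 1) = refinement_sum X * to_ncsym (sgl Y (1 :: 'k))" for Y
      by (simp add: mult_single to_ncsym_single block_prod_series_mult[OF nc_coeff_refinement_sum])
  qed
  show ?thesis
  proof (rule linear_eq_on_basis[where f = "\<lambda>x. to_ncsym (x * y)" and g = "\<lambda>x. to_ncsym x * to_ncsym y"])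
    show "lin fscale nc_scale (\<lambda>x. to_ncsym (x * y))"
      by (rule linear_comp[OF linear_kpi_mult(1) linear_to_ncsym])
    show "lin fscale nc_scale (\<lambda>x. to_ncsym x * to_ncsym y)"
      by (rule linearI[OF vector_space_fscale vector_space_nc_scale]) (simp_all add: L distrib_right
          nc_scale_mult(1))
    show "to_ncsym (sgl X 1 * y) = to_ncsym (sgl X 1) * to_ncsym y" for X
      by (simp add: 1 to_ncsym_single)
  qed
qed

lemma to_ncsym_counit: "nc_coeff (to_ncsym x) [] = coef x 0"
proof (rule linear_eq_on_basis[where f = "\<lambda>x. nc_coeff (to_ncsym x) []" and g = "\<lambda>x. coef x 0"])
  show "lin fscale (*) (\<lambda>x. nc_coeff (to_ncsym x) [])"
    by (rule linear_comp[OF linear_to_ncsym linear_nc_coeff])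
  show "lin fscale (*) (\<lambda>x. coef x 0)"
    by (rule linearI[OF vector_space_fscale vector_space_times]) (simp_all add: lookup_add)
  show "nc_coeff (to_ncsym (sgl X 1)) [] = coef (sgl X 1) 0" for X
    by (auto simp: to_ncsym_single nc_coeff_refinement_sum block_prod_def psize_eq_0_iff lookup_single
        when_def)
qed

definition degree_part :: "nat \<Rightarrow> 'k::field kpi \<Rightarrow> 'k kpi" where
  "degree_part n = lin_ext fscale (\<lambda>X. if psize X = n then sgl X 1 else 0)"

lemma linear_degree_part: "lin fscale fscale (degree_part n)"
  unfolding degree_part_def by (rule linear_lin_ext[OF vector_space_fscale])

lemma degree_part_in: "degree_part n x \<in> kpi_part n"
  using supp_lin_ext[of "\<lambda>X. if psize X = n then sgl X 1 else 0" x]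
  unfolding kpi_part_def degree_part_def by (auto split: if_splits)

text \<open>The series of a set partition of \<open>[n]\<close> is supported on words of length
  \<open>n\<close>, so cutting out a degree commutes with the map.\<close>

lemma nc_coeff_degree_part:
  "nc_coeff (to_ncsym (degree_part n x)) w = (if length w = n then nc_coeff (to_ncsym x) w else 0)"
proof (rule linear_eq_on_basis[where f = "\<lambda>x. nc_coeff (to_ncsym (degree_part n x)) w"
      and g = "\<lambda>x. if length w = n then nc_coeff (to_ncsym x) w else 0"])
  show "lin fscale (*) (\<lambda>x. nc_coeff (to_ncsym (degree_part n x)) w)"
    by (rule linear_comp[OF linear_degree_part linear_comp[OF linear_to_ncsym linear_nc_coeff]])
  show "lin fscale (*) (\<lambda>x. if length w = n then nc_coeff (to_ncsym x) w else 0)"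
    by (rule linearI[OF vector_space_fscale vector_space_times]) (simp_all add: linearD[OF linear_to_ncsym])
  show "nc_coeff (to_ncsym (degree_part n (sgl X 1))) w = (if length w
      = n then nc_coeff (to_ncsym (sgl X 1)) w else 0)" for X
    by (simp add: degree_part_def lin_ext_single_1[OF vector_space_fscale] to_ncsym_single
        nc_coeff_refinement_sum block_prod_def linearD[OF linear_to_ncsym])
qed

lemma to_ncsym_part: "to_ncsym ` kpi_part n = part NCSym n"
proof (intro equalityI subsetI)
  fix F :: "'a ncsym" assume "F \<in> to_ncsym ` kpi_part n"
  then obtain x where x: "F = to_ncsym x" "x \<in> kpi_part n" by blast
  have "nc_coeff F w = 0" if "length w \<noteq> n" for w
    unfolding x(1) to_ncsym_def lin_ext_def nc_coeff_sum nc_coeff_simps nc_coeff_refinement_sum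
    using that x(2) by (intro sum.neutral) (auto simp: block_prod_def kpi_part_def)
  thus "F \<in> part NCSym n" by (auto simp: NCSym_def)
next
  fix F :: "'a ncsym" assume F: "F \<in> part NCSym n"
  obtain x where x: "F = to_ncsym x" using bij_is_surj[OF bij_to_ncsym] by blast
  have "to_ncsym (degree_part n x) = F"
    by (rule nc_coeff_eqI) (use F in \<open>auto simp: nc_coeff_degree_part x NCSym_def\<close>)
  thus "F \<in> to_ncsym ` kpi_part n" using degree_part_in by (metis imageI)
qed

section \<open>The Hopf algebra of set partitions\<close>

subsection \<open>Restriction and standardization\<close>

lemma blocks_standard_restrict:
  "S \<subseteq> {1..psize X} \<Longrightarrow> blocks (standard_restrict S X) = (\<lambda>B. rank S ` (B \<inter> S)) ` blocks X - {{}}"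
  by (simp add: standard_restrict.rep_eq Union_blocks inf_absorb1)

lemma Union_blocks_standard_restrict:
  "S \<subseteq> {1..psize X} \<Longrightarrow> \<Union>(blocks (standard_restrict S X)) = rank S ` S"
proof -
  assume S: "S \<subseteq> {1..psize X}"
  have "\<Union>(blocks (standard_restrict S X)) = rank S ` (\<Union>(blocks X) \<inter> S)"
    unfolding blocks_standard_restrict[OF S] by blast
  thus ?thesis using S by (simp add: Union_blocks inf_absorb2)
qed

lemma finite_subset_interval: "S \<subseteq> {1..n :: nat} \<Longrightarrow> finite S"
  using finite_subset by blast

lemma psize_standard_restrict: "S \<subseteq> {1..psize X} \<Longrightarrow> psize (standard_restrict S X) = card S"
  unfolding psize_def[of "standard_restrict S X"]
  by (simp add: Union_blocks_standard_restrict rank_image finite_subset_interval)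

lemma same_block_standard_restrict:
  assumes "S \<subseteq> {1..psize X}"
  shows "same_block (standard_restrict S X) i j
    \<longleftrightarrow> (\<exists>a\<in>S. \<exists>b\<in>S. i = rank S a \<and> j = rank S b \<and> same_block X a b)"
  unfolding same_block_def blocks_standard_restrict[OF assms] by blast

lemma rank_le_iff: "finite S \<Longrightarrow> a \<in> S \<Longrightarrow> b \<in> S \<Longrightarrow> rank S a \<le> rank S b \<longleftrightarrow> a \<le> b"
  using rank_strict_mono[of S a b] rank_strict_mono[of S b a] by (metis leD leI nat_less_le order_refl)

lemma rank_in: "finite S \<Longrightarrow> a \<in> S \<Longrightarrow> rank S a \<in> {1..card S}"
  using rank_image[of S] by blast

lemma bij_betw_rank:
  assumes S: "finite S" and T: "T \<subseteq> {1..card S}"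
  shows "bij_betw (rank S) {i\<in>S. rank S i \<in> T} T"
proof (rule bij_betw_imageI)
  show "inj_on (rank S) {i\<in>S. rank S i \<in> T}" by (rule inj_on_subset[OF inj_on_rank[OF S]]) blast
  show "rank S ` {i\<in>S. rank S i \<in> T} = T"
  proof -
    have "rank S ` {i\<in>S. rank S i \<in> T} = rank S ` S \<inter> T" by blast
    thus ?thesis unfolding rank_image[OF S] using T by blast
  qed
qed

lemma rank_rank:
  assumes S: "finite S" and T: "T \<subseteq> {1..card S}" and a: "a \<in> S" "rank S a \<in> T"
  shows "rank T (rank S a) = rank {i\<in>S. rank S i \<in> T} a"
proof -
  have "rank S ` {b\<in>{i\<in>S. rank S i \<in> T}. b \<le> a} = {c\<in>T. c \<le> rank S a}"
  proof (intro equalityI subsetI)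
    fix c assume c: "c \<in> {c\<in>T. c \<le> rank S a}"
    hence "c \<in> rank S ` S" unfolding rank_image[OF S] using T by blast
    then obtain b where b: "c = rank S b" "b \<in> S" by (elim imageE)
    have "b \<le> a" using c b(1) rank_le_iff[OF S b(2) a(1)] by simp
    hence "b \<in> {b\<in>{i\<in>S. rank S i \<in> T}. b \<le> a}" using b c by simp
    thus "c \<in> rank S ` {b\<in>{i\<in>S. rank S i \<in> T}. b \<le> a}" using b(1) by (rule rev_image_eqI)
  next
    fix c assume "c \<in> rank S ` {b\<in>{i\<in>S. rank S i \<in> T}. b \<le> a}"
    then obtain b where b: "c = rank S b" "b \<in> S" "rank S b \<in> T" "b \<le> a" by (elim imageE) simp
    thus "c \<in> {c\<in>T. c \<le> rank S a}" using rank_le_iff[OF S b(2) a(1)] by simp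
  qed
  moreover have "inj_on (rank S) {b\<in>{i\<in>S. rank S i \<in> T}. b \<le> a}"
    by (rule inj_on_subset[OF inj_on_rank[OF S]]) blast
  ultimately have "card {c\<in>T. c \<le> rank S a} = card {b\<in>{i\<in>S. rank S i \<in> T}. b \<le> a}"
    using card_image[of "rank S" "{b\<in>{i\<in>S. rank S i \<in> T}. b \<le> a}"] by (simp only:)
  thus ?thesis unfolding rank_def[of T] rank_def[of "{i\<in>S. rank S i \<in> T}"] .
qed

text \<open>The order-preserving bijections compose (\<open>rank_rank\<close>), so restricting twice is restricting once.\<close>

lemma standard_restrict_restrict:
  assumes S: "S \<subseteq> {1..psize X}" and T: "T \<subseteq> {1..card S}"
  shows "standard_restrict T (standard_restrict S X) = standard_restrict {i\<in>S. rank S i \<in> T} X"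
proof (rule set_partition_eqI)
  note fin = finite_subset_interval[OF S]
  let ?U = "{i\<in>S. rank S i \<in> T}"
  have U: "?U \<subseteq> {1..psize X}" using S by blast
  have T': "T \<subseteq> {1..psize (standard_restrict S X)}" using T by (simp only: psize_standard_restrict[OF S])
  show "psize (standard_restrict T (standard_restrict S X)) = psize (standard_restrict ?U X)"
    unfolding psize_standard_restrict[OF T'] psize_standard_restrict[OF U]
    by (rule bij_betw_same_card[OF bij_betw_rank[OF fin T], symmetric])
  fix i j
  have rr: "rank T (rank S a) = rank ?U a" if "a \<in> S" "rank S a \<in> T" for a
    using rank_rank[OF fin T that] .
  have inj: "rank S a = rank S b \<Longrightarrow> a \<in> S \<Longrightarrow> b \<in> S \<Longrightarrow> a = b" for a b
    using inj_on_rank[OF fin] by (rule inj_onD)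
  show "same_block (standard_restrict T (standard_restrict S X)) i j
      \<longleftrightarrow> same_block (standard_restrict ?U X) i j"
    unfolding same_block_standard_restrict[OF T'] same_block_standard_restrict[OF U]
        same_block_standard_restrict[OF S]
  proof
    assume "\<exists>c\<in>T. \<exists>d\<in>T. i = rank T c \<and> j = rank T d \<and> (\<exists>a\<in>S. \<exists>b\<in>S. c = rank S a \<and> d
        = rank S b \<and> same_block X a b)"
    then obtain a b where ab: "a \<in> S" "b \<in> S" "rank S a \<in> T" "rank S b \<in> T" "same_block X a b"
      "i = rank T (rank S a)" "j = rank T (rank S b)" by blast
    hence "i = rank ?U a" "j = rank ?U b" using rr by simp_all
    with ab show "\<exists>a\<in>?U. \<exists>b\<in>?U. i = rank ?U a \<and> j = rank ?U b \<and> same_block X a b" by blast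
  next
    assume "\<exists>a\<in>?U. \<exists>b\<in>?U. i = rank ?U a \<and> j = rank ?U b \<and> same_block X a b"
    then obtain a b where ab: "a \<in> S" "b \<in> S" "rank S a \<in> T" "rank S b \<in> T" "same_block X a b"
      "i = rank ?U a" "j = rank ?U b" by blast
    hence "i = rank T (rank S a)" "j = rank T (rank S b)" using rr by simp_all
    with ab show "\<exists>c\<in>T. \<exists>d\<in>T. i = rank T c \<and> j = rank T d \<and> (\<exists>a\<in>S. \<exists>b\<in>S. c = rank S a \<and> d
        = rank S b \<and> same_block X a b)"
      by blast
  qed
qed

lemma rank_interval: "a \<in> {1..n} \<Longrightarrow> rank {1..n} a = a"
proof -
  assume "a \<in> {1..n}"
  hence "{j\<in>{1..n}. j \<le> a} = {1..a}" by auto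
  thus ?thesis by (simp add: rank_def)
qed

lemma standard_restrict_full: "standard_restrict {1..psize X} X = X"
proof (rule set_partition_eqI)
  show "same_block (standard_restrict {1..psize X} X) i j \<longleftrightarrow> same_block X i j" for i j
  proof -
    have "(\<exists>a\<in>{1..psize X}. \<exists>b\<in>{1..psize X}. i = rank {1..psize X} a \<and> j
        = rank {1..psize X} b \<and> same_block X a b)
      \<longleftrightarrow> (\<exists>a\<in>{1..psize X}. \<exists>b\<in>{1..psize X}. i = a \<and> j = b \<and> same_block X a b)"
      by (intro bex_cong refl) (simp only: rank_interval)
    thus ?thesis
      unfolding same_block_standard_restrict[OF order_refl] using same_block_range[of X i j] by blast
  qed
qed (simp add: psize_standard_restrict)

lemma standard_restrict_eq_0_iff: "S \<subseteq> {1..psize X} \<Longrightarrow> standard_restrict S X = 0 \<longleftrightarrow> S = {}"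
  by (simp add: psize_eq_0_iff[symmetric] psize_standard_restrict finite_subset_interval)

lemma same_block_plus:
  "same_block (X + Y) i j \<longleftrightarrow> same_block X i j \<or> (\<exists>a b. i = psize X + a \<and> j = psize X + b \<and> same_block Y a b)"
  unfolding same_block_def blocks_plus by blast

lemma standard_restrict_plus:
  assumes S: "S \<subseteq> {1..psize X}" and T: "T \<subseteq> {1..psize Y}"
  shows "standard_restrict (S \<union> (+) (psize X) ` T) (X + Y) = standard_restrict S X + standard_restrict T Y"
    (is "standard_restrict ?U _ = _")
proof (rule set_partition_eqI)
  note fin = finite_subset_interval[OF S] finite_subset_interval[OF T]
  have U: "?U \<subseteq> {1..psize (X + Y)}" using S T by fastforce
  have disj: "S \<inter> (+) (psize X) ` T = {}" using S T by fastforce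
  have cardT: "card ((+) (psize X) ` T) = card T" by (simp add: card_image)
  show "psize (standard_restrict ?U (X + Y)) = psize (standard_restrict S X + standard_restrict T Y)"
    unfolding psize_standard_restrict[OF U] psize_plus psize_standard_restrict[OF S]
        psize_standard_restrict[OF T]
    using card_Un_disjoint[OF fin(1) _ disj] fin cardT by simp
  have rS: "rank ?U a = rank S a" if a: "a \<in> S" for a
  proof -
    have "{j\<in>?U. j \<le> a} = {j\<in>S. j \<le> a}" using S T a by fastforce
    thus ?thesis by (simp add: rank_def)
  qed
  have rT: "rank ?U (psize X + b) = card S + rank T b" if b: "b \<in> T" for b
  proof -
    have "{j\<in>?U. j \<le> psize X + b} = S \<union> (+) (psize X) ` {j\<in>T. j \<le> b}" using S by fastforce
    moreover have "card (S \<union> (+) (psize X) ` {j\<in>T. j \<le> b}) = card S + card ((+) (psize X) ` {j\<in>T. j \<le> b})"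
      using fin disj by (intro card_Un_disjoint) auto
    ultimately show ?thesis by (simp add: rank_def card_image)
  qed
  fix i j
  have "same_block (standard_restrict ?U (X + Y)) i j \<longleftrightarrow>
    (\<exists>a\<in>S. \<exists>b\<in>S. i = rank S a \<and> j = rank S b \<and> same_block X a b)
    \<or> (\<exists>a\<in>T. \<exists>b\<in>T. i = card S + rank T a \<and> j = card S + rank T b \<and> same_block Y a b)"
    unfolding same_block_standard_restrict[OF U]
  proof
    assume "\<exists>a\<in>?U. \<exists>b\<in>?U. i = rank ?U a \<and> j = rank ?U b \<and> same_block (X + Y) a b"
    then obtain a b where ab: "a \<in> ?U" "b \<in> ?U" "i = rank ?U a" "j = rank ?U b" "same_block (X + Y) a b"
        by blast
    from ab(5)[unfolded same_block_plus]
    show "(\<exists>a\<in>S. \<exists>b\<in>S. i = rank S a \<and> j = rank S b \<and> same_block X a b)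
      \<or> (\<exists>a\<in>T. \<exists>b\<in>T. i = card S + rank T a \<and> j = card S + rank T b \<and> same_block Y a b)"
    proof
      assume s: "same_block X a b"
      have "a \<in> S" "b \<in> S" using same_block_range[OF s] ab(1,2) T by fastforce+
      thus ?thesis using s ab(3,4) rS by metis
    next
      assume "\<exists>a' b'. a = psize X + a' \<and> b = psize X + b' \<and> same_block Y a' b'"
      then obtain a' b' where s: "a = psize X + a'" "b = psize X + b'" "same_block Y a' b'" by blast
      have "a' \<in> T" "b' \<in> T" using same_block_range[OF s(3)] ab(1,2) S unfolding s(1,2) by fastforce+
      thus ?thesis using s(3) ab(3,4)[unfolded s(1,2)] rT by metis
    qed
  next
    assume "(\<exists>a\<in>S. \<exists>b\<in>S. i = rank S a \<and> j = rank S b \<and> same_block X a b)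
      \<or> (\<exists>a\<in>T. \<exists>b\<in>T. i = card S + rank T a \<and> j = card S + rank T b \<and> same_block Y a b)"
    thus "\<exists>a\<in>?U. \<exists>b\<in>?U. i = rank ?U a \<and> j = rank ?U b \<and> same_block (X + Y) a b"
    proof
      assume "\<exists>a\<in>S. \<exists>b\<in>S. i = rank S a \<and> j = rank S b \<and> same_block X a b"
      then obtain a b where "a \<in> S" "b \<in> S" "i = rank ?U a" "j = rank ?U b" "same_block X a b" using rS
          by metis
      thus ?thesis unfolding same_block_plus by blast
    next
      assume "\<exists>a\<in>T. \<exists>b\<in>T. i = card S + rank T a \<and> j = card S + rank T b \<and> same_block Y a b"
      then obtain a b where "a \<in> T" "b \<in> T" "i = rank ?U (psize X + a)" "j
          = rank ?U (psize X + b)" "same_block Y a b"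
        using rT by metis
      thus ?thesis unfolding same_block_plus by blast
    qed
  qed
  thus "same_block (standard_restrict ?U (X + Y)) i j
      \<longleftrightarrow> same_block (standard_restrict S X + standard_restrict T Y) i j"
    unfolding same_block_plus psize_standard_restrict[OF S] same_block_standard_restrict[OF S]
      same_block_standard_restrict[OF T] by blast
qed

subsection \<open>The coproduct\<close>

abbreviation basis :: "set_partition \<Rightarrow> 'k::field kpi" where "basis X \<equiv> sgl X 1"

lemma linear_kpi_coprod: "lin fscale fscale kpi_coprod"
  unfolding kpi_coprod_def by (rule linear_lin_ext[OF vector_space_fscale])

lemma kpi_coprod_single:
  "kpi_coprod (basis Z) = (\<Sum>S\<in>Pow {1..psize Z}.
     sgl [basis (standard_restrict S Z), basis (standard_restrict ({1..psize Z} - S) Z)] 1)"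
  unfolding kpi_coprod_def by (rule lin_ext_single_1[OF vector_space_fscale])

lemma supp_kpi_coprod:
  assumes "l \<in> supp (kpi_coprod x)"
  obtains Z S where "Z \<in> supp x" "S \<subseteq> {1..psize Z}"
    "l = [basis (standard_restrict S Z), basis (standard_restrict ({1..psize Z} - S) Z)]"
proof -
  obtain Z where Z: "Z \<in> supp x" "l \<in> supp (\<Sum>S\<in>Pow {1..psize Z}.
     sgl [basis (standard_restrict S Z), basis (standard_restrict ({1..psize Z} - S) Z ::
         set_partition)] (1 :: 'a))"
    using subsetD[OF supp_lin_ext assms[unfolded kpi_coprod_def]] by blast
  have "l \<in> (\<Union>S\<in>Pow {1..psize Z}. supp (sgl [basis (standard_restrict S Z),
      basis (standard_restrict ({1..psize Z} - S) Z :: set_partition)] (1 :: 'a)))"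
    by (rule subsetD[OF Poly_Mapping.keys_sum Z(2)])
  then obtain S where "S \<in> Pow {1..psize Z}" "l \<in> supp (sgl [basis (standard_restrict S Z),
      basis (standard_restrict ({1..psize Z} - S) Z :: set_partition)] (1 :: 'a))" by (elim UN_E)
  thus thesis using that[OF Z(1)] by simp
qed

lemma length_kpi_coprod: "l \<in> supp (kpi_coprod x) \<Longrightarrow> length l = 2"
  by (erule supp_kpi_coprod) simp

lemma sum_restrict_restrict:
  assumes S: "S \<subseteq> {1..psize Z}"
  shows "(\<Sum>T\<in>Pow {1..card S}. h (standard_restrict T (standard_restrict S Z))
      (standard_restrict ({1..card S} - T) (standard_restrict S Z)))
    = (\<Sum>A\<in>Pow S. h (standard_restrict A Z) (standard_restrict (S - A) Z))"
proof (rule sum.reindex_bij_witness[where i = "\<lambda>A. rank S ` A" and j = "\<lambda>T. {i\<in>S. rank S i \<in> T}"])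
  note fin = finite_subset_interval[OF S]
  fix T assume "T \<in> Pow {1..card S}"
  hence T: "T \<subseteq> {1..card S}" by simp
  show "rank S ` {i\<in>S. rank S i \<in> T} = T" by (rule bij_betw_imp_surj_on[OF bij_betw_rank[OF fin T]])
  have "S - {i\<in>S. rank S i \<in> T} = {i\<in>S. rank S i \<in> {1..card S} - T}" using rank_in[OF fin] by blast
  thus "h (standard_restrict {i\<in>S. rank S i \<in> T} Z) (standard_restrict (S - {i\<in>S. rank S i \<in> T}) Z)
    = h (standard_restrict T (standard_restrict S Z)) (standard_restrict ({1..card S} - T)
        (standard_restrict S Z))"
    using standard_restrict_restrict[OF S T] standard_restrict_restrict[OF S, of "{1..card S} - T"] by simp
next
  note fin = finite_subset_interval[OF S]
  fix A assume A: "A \<in> Pow S"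
  show "{i\<in>S. rank S i \<in> rank S ` A} = A" using A inj_on_rank[OF fin] by (auto dest: inj_onD)
  show "rank S ` A \<in> Pow {1..card S}" unfolding rank_image[OF fin, symmetric] using A by blast
qed auto

text \<open>Both sides sum over the ordered decompositions of \<open>[n]\<close> into three parts;
  the left one chooses the last part first, the right one the first part.\<close>

lemma kpi_coassoc:
  "lin_ext fscale (\<lambda>l. push (\<lambda>d. d @ [l ! 1]) (kpi_coprod (l ! 0))) (kpi_coprod x)
    = lin_ext fscale (\<lambda>l. push (\<lambda>d. [l ! 0] @ d) (kpi_coprod (l ! 1))) (kpi_coprod (x :: 'k::field kpi))"
proof (rule linear_eq_on_basis[where
      f = "\<lambda>x. lin_ext fscale (\<lambda>l. push (\<lambda>d. d @ [l ! 1]) (kpi_coprod (l ! 0))) (kpi_coprod x)" and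
      g = "\<lambda>x. lin_ext fscale (\<lambda>l. push (\<lambda>d. [l ! 0] @ d) (kpi_coprod (l ! 1))) (kpi_coprod x)"])
  fix Z
  let ?N = "{1..psize Z}" and ?r = "\<lambda>S. basis (standard_restrict S Z) :: 'k kpi"
  note L = linearD[OF linear_lin_ext[OF vector_space_fscale]] and P = linearD[OF linear_push]
  have "lin_ext fscale (\<lambda>l. push (\<lambda>d. d @ [l ! 1]) (kpi_coprod (l ! 0))) (kpi_coprod (basis Z))
    = (\<Sum>S\<in>Pow ?N. push (\<lambda>d. d @ [?r (?N - S)]) (kpi_coprod (?r S)))"
    unfolding kpi_coprod_single[of Z] L lin_ext_single_1[OF vector_space_fscale] by simp
  also have "\<dots> = (\<Sum>S\<in>Pow ?N. \<Sum>A\<in>Pow S. sgl [?r A, ?r (S - A), ?r (?N - S)] 1)"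
  proof (rule sum.cong[OF refl])
    fix S assume "S \<in> Pow ?N"
    hence S: "S \<subseteq> ?N" by simp
    show "push (\<lambda>d. d @ [?r (?N - S)]) (kpi_coprod (?r S))
        = (\<Sum>A\<in>Pow S. sgl [?r A, ?r (S - A), ?r (?N - S)] 1)"
      using sum_restrict_restrict[OF S, of "\<lambda>a b. sgl [basis a, basis b, ?r (?N - S)] (1 :: 'k)"]
      unfolding kpi_coprod_single P push_single psize_standard_restrict[OF S] by simp
  qed
  also have "\<dots> = (\<Sum>(S, A)\<in>Sigma (Pow ?N) Pow. sgl [?r A, ?r (S - A), ?r (?N - S)] 1)"
    by (rule sum.Sigma) (auto intro: finite_subset)
  also have "\<dots> = (\<Sum>(S, A)\<in>Sigma (Pow ?N) (\<lambda>S. Pow (?N - S)). sgl [?r S, ?r A, ?r (?N - S - A)] 1)"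
  proof (rule sum.reindex_bij_witness[where i = "\<lambda>(S, A). (S \<union> A, S)" and j = "\<lambda>(S, A). (A, S - A)"])
    fix a assume "a \<in> Sigma (Pow ?N) Pow"
    then obtain S A where a: "a = (S, A)" "S \<subseteq> ?N" "A \<subseteq> S" by blast
    have "?N - A - (S - A) = ?N - S" using a by blast
    thus "(case (case a of (S, A) \<Rightarrow> (A, S - A)) of (S, A) \<Rightarrow> sgl [?r S, ?r A, ?r (?N - S - A)] (1 :: 'k))
      = (case a of (S, A) \<Rightarrow> sgl [?r A, ?r (S - A), ?r (?N - S)] 1)"
      by (simp only: a(1) prod.case)
  qed auto
  also have "\<dots> = (\<Sum>S\<in>Pow ?N. \<Sum>A\<in>Pow (?N - S). sgl [?r S, ?r A, ?r (?N - S - A)] 1)"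
    by (rule sum.Sigma[symmetric]) auto
  also have "\<dots> = (\<Sum>S\<in>Pow ?N. push (\<lambda>d. [?r S] @ d) (kpi_coprod (?r (?N - S))))"
  proof (rule sum.cong[OF refl])
    fix S assume "S \<in> Pow ?N"
    have S: "?N - S \<subseteq> ?N" by blast
    show "(\<Sum>A\<in>Pow (?N - S). sgl [?r S, ?r A, ?r (?N - S - A)] 1)
        = push (\<lambda>d. [?r S] @ d) (kpi_coprod (?r (?N - S)))"
      using sum_restrict_restrict[OF S, of "\<lambda>a b. sgl [?r S, basis a, basis b] (1 :: 'k)"]
      unfolding kpi_coprod_single P push_single psize_standard_restrict[OF S] by simp
  qed
  also have "\<dots> = lin_ext fscale (\<lambda>l. push (\<lambda>d. [l ! 0] @ d) (kpi_coprod (l ! 1))) (kpi_coprod (basis Z))"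
    unfolding kpi_coprod_single[of Z] L lin_ext_single_1[OF vector_space_fscale]
        by (simp only: One_nat_def nth_Cons_0 nth_Cons_Suc)
  finally show "lin_ext fscale (\<lambda>l. push (\<lambda>d. d @ [l ! 1]) (kpi_coprod (l ! 0))) (kpi_coprod (basis Z))
    = lin_ext fscale (\<lambda>l. push (\<lambda>d. [l ! 0] @ d) (kpi_coprod (l ! 1))) (kpi_coprod (basis Z :: 'k kpi))" .
qed (rule linear_comp[OF linear_kpi_coprod linear_lin_ext[OF vector_space_fscale]])+

text \<open>A subset of \<open>[m + n]\<close> is a pair of subsets of \<open>[m]\<close> and
  \<open>[n]\<close>, and restriction respects this (\<open>standard_restrict_plus\<close>).\<close>

lemma kpi_coprod_mult:
  "kpi_coprod (x * y) =
    lin_ext fscale (\<lambda>l. push (\<lambda>m. [l ! 0 * m ! 0, l ! 1 * m ! 1]) (kpi_coprod y)) (kpi_coprod (x ::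
        'k::field kpi))"
proof -
  note L = linearD[OF linear_lin_ext[OF vector_space_fscale]] and P = linearD[OF linear_push]
    and C = linearD[OF linear_kpi_coprod]
  let ?M = "\<lambda>t r. lin_ext fscale (\<lambda>l. push (\<lambda>m. [l ! 0 * m ! 0, l ! 1 * m ! 1]) r) t :: 'k kpi list \<Rightarrow>\<^sub>0 'k"
  have lin_right: "lin fscale fscale (?M t)" for t
    by (rule linearI[OF vector_space_fscale vector_space_fscale])
      (simp_all only: P lin_ext_add_fun[OF vector_space_fscale] lin_ext_scale_fun[OF vector_space_fscale])
  have basis: "kpi_coprod (basis X * basis Y) = ?M (kpi_coprod (basis X)) (kpi_coprod (basis Y))" for X Y
  proof -
    let ?m = "{1..psize X}" and ?n = "{1..psize Y}" and ?s = "(+) (psize X)"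
    let ?N = "{1..psize (X + Y)}"
    let ?r = "\<lambda>S X. basis (standard_restrict S X) :: 'k kpi"
    have N: "?N = ?m \<union> ?s ` ?n"
    proof -
      have "?s ` ?n = {psize X + 1..psize X + psize Y}" by simp
      thus ?thesis by auto
    qed
    have "?M (kpi_coprod (basis X)) (kpi_coprod (basis Y))
      = (\<Sum>S\<in>Pow ?m. \<Sum>T\<in>Pow ?n. sgl [?r S X * ?r T Y, ?r (?m - S) X * ?r (?n - T) Y] 1)"
      unfolding kpi_coprod_single L P lin_ext_single_1[OF vector_space_fscale] push_single by simp
    also have "\<dots> = (\<Sum>(S, T)\<in>Pow ?m \<times> Pow ?n. sgl [?r S X * ?r T Y, ?r (?m - S) X * ?r (?n - T) Y] 1)"
      by (rule sum.cartesian_product)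
    also have "\<dots> = (\<Sum>U\<in>Pow ?N. sgl [?r U (X + Y), ?r (?N - U) (X + Y)] 1)"
    proof (rule sum.reindex_bij_witness[where i = "\<lambda>U. (U \<inter> ?m, {j\<in>?n. psize X + j \<in> U})"
          and j = "\<lambda>(S, T). S \<union> ?s ` T"])
      fix a assume "a \<in> Pow ?m \<times> Pow ?n"
      then obtain S T where a: "a = (S, T)" and S: "S \<subseteq> ?m" and T: "T \<subseteq> ?n" by blast
      have "(S \<union> ?s ` T) \<inter> ?m = S" using S T by fastforce
      moreover have "{j\<in>?n. psize X + j \<in> S \<union> ?s ` T} = T" using S T by fastforce
      ultimately show "((case a of (S, T) \<Rightarrow> S \<union> ?s ` T) \<inter> ?m, {j\<in>?n. psize X + j
          \<in> (case a of (S, T) \<Rightarrow> S \<union> ?s ` T)}) = a"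
        by (simp only: a prod.case)
      show "(case a of (S, T) \<Rightarrow> S \<union> ?s ` T) \<in> Pow ?N" unfolding N a using S T by auto
      have disj: "?m \<inter> ?s ` ?n = {}" by fastforce
      have "?N - (S \<union> ?s ` T) = (?m - S) \<union> (?s ` ?n - ?s ` T)" unfolding N using S T disj by blast
      also have "?s ` ?n - ?s ` T = ?s ` (?n - T)" by (rule image_set_diff[symmetric]) simp
      finally have compl: "?N - (S \<union> ?s ` T) = (?m - S) \<union> ?s ` (?n - T)" .
      have sub: "?m - S \<subseteq> ?m" "?n - T \<subseteq> ?n" by blast+
      have "sgl [?r (S \<union> ?s ` T) (X + Y), ?r (?N - (S \<union> ?s ` T)) (X + Y)] 1
        = sgl [?r S X * ?r T Y, ?r (?m - S) X * ?r (?n - T) Y] (1 :: 'k)"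
        unfolding compl standard_restrict_plus[OF S T] standard_restrict_plus[OF sub]
            by (simp add: mult_single)
      thus "(case case a of (S, T) \<Rightarrow> S \<union> ?s ` T of U \<Rightarrow> sgl [?r U (X + Y), ?r (?N - U) (X + Y)] (1 :: 'k))
        = (case a of (S, T) \<Rightarrow> sgl [?r S X * ?r T Y, ?r (?m - S) X * ?r (?n - T) Y] 1)"
        by (simp only: a prod.case)
    next
      fix U assume "U \<in> Pow ?N"
      hence U: "U \<subseteq> ?m \<union> ?s ` ?n" unfolding N by simp
      have "U \<inter> ?m \<union> ?s ` {j\<in>?n. psize X + j \<in> U} = U" using U by blast
      thus "(case (U \<inter> ?m, {j\<in>?n. psize X + j \<in> U}) of (S, T) \<Rightarrow> S \<union> ?s ` T) = U" by (simp only: prod.case)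
      show "(U \<inter> ?m, {j\<in>?n. psize X + j \<in> U}) \<in> Pow ?m \<times> Pow ?n" by blast
    qed
    also have "\<dots> = kpi_coprod (basis X * basis Y)"
      by (simp only: mult_single mult_1_left kpi_coprod_single)
    finally show ?thesis ..
  qed
  have right: "kpi_coprod (basis X * y) = ?M (kpi_coprod (basis X)) (kpi_coprod y)" for X
    by (rule linear_eq_on_basis[where f = "\<lambda>y. kpi_coprod (basis X * y)" and g
        = "\<lambda>y. ?M (kpi_coprod (basis X)) (kpi_coprod y)"])
      (rule linear_comp[OF linear_kpi_mult(2) linear_kpi_coprod] linear_comp[OF linear_kpi_coprod
          lin_right] basis)+
  show ?thesis
    by (rule linear_eq_on_basis[where f = "\<lambda>x. kpi_coprod (x * y)" and g
        = "\<lambda>x. ?M (kpi_coprod x) (kpi_coprod y)"])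
      (rule linear_comp[OF linear_kpi_mult(1) linear_kpi_coprod]
        linear_comp[OF linear_kpi_coprod linear_lin_ext[OF vector_space_fscale]] right)+
qed

lemma kpi_counit_left:
  "lin_ext fscale (\<lambda>l. fscale (kpi_counit (l ! 0)) (l ! 1)) (kpi_coprod x) = (x :: 'k::field kpi)"
proof (rule linear_eq_on_basis[where g = "\<lambda>x. x"
      and f = "\<lambda>x. lin_ext fscale (\<lambda>l. fscale (kpi_counit (l ! 0)) (l ! 1)) (kpi_coprod x)"])
  fix Z
  let ?N = "{1..psize Z}"
  have "lin_ext fscale (\<lambda>l. fscale (kpi_counit (l ! 0)) (l ! 1)) (kpi_coprod (basis Z))
    = (\<Sum>S\<in>Pow ?N. if S = {} then basis (standard_restrict (?N - S) Z) else (0 :: 'k kpi))"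
    unfolding kpi_coprod_single linearD[OF linear_lin_ext[OF vector_space_fscale]] lin_ext_single_1[OF
        vector_space_fscale]
    by (rule sum.cong[OF refl]) (auto simp: kpi_counit_def lookup_single standard_restrict_eq_0_iff)
  thus "lin_ext fscale (\<lambda>l. fscale (kpi_counit (l ! 0)) (l ! 1)) (kpi_coprod (basis Z))
      = (basis Z :: 'k kpi)"
    using standard_restrict_full[of Z] by simp
qed (rule linear_comp[OF linear_kpi_coprod linear_lin_ext[OF vector_space_fscale]] linear_id[OF
    vector_space_fscale])+

lemma kpi_counit_right:
  "lin_ext fscale (\<lambda>l. fscale (kpi_counit (l ! 1)) (l ! 0)) (kpi_coprod x) = (x :: 'k::field kpi)"
proof (rule linear_eq_on_basis[where g = "\<lambda>x. x"
      and f = "\<lambda>x. lin_ext fscale (\<lambda>l. fscale (kpi_counit (l ! 1)) (l ! 0)) (kpi_coprod x)"])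
  fix Z
  let ?N = "{1..psize Z}"
  have "lin_ext fscale (\<lambda>l. fscale (kpi_counit (l ! 1)) (l ! 0)) (kpi_coprod (basis Z))
    = (\<Sum>S\<in>Pow ?N. if S = ?N then basis (standard_restrict S Z) else (0 :: 'k kpi))"
    unfolding kpi_coprod_single linearD[OF linear_lin_ext[OF vector_space_fscale]] lin_ext_single_1[OF
        vector_space_fscale]
    by (rule sum.cong[OF refl]) (auto simp: kpi_counit_def lookup_single standard_restrict_eq_0_iff)
  thus "lin_ext fscale (\<lambda>l. fscale (kpi_counit (l ! 1)) (l ! 0)) (kpi_coprod (basis Z))
      = (basis Z :: 'k kpi)"
    using standard_restrict_full[of Z] by simp
qed (rule linear_comp[OF linear_kpi_coprod linear_lin_ext[OF vector_space_fscale]] linear_id[OF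
    vector_space_fscale])+

lemma coef_degree_part: "coef (degree_part n x) X = (if psize X = n then coef x X else 0)"
proof (rule linear_eq_on_basis[where f = "\<lambda>x. coef (degree_part n x) X" and g = "\<lambda>x. if psize X
    = n then coef x X else 0"])
  have c: "lin fscale (*) (\<lambda>x. coef x X)"
    by (rule linearI[OF vector_space_fscale vector_space_times]) (simp_all add: lookup_add)
  show "lin fscale (*) (\<lambda>x. coef (degree_part n x) X)" by (rule linear_comp[OF linear_degree_part c])
  show "lin fscale (*) (\<lambda>x. if psize X = n then coef x X else 0)"
    by (rule linearI[OF vector_space_fscale vector_space_times]) (simp_all add: lookup_add)
  show "coef (degree_part n (basis Y)) X = (if psize X = n then coef (basis Y) X else 0)" for Y
    by (auto simp: degree_part_def lin_ext_single_1[OF vector_space_fscale] lookup_single when_def)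
qed

lemma subspace_kpi_part: "fs.subspace (kpi_part n)"
  by (rule fs.subspaceI) (auto simp: kpi_part_def in_keys_iff lookup_add)

lemma coef_eq_0_if_part: "x \<in> kpi_part n \<Longrightarrow> psize X \<noteq> n \<Longrightarrow> coef x X = 0"
  by (auto simp: kpi_part_def in_keys_iff)

lemma kpi_part_direct:
  "\<exists>!g. (\<forall>n. g n \<in> kpi_part n) \<and> finite {n. g n \<noteq> 0} \<and> x = (\<Sum>n | g n \<noteq> 0. g n)"
proof (rule ex1I[of _ "\<lambda>n. degree_part n x"])
  have sub: "{n. degree_part n x \<noteq> 0} \<subseteq> psize ` supp x"
  proof
    fix n assume "n \<in> {n. degree_part n x \<noteq> 0}"
    hence "supp (degree_part n x) \<noteq> {}" by simp
    then obtain X where "X \<in> supp (degree_part n x)" by blast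
    thus "n \<in> psize ` supp x" by (auto simp: coef_degree_part in_keys_iff split: if_splits)
  qed
  have "x = (\<Sum>n\<in>psize ` supp x. degree_part n x)"
    by (rule poly_mapping_eqI) (auto simp: lookup_sum coef_degree_part in_keys_iff image_iff)
  also have "\<dots> = (\<Sum>n | degree_part n x \<noteq> 0. degree_part n x)"
    by (rule sum.mono_neutral_right) (use sub in auto)
  finally show "(\<forall>n. degree_part n x \<in> kpi_part n) \<and> finite {n. degree_part n x \<noteq> 0} \<and>
      x = (\<Sum>n | degree_part n x \<noteq> 0. degree_part n x)"
    by (intro conjI allI degree_part_in finite_subset[OF sub] finite_imageI finite_keys)
next
  fix g assume "(\<forall>n. g n \<in> kpi_part n) \<and> finite {n. g n \<noteq> 0} \<and> x = (\<Sum>n | g n \<noteq> 0. g n)"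
  hence g: "\<And>n. g n \<in> kpi_part n" "finite {n. g n \<noteq> 0}" "x = (\<Sum>n | g n \<noteq> 0. g n)" by simp_all
  show "g = (\<lambda>n. degree_part n x)"
  proof (intro ext poly_mapping_eqI)
    fix n X
    have "coef x X = (\<Sum>k | g k \<noteq> 0. coef (g k) X)" unfolding g(3) by (rule lookup_sum)
    also have "\<dots> = (\<Sum>k | g k \<noteq> 0. if k = psize X then coef (g k) X else 0)"
      by (rule sum.cong[OF refl]) (simp add: coef_eq_0_if_part[OF g(1)])
    also have "\<dots> = coef (g (psize X)) X" using g(2) by simp
    finally show "coef (g n) X = coef (degree_part n x) X"
      using coef_eq_0_if_part[OF g(1), of X n] by (simp add: coef_degree_part)
  qed
qed

theorem hopf_KPi: "graded_connected_hopf_algebra (KPi :: ('k::field, 'k kpi) hopf_data)"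
proof (rule graded_connected_bialgebra.hopf, intro graded_connected_bialgebra.intro
    graded_connected_bialgebra_axioms.intro)
  note [simp] = KPi_def
  note C = linearD[OF linear_kpi_coprod] and refl2 = tensor_eq_refl[OF length_kpi_coprod]
  have eq: "tensor_eq (scale KPi) n t t'" if "t = t'" "\<And>l. l \<in> supp t \<Longrightarrow> length l = n"
    for n and t t' :: "'k kpi list \<Rightarrow>\<^sub>0 'k"
    using tensor_eq_refl[of t n "scale KPi"] that by simp
  fix x y :: "'k kpi" and c :: 'k and m n :: nat
  show "vector_space (scale (KPi :: ('k, 'k kpi) hopf_data))" by (simp add: vector_space_fscale)
  show "scale KPi c (x * y) = scale KPi c x * y" "scale KPi c (x * y) = x * scale KPi c y"
    by (simp_all add: fscale_mult(1)) (simp add: fscale_mult(1)[symmetric] fscale_mult(2))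
  show "tensor_eq (scale KPi) 2 (coprod KPi (x + y)) (coprod KPi x + coprod KPi y)"
    by (rule eq) (simp_all add: C length_kpi_coprod flip: C(3))
  show "tensor_eq (scale KPi) 2 (coprod KPi (scale KPi c x)) (fscale c (coprod KPi x))"
    by (rule eq) (simp_all add: length_kpi_coprod flip: C(4))
  show "lin (scale KPi) (*) (counit (KPi :: ('k, 'k kpi) hopf_data))"
    by (rule linearI) (simp_all add: vector_space_fscale vector_space_times kpi_counit_def lookup_add)
  show "tensor_eq (scale KPi) 3
        (lin_ext fscale (\<lambda>l. push (\<lambda>d. d @ [l ! 1]) (coprod KPi (l ! 0))) (coprod KPi x))
        (lin_ext fscale (\<lambda>l. push (\<lambda>d. [l ! 0] @ d) (coprod KPi (l ! 1))) (coprod KPi x))"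
  proof (rule eq)
    show "lin_ext fscale (\<lambda>l. push (\<lambda>d. d @ [l ! 1]) (coprod KPi (l ! 0))) (coprod KPi x)
      = lin_ext fscale (\<lambda>l. push (\<lambda>d. [l ! 0] @ d) (coprod KPi (l ! 1))) (coprod KPi x)"
      using kpi_coassoc[of x] by simp
    show "length l = 3" if "l \<in> supp (lin_ext fscale (\<lambda>l. push (\<lambda>d. d @ [l ! 1]) (coprod KPi (l ! 0)))
        (coprod KPi x))" for l
      using that by (rule length_lin_ext_push) (simp add: length_kpi_coprod)
  qed
  show "lin_ext (scale KPi) (\<lambda>l. scale KPi (counit KPi (l ! 0)) (l ! 1)) (coprod KPi x) = x"
    using kpi_counit_left[of x] by simp
  show "lin_ext (scale KPi) (\<lambda>l. scale KPi (counit KPi (l ! 1)) (l ! 0)) (coprod KPi x) = x"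
    using kpi_counit_right[of x] by simp
  have one: "kpi_coprod 1 = sgl [1, 1 :: 'k kpi] 1"
    unfolding single_one[symmetric] kpi_coprod_single using standard_restrict_eq_0_iff[of "{}" 0] by simp
  show "tensor_eq (scale KPi) 2 (coprod KPi 1) (sgl [1, 1 :: 'k kpi] 1)"
    by (rule eq) (simp_all add: one)
  show "tensor_eq (scale KPi) 2 (coprod KPi (x * y))
        (lin_ext fscale (\<lambda>l. push (\<lambda>m. [l ! 0 * m ! 0, l ! 1 * m ! 1]) (coprod KPi y)) (coprod KPi x))"
    by (rule eq) (simp_all add: kpi_coprod_mult[symmetric] length_kpi_coprod del: One_nat_def)
  show "counit KPi (1 :: 'k kpi) = 1"
    by (simp add: kpi_counit_def lookup_one)
  show "counit KPi (x * y) = counit KPi x * counit KPi y"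
    unfolding KPi_def hopf_data.simps kpi_counit_def
    by (simp only: to_ncsym_counit[symmetric] to_ncsym_mult nc_coeff_mult) simp
  show "module.subspace (scale KPi) (part (KPi :: ('k, 'k kpi) hopf_data) n)"
    by (simp add: subspace_kpi_part)
  show "\<exists>!g. (\<forall>n. g n \<in> part KPi n) \<and> finite {n. g n \<noteq> 0} \<and> x = (\<Sum>n | g n \<noteq> 0. g n)"
    using kpi_part_direct[of x] by simp
  show "x * y \<in> part KPi (m + n)" if "x \<in> part KPi m" "y \<in> part KPi n"
    using that Poly_Mapping.keys_mult[of x y] by (fastforce simp: kpi_part_def)
  show "\<exists>t. tensor_eq (scale KPi) 2 (coprod KPi x) t \<and>
        (\<forall>l\<in>supp t. \<exists>i j. i + j = n \<and> l ! 0 \<in> part KPi i \<and> l ! 1 \<in> part KPi j)" if x: "x \<in> part KPi n"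
  proof (intro exI[of _ "coprod KPi x"] conjI ballI)
    show "tensor_eq (scale KPi) 2 (coprod KPi x) (coprod KPi x)"
        by (rule eq) (simp_all add: length_kpi_coprod)
    fix l assume "l \<in> supp (coprod KPi x)"
    hence "l \<in> supp (kpi_coprod x)" by simp
    then obtain Z S where Z: "Z \<in> supp x" "S \<subseteq> {1..psize Z}"
      "l = [basis (standard_restrict S Z), basis (standard_restrict ({1..psize Z} - S) Z)]"
      by (rule supp_kpi_coprod)
    have n: "psize Z = n" using x Z(1) by (simp add: kpi_part_def)
    have c: "card ({1..psize Z} - S) = n - card S" "card S \<le> n"
      using Z(2) n card_mono[of "{1..psize Z}" S] by (simp_all add: card_Diff_subset finite_subset_interval)
    have "card S + (n - card S) = n" using c by simp
    moreover have "l ! 0 \<in> part KPi (card S)" using Z by (simp add: kpi_part_def psize_standard_restrict)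
    moreover have "l ! 1 \<in> part KPi (n - card S)"
      using Z(3) c(1) psize_standard_restrict[of "{1..psize Z} - S" Z] by (simp add: kpi_part_def)
    ultimately show "\<exists>i j. i + j = n \<and> l ! 0 \<in> part KPi i \<and> l ! 1 \<in> part KPi j"
      by (intro exI conjI)
  qed
  show "counit KPi x = 0" if "x \<in> part KPi n" "n > 0"
    using that coef_eq_0_if_part[of x n 0] by (simp add: kpi_counit_def)
  show "part KPi 0 = range (\<lambda>c. scale KPi c (1 :: 'k kpi))"
  proof (intro equalityI subsetI)
    fix z :: "'k kpi" assume "z \<in> part KPi 0"
    hence "z \<in> kpi_part 0" by simp
    hence "z = fscale (coef z 0) 1"
      by (intro poly_mapping_eqI) (auto simp: lookup_one when_def psize_eq_0_iff coef_eq_0_if_part[of z 0])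
    thus "z \<in> range (\<lambda>c. scale KPi c 1)" by auto
  next
    fix z :: "'k kpi" assume "z \<in> range (\<lambda>c. scale KPi c 1)"
    then obtain c where "z = fscale c 1" by auto
    thus "z \<in> part KPi 0" by (auto simp: kpi_part_def in_keys_iff lookup_one when_def split: if_splits)
  qed
qed

section \<open>The coproduct in noncommuting variables\<close>

text \<open>The words which contribute to a coefficient of
  \<open>F(x\<^sub>1,y\<^sub>1,x\<^sub>2,y\<^sub>2,\<dots>)\<close> are determined by the set of
  positions of the \<open>x\<close>'s.\<close>

definition unshuffles :: "nat list \<Rightarrow> nat list \<Rightarrow> nat list set" where
  "unshuffles u v = {w. map (\<lambda>i. i div 2) (filter even w) = u \<and> map (\<lambda>i. i div 2) (filter odd w) = v}"

definition positions :: "(nat \<Rightarrow> bool) \<Rightarrow> nat list \<Rightarrow> nat set" where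
  "positions P w = {j\<in>{1..length w}. P (w ! (j - 1))}"

lemma card_positions: "card (positions P w) = length (filter P w)"
proof -
  have "positions P w = Suc ` {i. i < length w \<and> P (w ! i)}"
  proof (intro equalityI subsetI)
    fix j assume "j \<in> positions P w"
    hence "j = Suc (j - 1)" "j - 1 \<in> {i. i < length w \<and> P (w ! i)}" by (auto simp: positions_def)
    thus "j \<in> Suc ` {i. i < length w \<and> P (w ! i)}" by (rule image_eqI)
  qed (auto simp: positions_def)
  thus ?thesis by (simp add: card_image length_filter_conv_card)
qed

lemma rank_positions:
  assumes "j \<le> length w"
  shows "rank (positions P w) j = length (filter P (take j w))"
proof -
  have "{i\<in>positions P w. i \<le> j} = positions P (take j w)"
    using assms by (auto simp: positions_def)
  thus ?thesis by (simp add: rank_def card_positions)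
qed

text \<open>Passing to the letters with property \<open>P\<close> moves the \<open>j\<close>-th
  letter to the place \<open>rank _ j\<close>; this links unshuffling of words to standardization of
  set partitions.\<close>

lemma nth_filter_rank:
  assumes "j \<in> positions P w"
  shows "filter P w ! (rank (positions P w) j - 1) = w ! (j - 1)"
proof -
  have j: "j \<ge> 1" "j \<le> length w" "P (w ! (j - 1))" using assms by (auto simp: positions_def)
  have "take j w = take (j - 1) w @ [w ! (j - 1)]"
    using j take_Suc_conv_app_nth[of "j - 1" w] by simp
  hence f: "filter P (take j w) = filter P (take (j - 1) w) @ [w ! (j - 1)]" using j(3) by simp
  have "filter P w = filter P (take j w) @ filter P (drop j w)"
    unfolding filter_append[symmetric] append_take_drop_id ..
  thus ?thesis unfolding rank_positions[OF j(2)] f by simp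
qed

definition shuffle_at :: "nat set \<Rightarrow> nat list \<Rightarrow> nat list \<Rightarrow> nat list" where
  "shuffle_at S u v = map (\<lambda>j. if j \<in> S then 2 * u ! (rank S j - 1)
     else 2 * v ! (rank ({1..length u + length v} - S) j - 1) + 1) [1..<Suc (length u + length v)]"

lemma length_shuffle_at [simp]: "length (shuffle_at S u v) = length u + length v"
  by (simp add: shuffle_at_def del: upt_Suc)

lemma nth_shuffle_at:
  assumes "j \<in> {1..length u + length v}"
  shows "shuffle_at S u v ! (j - 1) = (if j \<in> S then 2 * u ! (rank S j - 1)
     else 2 * v ! (rank ({1..length u + length v} - S) j - 1) + 1)"
proof -
  have "[1..<Suc (length u + length v)] ! (j - 1) = j" "j - 1 < length [1..<Suc (length u + length v)]"
    using assms by (auto simp del: upt_Suc)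
  thus ?thesis unfolding shuffle_at_def by (simp only: nth_map)
qed

lemma length_unshuffles: "w \<in> unshuffles u v \<Longrightarrow> length w = length u + length v"
  using sum_length_filter_compl[of even w] by (auto simp: unshuffles_def)

lemma positions_odd: "{1..length w} - positions even w = positions odd w"
  by (auto simp: positions_def)

lemma shuffle_at_positions:
  assumes w: "w \<in> unshuffles u v"
  shows "shuffle_at (positions even w) u v = w"
proof (rule nth_equalityI)
  note len = length_unshuffles[OF w]
  show "length (shuffle_at (positions even w) u v) = length w" using len by simp
  fix i assume "i < length (shuffle_at (positions even w) u v)"
  hence i: "Suc i \<in> {1..length w}" using len by simp
  have u: "u = map (\<lambda>i. i div 2) (filter even w)" and v: "v = map (\<lambda>i. i div 2) (filter odd w)"
    using w by (auto simp: unshuffles_def)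
  have lt: "rank (positions P w) j - 1 < length (filter P w)" if j: "j \<in> positions P w" for P j
    using rank_in[of "positions P w" j] j card_positions[of P w] by (auto simp: positions_def)
  show "shuffle_at (positions even w) u v ! i = w ! i"
  proof (cases "even (w ! i)")
    case True
    hence p: "Suc i \<in> positions even w" using i by (simp add: positions_def)
    have "shuffle_at (positions even w) u v ! i = 2 * u ! (rank (positions even w) (Suc i) - 1)"
      using nth_shuffle_at[of "Suc i" u v "positions even w"] i p len by simp
    also have "\<dots> = w ! i" using nth_filter_rank[OF p] lt[OF p] True unfolding u by simp
    finally show ?thesis .
  next
    case False
    hence p: "Suc i \<in> positions odd w" "Suc i \<notin> positions even w" using i by (simp_all add: positions_def)
    have "shuffle_at (positions even w) u v ! i = 2 * v ! (rank ({1..length w} - positions even w) (Suc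
        i) - 1) + 1"
      using nth_shuffle_at[of "Suc i" u v "positions even w"] i p len by simp
    also have "\<dots> = w ! i" unfolding positions_odd using nth_filter_rank[OF p(1)] lt[OF p(1)] False
        unfolding v by simp
    finally show ?thesis .
  qed
qed

lemma positions_shuffle_at:
  assumes "S \<subseteq> {1..length u + length v}"
  shows "positions even (shuffle_at S u v) = S"
proof -
  have "even (shuffle_at S u v ! (j - 1)) \<longleftrightarrow> j \<in> S" if "j \<in> {1..length u + length v}" for j
    unfolding nth_shuffle_at[OF that] by simp
  thus ?thesis unfolding positions_def length_shuffle_at using assms by blast
qed

lemma shuffle_at_in:
  assumes S: "S \<subseteq> {1..length u + length v}" and c: "card S = length u"
  shows "shuffle_at S u v \<in> unshuffles u v"
proof -
  let ?w = "shuffle_at S u v" and ?T = "{1..length u + length v} - S"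
  note fin = finite_subset_interval[OF S]
  have pe: "positions even ?w = S" by (rule positions_shuffle_at[OF S])
  have po: "positions odd ?w = ?T" using positions_odd[of ?w] unfolding pe length_shuffle_at ..
  have cT: "card ?T = length v" using S c fin by (simp add: card_Diff_subset)
  have "map (\<lambda>i. i div 2) (filter even ?w) = u"
  proof (rule nth_equalityI)
    show len: "length (map (\<lambda>i. i div 2) (filter even ?w)) = length u"
      using card_positions[of even ?w] pe c by simp
    fix k assume "k < length (map (\<lambda>i. i div 2) (filter even ?w))"
    hence k: "k < length (filter even ?w)" "Suc k \<in> {1..card S}" using len c by simp_all
    obtain j where j: "Suc k = rank S j" "j \<in> S" using k(2) unfolding rank_image[OF fin, symmetric]
        by (elim imageE)
    have jn: "j \<in> {1..length u + length v}" using j(2) S by blast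
    have "filter even ?w ! (rank S j - 1) = ?w ! (j - 1)"
      using nth_filter_rank[of j even ?w] j(2) unfolding pe by blast
    hence "filter even ?w ! k = ?w ! (j - 1)" unfolding j(1)[symmetric] by simp
    also have "\<dots> = 2 * u ! (rank S j - 1)" unfolding nth_shuffle_at[OF jn] using j(2) by simp
    also have "\<dots> = 2 * u ! k" unfolding j(1)[symmetric] by simp
    finally show "map (\<lambda>i. i div 2) (filter even ?w) ! k = u ! k" using k(1) by simp
  qed
  moreover have "map (\<lambda>i. i div 2) (filter odd ?w) = v"
  proof (rule nth_equalityI)
    show len: "length (map (\<lambda>i. i div 2) (filter odd ?w)) = length v"
      using card_positions[of odd ?w] po cT by simp
    fix k assume "k < length (map (\<lambda>i. i div 2) (filter odd ?w))"
    hence k: "k < length (filter odd ?w)" "Suc k \<in> {1..card ?T}" using len cT by simp_all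
    have finT: "finite ?T" by simp
    obtain j where j: "Suc k = rank ?T j" "j \<in> ?T" using k(2) unfolding rank_image[OF finT, symmetric]
        by (elim imageE)
    have jn: "j \<in> {1..length u + length v}" "j \<notin> S" using j(2) by blast+
    have "filter odd ?w ! (rank ?T j - 1) = ?w ! (j - 1)"
      using nth_filter_rank[of j odd ?w] j(2) unfolding po by blast
    hence "filter odd ?w ! k = ?w ! (j - 1)" unfolding j(1)[symmetric] by simp
    also have "\<dots> = 2 * v ! (rank ?T j - 1) + 1" unfolding nth_shuffle_at[OF jn(1)] using jn(2) by simp
    also have "\<dots> = 2 * v ! k + 1" unfolding j(1)[symmetric] by simp
    finally show "map (\<lambda>i. i div 2) (filter odd ?w) ! k = v ! k" using k(1) by simp
  qed
  ultimately show ?thesis by (simp add: unshuffles_def)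
qed

lemma prod_standard_restrict:
  assumes S: "S \<subseteq> {1..psize X}" and one: "\<phi> {} = (1 :: 'k::comm_ring_1)"
  shows "(\<Prod>C\<in>blocks (standard_restrict S X). \<phi> C) = (\<Prod>B\<in>blocks X. \<phi> (rank S ` (B \<inter> S)))"
proof -
  let ?Q = "{B\<in>blocks X. B \<inter> S \<noteq> {}}"
  have "blocks (standard_restrict S X) = (\<lambda>B. rank S ` (B \<inter> S)) ` ?Q"
    unfolding blocks_standard_restrict[OF S] by auto
  moreover have "inj_on (\<lambda>B. rank S ` (B \<inter> S)) ?Q"
  proof (rule inj_onI)
    fix B C assume B: "B \<in> ?Q" and C: "C \<in> ?Q" and eq: "rank S ` (B \<inter> S) = rank S ` (C \<inter> S)"
    have "B \<inter> S = C \<inter> S"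
      using inj_on_image_eq_iff[OF inj_on_rank[OF finite_subset_interval[OF S]], of "B \<inter> S" "C \<inter> S"] eq
          by simp
    then obtain j where "j \<in> B" "j \<in> C" using B by blast
    thus "B = C" using B C blocks_disjoint by blast
  qed
  ultimately have "(\<Prod>C\<in>blocks (standard_restrict S X). \<phi> C) = (\<Prod>B\<in>?Q. \<phi> (rank S ` (B \<inter> S)))"
    by (simp add: prod.reindex)
  also have "\<dots> = (\<Prod>B\<in>blocks X. \<phi> (rank S ` (B \<inter> S)))"
    by (rule prod.mono_neutral_left) (auto simp: finite_blocks one)
  finally show ?thesis .
qed

lemma colors_restrict:
  assumes S: "finite S" and B: "finite B" and w: "\<And>j. j \<in> B \<Longrightarrow> j \<in> S \<Longrightarrow> w ! (j - 1) = h (u ! (rank S j - 1))"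
  shows "colors w (B \<inter> S) = image_mset h (colors u (rank S ` (B \<inter> S)))"
proof -
  have "inj_on (rank S) (B \<inter> S)" by (rule inj_on_subset[OF inj_on_rank[OF S]]) simp
  hence "mset_set (rank S ` (B \<inter> S)) = image_mset (rank S) (mset_set (B \<inter> S))"
    by (rule image_mset_mset_set[symmetric])
  thus ?thesis unfolding colors_def by (simp only: multiset.map_comp o_def)
    (rule image_mset_cong, use B w in simp)
qed

text \<open>In a block \<open>B\<close> the letters at the positions in \<open>S\<close> are even
  and the others are odd. As \<open>\<psi>\<close> is multiplicative for this separation, the factor
  of \<open>B\<close> splits into one factor for \<open>B \<inter> S\<close> and one for its
  complement.\<close>

lemma block_prod_unshuffle:
  fixes \<psi> :: "nat multiset \<Rightarrow> 'k::comm_ring_1"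
  assumes one: "\<psi> {#} = 1"
    and mult: "\<And>M N. \<psi> (image_mset (\<lambda>i. 2 * i) M + image_mset (\<lambda>i. 2 * i + 1) N) = \<psi> M * \<psi> N"
    and w: "w \<in> unshuffles u v" and len: "length w = psize X"
  defines "S \<equiv> positions even w"
  shows "block_prod \<psi> X w = block_prod \<psi> (standard_restrict S X) u * block_prod \<psi> (standard_restrict
      ({1..psize X} - S) X) v"
proof -
  let ?T = "{1..psize X} - S"
  have S: "S \<subseteq> {1..psize X}" unfolding S_def positions_def len[symmetric] by blast
  have T: "?T \<subseteq> {1..psize X}" by blast
  have n: "length u + length v = psize X" using length_unshuffles[OF w] len by simp
  have cu: "card S = length u" using w unfolding S_def card_positions by (auto simp: unshuffles_def)
  have cv: "card ?T = length v"
    using cu n S card_Diff_subset[OF finite_subset_interval[OF S] S] by simp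
  have ws: "w = shuffle_at S u v" unfolding S_def by (rule shuffle_at_positions[OF w, symmetric])
  have colors: "colors w B = image_mset (\<lambda>i. 2 * i) (colors u (rank S ` (B \<inter> S)))
      + image_mset (\<lambda>i. 2 * i + 1) (colors v (rank ?T ` (B \<inter> ?T)))" if B: "B \<in> blocks X" for B
  proof -
    note fin = finite_block[OF B]
    have B_sub: "j \<in> {1..length u + length v}" if "j \<in> B" for j
      unfolding n using blocks_subset[OF B] that by blast
    have "colors w (B \<inter> S) = image_mset (\<lambda>i. 2 * i) (colors u (rank S ` (B \<inter> S)))"
      by (rule colors_restrict[OF finite_subset_interval[OF S] fin], unfold ws, subst nth_shuffle_at[OF
          B_sub]) simp_all
    moreover have "colors w (B \<inter> ?T) = image_mset (\<lambda>i. 2 * i + 1) (colors v (rank ?T ` (B \<inter> ?T)))"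
      by (rule colors_restrict[OF finite_subset_interval[OF T] fin], unfold ws, subst nth_shuffle_at[OF
          B_sub]) (simp_all add: n)
    moreover have "mset_set B = mset_set (B \<inter> S) + mset_set (B \<inter> ?T)"
    proof -
      have "B = (B \<inter> S) \<union> (B \<inter> ?T)" "(B \<inter> S) \<inter> (B \<inter> ?T) = {}" using blocks_subset[OF B] by blast+
      thus ?thesis using mset_set_Union[of "B \<inter> S" "B \<inter> ?T"] fin by simp
    qed
    ultimately show ?thesis unfolding colors_def by simp
  qed
  have e: "\<psi> (colors z {}) = 1" for z by (simp add: colors_def one)
  have "block_prod \<psi> X w = (\<Prod>B\<in>blocks X. \<psi> (colors w B))" using len by (simp add: block_prod_def)
  also have "\<dots> = (\<Prod>B\<in>blocks X. \<psi> (colors u (rank S ` (B \<inter> S))) * \<psi> (colors v (rank ?T ` (B \<inter> ?T))))"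
    by (rule prod.cong[OF refl]) (simp only: colors mult)
  also have "\<dots> = (\<Prod>B\<in>blocks X. \<psi> (colors u (rank S ` (B \<inter> S)))) * (\<Prod>B\<in>blocks X. \<psi> (colors v (rank ?T `
      (B \<inter> ?T))))"
    by (rule prod.distrib)
  also have "\<dots> = block_prod \<psi> (standard_restrict S X) u * block_prod \<psi> (standard_restrict ?T X) v"
    unfolding block_prod_def psize_standard_restrict[OF S] psize_standard_restrict[OF T] cu cv
    using prod_standard_restrict[OF S, of "\<lambda>C. \<psi> (colors u C)", OF e]
      prod_standard_restrict[OF T, of "\<lambda>C. \<psi> (colors v C)", OF e] by simp
  finally show ?thesis .
qed

text \<open>A word in \<open>unshuffles u v\<close> amounts to the set of positions of its even
  letters. Sets of the wrong size contribute zero on the left.\<close>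

lemma sum_block_prod_unshuffles:
  fixes \<psi> :: "nat multiset \<Rightarrow> 'k::comm_ring_1"
  assumes one: "\<psi> {#} = 1"
    and mult: "\<And>M N. \<psi> (image_mset (\<lambda>i. 2 * i) M + image_mset (\<lambda>i. 2 * i + 1) N) = \<psi> M * \<psi> N"
  shows "(\<Sum>S\<in>Pow {1..psize X}. block_prod \<psi> (standard_restrict S X) u * block_prod \<psi> (standard_restrict
      ({1..psize X} - S) X) v)
    = (\<Sum>w\<in>unshuffles u v. block_prod \<psi> X w)"
proof (cases "length u + length v = psize X")
  case True
  let ?N = "{1..psize X}"
  let ?t = "\<lambda>S. block_prod \<psi> (standard_restrict S X) u * block_prod \<psi> (standard_restrict (?N - S) X) v"
  have "(\<Sum>S\<in>Pow ?N. ?t S) = (\<Sum>S | S \<subseteq> ?N \<and> card S = length u. ?t S)"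
  proof (rule sum.mono_neutral_right)
    show "\<forall>S\<in>Pow ?N - {S. S \<subseteq> ?N \<and> card S = length u}. ?t S = 0"
      by (auto simp: block_prod_def psize_standard_restrict)
  qed auto
  also have "\<dots> = (\<Sum>w\<in>unshuffles u v. block_prod \<psi> X w)"
  proof (rule sum.reindex_bij_witness[where i = "positions even" and j = "\<lambda>S. shuffle_at S u v"])
    fix S assume "S \<in> {S. S \<subseteq> ?N \<and> card S = length u}"
    hence S: "S \<subseteq> {1..length u + length v}" "card S = length u" using True by auto
    show pos: "positions even (shuffle_at S u v) = S" by (rule positions_shuffle_at[OF S(1)])
    show in_sh: "shuffle_at S u v \<in> unshuffles u v" by (rule shuffle_at_in[OF S])
    show "block_prod \<psi> X (shuffle_at S u v) = ?t S"
      using block_prod_unshuffle[of \<psi>, OF one mult in_sh, of X] True unfolding pos by simp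
  next
    fix w assume w: "w \<in> unshuffles u v"
    show "shuffle_at (positions even w) u v = w" by (rule shuffle_at_positions[OF w])
    have "card (positions even w) = length u" using w unfolding card_positions
        by (auto simp: unshuffles_def)
    moreover have "positions even w \<subseteq> ?N" unfolding positions_def using length_unshuffles[OF w] True by auto
    ultimately show "positions even w \<in> {S. S \<subseteq> ?N \<and> card S = length u}" by simp
  qed
  finally show ?thesis .
next
  case False
  have "block_prod \<psi> (standard_restrict S X) u * block_prod \<psi> (standard_restrict ({1..psize X} - S) X) v
      = 0"
    if S: "S \<in> Pow {1..psize X}" for S
  proof (rule ccontr)
    assume nz: "block_prod \<psi> (standard_restrict S X) u * block_prod \<psi> (standard_restrict ({1..psize X} -
        S) X) v \<noteq> 0"
    have sub: "S \<subseteq> {1..psize X}" "{1..psize X} - S \<subseteq> {1..psize X}" using S by auto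
    have "length u = card S" "length v = card ({1..psize X} - S)"
      using nz unfolding block_prod_def psize_standard_restrict[OF sub(1)] psize_standard_restrict[OF
          sub(2)]
      by (simp_all only: mult_zero_left mult_zero_right not_True_eq_False refl split: if_splits)
    moreover have "card S \<le> psize X" using card_mono[OF _ sub(1)] by simp
    ultimately show False using False sub(1) by (simp add: card_Diff_subset finite_subset_interval)
  qed
  moreover have "block_prod \<psi> X w = 0" if "w \<in> unshuffles u v" for w
    using length_unshuffles[OF that] False by (simp add: block_prod_def)
  ultimately show ?thesis by simp
qed

lemma count_image_mset_inj: "inj f \<Longrightarrow> count (image_mset f M) (f x) = count M x"
  by (induction M) (auto simp: inj_eq)

lemma count_prod_double:
  "count_prod g (image_mset (\<lambda>i. 2 * i) M + image_mset (\<lambda>i. 2 * i + 1) N) = count_prod g M * count_prod g N"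
proof -
  let ?a = "\<lambda>i :: nat. 2 * i" and ?b = "\<lambda>i :: nat. 2 * i + 1"
  let ?L = "image_mset ?a M + image_mset ?b N"
  have inj: "inj ?a" "inj ?b" by (auto simp: inj_def)
  have b: "count (image_mset ?b N) (2 * i) = 0" and a: "count (image_mset ?a M) (2 * i + 1) = 0" for i
    by (auto simp: count_eq_zero_iff) presburger+
  have "count_prod g ?L = (\<Prod>i\<in>?a ` set_mset M. g (count ?L i)) * (\<Prod>i\<in>?b ` set_mset N. g (count ?L i))"
    unfolding count_prod_def set_mset_union set_image_mset
    by (rule prod.union_disjoint) (auto, presburger)
  also have "(\<Prod>i\<in>?a ` set_mset M. g (count ?L i)) = count_prod g M"
  proof -
    have "(\<Prod>i\<in>?a ` set_mset M. g (count ?L i)) = (\<Prod>i\<in>set_mset M. g (count ?L (?a i)))"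
      by (subst prod.reindex) (auto simp: inj_on_def)
    also have "\<dots> = count_prod g M" unfolding count_prod_def count_union b count_image_mset_inj[OF
        inj(1)] by simp
    finally show ?thesis .
  qed
  also have "(\<Prod>i\<in>?b ` set_mset N. g (count ?L i)) = count_prod g N"
  proof -
    have "(\<Prod>i\<in>?b ` set_mset N. g (count ?L i)) = (\<Prod>i\<in>set_mset N. g (count ?L (?b i)))"
      by (subst prod.reindex) (auto simp: inj_on_def)
    also have "\<dots> = count_prod g N" unfolding count_prod_def count_union a count_image_mset_inj[OF
        inj(2)] by simp
    finally show ?thesis .
  qed
  finally show ?thesis .
qed

lemma nc_doubled_unshuffles: "nc_doubled F u v = (\<Sum>w\<in>unshuffles u v. nc_coeff F w)"
  by (simp add: nc_doubled_def unshuffles_def)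

text \<open>The tensor on the left is the image of the coproduct in \<open>K(\<^bold>\<Pi>)\<close>;
  it represents the series in the doubled alphabet.\<close>

lemma nc_doubled_to_ncsym:
  "lin_ext (*) (\<lambda>l. nc_coeff (l ! 0) u * nc_coeff (l ! 1) v) (push (map to_ncsym) (kpi_coprod x))
    = nc_doubled (to_ncsym (x :: 'k::field kpi)) u v"
proof (rule linear_eq_on_basis[where
      f = "\<lambda>x. lin_ext (*) (\<lambda>l. nc_coeff (l ! 0) u * nc_coeff (l ! 1) v) (push (map to_ncsym)
          (kpi_coprod x))" and
      g = "\<lambda>x. nc_doubled (to_ncsym x) u v"])
  show "lin fscale (*) (\<lambda>x :: 'k kpi. lin_ext (*) (\<lambda>l. nc_coeff (l ! 0) u * nc_coeff (l ! 1) v) (push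
      (map to_ncsym) (kpi_coprod x)))"
    by (rule linear_comp[OF linear_kpi_coprod linear_comp[OF linear_push linear_lin_ext[OF
        vector_space_times]]])
  show "lin fscale (*) (\<lambda>x :: 'k kpi. nc_doubled (to_ncsym x) u v)"
    unfolding nc_doubled_unshuffles
    by (rule linearI[OF vector_space_fscale vector_space_times])
      (simp_all add: linearD[OF linear_to_ncsym] sum.distrib sum_distrib_left)
  fix Z
  let ?N = "{1..psize Z}"
  have "lin_ext (*) (\<lambda>l. nc_coeff (l ! 0) u * nc_coeff (l ! 1) v) (push (map to_ncsym) (kpi_coprod
      (basis Z)))
    = (\<Sum>S\<in>Pow ?N. nc_coeff (refinement_sum (standard_restrict S Z)) u
        * nc_coeff (refinement_sum (standard_restrict (?N - S) Z)) (v :: nat list) :: 'k)"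
    unfolding kpi_coprod_single linearD[OF linear_push] push_single linearD[OF linear_lin_ext[OF
        vector_space_times]]
      lin_ext_single_1[OF vector_space_times] by (simp add: to_ncsym_single)
  also have "\<dots> = nc_doubled (to_ncsym (basis Z)) u v"
    unfolding nc_coeff_refinement_sum nc_doubled_unshuffles to_ncsym_single bell_prod_def
    by (rule sum_block_prod_unshuffles[OF _ count_prod_double]) (simp add: count_prod_def)
  finally show "lin_ext (*) (\<lambda>l. nc_coeff (l ! 0) u * nc_coeff (l ! 1) v) (push (map to_ncsym)
      (kpi_coprod (basis Z)))
    = nc_doubled (to_ncsym (basis Z :: 'k kpi)) u v" .
qed

lemma length_push_map: "l \<in> supp (push (map f) t) \<Longrightarrow> (\<And>l. l \<in> supp t \<Longrightarrow> length l = n) \<Longrightarrow> length l = n"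
  using supp_push[of "map f" t] by auto

text \<open>So the tensor required in the definition of \<open>nc_coprod\<close> exists, and it is
  unique because the coefficients separate the points of
  \<open>\<^bold>N\<^bold>C\<^bold>S\<^bold>y\<^bold>m\<close>.\<close>

lemma nc_coprod_spec:
  shows length_nc_coprod: "l \<in> supp (nc_coprod F) \<Longrightarrow> length l = 2"
    and nc_coprod_doubled:
      "lin_ext (*) (\<lambda>l. nc_coeff (l ! 0) u * nc_coeff (l ! 1) v) (nc_coprod F) = nc_doubled F u v"
proof -
  obtain x where x: "F = to_ncsym x" using bij_is_surj[OF bij_to_ncsym] by blast
  let ?P = "\<lambda>t. (\<forall>l\<in>supp t. length l = 2) \<and>
     (\<forall>u v. (\<Sum>l\<in>supp t. coef t l * (nc_coeff (l ! 0) u * nc_coeff (l ! 1) v))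
         = nc_doubled (to_ncsym x) u v)"
  let ?t = "push (map to_ncsym) (kpi_coprod x)"
  have len: "length l = 2" if "l \<in> supp ?t" for l
    using that by (rule length_push_map) (rule length_kpi_coprod)
  have t: "?P ?t"
    using nc_doubled_to_ncsym[of _ _ x] len by (simp add: lin_ext_def)
  hence c: "?P (nc_coprod (to_ncsym x))" unfolding nc_coprod_def by (rule someI)
  show "l \<in> supp (nc_coprod F) \<Longrightarrow> length l = 2" using c[THEN conjunct1] unfolding x by (rule bspec)
  show "lin_ext (*) (\<lambda>l. nc_coeff (l ! 0) u * nc_coeff (l ! 1) v) (nc_coprod F) = nc_doubled F u v"
    unfolding x lin_ext_def using c[THEN conjunct2] by (elim allE)
qed

lemma nc_coprod_to_ncsym:
  "tensor_eq nc_scale 2 (nc_coprod (to_ncsym x)) (push (map to_ncsym) (kpi_coprod (x :: 'k::field kpi)))"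
proof (rule tensor_eq_if_functionals_eq[OF vector_space_nc_scale linear_nc_coeff])
  show "a = 0" if "\<And>w. nc_coeff a w = 0" for a :: "'k ncsym"
    by (rule nc_coeff_eqI) (simp add: that)
  show "length l = 2" if "l \<in> supp (push (map to_ncsym) (kpi_coprod x))" for l
    using that by (rule length_push_map) (rule length_kpi_coprod)
  show "length l = 2" if "l \<in> supp (nc_coprod (to_ncsym x))" for l
    using that by (rule length_nc_coprod)
  show "(\<Sum>l\<in>supp (nc_coprod (to_ncsym x)). coef (nc_coprod (to_ncsym x)) l * (nc_coeff (l ! 0) u *
      nc_coeff (l ! 1) v))
    = (\<Sum>l\<in>supp (push (map to_ncsym) (kpi_coprod x)). coef (push (map to_ncsym) (kpi_coprod x)) l *
        (nc_coeff (l ! 0) u * nc_coeff (l ! 1) v))" for u v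
    unfolding lin_ext_def[of "(*)", symmetric] nc_coprod_doubled nc_doubled_to_ncsym ..
qed

lemma NCSym_simps [simp]:
  "scale NCSym = nc_scale" "coprod NCSym = nc_coprod" "counit NCSym F = nc_coeff F []"
  by (simp_all add: NCSym_def)

lemma KPi_simps [simp]:
  "scale KPi = fscale" "coprod KPi = kpi_coprod" "counit KPi x = coef x 0" "part KPi n = kpi_part n"
  by (simp_all add: KPi_def kpi_counit_def)

theorem hopf_iso_to_ncsym: "hopf_iso KPi NCSym (to_ncsym :: 'k::field kpi \<Rightarrow> 'k ncsym)"
proof -
  have "graded_connected_hopf_algebra (NCSym :: ('k, 'k ncsym) hopf_data)"
    by (rule graded_connected_hopf_algebra_bij[OF hopf_KPi, of _ to_ncsym])
      (simp_all add: linear_to_ncsym bij_to_ncsym to_ncsym_one to_ncsym_mult nc_coprod_to_ncsym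
          to_ncsym_counit to_ncsym_part)
  thus ?thesis unfolding hopf_iso_def
    by (simp add: hopf_KPi linear_to_ncsym bij_to_ncsym to_ncsym_one to_ncsym_mult nc_coprod_to_ncsym
        to_ncsym_counit to_ncsym_part)
qed

section \<open>Letting the variables commute\<close>

lemma sym_coeff_simps [simp]:
  "sym_coeff 0 M = 0" "sym_coeff (F + G) M = sym_coeff F M + sym_coeff G M"
  "sym_coeff (sym_scale c F) M = c * sym_coeff F M"
  by (simp_all add: zero_sym.rep_eq plus_sym.rep_eq sym_scale.rep_eq)

lemma sym_coeff_sum: "sym_coeff (sum f A) M = (\<Sum>a\<in>A. sym_coeff (f a) M)"
  by (induction A rule: infinite_finite_induct) simp_all

lemma sym_coeff_eqI: "(\<And>M. sym_coeff F M = sym_coeff G M) \<Longrightarrow> F = G"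
  by (simp add: sym_coeff_inject[symmetric] fun_eq_iff)

lemma vector_space_sym_scale: "vector_space (sym_scale :: 'k::field \<Rightarrow> _)"
  unfolding vector_space_def by (auto intro!: sym_coeff_eqI simp: algebra_simps)

lemma linear_sym_coeff: "lin sym_scale (*) (\<lambda>F. sym_coeff F M)"
  by (rule linearI[OF vector_space_sym_scale vector_space_times]) simp_all

lemma finite_words_mset [simp]: "finite {w. mset w = M}"
  using finite_permutations_of_multiset[of M] by (simp add: permutations_of_multiset_def)

lemma words_mset_nonempty: "{w. mset w = M} \<noteq> {}"
  using ex_mset[of M] by blast

lemma sym_coeff_commute_vars: "sym_coeff (commute_vars F) M = (\<Sum>w | mset w = M. nc_coeff F w)"
  by (simp add: commute_vars.rep_eq)

lemma linear_commute_vars: "lin nc_scale sym_scale commute_vars"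
  by (rule linearI[OF vector_space_nc_scale vector_space_sym_scale]; rule sym_coeff_eqI)
    (simp_all add: sym_coeff_commute_vars sum.distrib sum_distrib_left)

lemma commute_vars_one: "commute_vars 1 = 1"
  by (rule sym_coeff_eqI) (auto simp: sym_coeff_commute_vars one_ncsym.rep_eq one_sym.rep_eq)

lemma commute_vars_mult: "commute_vars (F * G) = commute_vars F * commute_vars G"
proof (rule sym_coeff_eqI)
  fix M :: "nat multiset"
  let ?W = "{(u, v). mset u + mset v = M}"
  let ?h = "\<lambda>p. nc_coeff F (fst p) * nc_coeff G (snd p)"
  have W: "?W = (\<Union>(A, B)\<in>{(A, B). A + B = M}. {u. mset u = A} \<times> {v. mset v = B})" by auto
  have fin: "finite ?W"
    unfolding W
  proof (rule finite_UN_I[OF finite_add_pairs])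
    fix p :: "nat multiset \<times> nat multiset"
    show "finite (case p of (A, B) \<Rightarrow> {u. mset u = A} \<times> {v. mset v = B})" by (cases p) simp
  qed
  have "sym_coeff (commute_vars (F * G)) M
    = (\<Sum>w | mset w = M. \<Sum>p | p \<in> ?W \<and> fst p @ snd p = w. ?h p)"
    unfolding sym_coeff_commute_vars
  proof (rule sum.cong[OF refl])
    fix w assume "w \<in> {w. mset w = M}"
    hence M: "M = mset w" by simp
    have "{(u, v). u @ v = w} = {p. p \<in> ?W \<and> fst p @ snd p = w}"
    proof (rule set_eqI)
      fix p :: "nat list \<times> nat list"
      show "p \<in> {(u, v). u @ v = w} \<longleftrightarrow> p \<in> {p. p \<in> ?W \<and> fst p @ snd p = w}"
        unfolding M by (cases p) auto
    qed
    moreover have "nc_coeff (F * G) w = (\<Sum>p\<in>{(u, v). u @ v = w}. ?h p)"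
      unfolding times_ncsym.rep_eq by (rule sum.cong[OF refl]) (simp add: case_prod_unfold)
    ultimately show "nc_coeff (F * G) w = (\<Sum>p | p \<in> ?W \<and> fst p @ snd p = w. ?h p)"
      by (simp only:)
  qed
  also have "\<dots> = sum ?h ?W"
    by (rule sum.group[OF fin]) auto
  also have "\<dots> = (\<Sum>q\<in>{(A, B). A + B = M}. \<Sum>p | p \<in> ?W \<and> (mset (fst p), mset (snd p)) = q. ?h p)"
    by (rule sum.group[OF fin finite_add_pairs, symmetric]) auto
  also have "\<dots> = (\<Sum>(A, B)\<in>{(A, B). A + B = M}. sym_coeff (commute_vars F) A * sym_coeff (commute_vars G) B)"
  proof (rule sum.cong[OF refl])
    fix q assume "q \<in> {(A, B). A + B = M}"
    then obtain A B where q: "q = (A, B)" "A + B = M" by blast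
    have "{p. p \<in> ?W \<and> (mset (fst p), mset (snd p)) = q} = {u. mset u = A} \<times> {v. mset v = B}"
    proof (rule set_eqI)
      fix p :: "nat list \<times> nat list"
      show "p \<in> {p. p \<in> ?W \<and> (mset (fst p), mset (snd p)) = q} \<longleftrightarrow> p \<in> {u. mset u = A} \<times> {v. mset v = B}"
        unfolding q(1) q(2)[symmetric] by (cases p) auto
    qed
    hence "(\<Sum>p | p \<in> ?W \<and> (mset (fst p), mset (snd p)) = q. ?h p) = (\<Sum>p\<in>{u. mset u = A} \<times> {v. mset v
        = B}. ?h p)"
      by (rule arg_cong)
    also have "\<dots> = sym_coeff (commute_vars F) A * sym_coeff (commute_vars G) B"
      unfolding sym_coeff_commute_vars sum_product sum.cartesian_product
      by (rule sum.cong[OF refl]) (simp add: case_prod_unfold)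
    finally show "(\<Sum>p | p \<in> ?W \<and> (mset (fst p), mset (snd p)) = q. ?h p)
      = (case q of (A, B) \<Rightarrow> sym_coeff (commute_vars F) A * sym_coeff (commute_vars G) B)" by (simp add: q)
  qed
  finally show "sym_coeff (commute_vars (F * G)) M = sym_coeff (commute_vars F * commute_vars G) M"
    by (simp add: times_sym.rep_eq)
qed

lemma commute_vars_counit: "sym_coeff (commute_vars F) {#} = nc_coeff F []"
  by (simp add: sym_coeff_commute_vars)

text \<open>In characteristic zero a symmetric function is lifted by distributing each coefficient
  equally over the words which give the monomial.\<close>

lift_definition spread :: "'k::field_char_0 sym \<Rightarrow> 'k ncsym" is
  "\<lambda>G w. G (mset w) / of_nat (card {w'. mset w' = mset w})"
proof (intro conjI allI impI)
  fix G :: "nat multiset \<Rightarrow> 'k"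
  assume G: "(\<exists>d. \<forall>M. d < size M \<longrightarrow> G M = 0) \<and> (\<forall>n \<sigma> M. \<sigma> permutes {..<n} \<longrightarrow> G (image_mset \<sigma> M) = G M)"
  then obtain d where "\<forall>M. d < size M \<longrightarrow> G M = 0" by blast
  thus "\<exists>d. \<forall>w. d < length w \<longrightarrow> G (mset w) / of_nat (card {w'. mset w' = mset w}) = 0"
    by (intro exI[of _ d]) simp
  fix n :: nat and \<sigma> :: "nat \<Rightarrow> nat" and w assume s: "\<sigma> permutes {..<n}"
  have inv: "map (inv \<sigma>) (map \<sigma> x) = x" "map \<sigma> (map (inv \<sigma>) x) = x" for x
    by (simp_all add: permutes_inv_o[OF s])
  have invm: "image_mset (inv \<sigma>) (image_mset \<sigma> M) = M" "image_mset \<sigma> (image_mset (inv \<sigma>) M) = M" for M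
    by (simp_all add: multiset.map_comp permutes_inv_o[OF s])
  have "bij_betw (map \<sigma>) {w'. mset w' = mset w} {w'. mset w' = mset (map \<sigma> w)}"
    by (rule bij_betw_byWitness[where f' = "map (inv \<sigma>)"]) (use inv invm in auto)
  hence "card {w'. mset w' = mset w} = card {w'. mset w' = mset (map \<sigma> w)}" by (rule bij_betw_same_card)
  moreover have "G (mset (map \<sigma> w)) = G (mset w)" using G s by simp
  ultimately show "G (mset (map \<sigma> w)) / of_nat (card {w'. mset w' = mset (map \<sigma> w)})
    = G (mset w) / of_nat (card {w'. mset w' = mset w})" by simp
qed

lemma commute_vars_spread: "commute_vars (spread G) = G"
proof (rule sym_coeff_eqI)
  fix M :: "nat multiset"
  have "card {w. mset w = M} \<noteq> 0" using words_mset_nonempty[of M] by simp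
  moreover have "sym_coeff (commute_vars (spread G)) M = (\<Sum>w | mset w
      = M. sym_coeff G M / of_nat (card {w. mset w = M}))"
    unfolding sym_coeff_commute_vars spread.rep_eq by (rule sum.cong) auto
  ultimately show "sym_coeff (commute_vars (spread G)) M = sym_coeff G M" by simp
qed

lemma surj_commute_vars: "surj (commute_vars :: 'k::field_char_0 ncsym \<Rightarrow> 'k sym)"
  using commute_vars_spread by (metis surjI)

lemma commute_vars_part: "commute_vars ` part NCSym n
    = part (Sym :: ('k::field_char_0, 'k sym) hopf_data) n"
proof (intro equalityI subsetI)
  fix G :: "'k sym" assume "G \<in> commute_vars ` part NCSym n"
  then obtain F where F: "G = commute_vars F" "F \<in> part NCSym n" by blast
  have "size M = n" if "sym_coeff G M \<noteq> 0" for M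
  proof (rule ccontr)
    assume "size M \<noteq> n"
    hence "nc_coeff F w = 0" if "mset w = M" for w using that F(2) by (auto simp: NCSym_def)
    thus False using that by (simp add: F(1) sym_coeff_commute_vars)
  qed
  thus "G \<in> part Sym n" by (simp add: Sym_def)
next
  fix G :: "'k sym" assume "G \<in> part Sym n"
  hence "spread G \<in> part NCSym n" by (auto simp: Sym_def NCSym_def spread.rep_eq)
  thus "G \<in> commute_vars ` part NCSym n" using commute_vars_spread by (metis imageI)
qed

lemma mset_double_iff:
  fixes w :: "nat list"
  shows "mset w = image_mset (\<lambda>i. 2 * i) A + image_mset (\<lambda>i. 2 * i + 1) B
    \<longleftrightarrow> mset (map (\<lambda>i. i div 2) (filter even w)) = A \<and> mset (map (\<lambda>i. i div 2) (filter odd w)) = B"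
proof
  assume w: "mset w = image_mset (\<lambda>i. 2 * i) A + image_mset (\<lambda>i. 2 * i + 1) B"
  have e: "filter_mset even (image_mset (\<lambda>i. 2 * i) M) = image_mset (\<lambda>i. 2 * i) M"
    "filter_mset even (image_mset (\<lambda>i. 2 * i + 1) M) = {#}"
    "filter_mset odd (image_mset (\<lambda>i. 2 * i) M) = {#}"
    "filter_mset odd (image_mset (\<lambda>i. 2 * i + 1) M) = image_mset (\<lambda>i. 2 * i + 1) M" for M :: "nat multiset"
    by (induction M) simp_all
  show "mset (map (\<lambda>i. i div 2) (filter even w)) = A \<and> mset (map (\<lambda>i. i div 2) (filter odd w)) = B"
    unfolding mset_map mset_filter w filter_union_mset e by (simp add: multiset.map_comp o_def)
next
  assume "mset (map (\<lambda>i. i div 2) (filter even w)) = A \<and> mset (map (\<lambda>i. i div 2) (filter odd w)) = B"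
  hence A: "A = image_mset (\<lambda>i. i div 2) (filter_mset even (mset w))"
    and B: "B = image_mset (\<lambda>i. i div 2) (filter_mset odd (mset w))" by (auto simp: mset_filter)
  have a: "image_mset (\<lambda>i. 2 * i) A = filter_mset even (mset w)"
    unfolding A multiset.map_comp by (rule trans[OF image_mset_cong[where g = "\<lambda>i. i"]]) auto
  have b: "image_mset (\<lambda>i. 2 * i + 1) B = filter_mset odd (mset w)"
    unfolding B multiset.map_comp by (rule trans[OF image_mset_cong[where g = "\<lambda>i. i"]]) auto
  show "mset w = image_mset (\<lambda>i. 2 * i) A + image_mset (\<lambda>i. 2 * i + 1) B"
    unfolding a b by (rule multiset_partition)
qed

text \<open>A word whose monomial is \<open>A\<close> in the \<open>x\<close>'s and \<open>B\<close>
  in the \<open>y\<close>'s unshuffles into a word with monomial \<open>A\<close> and one with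
  monomial \<open>B\<close>.\<close>

lemma sym_doubled_commute_vars:
  "sym_doubled (commute_vars F) A B = (\<Sum>u | mset u = A. \<Sum>v | mset v = B. nc_doubled F u v)"
proof -
  let ?W = "{w. mset w = image_mset (\<lambda>i. 2 * i) A + image_mset (\<lambda>i. 2 * i + 1) B}"
  define e where "e w = map (\<lambda>i. i div 2) (filter even w)" for w :: "nat list"
  define od where "od w = map (\<lambda>i. i div 2) (filter odd w)" for w :: "nat list"
  have W: "w \<in> ?W \<longleftrightarrow> mset (e w) = A \<and> mset (od w) = B" for w
    unfolding mem_Collect_eq mset_double_iff e_def od_def ..
  have "(\<Sum>u | mset u = A. \<Sum>v | mset v = B. nc_doubled F u v)
    = (\<Sum>p\<in>{u. mset u = A} \<times> {v. mset v = B}. nc_doubled F (fst p) (snd p))"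
    unfolding sum.cartesian_product by (rule sum.cong[OF refl]) (simp add: case_prod_unfold)
  also have "\<dots> = (\<Sum>p\<in>{u. mset u = A} \<times> {v. mset v = B}. \<Sum>w | w \<in> ?W \<and> (e w, od w) = p. nc_coeff F w)"
  proof (rule sum.cong[OF refl])
    fix p assume "p \<in> {u. mset u = A} \<times> {v. mset v = B}"
    then obtain u v where p: "p = (u, v)" "mset u = A" "mset v = B" by blast
    have "{w. e w = u \<and> od w = v} = {w. w \<in> ?W \<and> (e w, od w) = p}"
    proof (rule set_eqI)
      fix w
      show "w \<in> {w. e w = u \<and> od w = v} \<longleftrightarrow> w \<in> {w. w \<in> ?W \<and> (e w, od w) = p}"
        unfolding mem_Collect_eq[of w "\<lambda>w. w \<in> ?W \<and> (e w, od w) = p"] W using p by auto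
    qed
    moreover have "nc_doubled F (fst p) (snd p) = (\<Sum>w | e w = u \<and> od w = v. nc_coeff F w)"
      unfolding nc_doubled_def e_def od_def p(1) fst_conv snd_conv ..
    ultimately show "nc_doubled F (fst p) (snd p) = (\<Sum>w | w \<in> ?W \<and> (e w, od w) = p. nc_coeff F w)"
      by (simp only:)
  qed
  also have "\<dots> = (\<Sum>w\<in>?W. nc_coeff F w)"
  proof (rule sum.group)
    show "(\<lambda>w. (e w, od w)) ` ?W \<subseteq> {u. mset u = A} \<times> {v. mset v = B}"
    proof (rule image_subsetI)
      fix w assume "w \<in> ?W"
      thus "(e w, od w) \<in> {u. mset u = A} \<times> {v. mset v = B}" unfolding W by simp
    qed
    show "finite ?W" by (rule finite_words_mset)
    show "finite ({u. mset u = A} \<times> {v. mset v = B})" by (intro finite_cartesian_product finite_words_mset)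
  qed
  finally show ?thesis by (simp only: sym_doubled_def sym_coeff_commute_vars)
qed

lemma sym_doubled_push:
  "lin_ext (*) (\<lambda>l. sym_coeff (l ! 0) A * sym_coeff (l ! 1) B) (push (map commute_vars) (nc_coprod F))
    = sym_doubled (commute_vars F) A B"
proof -
  have "lin_ext (*) (\<lambda>l. sym_coeff (l ! 0) A * sym_coeff (l ! 1) B) (push (map commute_vars) (nc_coprod F))
    = lin_ext (*) (\<lambda>l. \<Sum>u | mset u = A. \<Sum>v | mset v
        = B. nc_coeff (l ! 0) u * nc_coeff (l ! 1) v) (nc_coprod F)"
    unfolding lin_ext_push[OF vector_space_times]
  proof (rule lin_ext_cong)
    fix l assume "l \<in> supp (nc_coprod F)"
    hence "length l = 2" by (rule length_nc_coprod)
    thus "sym_coeff (map commute_vars l ! 0) A * sym_coeff (map commute_vars l ! 1) B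
      = (\<Sum>u | mset u = A. \<Sum>v | mset v = B. nc_coeff (l ! 0) u * nc_coeff (l ! 1) v)"
      by (simp add: sym_coeff_commute_vars sum_product)
  qed
  also have "\<dots> = (\<Sum>u | mset u = A. \<Sum>v | mset v = B. nc_doubled F u v)"
    unfolding lin_ext_sum_fun[OF vector_space_times] nc_coprod_doubled ..
  finally show ?thesis by (simp add: sym_doubled_commute_vars)
qed

lemma sym_coprod_commute_vars:
  "tensor_eq sym_scale 2 (sym_coprod (commute_vars F)) (push (map commute_vars) (nc_coprod F))"
proof -
  let ?P = "\<lambda>t. (\<forall>l\<in>supp t. length l = 2) \<and>
     (\<forall>A B. (\<Sum>l\<in>supp t. coef t l * (sym_coeff (l ! 0) A * sym_coeff (l ! 1) B))
         = sym_doubled (commute_vars F) A B)"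
  let ?t = "push (map commute_vars) (nc_coprod F)"
  have len: "length l = 2" if "l \<in> supp ?t" for l
    using that by (rule length_push_map) (rule length_nc_coprod)
  have t: "?P ?t" using sym_doubled_push[of _ _ F] len by (simp add: lin_ext_def)
  hence c: "?P (sym_coprod (commute_vars F))" unfolding sym_coprod_def by (rule someI)
  show ?thesis
  proof (rule tensor_eq_if_functionals_eq[OF vector_space_sym_scale linear_sym_coeff])
    show "a = 0" if "\<And>M. sym_coeff a M = 0" for a :: "'a sym"
      by (rule sym_coeff_eqI) (simp add: that)
    show "length l = 2" if "l \<in> supp ?t" for l using that by (rule len)
    show "length l = 2" if "l \<in> supp (sym_coprod (commute_vars F))" for l
      using that by (rule bspec[OF c[THEN conjunct1]])
    show "(\<Sum>l\<in>supp (sym_coprod (commute_vars F)). coef (sym_coprod (commute_vars F)) l * (sym_coeff (l !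
        0) A * sym_coeff (l ! 1) B))
      = (\<Sum>l\<in>supp ?t. coef ?t l * (sym_coeff (l ! 0) A * sym_coeff (l ! 1) B))" for A B
      by (rule trans[OF c[THEN conjunct2, THEN spec, THEN spec] t[THEN conjunct2, THEN spec, THEN spec,
          symmetric]])
  qed
qed

lemma Sym_simps [simp]:
  "scale Sym = sym_scale" "coprod Sym = sym_coprod" "counit Sym F = sym_coeff F {#}"
  by (simp_all add: Sym_def)

lemma hopf_NCSym: "graded_connected_hopf_algebra (NCSym :: ('k::field, 'k ncsym) hopf_data)"
  by (rule hopf_iso_to_ncsym[unfolded hopf_iso_def, THEN conjunct2, THEN conjunct1])

theorem hopf_Sym: "graded_connected_hopf_algebra (Sym :: ('k::field_char_0, 'k sym) hopf_data)"
proof (rule graded_connected_hopf_algebra_image[OF hopf_NCSym, of _ commute_vars])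
  fix g :: "nat \<Rightarrow> 'k sym"
  assume g: "\<And>n. g n \<in> part Sym n" "finite {n. g n \<noteq> 0}" "(\<Sum>n | g n \<noteq> 0. g n) = 0"
  show "g = (\<lambda>_. 0)"
  proof (intro ext sym_coeff_eqI)
    fix n M
    have hom: "sym_coeff (g k) M = 0" if "k \<noteq> size M" for k using g(1)[of k] that by (auto simp: Sym_def)
    have "0 = (\<Sum>k | g k \<noteq> 0. sym_coeff (g k) M)" using g(3) by (simp flip: sym_coeff_sum)
    also have "\<dots> = (\<Sum>k | g k \<noteq> 0. if k = size M then sym_coeff (g k) M else 0)"
      by (rule sum.cong[OF refl]) (simp add: hom)
    also have "\<dots> = sym_coeff (g (size M)) M" using g(2) by simp
    finally show "sym_coeff (g n) M = sym_coeff 0 M" using hom[of n] by (cases "n = size M") simp_all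
  qed
qed (simp_all add: linear_commute_vars surj_commute_vars commute_vars_one commute_vars_mult
    sym_coprod_commute_vars commute_vars_counit commute_vars_part)

section \<open>Images of the bases in commuting variables\<close>

subsection \<open>Words as functions on positions\<close>

definition word :: "nat \<Rightarrow> (nat \<Rightarrow> nat) \<Rightarrow> nat list" where
  "word n v = map v [1..<Suc n]"

text \<open>For \<open>A = [n]\<close> these are the words which become the monomial
  \<open>M\<close>. Arbitrary \<open>A\<close> are admitted in order to restrict a word to the
  blocks of a set partition.\<close>

definition colorings :: "'a set \<Rightarrow> nat multiset \<Rightarrow> ('a \<Rightarrow> nat) set" where
  "colorings A M = {v \<in> A \<rightarrow>\<^sub>E UNIV. image_mset v (mset_set A) = M}"

lemma length_word [simp]: "length (word n v) = n"
  by (simp add: word_def del: upt_Suc)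

lemma nth_word: "j \<in> {1..n} \<Longrightarrow> word n v ! (j - 1) = v j"
proof -
  assume "j \<in> {1..n}"
  hence "[1..<Suc n] ! (j - 1) = j" "j - 1 < length [1..<Suc n]" by (auto simp del: upt_Suc)
  thus ?thesis unfolding word_def by (simp only: nth_map)
qed

lemma mset_word: "mset (word n v) = image_mset v (mset_set {1..n})"
proof -
  have "mset [1..<Suc n] = mset_set (set [1..<Suc n])" by (rule mset_set_set[symmetric]) simp
  also have "set [1..<Suc n] = {1..n}" by (auto simp del: upt_Suc)
  finally show ?thesis unfolding word_def by (simp only: mset_map)
qed

lemma colors_word:
  assumes "B \<subseteq> {1..n}"
  shows "colors (word n v) B = image_mset v (mset_set B)"
  unfolding colors_def
proof (rule image_mset_cong)
  fix j assume "j \<in># mset_set B"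
  hence "j \<in> {1..n}" using assms finite_subset_interval[OF assms] by auto
  thus "word n v ! (j - 1) = v j" by (rule nth_word)
qed

lemma bij_colorings_words:
  assumes h: "bij_betw h {1..n} A" and n: "size M = n"
  shows "bij_betw (\<lambda>v. word n (\<lambda>j. v (h j))) (colorings A M) {w. mset w = M}"
proof (rule bij_betw_byWitness[where f' = "\<lambda>w. \<lambda>a\<in>A. w ! (inv_into {1..n} h a - 1)"])
  let ?g = "inv_into {1..n} h"
  have g: "?g a \<in> {1..n}" "h (?g a) = a" if "a \<in> A" for a
    using bij_betwE[OF bij_betw_inv_into[OF h]] bij_betw_inv_into_right[OF h] that by blast+
  have ms: "mset (word n (\<lambda>j. v (h j))) = image_mset v (mset_set A)" for v
  proof -
    have "mset_set A = image_mset h (mset_set {1..n})"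
      using image_mset_mset_set[OF bij_betw_imp_inj_on[OF h]] bij_betw_imp_surj_on[OF h] by simp
    thus ?thesis unfolding mset_word by (simp add: multiset.map_comp o_def)
  qed
  show "\<forall>v\<in>colorings A M. (\<lambda>a\<in>A. word n (\<lambda>j. v (h j)) ! (?g a - 1)) = v"
  proof (intro ballI ext)
    fix v a assume "v \<in> colorings A M"
    hence v: "v \<in> A \<rightarrow>\<^sub>E UNIV" by (simp add: colorings_def)
    show "(\<lambda>a\<in>A. word n (\<lambda>j. v (h j)) ! (?g a - 1)) a = v a"
    proof (cases "a \<in> A")
      case True
      thus ?thesis using g nth_word[of "?g a" n "\<lambda>j. v (h j)"] by simp
    next
      case False
      thus ?thesis using PiE_arb[OF v] by simp
    qed
  qed
  have inv: "word n (\<lambda>j. (\<lambda>a\<in>A. w ! (?g a - 1)) (h j)) = w" if "mset w = M" for w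
  proof (rule nth_equalityI)
    show len: "length (word n (\<lambda>j. (\<lambda>a\<in>A. w ! (?g a - 1)) (h j))) = length w" using that n by auto
    fix i assume "i < length (word n (\<lambda>j. (\<lambda>a\<in>A. w ! (?g a - 1)) (h j)))"
    hence i: "Suc i \<in> {1..n}" by simp
    have "h (Suc i) \<in> A" "?g (h (Suc i)) = Suc i"
      using bij_betwE[OF h] i bij_betw_inv_into_left[OF h i] by blast+
    thus "word n (\<lambda>j. (\<lambda>a\<in>A. w ! (?g a - 1)) (h j)) ! i = w ! i"
      using nth_word[OF i, of "\<lambda>j. (\<lambda>a\<in>A. w ! (?g a - 1)) (h j)"] by simp
  qed
  thus "\<forall>w\<in>{w. mset w = M}. word n (\<lambda>j. (\<lambda>a\<in>A. w ! (?g a - 1)) (h j)) = w" by blast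
  show "(\<lambda>v. word n (\<lambda>j. v (h j))) ` colorings A M \<subseteq> {w. mset w = M}"
    by (rule image_subsetI) (simp add: ms colorings_def)
  show "(\<lambda>w. \<lambda>a\<in>A. w ! (?g a - 1)) ` {w. mset w = M} \<subseteq> colorings A M"
  proof (rule image_subsetI)
    fix w assume "w \<in> {w. mset w = M}"
    hence w: "mset w = M" by simp
    have "image_mset (\<lambda>a\<in>A. w ! (?g a - 1)) (mset_set A) = M"
      unfolding ms[symmetric] inv[OF w] by (rule w)
    thus "(\<lambda>a\<in>A. w ! (?g a - 1)) \<in> colorings A M" unfolding colorings_def by simp
  qed
qed

lemma colorings_empty: "size M \<noteq> card A \<Longrightarrow> colorings A M = {}"
  by (auto simp: colorings_def)

lemma finite_colorings:
  assumes "finite A"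
  shows "finite (colorings A M)"
proof (cases "size M = card A")
  case True
  obtain h where "bij_betw h {1..card A} A" using ex_bij_betw_nat_finite_1[OF assms] by blast
  thus ?thesis using bij_betw_finite[OF bij_colorings_words[OF _ True]] by simp
qed (simp add: colorings_empty)

text \<open>A bijection \<open>[n] \<rightarrow> A\<close> identifies the colorings with the
  arrangements of \<open>M\<close> in a list, which a multinomial coefficient counts.\<close>

lemma card_colorings:
  assumes "finite A" "size M = card A"
  shows "card (colorings A M) * (\<Prod>i\<in>set_mset M. fact (count M i)) = fact (card A)"
proof -
  obtain h where "bij_betw h {1..card A} A" using ex_bij_betw_nat_finite_1[OF assms(1)] by blast
  hence "card (colorings A M) = card (permutations_of_multiset M)"
    using bij_betw_same_card[OF bij_colorings_words[OF _ assms(2)]]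
        by (simp add: permutations_of_multiset_def)
  thus ?thesis using card_permutations_of_multiset_aux[of M] assms(2) by simp
qed

lemma sum_colorings:
  "sym_coeff (commute_vars F) M = (\<Sum>v\<in>colorings {1..size M} M. nc_coeff F (word (size M) v))"
  unfolding sym_coeff_commute_vars
  using sum.reindex_bij_betw[OF bij_colorings_words[OF bij_betw_id[of "{1..size M}"] refl], of "nc_coeff F"]
  by simp

lemma sum_colorings_Un:
  fixes \<phi> \<chi> :: "('a \<Rightarrow> nat) \<Rightarrow> 'k::comm_ring_1"
  assumes fin: "finite A" "finite B" and disj: "A \<inter> B = {}"
  shows "(\<Sum>v\<in>colorings (A \<union> B) M. \<phi> (restrict v A) * \<chi> (restrict v B))
    = (\<Sum>(N, N') | N + N' = M. (\<Sum>v\<in>colorings A N. \<phi> v) * (\<Sum>v\<in>colorings B N'. \<chi> v))"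
proof -
  let ?D = "{(N, N'). N + N' = M}"
  let ?C = "\<lambda>q. colorings A (fst q) \<times> colorings B (snd q)"
  have im: "image_mset (restrict v S) (mset_set S) = image_mset v (mset_set S)" for v :: "'a \<Rightarrow> nat" and S
    by (rule image_mset_cong) (metis finite_set_mset_mset_set mset_set.infinite restrict_apply
        set_mset_empty empty_iff)
  have split: "mset_set (A \<union> B) = mset_set A + mset_set B" using mset_set_Union[OF fin disj] .
  have "(\<Sum>v\<in>colorings (A \<union> B) M. \<phi> (restrict v A) * \<chi> (restrict v B))
    = (\<Sum>(q, p)\<in>Sigma ?D ?C. \<phi> (fst p) * \<chi> (snd p))"
  proof (rule sum.reindex_bij_witness[where
        j = "\<lambda>v. ((image_mset v (mset_set A), image_mset v (mset_set B)), (restrict v A, restrict v B))" and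
        i = "\<lambda>(q, p). \<lambda>x\<in>A \<union> B. if x \<in> A then fst p x else snd p x"])
    fix v assume v: "v \<in> colorings (A \<union> B) M"
    hence vE: "v \<in> (A \<union> B) \<rightarrow>\<^sub>E UNIV" by (simp add: colorings_def)
    have "(\<lambda>x\<in>A \<union> B. if x \<in> A then restrict v A x else restrict v B x) = v"
    proof
      show "(\<lambda>x\<in>A \<union> B. if x \<in> A then restrict v A x else restrict v B x) x = v x" for x
        using PiE_arb[OF vE, of x] by (cases "x \<in> A \<union> B") auto
    qed
    thus "(case ((image_mset v (mset_set A), image_mset v (mset_set B)), (restrict v A, restrict v B)) of
      (q, p) \<Rightarrow> \<lambda>x\<in>A \<union> B. if x \<in> A then fst p x else snd p x) = v"
          by (simp only: prod.case fst_conv snd_conv)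
    show "((image_mset v (mset_set A), image_mset v (mset_set B)), (restrict v A, restrict v B))
        \<in> Sigma ?D ?C"
      using v by (simp add: colorings_def im split)
  next
    fix b assume "b \<in> Sigma ?D ?C"
    then obtain N N' u w where b: "b = ((N, N'), (u, w))" "N + N' = M" "u \<in> colorings A N" "w
        \<in> colorings B N'" by auto
    hence u: "u \<in> A \<rightarrow>\<^sub>E UNIV" "image_mset u (mset_set A) = N" and w: "w
        \<in> B \<rightarrow>\<^sub>E UNIV" "image_mset w (mset_set B) = N'"
      by (simp_all add: colorings_def)
    let ?v = "\<lambda>x\<in>A \<union> B. if x \<in> A then u x else w x"
    have rA: "restrict ?v A = u"
    proof
      show "restrict ?v A x = u x" for x using PiE_arb[OF u(1), of x] by (cases "x \<in> A") auto
    qed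
    have rB: "restrict ?v B = w"
    proof
      show "restrict ?v B x = w x" for x using PiE_arb[OF w(1), of x] disj by (cases "x \<in> B") auto
    qed
    have iA: "image_mset ?v (mset_set A) = N" using im[of ?v A] unfolding rA u(2) ..
    have iB: "image_mset ?v (mset_set B) = N'" using im[of ?v B] unfolding rB w(2) ..
    have v: "(case b of (q, p) \<Rightarrow> \<lambda>x\<in>A \<union> B. if x \<in> A then fst p x else snd p x) = ?v"
      by (simp only: b(1) prod.case fst_conv snd_conv)
    show "((image_mset (case b of (q, p) \<Rightarrow> \<lambda>x\<in>A \<union> B. if x \<in> A then fst p x else snd p x) (mset_set A),
        image_mset (case b of (q, p) \<Rightarrow> \<lambda>x\<in>A \<union> B. if x \<in> A then fst p x else snd p x) (mset_set B)),
       (restrict (case b of (q, p) \<Rightarrow> \<lambda>x\<in>A \<union> B. if x \<in> A then fst p x else snd p x) A,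
        restrict (case b of (q, p) \<Rightarrow> \<lambda>x\<in>A \<union> B. if x \<in> A then fst p x else snd p x) B)) = b"
      unfolding v rA rB iA iB by (simp only: b(1))
    have "image_mset ?v (mset_set (A \<union> B)) = M" unfolding split image_mset_union iA iB by (rule b(2))
    thus "(case b of (q, p) \<Rightarrow> \<lambda>x\<in>A \<union> B. if x \<in> A then fst p x else snd p x) \<in> colorings (A \<union> B) M"
      unfolding v colorings_def by simp
  qed simp
  also have "\<dots> = (\<Sum>q\<in>?D. \<Sum>p\<in>?C q. \<phi> (fst p) * \<chi> (snd p))"
    by (rule sum.Sigma[symmetric]) (auto simp: finite_add_pairs intro!: finite_cartesian_product
        finite_colorings fin)
  also have "\<dots> = (\<Sum>(N, N') | N + N' = M. (\<Sum>v\<in>colorings A N. \<phi> v) * (\<Sum>v\<in>colorings B N'. \<chi> v))"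
    by (rule sum.cong[OF refl]) (auto simp: sum_product sum.cartesian_product case_prod_unfold)
  finally show ?thesis .
qed

text \<open>Colorings of a disjoint union are colored on each part separately, and multiplication of
  series is the sum over the ways to distribute the monomial.\<close>

lemma sym_coeff_prod_blocks:
  fixes R :: "'a set \<Rightarrow> 'k::field sym"
  assumes "finite P" "\<And>B. B \<in> P \<Longrightarrow> finite B" "\<And>B C. B \<in> P \<Longrightarrow> C \<in> P \<Longrightarrow> B \<noteq> C \<Longrightarrow> B \<inter> C = {}"
    and R: "\<And>B N. B \<in> P \<Longrightarrow> sym_coeff (R B) N = of_nat (card (colorings B N)) * \<psi> N"
  shows "sym_coeff (\<Prod>B\<in>P. R B) M = (\<Sum>v\<in>colorings (\<Union>P) M. \<Prod>B\<in>P. \<psi> (image_mset v (mset_set B)))"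
  using assms
proof (induction P arbitrary: M)
  case empty
  have "colorings ({} :: 'a set) M = (if M = {#} then {\<lambda>_. undefined} else {})"
    by (auto simp: colorings_def)
  thus ?case by (simp add: one_sym.rep_eq)
next
  case (insert B P)
  let ?\<phi> = "\<lambda>v. \<psi> (image_mset v (mset_set B))" and ?\<chi> = "\<lambda>v. \<Prod>C\<in>P. \<psi> (image_mset v (mset_set C))"
  have fin: "finite B" "finite (\<Union>P)" using insert by auto
  have disj: "B \<inter> \<Union>P = {}"
  proof -
    have "B \<inter> C = {}" if "C \<in> P" for C using insert.prems(2)[of B C] insert.hyps(2) that by auto
    thus ?thesis by blast
  qed
  have 1: "?\<phi> (restrict v B) = ?\<phi> v" for v
    by (rule arg_cong[where f = \<psi>], rule image_mset_cong) (simp add: fin)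
  have 2: "?\<chi> (restrict v (\<Union>P)) = ?\<chi> v" for v
  proof (rule prod.cong[OF refl])
    fix C assume C: "C \<in> P"
    hence "finite C" using insert.prems(1) by simp
    thus "\<psi> (image_mset (restrict v (\<Union>P)) (mset_set C)) = \<psi> (image_mset v (mset_set C))"
      using C by (intro arg_cong[where f = \<psi>] image_mset_cong) auto
  qed
  have "sym_coeff (\<Prod>C\<in>insert B P. R C) M = (\<Sum>(N, N') | N + N'
      = M. sym_coeff (R B) N * sym_coeff (\<Prod>C\<in>P. R C) N')"
    using insert.hyps by (simp add: times_sym.rep_eq)
  also have "\<dots> = (\<Sum>(N, N') | N + N' = M. (\<Sum>v\<in>colorings B N. ?\<phi> v) * (\<Sum>v\<in>colorings (\<Union>P) N'. ?\<chi> v))"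
  proof (rule sum.cong[OF refl], clarify)
    fix N N'
    have "(\<Sum>v\<in>colorings B N. ?\<phi> v) = (\<Sum>v\<in>colorings B N. \<psi> N)"
      by (rule sum.cong[OF refl]) (simp add: colorings_def)
    hence "sym_coeff (R B) N = (\<Sum>v\<in>colorings B N. ?\<phi> v)" using insert.prems(3)[of B N] by simp
    moreover have "sym_coeff (\<Prod>C\<in>P. R C) N' = (\<Sum>v\<in>colorings (\<Union>P) N'. ?\<chi> v)"
      using insert.prems by (intro insert.IH) auto
    ultimately show "sym_coeff (R B) N * sym_coeff (\<Prod>C\<in>P. R C) N'
      = (\<Sum>v\<in>colorings B N. ?\<phi> v) * (\<Sum>v\<in>colorings (\<Union>P) N'. ?\<chi> v)" by simp
  qed
  also have "\<dots> = (\<Sum>v\<in>colorings (B \<union> \<Union>P) M. ?\<phi> (restrict v B) * ?\<chi> (restrict v (\<Union>P)))"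
    by (rule sum_colorings_Un[OF fin disj, symmetric])
  also have "\<dots> = (\<Sum>v\<in>colorings (\<Union>(insert B P)) M. \<Prod>C\<in>insert B P. \<psi> (image_mset v (mset_set C)))"
    unfolding 1 2 using insert.hyps by simp
  finally show ?case .
qed

lemma commute_vars_block_prod:
  fixes R :: "nat set \<Rightarrow> 'k::field sym"
  assumes F: "\<And>w. nc_coeff F w = block_prod \<psi> X w"
    and R: "\<And>B N. B \<in> blocks X \<Longrightarrow> sym_coeff (R B) N = of_nat (card (colorings B N)) * \<psi> N"
  shows "commute_vars F = (\<Prod>B\<in>blocks X. R B)"
proof (rule sym_coeff_eqI)
  fix M
  have P: "sym_coeff (\<Prod>B\<in>blocks X. R B) M
    = (\<Sum>v\<in>colorings {1..psize X} M. \<Prod>B\<in>blocks X. \<psi> (image_mset v (mset_set B)))"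
    unfolding Union_blocks[symmetric]
    by (rule sym_coeff_prod_blocks[OF finite_blocks]) (use finite_block blocks_disjoint R in blast)+
  show "sym_coeff (commute_vars F) M = sym_coeff (\<Prod>B\<in>blocks X. R B) M"
  proof (cases "size M = psize X")
    case True
    have "nc_coeff F (word (size M) v) = (\<Prod>B\<in>blocks X. \<psi> (image_mset v (mset_set B)))" for v
      using True by (simp add: F block_prod_def colors_word blocks_subset del: One_nat_def)
    thus ?thesis unfolding sum_colorings P using True by simp
  next
    case False
    thus ?thesis unfolding sum_colorings P by (simp add: F block_prod_def colorings_empty)
  qed
qed

lemma prod_blocks_ptype: "(\<Prod>B\<in>blocks X. q (card B)) = (\<Prod>k\<in>#ptype X. q k)"
  by (simp add: ptype_def prod_unfold_prod_mset multiset.map_comp o_def)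

text \<open>A block of size \<open>k\<close> has exactly one coloring whose colors form \<open>k\<close> copies of \<open>i\<close>.\<close>

lemma commute_vars_p: "commute_vars (nc_p X :: 'k::field ncsym) = sym_p (ptype X)"
proof -
  have "sym_coeff (power_sum (card B)) N = of_nat (card (colorings B N)) * (constant_mset N :: 'k)"
    if B: "B \<in> blocks X" for B N
  proof (cases "size N = card B")
    case True
    have "card (colorings B N) = 1" if N: "N = replicate_mset (card B) i" for i
    proof -
      have "(\<Prod>i\<in>set_mset N. fact (count N i)) = (fact (card B) :: nat)"
        unfolding N by (cases "card B = 0") auto
      thus ?thesis using card_colorings[OF finite_block[OF B] True] by simp
    qed
    thus ?thesis using True by (auto simp: power_sum.rep_eq constant_mset_def)
  qed (auto simp: power_sum.rep_eq colorings_empty)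
  hence "commute_vars (nc_p X :: 'k ncsym) = (\<Prod>B\<in>blocks X. power_sum (card B))"
    by (rule commute_vars_block_prod[OF nc_coeff_p])
  thus ?thesis by (simp only: prod_blocks_ptype sym_p_def)
qed

lemma prod_sym_scale:
  fixes c :: "'a \<Rightarrow> 'k::field"
  shows "(\<Prod>B\<in>P. sym_scale (c B) (E B)) = sym_scale (\<Prod>B\<in>P. c B) (\<Prod>B\<in>P. E B)"
proof (induction P rule: infinite_finite_induct)
  case (insert B P)
  have "sym_scale a F * sym_scale b G = sym_scale (a * b) (F * G)" for a b and F G :: "'k sym"
    by (rule sym_coeff_eqI) (simp add: times_sym.rep_eq sum_distrib_left case_prod_unfold mult_ac)
  thus ?case using insert by simp
qed (simp_all add: vector_spaceD[OF vector_space_sym_scale])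

lemma parts_fact_ptype: "of_nat (parts_fact (ptype X)) = (\<Prod>B\<in>blocks X. fact (card B) :: 'k::field_char_0)"
  unfolding parts_fact_def prod_blocks_ptype[symmetric] by simp

text \<open>A monomial with \<open>k\<close> distinct variables comes from \<open>k!\<close> colorings of a block of size \<open>k\<close>.\<close>

lemma commute_vars_e:
  "commute_vars (nc_e X :: 'k::field_char_0 ncsym) = sym_scale (of_nat (parts_fact (ptype X))) (sym_e
      (ptype X))"
proof -
  have "sym_coeff (sym_scale (fact (card B)) (elementary (card B))) N
      = of_nat (card (colorings B N)) * (distinct_mset N :: 'k)" if B: "B \<in> blocks X" for B N
  proof (cases "size N = card B")
    case True
    have "of_nat (card (colorings B N)) = (fact (card B) :: 'k)" if N: "\<forall>i. count N i \<le> 1"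
    proof -
      have "(\<Prod>i\<in>set_mset N. fact (count N i)) = (1 :: nat)"
      proof (rule prod.neutral, rule ballI)
        fix i assume "i \<in># N"
        hence "count N i > 0" by simp
        moreover have "count N i \<le> 1" using N by blast
        ultimately have "count N i = 1" by linarith
        thus "fact (count N i) = (1 :: nat)" by simp
      qed
      hence "card (colorings B N) = fact (card B)" using card_colorings[OF finite_block[OF B] True] by simp
      thus ?thesis by simp
    qed
    thus ?thesis using True by (auto simp: elementary.rep_eq distinct_mset_def)
  qed (auto simp: elementary.rep_eq colorings_empty)
  hence "commute_vars (nc_e X :: 'k ncsym) = (\<Prod>B\<in>blocks X. sym_scale (fact (card B)) (elementary (card B)))"
    by (rule commute_vars_block_prod[OF nc_coeff_e])
  thus ?thesis by (simp only: prod_sym_scale parts_fact_ptype prod_blocks_ptype sym_e_def)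
qed

text \<open>The coefficient of a word in \<open>nc_h\<close> cancels the denominator of the
  multinomial coefficient, so that every monomial of degree \<open>k\<close> receives
  \<open>k!\<close> from a block of size \<open>k\<close>.\<close>

lemma commute_vars_h:
  "commute_vars (nc_h X :: 'k::field_char_0 ncsym) = sym_scale (of_nat (parts_fact (ptype X))) (sym_h
      (ptype X))"
proof -
  have "sym_coeff (sym_scale (fact (card B)) (complete_hom (card B))) N
      = of_nat (card (colorings B N)) * (count_prod (\<lambda>k. of_nat (fact k)) N :: 'k)" if B: "B \<in> blocks X"
          for B N
  proof (cases "size N = card B")
    case True
    have "of_nat (card (colorings B N)) * count_prod (\<lambda>k. of_nat (fact k)) N
      = (of_nat (card (colorings B N) * (\<Prod>i\<in>set_mset N. fact (count N i))) :: 'k)"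
      by (simp add: count_prod_def)
    also have "\<dots> = fact (card B)" unfolding card_colorings[OF finite_block[OF B] True] by simp
    finally show ?thesis using True by (simp add: complete_hom.rep_eq)
  qed (auto simp: complete_hom.rep_eq colorings_empty)
  hence "commute_vars (nc_h X :: 'k ncsym) = (\<Prod>B\<in>blocks X. sym_scale (fact (card B)) (complete_hom (card
      B)))"
    by (rule commute_vars_block_prod[OF nc_coeff_h])
  thus ?thesis by (simp only: prod_sym_scale parts_fact_ptype prod_blocks_ptype sym_h_def)
qed

subsection \<open>The monomial basis\<close>

definition matchings :: "('a \<Rightarrow> nat) \<Rightarrow> ('b \<Rightarrow> nat) \<Rightarrow> 'a set \<Rightarrow> 'b set \<Rightarrow> ('a \<Rightarrow> 'b) set" where
  "matchings d c D E = {\<beta> \<in> D \<rightarrow>\<^sub>E E. bij_betw \<beta> D E \<and> (\<forall>a\<in>D. c (\<beta> a) = d a)}"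

lemma mults_fact_add_mset: "mults_fact (add_mset x p) = (count p x + 1) * mults_fact p"
proof -
  have split: "mults_fact q = fact (count q x) * (\<Prod>i\<in>set_mset q - {x}. fact (count q i))" for q
  proof (cases "x \<in># q")
    case True
    thus ?thesis unfolding mults_fact_def by (intro prod.remove) simp_all
  next
    case False
    thus ?thesis by (simp add: mults_fact_def not_in_iff)
  qed
  have "(\<Prod>i\<in>set_mset (add_mset x p) - {x}. fact (count (add_mset x p) i))
      = (\<Prod>i\<in>set_mset p - {x}. fact (count p i) :: nat)"
    by (rule prod.cong) auto
  thus ?thesis unfolding split[of p] split[of "add_mset x p"] by (simp add: algebra_simps)
qed

lemma finite_matchings: "finite D \<Longrightarrow> finite E \<Longrightarrow> finite (matchings d c D E)"
  unfolding matchings_def by (rule finite_subset[OF _ finite_PiE[of D "\<lambda>_. E"]]) auto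

text \<open>Induction on \<open>D\<close>: the image \<open>e\<close> of a new element
  \<open>a\<close> is any of the elements of \<open>E\<close> with \<open>c e = d a\<close>, and
  their number is the multiplicity of \<open>d a\<close>.\<close>

lemma card_matchings:
  assumes "finite D" "finite E"
  shows "card (matchings d c D E)
    = (if image_mset d (mset_set D) = image_mset c (mset_set E) then mults_fact (image_mset d (mset_set
        D)) else 0)"
  using assms
proof (induction D arbitrary: E)
  case empty
  have "matchings d c {} E = (if E = {} then {\<lambda>_. undefined} else {})"
    by (auto simp: matchings_def bij_betw_def)
  moreover have "E = {} \<longleftrightarrow> {#} = image_mset c (mset_set E)" using empty by (auto simp: mset_set_empty_iff)
  ultimately show ?case by (auto simp: mults_fact_def)
next
  case (insert a D)
  let ?E = "{e\<in>E. c e = d a}"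
  let ?p = "image_mset d (mset_set D)"
  have "bij_betw (\<lambda>\<beta>. (\<beta> a, restrict \<beta> D)) (matchings d c (insert a D) E)
      (SIGMA e:?E. matchings d c D (E - {e}))"
  proof (rule bij_betw_byWitness[where f' = "\<lambda>(e, \<gamma>). \<gamma>(a := e)"])
    show "\<forall>\<beta>\<in>matchings d c (insert a D) E. (case (\<beta> a, restrict \<beta> D) of (e, \<gamma>) \<Rightarrow> \<gamma>(a := e)) = \<beta>"
    proof (intro ballI ext)
      fix \<beta> x assume "\<beta> \<in> matchings d c (insert a D) E"
      hence \<beta>: "\<beta> \<in> insert a D \<rightarrow>\<^sub>E E" by (simp add: matchings_def)
      show "(case (\<beta> a, restrict \<beta> D) of (e, \<gamma>) \<Rightarrow> \<gamma>(a := e)) x = \<beta> x"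
        using PiE_arb[OF \<beta>, of x] by (cases "x \<in> D") auto
    qed
    show "\<forall>q\<in>SIGMA e:?E. matchings d c D (E - {e}). ((case q of (e, \<gamma>) \<Rightarrow> \<gamma>(a := e)) a, restrict (case q
        of (e, \<gamma>) \<Rightarrow> \<gamma>(a := e)) D) = q"
    proof (rule ballI)
      fix q assume "q \<in> (SIGMA e:?E. matchings d c D (E - {e}))"
      then obtain e \<gamma> where q: "q = (e, \<gamma>)" "\<gamma> \<in> D \<rightarrow>\<^sub>E (E - {e})" by (auto simp: matchings_def)
      have "restrict (\<gamma>(a := e)) D = \<gamma>"
      proof
        show "restrict (\<gamma>(a := e)) D x = \<gamma> x" for x
          using PiE_arb[OF q(2), of x] insert.hyps(2) by (cases "x \<in> D") auto
      qed
      thus "((case q of (e, \<gamma>) \<Rightarrow> \<gamma>(a := e)) a, restrict (case q of (e, \<gamma>) \<Rightarrow> \<gamma>(a := e)) D) = q"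
          by (simp add: q(1))
    qed
    show "(\<lambda>\<beta>. (\<beta> a, restrict \<beta> D)) ` matchings d c (insert a D) E \<subseteq> (SIGMA e:?E. matchings d c D (E -
        {e}))"
    proof (rule image_subsetI)
      fix \<beta> assume "\<beta> \<in> matchings d c (insert a D) E"
      hence \<beta>: "bij_betw \<beta> (insert a D) E" "\<forall>x\<in>insert a D. c (\<beta> x) = d x" by (simp_all add: matchings_def)
      have e: "\<beta> a \<in> ?E" using \<beta> by (auto simp: bij_betw_def)
      have inj: "inj_on \<beta> D" and "\<beta> a \<notin> \<beta> ` D" and "E = insert (\<beta> a) (\<beta> ` D)"
        using \<beta>(1) insert.hyps(2) by (auto simp: bij_betw_def)
      hence img: "\<beta> ` D = E - {\<beta> a}" by blast
      have "bij_betw (restrict \<beta> D) D (E - {\<beta> a})"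
        using img inj by (auto simp: bij_betw_def inj_on_def)
      moreover have "restrict \<beta> D \<in> D \<rightarrow>\<^sub>E E - {\<beta> a}" using img by auto
      ultimately show "(\<beta> a, restrict \<beta> D) \<in> (SIGMA e:?E. matchings d c D (E - {e}))"
        using e \<beta>(2) by (auto simp: matchings_def)
    qed
    show "(\<lambda>(e, \<gamma>). \<gamma>(a := e)) ` (SIGMA e:?E. matchings d c D (E - {e})) \<subseteq> matchings d c (insert a D) E"
    proof (rule image_subsetI)
      fix q assume "q \<in> (SIGMA e:?E. matchings d c D (E - {e}))"
      then obtain e \<gamma> where q: "q = (e, \<gamma>)" "e \<in> E" "c e = d a" "\<gamma> \<in> D \<rightarrow>\<^sub>E (E - {e})"
        "bij_betw \<gamma> D (E - {e})" "\<forall>x\<in>D. c (\<gamma> x) = d x" by (auto simp: matchings_def)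
      let ?\<beta> = "\<gamma>(a := e)"
      have img: "?\<beta> ` D = E - {e}" and inj: "inj_on ?\<beta> D"
        using q(5) insert.hyps(2) by (auto simp: bij_betw_def inj_on_def)
      have "bij_betw ?\<beta> (insert a D) E"
        using img inj q(2) insert.hyps(2) by (auto simp: bij_betw_def)
      moreover have "?\<beta> \<in> insert a D \<rightarrow>\<^sub>E E" using q(2,4) by (auto simp: PiE_iff extensional_def)
      moreover have "\<forall>x\<in>insert a D. c (?\<beta> x) = d x" using q(3,6) insert.hyps(2) by auto
      ultimately show "(case q of (e, \<gamma>) \<Rightarrow> \<gamma>(a := e)) \<in> matchings d c (insert a D) E"
        by (simp add: q(1) matchings_def)
    qed
  qed
  hence "card (matchings d c (insert a D) E) = card (SIGMA e:?E. matchings d c D (E - {e}))"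
    by (rule bij_betw_same_card)
  also have "\<dots> = (\<Sum>e\<in>?E. card (matchings d c D (E - {e})))"
    using insert by (intro card_SigmaI) (auto intro: finite_matchings)
  also have "\<dots> = (\<Sum>e\<in>?E. if add_mset (d a) ?p = image_mset c (mset_set E) then mults_fact ?p else 0)"
  proof (rule sum.cong[OF refl])
    fix e assume e: "e \<in> ?E"
    have "mset_set E = add_mset e (mset_set (E - {e}))"
      using e insert.prems by (simp add: mset_set.remove)
    hence "image_mset c (mset_set E) = add_mset (d a) (image_mset c (mset_set (E - {e})))" using e by simp
    thus "card (matchings d c D (E - {e})) = (if add_mset (d a) ?p
        = image_mset c (mset_set E) then mults_fact ?p else 0)"
      using insert.IH[of "E - {e}"] insert.prems by simp
  qed
  also have "\<dots> = (if add_mset (d a) ?p = image_mset c (mset_set E) then mults_fact (add_mset (d a) ?p)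
      else 0)"
  proof (cases "add_mset (d a) ?p = image_mset c (mset_set E)")
    case True
    have "card ?E = count (image_mset c (mset_set E)) (d a)"
      unfolding count_image_mset' using insert.prems by (simp add: conj_commute eq_commute)
    also have "\<dots> = count ?p (d a) + 1" unfolding True[symmetric] by simp
    finally show ?thesis using True mults_fact_add_mset[of "d a" ?p] by simp
  qed simp
  finally show ?case using insert.hyps by simp
qed

lemma kernel_word_iff:
  "kernel (word n v) = X \<longleftrightarrow> psize X = n \<and> (\<forall>j\<in>{1..n}. \<forall>k\<in>{1..n}. same_block X j k \<longleftrightarrow> v j = v k)"
proof
  assume "kernel (word n v) = X"
  hence X: "X = kernel (word n v)" by simp
  show "psize X = n \<and> (\<forall>j\<in>{1..n}. \<forall>k\<in>{1..n}. same_block X j k \<longleftrightarrow> v j = v k)"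
    unfolding X same_block_kernel psize_kernel length_word by (simp add: nth_word del: One_nat_def)
next
  assume X: "psize X = n \<and> (\<forall>j\<in>{1..n}. \<forall>k\<in>{1..n}. same_block X j k \<longleftrightarrow> v j = v k)"
  hence pX: "psize X = n" by blast
  show "kernel (word n v) = X"
  proof (rule set_partition_eqI)
    fix j k
    show "same_block (kernel (word n v)) j k \<longleftrightarrow> same_block X j k"
    proof (cases "j \<in> {1..n} \<and> k \<in> {1..n}")
      case True
      hence "same_block (kernel (word n v)) j k \<longleftrightarrow> v j = v k"
        unfolding same_block_kernel length_word by (simp add: nth_word del: One_nat_def)
      thus ?thesis using X True by blast
    next
      case False
      have "\<not> same_block X j k" using same_block_range[of X j k] False unfolding pX by blast
      moreover have "\<not> same_block (kernel (word n v)) j k"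
        using same_block_range[of "kernel (word n v)" j k] False unfolding psize_kernel length_word by blast
      ultimately show ?thesis by blast
    qed
  qed (simp add: pX)
qed

text \<open>A word with kernel \<open>X\<close> assigns distinct letters to the blocks of
  \<open>X\<close>, and gives the monomial \<open>M\<close> when the letter of each block has the
  block size as its multiplicity in \<open>M\<close>.\<close>

lemma card_colorings_kernel:
  assumes n: "size M = psize X"
  shows "card {v\<in>colorings {1..psize X} M. kernel (word (psize X) v) = X}
    = card (matchings card (count M) (blocks X) (set_mset M))"
proof -
  let ?N = "{1..psize X}"
  let ?V = "{v\<in>colorings ?N M. kernel (word (psize X) v) = X}"
  \<comment> \<open>The block of a position, and a position in each block.\<close>
  define blk where "blk j = (THE B. B \<in> blocks X \<and> j \<in> B)" for j
  have blk: "blk j = B" if "B \<in> blocks X" "j \<in> B" for j B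
    unfolding blk_def using that blocks_disjoint by (intro the_equality) blast+
  have blkN: "blk j \<in> blocks X" "j \<in> blk j" if j: "j \<in> ?N" for j
  proof -
    obtain B where B: "B \<in> blocks X" "j \<in> B" using ex_block[OF j] by blast
    thus "blk j \<in> blocks X" "j \<in> blk j" using blk by simp_all
  qed
  define rep where "rep B = (SOME j. j \<in> B)" for B :: "nat set"
  have rep: "rep B \<in> B" if "B \<in> blocks X" for B
    unfolding rep_def using blocks_nonempty[OF that] by (simp add: some_in_eq)
  have repN: "rep B \<in> ?N" if "B \<in> blocks X" for B using rep[OF that] blocks_subset[OF that] by blast
  have sb: "same_block X j k \<longleftrightarrow> blk j = blk k" if "j \<in> ?N" "k \<in> ?N" for j k
    unfolding same_block_def using blkN that blk by metis
  have V: "v \<in> ?V \<longleftrightarrow> v \<in> ?N \<rightarrow>\<^sub>E UNIV \<and> image_mset v (mset_set ?N) = M \<and> (\<forall>j\<in>?N. \<forall>k\<in>?N. blk j = blk k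
      \<longleftrightarrow> v j = v k)" for v
  proof -
    have "(\<forall>j\<in>?N. \<forall>k\<in>?N. same_block X j k \<longleftrightarrow> v j = v k) \<longleftrightarrow> (\<forall>j\<in>?N. \<forall>k\<in>?N. blk j = blk k \<longleftrightarrow> v j = v k)"
      by (intro ball_cong refl) (simp only: sb)
    thus ?thesis unfolding mem_Collect_eq colorings_def kernel_word_iff by (simp only: simp_thms conj_assoc)
  qed
  have cnt: "count (image_mset v (mset_set ?N)) i = card {j\<in>?N. v j = i}" for v i
  proof -
    have "{x. x \<in># mset_set ?N \<and> i = v x} = {j\<in>?N. v j = i}" by auto
    thus ?thesis unfolding count_image_mset' by simp
  qed
  have "bij_betw (\<lambda>v. \<lambda>B\<in>blocks X. v (rep B)) ?V (matchings card (count M) (blocks X) (set_mset M))"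
  proof (rule bij_betw_byWitness[where f' = "\<lambda>\<beta>. \<lambda>j\<in>?N. \<beta> (blk j)"])
    show "\<forall>v\<in>?V. (\<lambda>j\<in>?N. (\<lambda>B\<in>blocks X. v (rep B)) (blk j)) = v"
    proof (intro ballI ext)
      fix v j assume "v \<in> ?V"
      hence vV: "v \<in> ?N \<rightarrow>\<^sub>E UNIV \<and> image_mset v (mset_set ?N) = M \<and> (\<forall>j\<in>?N. \<forall>k\<in>?N. blk j = blk k \<longleftrightarrow> v j
          = v k)"
        unfolding V .
      have viff: "blk j = blk k \<longleftrightarrow> v j = v k" if j: "j \<in> ?N" and k: "k \<in> ?N" for j k
        by (rule bspec[OF bspec[OF vV[THEN conjunct2, THEN conjunct2] j] k])
      note v = vV[THEN conjunct1] viff[THEN iffD1]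
      show "(\<lambda>j\<in>?N. (\<lambda>B\<in>blocks X. v (rep B)) (blk j)) j = v j"
      proof (cases "j \<in> ?N")
        case True
        have "blk (rep (blk j)) = blk j" using blk[OF blkN(1)[OF True] rep[OF blkN(1)[OF True]]] .
        hence "v (rep (blk j)) = v j" using v(2)[OF repN[OF blkN(1)[OF True]] True] by blast
        thus ?thesis using True blkN(1) by simp
      next
        case False
        show ?thesis unfolding PiE_arb[OF v(1) False] restrict_apply[of _ ?N j]
            by (simp only: False if_False)
      qed
    qed
    show "\<forall>\<beta>\<in>matchings card (count M) (blocks X) (set_mset M). (\<lambda>B\<in>blocks X. (\<lambda>j\<in>?N. \<beta> (blk j)) (rep B))
        = \<beta>"
    proof (intro ballI ext)
      fix \<beta> B assume "\<beta> \<in> matchings card (count M) (blocks X) (set_mset M)"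
      hence \<beta>: "\<beta> \<in> blocks X \<rightarrow>\<^sub>E set_mset M" by (simp add: matchings_def)
      show "(\<lambda>B\<in>blocks X. (\<lambda>j\<in>?N. \<beta> (blk j)) (rep B)) B = \<beta> B"
      proof (cases "B \<in> blocks X")
        case True
        thus ?thesis using repN[OF True] blk[OF True rep[OF True]] by simp
      next
        case False
        thus ?thesis using PiE_arb[OF \<beta> False] by simp
      qed
    qed
    show "(\<lambda>v. \<lambda>B\<in>blocks X. v (rep B)) ` ?V \<subseteq> matchings card (count M) (blocks X) (set_mset M)"
    proof (rule image_subsetI)
      fix v assume "v \<in> ?V"
      hence vV: "v \<in> ?N \<rightarrow>\<^sub>E UNIV \<and> image_mset v (mset_set ?N) = M \<and> (\<forall>j\<in>?N. \<forall>k\<in>?N. blk j = blk k \<longleftrightarrow> v j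
          = v k)"
        unfolding V .
      have viff: "blk j = blk k \<longleftrightarrow> v j = v k" if j: "j \<in> ?N" and k: "k \<in> ?N" for j k
        by (rule bspec[OF bspec[OF vV[THEN conjunct2, THEN conjunct2] j] k])
      note v = vV[THEN conjunct2, THEN conjunct1] viff
      let ?\<beta> = "\<lambda>B\<in>blocks X. v (rep B)"
      have set: "set_mset M = v ` ?N" unfolding v(1)[symmetric] by simp
      have inj: "inj_on ?\<beta> (blocks X)"
      proof (rule inj_onI)
        fix B C assume B: "B \<in> blocks X" and C: "C \<in> blocks X" and "?\<beta> B = ?\<beta> C"
        hence "v (rep B) = v (rep C)" by simp
        hence "blk (rep B) = blk (rep C)" using v(2)[OF repN[OF B] repN[OF C]] by simp
        thus "B = C" using blk[OF B rep[OF B]] blk[OF C rep[OF C]] by simp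
      qed
      have surj: "?\<beta> ` blocks X = set_mset M"
      proof (intro equalityI subsetI)
        fix i assume "i \<in> set_mset M"
        then obtain j where j: "i = v j" "j \<in> ?N" unfolding set by (elim imageE)
        have "v (rep (blk j)) = i"
          using v(2)[OF repN[OF blkN(1)[OF j(2)]] j(2)] blk[OF blkN(1)[OF j(2)] rep[OF blkN(1)[OF
              j(2)]]] j(1) by simp
        thus "i \<in> ?\<beta> ` blocks X" using blkN(1)[OF j(2)] by (intro image_eqI[of _ _ "blk j"]) simp_all
      next
        fix i assume "i \<in> ?\<beta> ` blocks X"
        then obtain B where "B \<in> blocks X" "i = v (rep B)" by auto
        thus "i \<in> set_mset M" unfolding set using repN by simp
      qed
      have "count M (?\<beta> B) = card B" if B: "B \<in> blocks X" for B
      proof -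
        have "{j\<in>?N. v j = v (rep B)} = B"
        proof (intro equalityI subsetI)
          fix j assume j: "j \<in> {j\<in>?N. v j = v (rep B)}"
          hence "blk j = blk (rep B)" using v(2)[of j "rep B"] repN[OF B] by simp
          thus "j \<in> B" using blkN(2)[of j] j blk[OF B rep[OF B]] by simp
        next
          fix j assume j: "j \<in> B"
          hence "j \<in> ?N" using blocks_subset[OF B] by blast
          moreover have "blk j = blk (rep B)" using blk[OF B j] blk[OF B rep[OF B]] by simp
          ultimately show "j \<in> {j\<in>?N. v j = v (rep B)}" using v(2)[of j "rep B"] repN[OF B] by simp
        qed
        thus ?thesis using B cnt[of v "v (rep B)"] v(1) by simp
      qed
      thus "?\<beta> \<in> matchings card (count M) (blocks X) (set_mset M)"
        unfolding matchings_def using inj surj by (auto simp: bij_betw_def)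
    qed
    show "(\<lambda>\<beta>. \<lambda>j\<in>?N. \<beta> (blk j)) ` matchings card (count M) (blocks X) (set_mset M) \<subseteq> ?V"
    proof (rule image_subsetI)
      fix \<beta> assume "\<beta> \<in> matchings card (count M) (blocks X) (set_mset M)"
      hence \<beta>: "bij_betw \<beta> (blocks X) (set_mset M)" "\<And>B. B \<in> blocks X \<Longrightarrow> count M (\<beta> B) = card B"
        by (simp_all add: matchings_def)
      let ?v = "\<lambda>j\<in>?N. \<beta> (blk j)"
      have inj: "\<beta> B = \<beta> C \<longleftrightarrow> B = C" if "B \<in> blocks X" "C \<in> blocks X" for B C
        using inj_on_eq_iff[OF bij_betw_imp_inj_on[OF \<beta>(1)] that] .
      have "image_mset ?v (mset_set ?N) = M"
      proof (rule multiset_eqI)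
        fix i
        show "count (image_mset ?v (mset_set ?N)) i = count M i"
        proof (cases "i \<in># M")
          case True
          then obtain B where B: "B \<in> blocks X" "i = \<beta> B" using bij_betw_imp_surj_on[OF \<beta>(1)] by blast
          have "{j\<in>?N. ?v j = i} = B"
          proof (intro equalityI subsetI)
            fix j assume j: "j \<in> {j\<in>?N. ?v j = i}"
            hence jN: "j \<in> ?N" and "?v j = \<beta> B" unfolding B(2) by blast+
            hence "\<beta> (blk j) = \<beta> B" by simp
            hence "blk j = B" using inj[OF blkN(1)[OF jN] B(1)] by blast
            thus "j \<in> B" using blkN(2)[OF jN] by simp
          next
            fix j assume j: "j \<in> B"
            hence "j \<in> ?N" using blocks_subset[OF B(1)] by blast
            thus "j \<in> {j\<in>?N. ?v j = i}" using blk[OF B(1) j] B(2) by simp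
          qed
          thus ?thesis unfolding cnt using \<beta>(2)[OF B(1)] B(2) by simp
        next
          case False
          have "{j\<in>?N. ?v j = i} = {}"
          proof (rule ccontr)
            assume "{j\<in>?N. ?v j = i} \<noteq> {}"
            then obtain j where j: "j \<in> ?N" "\<beta> (blk j) = i" by auto
            thus False using bij_betwE[OF \<beta>(1)] blkN(1)[OF j(1)] False by blast
          qed
          thus ?thesis unfolding cnt using False by (simp add: not_in_iff)
        qed
      qed
      moreover have "blk j = blk k \<longleftrightarrow> ?v j = ?v k" if j: "j \<in> ?N" and k: "k \<in> ?N" for j k
        using inj[OF blkN(1)[OF j] blkN(1)[OF k]] j k by simp
      ultimately show "?v \<in> ?V" unfolding V by (intro conjI ballI) simp_all
    qed
  qed
  thus ?thesis by (rule bij_betw_same_card)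
qed

lemma sum_mset_ptype: "sum_mset (ptype X) = psize X"
proof -
  have "sum_mset (ptype X) = (\<Sum>B\<in>blocks X. card B)" by (simp add: ptype_def sum_unfold_sum_mset)
  also have "\<dots> = card (\<Union>(blocks X))"
    by (rule card_Union_disjoint[symmetric]) (auto simp: finite_block partition_onD2[OF
        partition_on_blocks])
  finally show ?thesis by (simp add: psize_def)
qed

text \<open>The matchings of blocks with the variables of \<open>M\<close> exist only if the
  exponents of \<open>M\<close> form the type of \<open>X\<close>; then they permute the blocks of
  equal size.\<close>

lemma commute_vars_m:
  "commute_vars (nc_m X :: 'k::field ncsym) = sym_scale (of_nat (mults_fact (ptype X))) (sym_m (ptype X))"
proof (rule sym_coeff_eqI)
  fix M :: "nat multiset"
  let ?t = "image_mset (count M) (mset_set (set_mset M))"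
  show "sym_coeff (commute_vars (nc_m X :: 'k ncsym)) M
    = sym_coeff (sym_scale (of_nat (mults_fact (ptype X))) (sym_m (ptype X))) M"
  proof (cases "size M = psize X")
    case True
    have "sym_coeff (commute_vars (nc_m X :: 'k ncsym)) M
      = (\<Sum>v\<in>colorings {1..psize X} M. if kernel (word (psize X) v) = X then 1 else 0)"
      unfolding sum_colorings True nc_coeff_m by (rule sum.cong[OF refl]) auto
    also have "\<dots> = of_nat (card {v\<in>colorings {1..psize X} M. kernel (word (psize X) v) = X})"
      using sum.inter_filter[of "colorings {1..psize X} M" "\<lambda>_. 1 :: 'k", OF finite_colorings] by simp
    also have "\<dots> = of_nat (if ptype X = ?t then mults_fact (ptype X) else 0)"
      unfolding card_colorings_kernel[OF True] card_matchings[OF finite_blocks finite_set_mset] ptype_def ..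
    finally show ?thesis by (auto simp: sym_m.rep_eq)
  next
    case False
    have "size M = sum_mset ?t" by (simp add: size_multiset_overloaded_eq sum_unfold_sum_mset)
    hence "?t \<noteq> ptype X" using False sum_mset_ptype[of X] by auto
    moreover have "sym_coeff (commute_vars (nc_m X :: 'k ncsym)) M = 0"
      unfolding sym_coeff_commute_vars nc_coeff_m using False by (intro sum.neutral) auto
    ultimately show ?thesis by (simp add: sym_m.rep_eq)
  qed
qed

section \<open>Coinvariants\<close>

lemma nc_coeff_permute:
  assumes s: "\<sigma> permutes {1..psize X}"
  shows "block_prod \<psi> (permute_partition \<sigma> X) (word (psize X) v)
      = block_prod \<psi> X (word (psize X) (\<lambda>j. v (\<sigma> j)))"
proof -
  have inj: "inj_on ((`) \<sigma>) (blocks X)"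
    by (rule inj_onI) (use permutes_inj[OF s] in \<open>simp add: inj_image_eq_iff\<close>)
  have "colors (word (psize X) v) (\<sigma> ` B) = colors (word (psize X) (\<lambda>j. v (\<sigma> j))) B" if B: "B
      \<in> blocks X" for B
  proof -
    note sub = blocks_subset[OF B]
    have "\<sigma> ` B \<subseteq> \<sigma> ` {1..psize X}" using sub by blast
    hence sub': "\<sigma> ` B \<subseteq> {1..psize X}" unfolding permutes_image[OF s] .
    have "mset_set (\<sigma> ` B) = image_mset \<sigma> (mset_set B)"
      by (rule image_mset_mset_set[symmetric]) (rule inj_on_subset[OF permutes_inj[OF s]], simp)
    thus ?thesis unfolding colors_word[OF sub] colors_word[OF sub'] by (simp add: multiset.map_comp o_def)
  qed
  hence "(\<Prod>B\<in>(`) \<sigma> ` blocks X. \<psi> (colors (word (psize X) v) B))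
      = (\<Prod>B\<in>blocks X. \<psi> (colors (word (psize X) (\<lambda>j. v (\<sigma> j))) B))"
    unfolding prod.reindex[OF inj] by (intro prod.cong) simp_all
  thus ?thesis by (simp add: block_prod_def blocks_permute[OF s] psize_permute[OF s])
qed

lemma word_cong: "(\<And>j. j \<in> {1..n} \<Longrightarrow> v j = v' j) \<Longrightarrow> word n v = word n v'"
  unfolding word_def by (rule map_cong) auto

lemma bij_colorings_permute:
  assumes s: "\<sigma> permutes A"
  shows "bij_betw (\<lambda>v. restrict (\<lambda>a. v (\<sigma> a)) A) (colorings A M) (colorings A M)"
proof -
  have perm: "restrict (\<lambda>a. v (\<tau> a)) A \<in> colorings A M" if t: "\<tau> permutes A" and v: "v \<in> colorings A M"
      for \<tau> v
  proof -
    have "image_mset (restrict (\<lambda>a. v (\<tau> a)) A) (mset_set A) = image_mset (\<lambda>a. v (\<tau> a)) (mset_set A)"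
      by (rule image_mset_cong) (metis finite_set_mset_mset_set mset_set.infinite restrict_apply
          set_mset_empty empty_iff)
    also have "\<dots> = image_mset v (image_mset \<tau> (mset_set A))" by (simp add: multiset.map_comp o_def)
    also have "image_mset \<tau> (mset_set A) = mset_set A"
      using image_mset_mset_set[OF permutes_inj_on[OF t]] permutes_image[OF t] by simp
    also have "image_mset v (mset_set A) = M" using v by (simp add: colorings_def)
    finally have M: "image_mset (restrict (\<lambda>a. v (\<tau> a)) A) (mset_set A) = M" .
    show ?thesis
      unfolding colorings_def
    proof (intro CollectI conjI)
      show "image_mset (restrict (\<lambda>a. v (\<tau> a)) A) (mset_set A) = M" by (rule M)
    qed simp
  qed
  have inv: "restrict (\<lambda>a. restrict (\<lambda>a. v (\<tau> a)) A (\<tau>' a)) A = v"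
    if t: "\<tau>' permutes A" "\<And>a. \<tau> (\<tau>' a) = a" and v: "v \<in> colorings A M" for \<tau> \<tau>' v
  proof
    fix a
    have "v \<in> A \<rightarrow>\<^sub>E UNIV" using v by (simp add: colorings_def)
    thus "restrict (\<lambda>a. restrict (\<lambda>a. v (\<tau> a)) A (\<tau>' a)) A a = v a"
      using PiE_arb[of v A "\<lambda>_. UNIV" a] t(2) permutes_in_image[OF t(1), of a] by (cases "a \<in> A") auto
  qed
  show ?thesis
  proof (rule bij_betw_byWitness[where f' = "\<lambda>v. restrict (\<lambda>a. v (inv \<sigma> a)) A"])
    show "\<forall>v\<in>colorings A M. restrict (\<lambda>a. restrict (\<lambda>a. v (\<sigma> a)) A (inv \<sigma> a)) A = v"
      by (intro ballI inv permutes_inv[OF s]) (simp add: permutes_inverses[OF s])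
    show "\<forall>v\<in>colorings A M. restrict (\<lambda>a. restrict (\<lambda>a. v (inv \<sigma> a)) A (\<sigma> a)) A = v"
      by (intro ballI inv s) (simp add: permutes_inverses[OF s])
  qed (use perm s permutes_inv[OF s] in blast)+
qed

lemma sum_colorings_permute:
  assumes s: "\<sigma> permutes {1..n}"
  shows "(\<Sum>v\<in>colorings {1..n} M. G (word n (\<lambda>j. v (\<sigma> j)))) = (\<Sum>v\<in>colorings {1..n} M. G (word n v))"
proof -
  have "word n (\<lambda>j. v (\<sigma> j)) = word n (restrict (\<lambda>j. v (\<sigma> j)) {1..n})" for v by (rule word_cong) simp
  thus ?thesis using sum.reindex_bij_betw[OF bij_colorings_permute[OF s], of "\<lambda>v. G (word n v)" M] by simp
qed

text \<open>A permutation of the positions permutes the colorings with given multiset of colors.\<close>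

lemma commute_vars_permute:
  assumes s: "\<sigma> permutes {1..psize X}"
  shows "commute_vars (refinement_sum (permute_partition \<sigma> X)) = commute_vars (refinement_sum X)"
proof (rule sym_coeff_eqI)
  fix M
  show "sym_coeff (commute_vars (refinement_sum (permute_partition \<sigma> X))) M
      = sym_coeff (commute_vars (refinement_sum X)) M"
  proof (cases "size M = psize X")
    case True
    show ?thesis
      unfolding sum_colorings nc_coeff_refinement_sum True nc_coeff_permute[OF s]
          by (rule sum_colorings_permute[OF s])
  next
    case False
    thus ?thesis unfolding sum_colorings nc_coeff_refinement_sum
        by (simp add: block_prod_def psize_permute[OF s])
  qed
qed

lemma linear_commute_to_ncsym: "lin fscale sym_scale (\<lambda>x. commute_vars (to_ncsym x))"
  by (rule linear_comp[OF linear_to_ncsym linear_commute_vars])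

lemma push_permute_part:
  assumes "x \<in> kpi_part n" "\<sigma> permutes {1..n}"
  shows "commute_vars (to_ncsym (push (permute_partition \<sigma>) x)) = commute_vars (to_ncsym x)"
proof -
  have "commute_vars (to_ncsym (push (permute_partition \<sigma>) x))
    = lin_ext sym_scale (\<lambda>X. commute_vars (refinement_sum (permute_partition \<sigma> X))) x"
    unfolding to_ncsym_def lin_ext_push[OF vector_space_nc_scale]
        by (rule lin_ext_comp[OF linear_commute_vars])
  also have "\<dots> = lin_ext sym_scale (\<lambda>X. commute_vars (refinement_sum X)) x"
    using assms by (intro lin_ext_cong commute_vars_permute) (simp add: kpi_part_def)
  also have "\<dots> = commute_vars (to_ncsym x)"
    unfolding to_ncsym_def by (rule lin_ext_comp[OF linear_commute_vars, symmetric])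
  finally show ?thesis .
qed

lemma commute_to_ncsym_coinv_null:
  assumes "x \<in> coinv_null"
  shows "commute_vars (to_ncsym x) = 0"
  using assms unfolding coinv_null_def
proof (induction rule: fs.span_induct)
  case base
  show ?case by (auto simp: fs.subspace_def linearD[OF linear_commute_to_ncsym] vector_spaceD[OF
      vector_space_sym_scale])
next
  case (step x)
  then obtain y \<sigma> n where "x = y - push (permute_partition \<sigma>) y" "y \<in> kpi_part n" "\<sigma> permutes {1..n}"
      by blast
  thus ?case using push_permute_part[of y n \<sigma>] by (simp add: linearD(6)[OF linear_commute_to_ncsym])
qed

lemma nc_coeff_push_permute:
  assumes x: "x \<in> kpi_part n" and s: "\<sigma> permutes {1..n}"
  shows "nc_coeff (to_ncsym (push (permute_partition \<sigma>) x)) (word n v)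
      = nc_coeff (to_ncsym x) (word n (\<lambda>j. v (\<sigma> j)))"
proof -
  have "nc_coeff (to_ncsym (push (permute_partition \<sigma>) x)) (word n v)
    = lin_ext (*) (\<lambda>X. nc_coeff (refinement_sum (permute_partition \<sigma> X)) (word n v)) x"
    unfolding to_ncsym_def lin_ext_push[OF vector_space_nc_scale] by (rule lin_ext_comp[OF linear_nc_coeff])
  also have "\<dots> = lin_ext (*) (\<lambda>X. nc_coeff (refinement_sum X) (word n (\<lambda>j. v (\<sigma> j)))) x"
  proof (rule lin_ext_cong)
    fix X assume "X \<in> supp x"
    hence "psize X = n" using x by (simp add: kpi_part_def)
    thus "nc_coeff (refinement_sum (permute_partition \<sigma> X)) (word n v)
        = nc_coeff (refinement_sum X) (word n (\<lambda>j. v (\<sigma> j)))"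
      unfolding nc_coeff_refinement_sum using nc_coeff_permute[of \<sigma> X _ v] s by blast
  qed
  also have "\<dots> = nc_coeff (to_ncsym x) (word n (\<lambda>j. v (\<sigma> j)))"
    unfolding to_ncsym_def by (rule lin_ext_comp[OF linear_nc_coeff, symmetric])
  finally show ?thesis .
qed

lemma word_of_list: "length w = n \<Longrightarrow> word n (\<lambda>j. w ! (j - 1)) = w"
proof (rule nth_equalityI)
  assume n: "length w = n"
  show "length (word n (\<lambda>j. w ! (j - 1))) = length w" using n by simp
  fix i assume "i < length (word n (\<lambda>j. w ! (j - 1)))"
  hence "Suc i \<in> {1..n}" by simp
  from nth_word[OF this, of "\<lambda>j. w ! (j - 1)"] show "word n (\<lambda>j. w ! (j - 1)) ! i = w ! i" by simp
qed

text \<open>The sum of the translates of \<open>x\<close> under \<open>S\<^sub>n\<close> corresponds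
  to a series whose coefficient at a word is, up to a factor, the coefficient of the commutative
  image at its monomial. If that vanishes, so does the sum of the translates, and
  \<open>n! x\<close> is the sum of the differences \<open>x - \<sigma> x\<close>.\<close>

lemma homogeneous_in_coinv_null:
  fixes x :: "'k::field_char_0 kpi"
  assumes x: "x \<in> kpi_part n" and zero: "commute_vars (to_ncsym x) = 0"
  shows "x \<in> coinv_null"
proof -
  let ?S = "{\<sigma>. \<sigma> permutes {1..n}}"
  let ?G = "nc_coeff (to_ncsym x)"
  \<comment> \<open>The sum of the translates of \<open>x\<close> and its coefficients.\<close>
  define y where "y = (\<Sum>\<sigma>\<in>?S. push (permute_partition \<sigma>) x)"
  define T where "T v = (\<Sum>\<sigma>\<in>?S. ?G (word n (\<lambda>j. v (\<sigma> j))))" for v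
  have finS: "finite ?S" by (rule finite_permutations) simp
  have Tword: "nc_coeff (to_ncsym y) (word n v) = T v" for v
    unfolding y_def T_def linearD(7)[OF linear_to_ncsym] nc_coeff_sum
    by (rule sum.cong[OF refl]) (simp add: nc_coeff_push_permute[OF x])
  have T_cong: "T v = T v'" if "\<And>j. j \<in> {1..n} \<Longrightarrow> v j = v' j" for v v'
    unfolding Tword[symmetric] using word_cong[of n v v'] that by simp
  have T0: "T v = 0" for v
  proof -
    define u where "u = restrict v {1..n}"
    define M where "M = image_mset u (mset_set {1..n})"
    have u: "u \<in> colorings {1..n} M" by (simp add: colorings_def M_def u_def)
    have szM: "size M = n" by (simp add: M_def)
    \<comment> \<open>Colorings with the same multiset of colors differ by a permutation, which the sum absorbs.\<close>
    have const: "T u' = T u" if u': "u' \<in> colorings {1..n} M" for u'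
    proof -
      have "image_mset u' (mset_set {1..n}) = image_mset u (mset_set {1..n})"
        using u u' by (simp add: colorings_def)
      then obtain \<tau> where t: "\<tau> permutes {1..n}" "\<forall>j\<in>{1..n}. u' j = u (\<tau> j)"
        by (rule image_mset_eq_implies_permutes[OF finite_atLeastAtMost])
      have "T u' = T (\<lambda>j. u (\<tau> j))" by (rule T_cong) (use t(2) in blast)
      also have "\<dots> = (\<Sum>\<sigma>\<in>?S. ?G (word n (\<lambda>j. u ((\<tau> \<circ> \<sigma>) j))))" by (simp add: T_def)
      also have "\<dots> = T u"
        unfolding T_def by (rule setum_permutations_compose_left[OF t(1), of "\<lambda>\<sigma>. ?G (word n (\<lambda>j. u (\<sigma>
            j)))", symmetric])
      finally show ?thesis .
    qed
    have "of_nat (card (colorings {1..n} M)) * T u = (\<Sum>u'\<in>colorings {1..n} M. T u')"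
      using const by simp
    also have "\<dots> = (\<Sum>\<sigma>\<in>?S. \<Sum>u'\<in>colorings {1..n} M. ?G (word n (\<lambda>j. u' (\<sigma> j))))"
      unfolding T_def by (rule sum.swap)
    also have "\<dots> = (\<Sum>\<sigma>\<in>?S. sym_coeff (commute_vars (to_ncsym x)) M)"
    proof (rule sum.cong[OF refl])
      fix \<sigma> assume "\<sigma> \<in> ?S"
      hence "\<sigma> permutes {1..n}" by simp
      from sum_colorings_permute[OF this, of ?G M]
      show "(\<Sum>u'\<in>colorings {1..n} M. ?G (word n (\<lambda>j. u' (\<sigma> j)))) = sym_coeff (commute_vars (to_ncsym x)) M"
        unfolding sum_colorings szM .
    qed
    also have "\<dots> = 0" by (simp add: zero)
    finally have "of_nat (card (colorings {1..n} M)) * T u = 0" .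
    moreover have "card (colorings {1..n} M) \<noteq> 0"
      using u finite_colorings[of "{1..n}" M] by (auto simp: card_eq_0_iff)
    ultimately have "T u = 0" by simp
    moreover have "T v = T u" by (rule T_cong) (simp add: u_def)
    ultimately show ?thesis by simp
  qed
  have "to_ncsym y = 0"
  proof (rule nc_coeff_eqI)
    fix w
    show "nc_coeff (to_ncsym y) w = nc_coeff 0 w"
    proof (cases "length w = n")
      case True
      show ?thesis using Tword[of "\<lambda>j. w ! (j - 1)"] unfolding word_of_list[OF True] T0 by simp
    next
      case False
      have "push (permute_partition \<sigma>) x \<in> kpi_part n" if "\<sigma> \<in> ?S" for \<sigma>
      proof -
        have "psize (permute_partition \<sigma> X) = n" if "X \<in> supp x" for X
          using psize_permute[of \<sigma> X] \<open>\<sigma> \<in> ?S\<close> x that by (simp add: kpi_part_def)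
        thus ?thesis using supp_push[of "permute_partition \<sigma>" x] unfolding kpi_part_def by auto
      qed
      hence "y \<in> kpi_part n" unfolding y_def by (intro fs.subspace_sum[OF subspace_kpi_part])
      hence "to_ncsym y \<in> part NCSym n" unfolding to_ncsym_part[symmetric] by (rule imageI)
      thus ?thesis using False by (auto simp: NCSym_def)
    qed
  qed
  hence y0: "y = 0" by (rule inj_to_ncsym)
  have sub: "fs.subspace (coinv_null :: 'k kpi set)" unfolding coinv_null_def by (rule fs.subspace_span)
  have "(\<Sum>\<sigma>\<in>?S. x - push (permute_partition \<sigma>) x) \<in> coinv_null"
  proof (rule fs.subspace_sum[OF sub])
    fix \<sigma> assume "\<sigma> \<in> ?S"
    thus "x - push (permute_partition \<sigma>) x \<in> coinv_null"
      unfolding coinv_null_def using x by (intro fs.span_base) blast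
  qed
  also have "(\<Sum>\<sigma>\<in>?S. x - push (permute_partition \<sigma>) x) = (\<Sum>\<sigma>\<in>?S. x) - y"
    unfolding y_def by (rule sum_subtractf)
  also have "\<dots> = fscale (of_nat (card ?S)) x"
  proof -
    have "(\<Sum>\<sigma>\<in>A. x) = fscale (of_nat (card A)) x" if "finite A" for A :: "(nat \<Rightarrow> nat) set"
      using that by (induction A) (simp_all add: fs.scale_left_distrib del: sum_constant)
    from this[OF finS] show ?thesis unfolding y0 by (simp only: diff_zero)
  qed
  finally have "fscale (inverse (of_nat (card ?S))) (fscale (of_nat (card ?S)) x) \<in> coinv_null"
    by (rule fs.subspace_scale[OF sub])
  moreover have "card ?S \<noteq> 0" using card_permutations[of "{1..n}" n] by simp
  ultimately show ?thesis by simp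
qed

text \<open>The relation is homogeneous, so it suffices to treat each degree separately.\<close>

lemma in_coinv_null_iff:
  fixes x :: "'k::field_char_0 kpi"
  shows "x \<in> coinv_null \<longleftrightarrow> commute_vars (to_ncsym x) = 0"
proof
  assume zero: "commute_vars (to_ncsym x) = 0"
  have sub: "fs.subspace (coinv_null :: 'k kpi set)" unfolding coinv_null_def by (rule fs.subspace_span)
  have "commute_vars (to_ncsym (degree_part n x)) = 0" for n
  proof (rule sym_coeff_eqI)
    fix M
    have "sym_coeff (commute_vars (to_ncsym (degree_part n x))) M
      = (if size M = n then sym_coeff (commute_vars (to_ncsym x)) M else 0)"
      unfolding sum_colorings nc_coeff_degree_part by simp
    thus "sym_coeff (commute_vars (to_ncsym (degree_part n x))) M = sym_coeff 0 M" by (simp add: zero)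
  qed
  hence parts: "degree_part n x \<in> coinv_null" for n by (rule homogeneous_in_coinv_null[OF degree_part_in])
  have "x = (\<Sum>n\<in>psize ` supp x. degree_part n x)"
    by (rule poly_mapping_eqI) (auto simp: lookup_sum coef_degree_part in_keys_iff image_iff)
  also have "\<dots> \<in> coinv_null" by (rule fs.subspace_sum[OF sub parts])
  finally show "x \<in> coinv_null" .
qed (rule commute_to_ncsym_coinv_null)

definition to_sym :: "'k::field kpi_bar \<Rightarrow> 'k sym" where
  "to_sym y = commute_vars (to_ncsym (rep_kpi_bar y))"

lemma kpi_proj_rep: "kpi_proj (rep_kpi_bar y) = y"
  by (rule Quotient3_abs_rep[OF Quotient3_kpi_bar])

lemma kpi_proj_eq_iff: "kpi_proj x = kpi_proj y \<longleftrightarrow> x - y \<in> coinv_null"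
  by (rule kpi_bar.abs_eq_iff)

lemma to_sym_proj: "to_sym (kpi_proj x) = commute_vars (to_ncsym (x :: 'k::field kpi))"
proof -
  have "rep_kpi_bar (kpi_proj x) - x \<in> coinv_null"
    unfolding kpi_proj_eq_iff[symmetric] by (rule kpi_proj_rep)
  hence "commute_vars (to_ncsym (rep_kpi_bar (kpi_proj x) - x)) = 0" by (rule commute_to_ncsym_coinv_null)
  thus ?thesis by (simp add: to_sym_def linearD(6)[OF linear_commute_to_ncsym])
qed

lemma ex_kpi_proj: "\<exists>x. y = kpi_proj x"
  using kpi_proj_rep[of y] by metis

lemma kpi_proj_hom:
  "kpi_proj (x + y) = kpi_proj x + kpi_proj y" "kpi_proj (x * y) = kpi_proj x * kpi_proj y"
  "kpi_proj (fscale c x) = kpi_bar_scale c (kpi_proj x)" "kpi_proj 1 = 1"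
  by (simp_all add: plus_kpi_bar.abs_eq times_kpi_bar.abs_eq kpi_bar_scale.abs_eq one_kpi_bar.abs_eq)

lemma vector_space_kpi_bar_scale: "vector_space (kpi_bar_scale :: 'k::field \<Rightarrow> _)"
proof -
  have *: "kpi_bar_scale a (x + y) = kpi_bar_scale a x + kpi_bar_scale a y"
    "kpi_bar_scale (a + b) x = kpi_bar_scale a x + kpi_bar_scale b x"
    "kpi_bar_scale a (kpi_bar_scale b x) = kpi_bar_scale (a * b) x" "kpi_bar_scale 1 x = x"
        for a b :: 'k and x y
  proof -
    obtain u where u: "x = kpi_proj u" using ex_kpi_proj by blast
    obtain w where w: "y = kpi_proj w" using ex_kpi_proj by blast
    show "kpi_bar_scale a (x + y) = kpi_bar_scale a x + kpi_bar_scale a y"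
      "kpi_bar_scale (a + b) x = kpi_bar_scale a x + kpi_bar_scale b x"
      "kpi_bar_scale a (kpi_bar_scale b x) = kpi_bar_scale (a * b) x" "kpi_bar_scale 1 x = x"
      unfolding u w kpi_proj_hom(1,3)[symmetric]
      by (simp_all add: fs.scale_right_distrib fs.scale_left_distrib)
  qed
  show ?thesis unfolding vector_space_def using * by blast
qed

lemma linear_to_sym: "lin kpi_bar_scale sym_scale to_sym"
proof (rule linearI[OF vector_space_kpi_bar_scale vector_space_sym_scale])
  fix x y :: "'a kpi_bar" and c
  obtain u where u: "x = kpi_proj u" using ex_kpi_proj by blast
  obtain w where w: "y = kpi_proj w" using ex_kpi_proj by blast
  show "to_sym (x + y) = to_sym x + to_sym y" "to_sym (kpi_bar_scale c x) = sym_scale c (to_sym x)"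
    unfolding u w kpi_proj_hom(1,3)[symmetric] to_sym_proj
        by (simp_all only: linearD[OF linear_commute_to_ncsym])
qed

lemma to_sym_one: "to_sym 1 = 1"
  unfolding kpi_proj_hom(4)[symmetric] to_sym_proj to_ncsym_one by (rule commute_vars_one)

lemma to_sym_mult: "to_sym (x * y) = to_sym x * to_sym y"
proof -
  obtain u where u: "x = kpi_proj u" using ex_kpi_proj by blast
  obtain w where w: "y = kpi_proj w" using ex_kpi_proj by blast
  show ?thesis
    unfolding u w kpi_proj_hom(2)[symmetric] to_sym_proj to_ncsym_mult by (rule commute_vars_mult)
qed

lemma bij_to_sym: "bij (to_sym :: 'k::field_char_0 kpi_bar \<Rightarrow> 'k sym)"
proof (rule bijI)
  show "inj (to_sym :: 'k kpi_bar \<Rightarrow> 'k sym)"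
  proof (rule injI)
    fix x y :: "'k kpi_bar" assume eq: "to_sym x = to_sym y"
    obtain u where u: "x = kpi_proj u" using ex_kpi_proj by blast
    obtain w where w: "y = kpi_proj w" using ex_kpi_proj by blast
    have "commute_vars (to_ncsym (u - w)) = 0"
      using eq unfolding u w to_sym_proj by (simp add: linearD(6)[OF linear_commute_to_ncsym])
    thus "x = y" unfolding u w kpi_proj_eq_iff in_coinv_null_iff .
  qed
  show "surj (to_sym :: 'k kpi_bar \<Rightarrow> 'k sym)"
  proof (rule surjI)
    fix G :: "'k sym"
    have "to_ncsym (inv to_ncsym (spread G)) = spread G"
        by (rule surj_f_inv_f[OF bij_is_surj[OF bij_to_ncsym]])
    thus "to_sym (kpi_proj (inv to_ncsym (spread G))) = G" by (simp add: to_sym_proj commute_vars_spread)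
  qed
qed

lemma KPi_bar_simps [simp]:
  "scale KPi_bar = kpi_bar_scale" "coprod KPi_bar y = push (map kpi_proj) (kpi_coprod (rep_kpi_bar y))"
  "counit KPi_bar y = coef (rep_kpi_bar y) 0" "part KPi_bar n = kpi_proj ` kpi_part n"
  by (simp_all add: KPi_bar_def kpi_counit_def)

lemma sym_coprod_to_sym:
  "tensor_eq sym_scale 2 (sym_coprod (to_sym y)) (push (map to_sym) (coprod KPi_bar (y :: 'k::field
      kpi_bar)))"
proof -
  let ?x = "rep_kpi_bar y"
  have "tensor_eq sym_scale 2 (sym_coprod (commute_vars (to_ncsym ?x))) (push (map commute_vars)
      (nc_coprod (to_ncsym ?x)))"
    by (rule sym_coprod_commute_vars)
  moreover have "tensor_eq sym_scale 2 (push (map commute_vars) (nc_coprod (to_ncsym ?x)))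
      (push (map commute_vars) (push (map to_ncsym) (kpi_coprod ?x)))"
    by (rule tensor_eq_push[OF linear_commute_vars nc_coprod_to_ncsym])
  moreover have "push (map commute_vars) (push (map to_ncsym) (kpi_coprod ?x))
      = push (map to_sym) (coprod KPi_bar y)"
    by (simp add: push_push o_def to_sym_proj)
  ultimately show ?thesis unfolding to_sym_def[of y] by (metis tensor_eq_trans)
qed

lemma to_sym_counit: "sym_coeff (to_sym y) {#} = coef (rep_kpi_bar y) 0"
  by (simp add: to_sym_def commute_vars_counit to_ncsym_counit)

lemma to_sym_part: "to_sym ` kpi_proj ` kpi_part n = part (Sym :: ('k::field_char_0, 'k sym) hopf_data) n"
  unfolding commute_vars_part[symmetric] to_ncsym_part[symmetric] image_image to_sym_proj ..

text \<open>The structure is carried back from \<open>\<^bold>S\<^bold>y\<^bold>m\<close>, which in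
  particular shows that the coproduct is independent of the chosen representatives and that the
  homogeneous parts remain independent.\<close>

theorem hopf_KPi_bar: "graded_connected_hopf_algebra (KPi_bar :: ('k::field_char_0, 'k kpi_bar) hopf_data)"
proof (rule graded_connected_hopf_algebra_bij[OF hopf_Sym, of _ "inv to_sym"])
  let ?g = "inv (to_sym :: 'k kpi_bar \<Rightarrow> 'k sym)"
  have fg: "to_sym (?g F) = F" for F by (rule surj_f_inv_f[OF bij_is_surj[OF bij_to_sym]])
  have gf: "?g (to_sym y) = y" for y by (rule inv_f_f[OF bij_is_inj[OF bij_to_sym]])
  have lin: "lin sym_scale kpi_bar_scale ?g" by (rule linear_inv[OF linear_to_sym bij_to_sym])
  show "lin (scale Sym) (scale KPi_bar) ?g" using lin by simp
  show "bij ?g" by (rule bij_imp_bij_inv[OF bij_to_sym])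
  show "?g 1 = 1" using gf[of 1] by (simp add: to_sym_one)
  show "?g (F * G) = ?g F * ?g G" for F G
    using gf[of "?g F * ?g G"] by (simp add: to_sym_mult fg)
  show "tensor_eq (scale KPi_bar) 2 (coprod KPi_bar (?g F)) (push (map ?g) (coprod Sym F))" for F
  proof -
    have "tensor_eq kpi_bar_scale 2 (push (map ?g) (sym_coprod (to_sym (?g F)))) (push (map ?g) (push
        (map to_sym) (coprod KPi_bar (?g F))))"
      by (rule tensor_eq_push[OF lin sym_coprod_to_sym])
    moreover have "push (map ?g) (push (map to_sym) t) = t" for t :: "'k kpi_bar list \<Rightarrow>\<^sub>0 'k"
    proof -
      have "push (map ?g) (push (map to_sym) t) = push (\<lambda>l. l) t" unfolding push_push
          by (rule push_cong) (simp add: o_def gf)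
      also have "\<dots> = t" unfolding push_def by (rule lin_ext_singles)
      finally show ?thesis .
    qed
    ultimately have "tensor_eq kpi_bar_scale 2 (push (map ?g) (sym_coprod F)) (coprod KPi_bar (?g F))"
      unfolding fg by (simp only:)
    thus ?thesis unfolding KPi_bar_simps(1) Sym_simps by (rule tensor_eq_sym)
  qed
  show "counit KPi_bar (?g F) = counit Sym F" for F
    using to_sym_counit[of "?g F"] by (simp add: fg)
  show "?g ` part Sym n = part KPi_bar n" for n
    unfolding to_sym_part[symmetric] by (simp add: image_image gf)
qed

theorem hopf_iso_to_sym: "hopf_iso KPi_bar Sym (to_sym :: 'k::field_char_0 kpi_bar \<Rightarrow> 'k sym)"
  unfolding hopf_iso_def
proof (intro conjI allI)
  show "tensor_eq (scale Sym) 2 (coprod Sym (to_sym y)) (push (map to_sym) (coprod KPi_bar y))"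
      for y :: "'k kpi_bar"
    using sym_coprod_to_sym[of y] by (simp only: Sym_simps)
qed (simp_all only: hopf_KPi_bar hopf_Sym bij_to_sym to_sym_one to_sym_mult KPi_bar_simps Sym_simps
    linear_to_sym to_sym_counit to_sym_part)

theorem theorem5p4:
  shows "\<exists>(f :: 'k::field_char_0 kpi \<Rightarrow> 'k ncsym) (f_bar :: 'k kpi_bar \<Rightarrow> 'k sym).
    hopf_iso KPi NCSym f \<and> hopf_iso KPi_bar Sym f_bar \<and>
    commute_vars \<circ> f = f_bar \<circ> kpi_proj \<and>
    (\<forall>X p. ptype X = p \<longrightarrow>
      f (kpi_m X) = nc_m X \<and>
      f (kpi_p X) = nc_p X \<and>
      f (kpi_e X) = nc_e X \<and>
      f (kpi_h X) = nc_h X \<and>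
      f_bar (kpi_proj (kpi_m X)) = sym_scale (of_nat (mults_fact p)) (sym_m p) \<and>
      f_bar (kpi_proj (kpi_p X)) = sym_p p \<and>
      f_bar (kpi_proj (kpi_e X)) = sym_scale (of_nat (parts_fact p)) (sym_e p) \<and>
      f_bar (kpi_proj (kpi_h X)) = sym_scale (of_nat (parts_fact p)) (sym_h p))"
proof (intro exI conjI allI impI)
  show "hopf_iso KPi NCSym (to_ncsym :: 'k kpi \<Rightarrow> 'k ncsym)" by (rule hopf_iso_to_ncsym)
  show "hopf_iso KPi_bar Sym (to_sym :: 'k kpi_bar \<Rightarrow> 'k sym)" by (rule hopf_iso_to_sym)
  show "commute_vars \<circ> to_ncsym = (to_sym :: 'k kpi_bar \<Rightarrow> 'k sym) \<circ> kpi_proj"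
    by (simp add: fun_eq_iff to_sym_proj)
qed (auto simp: to_sym_proj to_ncsym_m to_ncsym_p to_ncsym_e to_ncsym_h
    commute_vars_m commute_vars_p commute_vars_e commute_vars_h)

end
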